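(* The decision version of \textsf{Min-Max-Delay} is NP-complete in the weak sense; that is, it is NP-complete and it can be solved in pseudo-polynomial time. Here the decision problem is: given a directed graph $G=(V,E)$ with non-negative integer edge capacities $c_e$ and non-negative integer edge delays $d_e$, a source $s$, a sink $t\ne s$, a positive integer rate $R$ and a number $D$, decide whether there is a feasible flow $f$ with $\mathcal{D}(f)\le D$.
   Context: Let $P$ be the set of directed $s$-$t$ paths, $d^p=\sum_{e\in p}d_e$. A flow is $f=\{f^p\ge 0: p\in P\}$ (fractional rates allowed); it is feasible if $\sum_{p\in P}f^p=R$ and $\sum_{p\in P: e\in p}f^p\le c_e$ for all $e\in E$. Its maximum delay is $\mathcal{D}(f)=\max_{p\in P: f^p>0}d^p$. Pseudo-polynomial time means polynomial in the input size and in the numeric values of the input integers (in particular $\max_e d_e$). *)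

theory Defs
  imports "Graph_Theory.Pair_Digraph" "HOL-Computational_Algebra.Polynomial"
begin

section \<open>Deterministic multi-tape Turing machines\<close>

datatype move = MoveLeft | Stay | MoveRight

text \<open>
  The states are \<open>0, \<dots>, nstates\<close>, where \<open>0\<close> is the start state and \<open>nstates\<close> is the halting
  state. The tape symbols are \<open>0, \<dots>, nsyms - 1\<close>, where \<open>0\<close> is the blank and \<open>1\<close>, \<open>2\<close>
  represent the bits \<open>False\<close>, \<open>True\<close>. Tapes are infinite in both directions. The input is on
  tape \<open>0\<close>, the output on tape \<open>1\<close>, and all further tapes are work tapes.
\<close>

record tm =
  ntapes :: nat
  nstates :: nat
  nsyms :: nat
  trans :: "nat \<Rightarrow> nat list \<Rightarrow> nat \<times> (nat \<times> move) list"

definition wf_tm :: "tm \<Rightarrow> bool" where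
  "wf_tm M \<longleftrightarrow> 2 \<le> ntapes M \<and> 3 \<le> nsyms M \<and>
    (\<forall>q < nstates M. \<forall>as. length as = ntapes M \<and> set as \<subseteq> {..<nsyms M} \<longrightarrow>
       (case trans M q as of (q', acts) \<Rightarrow>
          q' \<le> nstates M \<and> length acts = ntapes M \<and> fst ` set acts \<subseteq> {..<nsyms M}))"

type_synonym tape = "(int \<Rightarrow> nat) \<times> int"
type_synonym config = "nat \<times> tape list"

fun shift :: "move \<Rightarrow> int" where
  "shift MoveLeft = -1"
| "shift Stay = 0"
| "shift MoveRight = 1"

fun act :: "tape \<Rightarrow> nat \<times> move \<Rightarrow> tape" where
  "act (t, h) (a, m) = (t(h := a), h + shift m)"

definition step :: "tm \<Rightarrow> config \<Rightarrow> config" where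
  "step M = (\<lambda>(q, ts).
     if q = nstates M then (q, ts)
     else (case trans M q (map (\<lambda>(t, h). t h) ts) of (q', acts) \<Rightarrow> (q', map2 act ts acts)))"

definition tape_of :: "bool list \<Rightarrow> int \<Rightarrow> nat" where
  "tape_of x i =
    (if 0 \<le> i \<and> nat i < length x then (if x ! nat i then 2 else 1) else 0)"

definition init_config :: "tm \<Rightarrow> bool list \<Rightarrow> config" where
  "init_config M x = (0, (tape_of x, 0) # replicate (ntapes M - 1) (\<lambda>_. 0, 0))"

definition halts_with :: "tm \<Rightarrow> bool list \<Rightarrow> bool list \<Rightarrow> nat \<Rightarrow> bool" where
  "halts_with M x y n \<longleftrightarrow>
    (case (step M ^^ n) (init_config M x) of (q, ts) \<Rightarrow>
       q = nstates M \<and> fst (ts ! 1) = tape_of y)"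

lemma tape_of_inject: "tape_of x = tape_of y \<longleftrightarrow> x = y"
proof
  assume eq: "tape_of x = tape_of y"
  have nth: "tape_of z (int i) = (if i < length z then (if z ! i then 2 else 1) else 0)" for z i
    by (simp add: tape_of_def)
  have lt: "i < length z \<longleftrightarrow> tape_of z (int i) \<noteq> 0" for z i
    by (simp add: nth)
  have len: "length x = length y"
    using lt[of "length x" x] lt[of "length x" y] lt[of "length y" x] lt[of "length y" y]
    unfolding eq by linarith
  show "x = y"
  proof (rule nth_equalityI[OF len])
    fix i assume "i < length x"
    moreover have bit: "z ! i \<longleftrightarrow> tape_of z (int i) = 2" if "i < length z" for z
      using that by (simp add: nth)
    ultimately show "x ! i = y ! i"
      using bit[of x] bit[of y] len eq by simp
  qed
qed simp

lemma step_halted: "fst c = nstates M \<Longrightarrow> (step M ^^ n) c = c"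
  by (induction n) (auto simp: step_def split: prod.splits)

lemma halts_with_mono:
  assumes "halts_with M x y m" "m \<le> n"
  shows "halts_with M x y n"
proof -
  have "(step M ^^ n) (init_config M x) = (step M ^^ (n - m)) ((step M ^^ m) (init_config M x))"
    using assms(2) funpow_add[of "n - m" m "step M"] by simp
  also have "\<dots> = (step M ^^ m) (init_config M x)"
    using assms(1) by (intro step_halted) (auto simp: halts_with_def split: prod.splits)
  finally show ?thesis
    using assms(1) by (simp add: halts_with_def)
qed

lemma halts_with_unique:
  assumes "halts_with M x y m" "halts_with M x z n"
  shows "y = z"
proof -
  have "halts_with M x y (max m n)" "halts_with M x z (max m n)"
    using assms by (auto intro: halts_with_mono)
  then show ?thesis
    by (auto simp: halts_with_def tape_of_inject split: prod.splits)
qed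


section \<open>Complexity classes\<close>

definition poly_time_computable :: "(bool list \<Rightarrow> bool list) \<Rightarrow> bool" where
  "poly_time_computable f \<longleftrightarrow>
    (\<exists>M (p :: nat poly). wf_tm M \<and>
       (\<forall>x. \<exists>n \<le> poly p (length x). halts_with M x (f x) n))"

definition class_P :: "bool list set set" where
  "class_P = {L. poly_time_computable (\<lambda>x. [x \<in> L])}"

definition pair_word :: "bool list \<Rightarrow> bool list \<Rightarrow> bool list" where
  "pair_word x w = concat (map (\<lambda>b. [b, b]) x) @ [False, True] @ w"

definition class_NP :: "bool list set set" where
  "class_NP = {L. \<exists>V \<in> class_P. \<exists>p :: nat poly. \<forall>x.
     x \<in> L \<longleftrightarrow> (\<exists>w. length w \<le> poly p (length x) \<and> pair_word x w \<in> V)}"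

definition poly_reducible :: "bool list set \<Rightarrow> bool list set \<Rightarrow> bool" where
  "poly_reducible A B \<longleftrightarrow>
    (\<exists>f. poly_time_computable f \<and> (\<forall>x. x \<in> A \<longleftrightarrow> f x \<in> B))"

definition NP_complete :: "bool list set \<Rightarrow> bool" where
  "NP_complete L \<longleftrightarrow> L \<in> class_NP \<and> (\<forall>A \<in> class_NP. poly_reducible A L)"

text \<open>
  The next two definitions concern a decision problem that is given by its set \<open>X\<close> of instances,
  an encoding \<open>enc\<close> of instances, the predicate \<open>yes\<close> of yes-instances, and the magnitude
  \<open>mx\<close> of the largest integer that occurs in an instance. Strings that do not encode an instance
  are not in the language.

  A bound that is polynomial in both \<open>length (enc I)\<close> and \<open>mx I\<close> is the same as a bound that is
  polynomial in their sum.
\<close>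

definition language_of :: "'i set \<Rightarrow> ('i \<Rightarrow> bool list) \<Rightarrow> ('i \<Rightarrow> bool) \<Rightarrow> bool list set" where
  "language_of X enc yes = enc ` {I \<in> X. yes I}"

definition pseudo_poly_solvable ::
  "'i set \<Rightarrow> ('i \<Rightarrow> bool list) \<Rightarrow> ('i \<Rightarrow> bool) \<Rightarrow> ('i \<Rightarrow> nat) \<Rightarrow> bool" where
  "pseudo_poly_solvable X enc yes mx \<longleftrightarrow>
    (\<exists>M (p :: nat poly). wf_tm M \<and>
       (\<forall>x. \<exists>n. halts_with M x [x \<in> language_of X enc yes] n) \<and>
       (\<forall>I \<in> X. \<exists>n \<le> poly p (length (enc I) + mx I). halts_with M (enc I) [yes I] n))"


section \<open>Flows and their maximum delay\<close>

definition st_paths :: "'a pair_pre_digraph \<Rightarrow> 'a \<Rightarrow> 'a \<Rightarrow> ('a \<times> 'a) list set" where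
  "st_paths G s t = {p. pre_digraph.apath (with_proj G) s p t}"

definition path_delay :: "('a \<times> 'a \<Rightarrow> nat) \<Rightarrow> ('a \<times> 'a) list \<Rightarrow> nat" where
  "path_delay d p = (\<Sum>e \<in> set p. d e)"

definition feasible_flow ::
  "'a pair_pre_digraph \<Rightarrow> ('a \<times> 'a \<Rightarrow> nat) \<Rightarrow> 'a \<Rightarrow> 'a \<Rightarrow> nat \<Rightarrow> (('a \<times> 'a) list \<Rightarrow> real) \<Rightarrow> bool"
where
  "feasible_flow G c s t R f \<longleftrightarrow>
    (\<forall>p \<in> st_paths G s t. 0 \<le> f p) \<and>
    (\<Sum>p \<in> st_paths G s t. f p) = real R \<and>
    (\<forall>e \<in> parcs G. (\<Sum>p \<in> {p \<in> st_paths G s t. e \<in> set p}. f p) \<le> real (c e))"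

text \<open>
  The set below is nonempty for every feasible flow of positive rate, so that the value of
  \<^const>\<open>Max\<close> on the empty set does not matter.
\<close>

definition max_delay ::
  "'a pair_pre_digraph \<Rightarrow> ('a \<times> 'a \<Rightarrow> nat) \<Rightarrow> 'a \<Rightarrow> 'a \<Rightarrow> (('a \<times> 'a) list \<Rightarrow> real) \<Rightarrow> nat" where
  "max_delay G d s t f = Max (path_delay d ` {p \<in> st_paths G s t. f p > 0})"


section \<open>The decision version of Min-Max-Delay\<close>

text \<open>
  The vertices are \<open>0, \<dots>, num_verts - 1\<close>. An entry \<open>((u, v), (c, d))\<close> of the edge list
  is the edge from \<open>u\<close> to \<open>v\<close> with capacity \<open>c\<close> and delay \<open>d\<close>.
\<close>

record mmd_instance =
  num_verts :: nat
  edge_list :: "((nat \<times> nat) \<times> (nat \<times> nat)) list"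
  source :: nat
  sink :: nat
  rate :: nat
  delay_bound :: int

definition graph_of :: "mmd_instance \<Rightarrow> nat pair_pre_digraph" where
  "graph_of I = \<lparr> pverts = {..<num_verts I}, parcs = fst ` set (edge_list I) \<rparr>"

definition capacity :: "mmd_instance \<Rightarrow> nat \<times> nat \<Rightarrow> nat" where
  "capacity I e = fst (the (map_of (edge_list I) e))"

definition delay :: "mmd_instance \<Rightarrow> nat \<times> nat \<Rightarrow> nat" where
  "delay I e = snd (the (map_of (edge_list I) e))"

definition mmd_instances :: "mmd_instance set" where
  "mmd_instances = {I. pair_fin_digraph (graph_of I) \<and> distinct (map fst (edge_list I)) \<and>
     source I \<in> pverts (graph_of I) \<and> sink I \<in> pverts (graph_of I) \<and>
     source I \<noteq> sink I \<and> 0 < rate I}"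

definition mmd_yes :: "mmd_instance \<Rightarrow> bool" where
  "mmd_yes I \<longleftrightarrow>
    (\<exists>f. feasible_flow (graph_of I) (capacity I) (source I) (sink I) (rate I) f \<and>
         int (max_delay (graph_of I) (delay I) (source I) (sink I) f) \<le> delay_bound I)"

text \<open>
  Integers are encoded in binary, least significant bit first, with self-delimiting code words.
  The number of vertices is encoded in unary, so that the length of the encoding is at least
  the number of vertices and edges.
\<close>

fun bits :: "nat \<Rightarrow> bool list" where
  "bits n = (if n = 0 then [] else odd n # bits (n div 2))"

declare bits.simps [simp del]

definition enc_list :: "('b \<Rightarrow> bool list) \<Rightarrow> 'b list \<Rightarrow> bool list" where
  "enc_list e xs = concat (map (\<lambda>x. True # e x) xs) @ [False]"

definition enc_nat :: "nat \<Rightarrow> bool list" where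
  "enc_nat n = enc_list (\<lambda>b. [b]) (bits n)"

definition enc_int :: "int \<Rightarrow> bool list" where
  "enc_int z = (z < 0) # enc_nat (nat \<bar>z\<bar>)"

fun enc_edge :: "(nat \<times> nat) \<times> (nat \<times> nat) \<Rightarrow> bool list" where
  "enc_edge ((u, v), (c, d)) = enc_nat u @ enc_nat v @ enc_nat c @ enc_nat d"

definition mmd_encode :: "mmd_instance \<Rightarrow> bool list" where
  "mmd_encode I =
     replicate (num_verts I) True @ [False] @ enc_list enc_edge (edge_list I) @
     enc_nat (source I) @ enc_nat (sink I) @ enc_nat (rate I) @ enc_int (delay_bound I)"

definition mmd_max :: "mmd_instance \<Rightarrow> nat" where
  "mmd_max I = Max ({rate I, nat \<bar>delay_bound I\<bar>} \<union>
     capacity I ` parcs (graph_of I) \<union> delay I ` parcs (graph_of I))"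

lemma bits_inject: "bits m = bits n \<longleftrightarrow> m = n"
proof (induction m arbitrary: n rule: less_induct)
  case (less m)
  show ?case
  proof (cases "m = 0 \<or> n = 0")
    case True
    have "bits k = [] \<longleftrightarrow> k = 0" for k
      by (subst bits.simps) simp
    with True show ?thesis by (metis (full_types))
  next
    case False
    then have "bits m = bits n \<longleftrightarrow> odd m = odd n \<and> m div 2 = n div 2"
      using less.IH[of "m div 2" "n div 2"]
      by (subst bits.simps, subst bits.simps[of n]) auto
    also have "\<dots> \<longleftrightarrow> m = n" by presburger
    finally show ?thesis .
  qed
qed

lemma enc_list_append_inject:
  assumes "\<And>x y v w. e x @ v = e y @ w \<longleftrightarrow> x = y \<and> v = w"
  shows "enc_list e xs @ v = enc_list e ys @ w \<longleftrightarrow> xs = ys \<and> v = w"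
proof (induction xs arbitrary: ys)
  case Nil
  then show ?case by (cases ys) (auto simp: enc_list_def)
next
  case (Cons x xs)
  then show ?case using assms by (cases ys) (auto simp: enc_list_def)
qed

lemma enc_nat_append_inject: "enc_nat m @ v = enc_nat n @ w \<longleftrightarrow> m = n \<and> v = w"
  unfolding enc_nat_def by (subst enc_list_append_inject) (auto simp: bits_inject)

lemma enc_int_inject: "enc_int y = enc_int z \<longleftrightarrow> y = z"
  using enc_nat_append_inject[of "nat \<bar>y\<bar>" "[]" "nat \<bar>z\<bar>" "[]"] by (auto simp: enc_int_def)

lemma enc_edge_append_inject: "enc_edge a @ v = enc_edge b @ w \<longleftrightarrow> a = b \<and> v = w"
  by (cases a rule: enc_edge.cases; cases b rule: enc_edge.cases)
    (auto simp: enc_nat_append_inject)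

lemma unary_append_inject:
  "replicate m True @ False # v = replicate n True @ False # w \<longleftrightarrow> m = n \<and> v = w"
proof (induction m arbitrary: n)
  case 0
  then show ?case by (cases n) auto
next
  case (Suc m)
  then show ?case by (cases n) auto
qed

lemma inj_mmd_encode: "inj mmd_encode"
  by (rule injI)
    (auto simp: mmd_encode_def unary_append_inject enc_list_append_inject[OF enc_edge_append_inject]
       enc_nat_append_inject enc_int_inject)

end

theory Submission
  imports Defs "HOL-Library.FuncSet"
begin

text \<open>
  A small register language over binary trees is compiled to Turing machines; it is closed under
  composition and bounded iteration, so polynomial-time algorithms can be given as HOL functions.

  For membership in NP, a feasible flow is a solution of a linear system with one row per edge and one for
  the rate. By a determinant-style bound such a system has an integral solution, up to a common
  denominator, whose entries have polynomially many bits and whose support is linear in the number of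
  edges; it serves as the certificate.

  In pseudo-polynomial time, the flow problem in the time-expanded graph with \<open>D + 1\<close> layers is a linear
  program of polynomial size. A feasible solution decomposes into walks of delay at most \<open>D\<close>, and every
  walk contains a path whose edges are among those of the walk.

  For hardness, the computation of a verifier is written as a set of clauses (Horn except for those that guess the
  witness), and satisfiability is turned into a chain of diamonds with unit capacities and rate 2. Both
  branches of every diamond are saturated, so the delays of the flow average to half the total delay, and
  some path has delay exactly \<open>D\<close>. The base-\<open>2\<^sup>b\<close> digits of the delays count the true literals of each clause;
  the number of missing literals is filled by slack diamonds.
\<close>

section \<open>Compiling a register language to Turing machines\<close>

text \<open>Polynomial-time linear programming is itself part of the development and shapes it: the
  method has to be a short list program whose numbers provably stay small. The program is brought to
  the form \<open>x \<ge> 0\<close>, \<open>A x = 0\<close>, \<open>x 0 > 0\<close>. Column weights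
  \<open>D\<close>, powers of two, bound every solution in the unit box. A perceptron in the kernel
  of the scaled matrix \<open>M\<close> either finds an approximate solution or exhibits a
  coordinate whose weight can be halved, so the total bit length of \<open>D\<close> bounds the
  number of rounds. The projection onto the kernel is replaced by a large power of the contraction
  \<open>I - M' M / h\<close>, with \<open>M'\<close> the transpose, obtained by repeated squaring
  with rounding; this avoids elimination and the control of intermediate fractions. The bound on
  integral solutions behind the certificates has a second use here: a sufficiently small residual
  can be removed exactly. In the hardness proof, literals and slack alone would give each clause an
  odd digit total; one extra diamond makes it even and turns the symmetry between a path and its
  complement into negation of the assignment.\<close>

datatype com =
  Do nat "nat option" move
 | Seq com com
 | If nat "nat => bool" com com
 | While nat "nat => bool" com

fun rd :: "tape => nat" where
 "rd (t, h) = t h"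

definition wr :: "nat option => move => nat => nat \<times> move" where
 "wr w m a = (case w of None => a | Some b => b, m)"

text \<open>The step count is exact: every command, including sequencing and each test of a loop,
  costs one transition. So compilation changes no running time.\<close>

inductive exec :: "com => tape list => nat => tape list => bool" where
 exec_Do: "exec (Do j w m) ts 1 (ts[j := act (ts ! j) (wr w m (rd (ts ! j)))])"
| exec_Seq: "exec p ts m ts' ==> exec q ts' n ts'' ==> exec (Seq p q) ts (Suc (m + n)) ts''"
| exec_IfT: "P (rd (ts ! j)) ==> exec p ts n ts' ==> exec (If j P p q) ts (Suc n) ts'"
| exec_IfF: "\<not> P (rd (ts ! j)) ==> exec q ts n ts' ==> exec (If j P p q) ts (Suc n) ts'"
| exec_WhileT: "P (rd (ts ! j)) ==> exec p ts m ts' ==> exec (While j P p) ts' n ts''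
  ==> exec (While j P p) ts (Suc (m + n)) ts''"
| exec_WhileF: "\<not> P (rd (ts ! j)) ==> exec (While j P p) ts 1 ts"

definition idle :: "nat list => (nat \<times> move) list" where
 "idle as = map (%a. (a, Stay)) as"

text \<open>The states of the compiled machine are continuations, that is, lists of commands that
 remain to be executed; only finitely many of them are reachable.\<close>

fun kt :: "com list => nat list => com list \<times> (nat \<times> move) list" where
 "kt [] as = ([], idle as)"
| "kt (Do j w m # K) as = (K, (idle as)[j := wr w m (as ! j)])"
| "kt (Seq p q # K) as = (p # q # K, idle as)"
| "kt (If j P p q # K) as = ((if P (as ! j) then p else q) # K, idle as)"
| "kt (While j P p # K) as = (if P (as ! j) then p # While j P p # K else K, idle as)"

definition kstep :: "com list \<times> tape list => com list \<times> tape list" where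
 "kstep c = (case kt (fst c) (map rd (snd c)) of (K, acts) => (K, map2 act (snd c) acts))"

lemma act_idle: "act t (rd t, Stay) = t"
 by (cases t) simp

lemma map2_act_idle: "map2 act ts (idle (map rd ts)) = ts"
 by (induction ts) (auto simp: idle_def)

lemma map2_act_update:
 "map2 act ts ((idle (map rd ts))[j := wr w m (map rd ts ! j)])
  = ts[j := act (ts ! j) (wr w m (rd (ts ! j)))]"
proof (cases "j < length ts")
 case True
 then show ?thesis
  by (intro nth_equalityI) (auto simp: idle_def nth_list_update act_idle)
next
 case False
 then show ?thesis using map2_act_idle[of ts] by (simp add: idle_def list_update_beyond)
qed

lemma funpow_plus: "(f ^^ (m + n)) x = (f ^^ n) ((f ^^ m) x)"
 by (induction n) auto

fun tapes_below :: "nat => com => bool" where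
 "tapes_below k (Do j w m) \<longleftrightarrow> j < k"
| "tapes_below k (Seq p q) \<longleftrightarrow> tapes_below k p & tapes_below k q"
| "tapes_below k (If j P p q) \<longleftrightarrow> j < k & tapes_below k p & tapes_below k q"
| "tapes_below k (While j P p) \<longleftrightarrow> j < k & tapes_below k p"

fun syms_below :: "nat => com => bool" where
 "syms_below s (Do j w m) \<longleftrightarrow> pred_option (%b. b < s) w"
| "syms_below s (Seq p q) \<longleftrightarrow> syms_below s p & syms_below s q"
| "syms_below s (If j P p q) \<longleftrightarrow> syms_below s p & syms_below s q"
| "syms_below s (While j P p) \<longleftrightarrow> syms_below s p"

text \<open>The continuation \<open>K\<close> is arbitrary because the body of a sequence or of a
  loop runs in front of what follows it.\<close>

lemma kstep_exec:
 assumes "exec p ts n ts'" "tapes_below (length ts) p"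
 shows "length ts' = length ts & (kstep ^^ n) (p # K, ts) = (K, ts')"
 using assms
proof (induction arbitrary: K)
 case (exec_Do j w m ts)
 then show ?case using map2_act_update[of ts j w m] by (simp add: kstep_def)
next
 case (exec_Seq p ts m ts' q n ts'')
 have "(kstep ^^ Suc (m + n)) (Seq p q # K, ts) = (kstep ^^ (m + n)) (p # q # K, ts)"
  by (simp only: funpow_Suc_right o_apply) (simp add: kstep_def map2_act_idle)
 also have "\<dots> = (kstep ^^ n) ((kstep ^^ m) (p # q # K, ts))"
  by (rule funpow_plus)
 finally show ?case using exec_Seq by simp
next
 case (exec_IfT P ts j p n ts' q)
 have "(kstep ^^ Suc n) (If j P p q # K, ts) = (kstep ^^ n) (p # K, ts)"
  using exec_IfT(1,4) by (simp only: funpow_Suc_right o_apply) (simp add: kstep_def map2_act_idle)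
 then show ?case using exec_IfT by simp
next
 case (exec_IfF P ts j q n ts' p)
 have "(kstep ^^ Suc n) (If j P p q # K, ts) = (kstep ^^ n) (q # K, ts)"
  using exec_IfF(1,4) by (simp only: funpow_Suc_right o_apply) (simp add: kstep_def map2_act_idle)
 then show ?case using exec_IfF by simp
next
 case (exec_WhileT P ts j p m ts' n ts'')
 have "(kstep ^^ Suc (m + n)) (While j P p # K, ts) = (kstep ^^ (m + n)) (p # While j P p # K, ts)"
  using exec_WhileT(1,6) by (simp only: funpow_Suc_right o_apply) (simp add: kstep_def map2_act_idle)
 also have "\<dots> = (kstep ^^ n) ((kstep ^^ m) (p # While j P p # K, ts))"
  by (rule funpow_plus)
 finally show ?case using exec_WhileT by simp
next
 case (exec_WhileF P ts j p)
 then show ?case by (simp add: kstep_def map2_act_idle)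
qed

text \<open>A superset of the continuations reachable from \<open>p # K\<close>, without
  \<open>K\<close> itself. It is finite because a loop puts itself back instead of a fresh
  unfolding.\<close>

fun kset :: "com => com list => com list set" where
 "kset (Do j w m) K = {Do j w m # K}"
| "kset (Seq p q) K = {Seq p q # K} \<union> kset p (q # K) \<union> kset q K"
| "kset (If j P p q) K = {If j P p q # K} \<union> kset p K \<union> kset q K"
| "kset (While j P p) K = {While j P p # K} \<union> kset p (While j P p # K)"

lemma kset_start: "p # K \<in> kset p K"
 by (cases p) auto

lemma finite_kset: "finite (kset p K)"
 by (induction p arbitrary: K) auto

lemma kset_nonempty: "[] \<notin> kset p K"
 by (induction p arbitrary: K) auto

lemma kset_closed: "K' \<in> kset p K ==> fst (kt K' as) \<in> insert K (kset p K)"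
proof (induction p arbitrary: K)
 case (Seq p q)
 show ?case using Seq.prems kset_start[of p "q # K"] kset_start[of q K] Seq.IH(1)[of "q # K"] Seq.IH(2)[of K]
  by auto
next
 case (If j P p q)
 show ?case using If.prems kset_start[of p K] kset_start[of q K] If.IH(1)[of K] If.IH(2)[of K]
  by auto
next
 case (While j P p)
 show ?case using While.prems kset_start[of p "While j P p # K"] While.IH[of "While j P p # K"]
  by (auto split: if_splits)
qed auto

lemma kset_syms:
 assumes "K' \<in> kset p K" "\<forall>c \<in> set (p # K). syms_below s c"
 shows "\<forall>c \<in> set K'. syms_below s c"
 using assms
proof (induction p arbitrary: K)
 case (Seq p q)
 show ?case using Seq.prems Seq.IH(1)[of "q # K"] Seq.IH(2)[of K] by auto
next
 case (If j P p q)
 show ?case using If.prems If.IH(1)[of K] If.IH(2)[of K] by auto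
next
 case (While j P p)
 show ?case using While.prems While.IH[of "While j P p # K"] by auto
qed auto

lemma kt_acts:
 assumes "\<forall>c \<in> set K. syms_below s c" "set as \<subseteq> {..<s}"
 shows "length (snd (kt K as)) = length as & fst ` set (snd (kt K as)) \<subseteq> {..<s}"
proof -
 have idle: "fst ` set (idle as) \<subseteq> {..<s}" using assms(2) by (auto simp: idle_def)
 have upd: "fst ` set ((idle as)[j := wr w m (as ! j)]) \<subseteq> {..<s}" if "pred_option (%b. b < s) w" for j w m
 proof (cases "j < length as")
  case True
  then have "as ! j < s" using assms(2) by (auto dest: nth_mem)
  then have "fst (wr w m (as ! j)) < s" using that by (cases w) (auto simp: wr_def)
  then have ins: "insert (fst (wr w m (as ! j))) (fst ` set (idle as)) \<subseteq> {..<s}" using idle by simp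
  have "fst ` set ((idle as)[j := wr w m (as ! j)]) \<subseteq> insert (fst (wr w m (as ! j))) (fst ` set (idle as))"
   using image_mono[OF set_update_subset_insert[of "idle as" j "wr w m (as ! j)"], of fst] by simp
  then show ?thesis using ins by (rule subset_trans)
 next
  case False
  then show ?thesis using idle by (simp add: list_update_beyond idle_def)
 qed
 show ?thesis using assms idle upd by (cases "(K, as)" rule: kt.cases) (auto simp: idle_def)
qed

text \<open>The states are the indices in an enumeration of continuations that starts with
  \<open>[p]\<close> and ends with \<open>[]\<close>, so that these two become the start and the
  halting state. The machine then follows \<open>kstep\<close> one transition at a time.\<close>

theorem compile:
 assumes "tapes_below k p" "syms_below s p" "2 \<le> k" "3 \<le> s"
 obtains M where "wf_tm M" "ntapes M = k"
  "!!ts n ts'. length ts = k ==> exec p ts n ts' ==> (step M ^^ n) (0, ts) = (nstates M, ts')"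
proof -
 let ?S = "kset p []"
 obtain l where l: "set l = ?S - {[p]}" "distinct l"
  using finite_distinct_list[of "?S - {[p]}"] finite_kset by blast
 define sl where "sl = [p] # l @ [[]]"
 have dist: "distinct sl" and setsl: "set sl = insert [] ?S"
  using l kset_nonempty[of p "[]"] kset_start[of p "[]"] by (auto simp: sl_def)
 define N where "N = Suc (length l)"
 have lensl: "length sl = Suc N" by (simp add: sl_def N_def)
 have slN: "sl ! N = []" "sl ! 0 = [p]" by (simp_all add: sl_def N_def nth_append)
 define ix where "ix K = (THE i. i < length sl & sl ! i = K)" for K
 have ix: "ix (sl ! i) = i" if "i < length sl" for i
  unfolding ix_def using that dist by (intro the_equality) (auto simp: nth_eq_iff_index_eq)
 have ix2: "ix K < length sl & sl ! ix K = K" if "K \<in> insert [] ?S" for K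
  using that setsl ix by (metis in_set_conv_nth)
 define M where "M = \<lparr>ntapes = k, nstates = N, nsyms = s,
   trans = (%q as. (ix (fst (kt (sl ! q) as)), snd (kt (sl ! q) as)))\<rparr>"
 have inS: "sl ! q \<in> ?S" if "q < N" for q
 proof -
  have "sl ! q \<in> set sl" using that lensl by simp
  moreover have "sl ! q ~= []" using that slN(1) dist lensl by (metis less_Suc_eq nat_neq_iff nth_eq_iff_index_eq)
  ultimately show ?thesis using setsl by auto
 qed
 have wf: "wf_tm M"
  unfolding wf_tm_def
 proof (intro conjI allI impI)
  fix q as assume q: "q < nstates M" and as: "length as = ntapes M & set as \<subseteq> {..<nsyms M}"
  have qN: "q < N" using q by (simp add: M_def)
  have "fst (kt (sl ! q) as) \<in> insert [] ?S" using kset_closed[OF inS[OF qN]] .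
  then have "ix (fst (kt (sl ! q) as)) \<le> N" using ix2 lensl by force
  moreover have "\<forall>c \<in> set (sl ! q). syms_below s c" using kset_syms[OF inS[OF qN]] assms(2) by simp
  ultimately show "case trans M q as of (q', acts) => q' \<le> nstates M & length acts = ntapes M &
    fst ` set acts \<subseteq> {..<nsyms M}"
   using kt_acts[of "sl ! q" s as] as by (simp add: M_def)
 qed (use assms in \<open>simp_all add: M_def\<close>)
 have sim: "(step M ^^ n) (ix K, ts) = (ix (fst ((kstep ^^ n) (K, ts))), snd ((kstep ^^ n) (K, ts)))
   & fst ((kstep ^^ n) (K, ts)) \<in> insert [] ?S" if "K \<in> insert [] ?S" for K ts n
 proof (induction n)
  case 0
  then show ?case using that by simp
 next
  case (Suc n)
  obtain K' ts' where K': "(kstep ^^ n) (K, ts) = (K', ts')" by fastforce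
  have mem: "K' \<in> insert [] ?S" using Suc K' by simp
  have rdeq: "map (%(t, h). t h) ts' = map rd ts'" by auto
  show ?case
  proof (cases "K' = []")
   case True
   have "ix [] = N" using ix[of N] slN lensl by simp
   moreover have "kstep ([], ts') = ([], ts')" by (simp add: kstep_def map2_act_idle)
   moreover have "step M (N, ts') = (N, ts')" by (simp add: step_def M_def)
   ultimately show ?thesis using Suc K' True by simp
  next
   case False
   then have S: "K' \<in> ?S" using mem by simp
   have ne: "ix K' ~= N" using ix2[OF mem] False slN by auto
   have sl: "sl ! ix K' = K'" using ix2[OF mem] by simp
   have "step M (ix K', ts') = (ix (fst (kstep (K', ts'))), snd (kstep (K', ts')))"
    using ne sl by (simp add: step_def M_def kstep_def rdeq split: prod.splits)
   moreover have "fst (kstep (K', ts')) \<in> insert [] ?S"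
    using kset_closed[OF S, of "map rd ts'"] by (simp add: kstep_def case_prod_beta)
   ultimately show ?thesis using Suc K' by simp
  qed
 qed
 show ?thesis
 proof (rule that[OF wf])
  show "ntapes M = k" by (simp add: M_def)
  fix ts n ts' assume len: "length ts = k" and ex: "exec p ts n ts'"
  have "(kstep ^^ n) ([p], ts) = ([], ts')" using kstep_exec[OF ex] assms(1) len by simp
  moreover have "ix [p] = 0" "ix [] = N" using ix[of 0] ix[of N] slN lensl by simp_all
  ultimately show "(step M ^^ n) (0, ts) = (nstates M, ts')"
   using sim[of "[p]" n ts] kset_start[of p "[]"] by (simp add: M_def)
 qed
qed

section \<open>Stacks on tapes\<close>

definition stk :: "nat list => int => tape" where
 "stk xs h = (%p. if h \<le> p & nat (p - h) < length xs then xs ! nat (p - h) else 0, h)"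

text \<open>The output is only appended to, with the head behind its last symbol. It starts at cell
  0, where \<open>tape_of\<close> expects it.\<close>

definition otape :: "nat list => tape" where
 "otape ys = (fst (stk ys 0), int (length ys))"

definition hd0 :: "nat list => nat" where
 "hd0 xs = (case xs of [] => 0 | a # _ => a)"

lemma hd0_simps [simp]: "hd0 [] = 0" "hd0 (a # xs) = a"
 by (simp_all add: hd0_def)

lemma rd_stk: "rd (stk xs h) = hd0 xs"
 by (cases xs) (auto simp: stk_def)

lemma stk_push: "act (act (stk xs h) (rd (stk xs h), MoveLeft)) (a, Stay) = stk (a # xs) (h - 1)"
proof -
 have "nat (p - (h - 1)) = Suc (nat (p - h))" if "h \<le> p" for p using that by simp
 then show ?thesis by (auto simp: stk_def fun_eq_iff)
qed

text \<open>Cells outside a stack must be blank, also those above its top; hence a pop erases the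
  symbol before the head moves on.\<close>

lemma stk_pop: "act (stk xs h) (0, MoveRight) = stk (tl xs) (h + 1)"
proof -
 have "nat (p - h) = Suc (nat (p - (h + 1)))" if "h + 1 \<le> p" for p using that by simp
 then show ?thesis by (cases xs) (auto simp: stk_def fun_eq_iff)
qed

lemma otape_out: "act (otape ys) (a, MoveRight) = otape (ys @ [a])"
proof -
 have "nat p < Suc (length ys) \<longleftrightarrow> nat p < length ys \<or> p = int (length ys)" if "0 \<le> p" for p
  using that by auto
 then show ?thesis by (auto simp: otape_def stk_def fun_eq_iff nth_append)
qed

type_synonym stacks = "nat list \<times> nat list \<times> nat list \<times> nat list \<times> nat list"

text \<open>Stacks drift along their tapes, so the head positions are existential. Tape 1, the
  output, is the only one that is anchored.\<close>

fun rep :: "tape list => stacks => bool" where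
 "rep ts (s0, s1, s2, s3, s4) \<longleftrightarrow>
  (\<exists>h0 h2 h3 h4. ts = [stk s0 h0, otape s1, stk s2 h2, stk s3 h3, stk s4 h4])"

fun stack :: "stacks => nat => nat list" where
 "stack (s0, s1, s2, s3, s4) j = (if j = 0 then s0 else if j = 2 then s2 else if j = 3 then s3 else s4)"

fun upd :: "stacks => nat => nat list => stacks" where
 "upd (s0, s1, s2, s3, s4) j x = (if j = 0 then (x, s1, s2, s3, s4) else if j = 2 then (s0, s1, x, s3, s4)
  else if j = 3 then (s0, s1, s2, x, s4) else (s0, s1, s2, s3, x))"

definition "wtape j \<longleftrightarrow> j \<in> {0, 2, 3, 4::nat}"

lemma wtapes [simp]: "wtape 0" "wtape 2" "wtape 3" "wtape 4"
 by (simp_all add: wtape_def)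

definition run :: "com => stacks => nat => stacks => bool" where
 "run p st n st' \<longleftrightarrow> (\<forall>ts. rep ts st --> (\<exists>m \<le> n. \<exists>ts'. exec p ts m ts' & rep ts' st'))"

text \<open>A transition writes before it moves, so the move to the free cell takes a command of its
  own.\<close>

definition Push :: "nat => nat => com" where
 "Push j a = Seq (Do j None MoveLeft) (Do j (Some a) Stay)"

definition Pop :: "nat => com" where
 "Pop j = Do j (Some 0) MoveRight"

definition Out :: "nat => com" where
 "Out a = Do 1 (Some a) MoveRight"

lemma rd_rep: "rep ts st ==> wtape j ==> rd (ts ! j) = hd0 (stack st j)"
 by (cases st) (auto simp: wtape_def rd_stk numeral_eq_Suc)

lemma run_mono: "run p st n st' ==> n \<le> n' ==> run p st n' st'"
 unfolding run_def by (meson le_trans)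

lemma rep_upd:
 assumes "rep ts st" "wtape j" "\<exists>h. t = stk x h"
 shows "rep (ts[j := t]) (upd st j x)"
 using assms by (cases st) (auto simp: wtape_def numeral_eq_Suc)

lemma rep_nth: "rep ts st ==> wtape j ==> length ts = 5 & j < 5 & (\<exists>h. ts ! j = stk (stack st j) h)"
 by (cases st) (auto simp: wtape_def numeral_eq_Suc)

lemma run_Push: "wtape j ==> run (Push j a) st 3 (upd st j (a # stack st j))"
 unfolding run_def
proof (intro allI impI)
 fix ts assume j: "wtape j" and r: "rep ts st"
 obtain h where h: "ts ! j = stk (stack st j) h" and len: "j < length ts" using rep_nth[OF r j] by auto
 let ?t1 = "ts[j := act (ts ! j) (wr None MoveLeft (rd (ts ! j)))]"
 let ?t2 = "?t1[j := act (?t1 ! j) (wr (Some a) Stay (rd (?t1 ! j)))]"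
 have "exec (Push j a) ts (Suc (1 + 1)) ?t2"
  unfolding Push_def by (rule exec_Seq[OF exec_Do exec_Do])
 moreover have "?t2 = ts[j := stk (a # stack st j) (h - 1)]"
  using len h stk_push[of "stack st j" h a] by (simp add: wr_def)
 moreover have "rep (ts[j := stk (a # stack st j) (h - 1)]) (upd st j (a # stack st j))"
  by (rule rep_upd[OF r j]) blast
 ultimately show "\<exists>m\<le>3. \<exists>ts'. exec (Push j a) ts m ts' & rep ts' (upd st j (a # stack st j))"
  by (intro exI[of _ 3]) (auto simp: numeral_3_eq_3)
qed

lemma run_Pop: "wtape j ==> run (Pop j) st 1 (upd st j (tl (stack st j)))"
 unfolding run_def
proof (intro allI impI)
 fix ts assume j: "wtape j" and r: "rep ts st"
 obtain h where h: "ts ! j = stk (stack st j) h" and len: "j < length ts" using rep_nth[OF r j] by auto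
 let ?t1 = "ts[j := act (ts ! j) (wr (Some 0) MoveRight (rd (ts ! j)))]"
 have "exec (Pop j) ts 1 ?t1"
  unfolding Pop_def by (rule exec_Do)
 moreover have "?t1 = ts[j := stk (tl (stack st j)) (h + 1)]"
  using len h stk_pop[of "stack st j" h] by (simp add: wr_def)
 ultimately show "\<exists>m\<le>1. \<exists>ts'. exec (Pop j) ts m ts' & rep ts' (upd st j (tl (stack st j)))"
  using rep_upd[OF r j, of "stk (tl (stack st j)) (h + 1)" "tl (stack st j)"] by auto
qed

lemma run_Out: "run (Out a) (s0, s1, s2, s3, s4) 1 (s0, s1 @ [a], s2, s3, s4)"
 unfolding run_def
proof (intro allI impI)
 fix ts assume r: "rep ts (s0, s1, s2, s3, s4)"
 have "exec (Out a) ts 1 (ts[1 := act (ts ! 1) (wr (Some a) MoveRight (rd (ts ! 1)))])"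
  unfolding Out_def by (rule exec_Do)
 moreover have "rep (ts[1 := act (ts ! 1) (wr (Some a) MoveRight (rd (ts ! 1)))]) (s0, s1 @ [a], s2, s3, s4)"
  using r otape_out[of s1 a] by (auto simp: wr_def)
 ultimately show "\<exists>m\<le>1. \<exists>ts'. exec (Out a) ts m ts' & rep ts' (s0, s1 @ [a], s2, s3, s4)" by blast
qed

lemma runE:
 assumes "run p st n st'" "rep ts st"
 obtains m ts' where "m \<le> n" "exec p ts m ts'" "rep ts' st'"
 using assms unfolding run_def by blast

lemma runI:
 assumes "!!ts. rep ts st ==> \<exists>m ts'. m \<le> n & exec p ts m ts' & rep ts' st'"
 shows "run p st n st'"
 using assms unfolding run_def by blast

lemma run_Seq:
 assumes "run p st m st'" "run q st' n st''"
 shows "run (Seq p q) st (Suc (m + n)) st''"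
proof (rule runI)
 fix ts assume "rep ts st"
 with assms(1) obtain m' ts' where 1: "m' \<le> m" "exec p ts m' ts'" "rep ts' st'" by (rule runE)
 from assms(2) 1(3) obtain n' ts'' where 2: "n' \<le> n" "exec q ts' n' ts''" "rep ts'' st''" by (rule runE)
 have "Suc (m' + n') \<le> Suc (m + n)" using 1(1) 2(1) by simp
 then show "\<exists>k ts'. k \<le> Suc (m + n) & exec (Seq p q) ts k ts' & rep ts' st''"
  using exec_Seq[OF 1(2) 2(2)] 2(3) by blast
qed

lemma run_IfT:
 assumes "wtape j" "P (hd0 (stack st j))" "run p st n st'"
 shows "run (If j P p q) st (Suc n) st'"
proof (rule runI)
 fix ts assume r: "rep ts st"
 with assms(3) obtain m ts' where 1: "m \<le> n" "exec p ts m ts'" "rep ts' st'" by (rule runE)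
 have "P (rd (ts ! j))" using assms(2) rd_rep[OF r assms(1)] by simp
 then show "\<exists>k ts'. k \<le> Suc n & exec (If j P p q) ts k ts' & rep ts' st'"
  using exec_IfT[of P ts j p m ts' q] 1 by (intro exI[of _ "Suc m"] exI[of _ ts']) simp
qed

lemma run_IfF:
 assumes "wtape j" "\<not> P (hd0 (stack st j))" "run q st n st'"
 shows "run (If j P p q) st (Suc n) st'"
proof (rule runI)
 fix ts assume r: "rep ts st"
 with assms(3) obtain m ts' where 1: "m \<le> n" "exec q ts m ts'" "rep ts' st'" by (rule runE)
 have "\<not> P (rd (ts ! j))" using assms(2) rd_rep[OF r assms(1)] by simp
 then show "\<exists>k ts'. k \<le> Suc n & exec (If j P p q) ts k ts' & rep ts' st'"
  using exec_IfF[of P ts j q m ts' p] 1 by (intro exI[of _ "Suc m"] exI[of _ ts']) simp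
qed

lemma run_WhileT:
 assumes "wtape j" "P (hd0 (stack st j))" "run p st m st'" "run (While j P p) st' n st''"
 shows "run (While j P p) st (Suc (m + n)) st''"
proof (rule runI)
 fix ts assume r: "rep ts st"
 with assms(3) obtain m' ts' where 1: "m' \<le> m" "exec p ts m' ts'" "rep ts' st'" by (rule runE)
 from assms(4) 1(3) obtain n' ts'' where 2: "n' \<le> n" "exec (While j P p) ts' n' ts''" "rep ts'' st''"
  by (rule runE)
 have "P (rd (ts ! j))" using assms(2) rd_rep[OF r assms(1)] by simp
 then show "\<exists>k ts'. k \<le> Suc (m + n) & exec (While j P p) ts k ts' & rep ts' st''"
  using exec_WhileT[of P ts j p m' ts' n' ts''] 1 2
  by (intro exI[of _ "Suc (m' + n')"] exI[of _ ts'']) simp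
qed

lemma run_WhileF:
 assumes "wtape j" "\<not> P (hd0 (stack st j))"
 shows "run (While j P p) st 1 st"
proof (rule runI)
 fix ts assume r: "rep ts st"
 have "\<not> P (rd (ts ! j))" using assms(2) rd_rep[OF r assms(1)] by simp
 then show "\<exists>k ts'. k \<le> 1 & exec (While j P p) ts k ts' & rep ts' st"
  using exec_WhileF[of P ts j p] r by blast
qed

lemma run_Push0: "run (Push 0 a) (s0, s1, s2, s3, s4) 3 (a # s0, s1, s2, s3, s4)"
 using run_Push[of 0 a "(s0, s1, s2, s3, s4)"] by simp

lemma run_Push2: "run (Push 2 a) (s0, s1, s2, s3, s4) 3 (s0, s1, a # s2, s3, s4)"
 using run_Push[of 2 a "(s0, s1, s2, s3, s4)"] by simp

lemma run_Push3: "run (Push 3 a) (s0, s1, s2, s3, s4) 3 (s0, s1, s2, a # s3, s4)"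
 using run_Push[of 3 a "(s0, s1, s2, s3, s4)"] by simp

lemma run_Push4: "run (Push 4 a) (s0, s1, s2, s3, s4) 3 (s0, s1, s2, s3, a # s4)"
 using run_Push[of 4 a "(s0, s1, s2, s3, s4)"] by simp

lemma run_Pop0: "run (Pop 0) (a # s0, s1, s2, s3, s4) 1 (s0, s1, s2, s3, s4)"
 using run_Pop[of 0 "(a # s0, s1, s2, s3, s4)"] by simp

lemma run_Pop2: "run (Pop 2) (s0, s1, a # s2, s3, s4) 1 (s0, s1, s2, s3, s4)"
 using run_Pop[of 2 "(s0, s1, a # s2, s3, s4)"] by simp

lemma run_Pop3: "run (Pop 3) (s0, s1, s2, a # s3, s4) 1 (s0, s1, s2, s3, s4)"
 using run_Pop[of 3 "(s0, s1, s2, a # s3, s4)"] by simp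

lemma run_Pop4: "run (Pop 4) (s0, s1, s2, s3, a # s4) 1 (s0, s1, s2, s3, s4)"
 using run_Pop[of 4 "(s0, s1, s2, s3, a # s4)"] by simp

lemmas runs = run_Push0 run_Push2 run_Push3 run_Push4 run_Pop0 run_Pop2 run_Pop3 run_Pop4 run_Out run_Seq

section \<open>Binary trees as stack contents\<close>

datatype tree = Lf | Nd tree tree

text \<open>Prefix notation: it is self-delimiting, so trees can be concatenated on one stack, and
  the top symbol tells a leaf from a node. Symbol 3 stays free as a marker.\<close>

fun enc :: "tree => nat list" where
 "enc Lf = [1]"
| "enc (Nd a b) = 2 # enc a @ enc b"

definition tsz :: "tree => nat" where
 "tsz x = length (enc x)"

lemma tsz_simps [simp]: "tsz Lf = 1" "tsz (Nd a b) = Suc (tsz a + tsz b)"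
 by (simp_all add: tsz_def)

lemma tsz_pos [simp]: "0 < tsz x"
 by (cases x) simp_all

lemma set_enc: "set (enc x) \<subseteq> {1, 2}"
 by (induction x) auto

lemma hd0_enc: "hd0 (enc x @ r) = (if x = Lf then 1 else 2)"
 by (cases x) auto

text \<open>Tape 4 counts, above the marker 3, the subtrees that are still to be read.\<close>

definition xloop :: "nat => com" where
 "xloop j = While 4 (%a. a = 1) (If 0 (%a. a = 2)
  (Seq (Pop 0) (Seq (Push j 2) (Push 4 1))) (Seq (Pop 0) (Seq (Push j 1) (Pop 4))))"

text \<open>The run on the remaining stack is a premise, so that the induction can chain the
  subtrees of a node: the run for the second subtree becomes the premise for the first.\<close>

lemma run_xloop2:
 "run (xloop 2) (r, ou, rev (enc x) @ s2, s3, c) n st'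
  ==> run (xloop 2) (enc x @ r, ou, s2, s3, 1 # c) (n + 20 * tsz x) st'"
proof (induction x arbitrary: r s2 c n)
 case Lf
 have "run (xloop 2) (1 # r, ou, s2, s3, 1 # c) (Suc (Suc (Suc (1 + Suc (3 + 1))) + n)) st'"
  unfolding xloop_def
  by (rule run_WhileT[OF _ _ run_IfF], simp, simp, simp, simp, (rule runs)+) (use Lf in \<open>simp add: xloop_def\<close>)
 from run_mono[OF this, of "n + 20 * tsz Lf"] show ?case by simp
next
 case (Nd a b)
 have "run (xloop 2) (enc b @ r, ou, rev (enc a) @ 2 # s2, s3, 1 # c) (n + 20 * tsz b) st'"
  using Nd.prems by (intro Nd.IH(2)) simp
 then have "run (xloop 2) (enc a @ enc b @ r, ou, 2 # s2, s3, 1 # 1 # c) (n + 20 * tsz b + 20 * tsz a) st'"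
  by (rule Nd.IH(1))
 then have "run (xloop 2) (2 # enc a @ enc b @ r, ou, s2, s3, 1 # c)
   (Suc (Suc (Suc (1 + Suc (3 + 3))) + (n + 20 * tsz b + 20 * tsz a))) st'"
  unfolding xloop_def
  by (intro run_WhileT[OF _ _ run_IfT]) (simp, simp, simp, simp, (rule runs)+, simp)
 from run_mono[OF this, of "n + 20 * tsz (Nd a b)"] show ?case by simp
qed

lemma run_xloop3:
 "run (xloop 3) (r, ou, s2, rev (enc x) @ s3, c) n st'
  ==> run (xloop 3) (enc x @ r, ou, s2, s3, 1 # c) (n + 20 * tsz x) st'"
proof (induction x arbitrary: r s3 c n)
 case Lf
 have "run (xloop 3) (1 # r, ou, s2, s3, 1 # c) (Suc (Suc (Suc (1 + Suc (3 + 1))) + n)) st'"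
  unfolding xloop_def
  by (rule run_WhileT[OF _ _ run_IfF], simp, simp, simp, simp, (rule runs)+) (use Lf in \<open>simp add: xloop_def\<close>)
 from run_mono[OF this, of "n + 20 * tsz Lf"] show ?case by simp
next
 case (Nd a b)
 have "run (xloop 3) (enc b @ r, ou, s2, rev (enc a) @ 2 # s3, 1 # c) (n + 20 * tsz b) st'"
  using Nd.prems by (intro Nd.IH(2)) simp
 then have "run (xloop 3) (enc a @ enc b @ r, ou, s2, 2 # s3, 1 # 1 # c) (n + 20 * tsz b + 20 * tsz a) st'"
  by (rule Nd.IH(1))
 then have "run (xloop 3) (2 # enc a @ enc b @ r, ou, s2, s3, 1 # c)
   (Suc (Suc (Suc (1 + Suc (3 + 3))) + (n + 20 * tsz b + 20 * tsz a))) st'"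
  unfolding xloop_def
  by (intro run_WhileT[OF _ _ run_IfT]) (simp, simp, simp, simp, (rule runs)+, simp)
 from run_mono[OF this, of "n + 20 * tsz (Nd a b)"] show ?case by simp
qed

definition xfer :: "nat => com" where
 "xfer j = Seq (Push j 3) (Seq (Push 4 3) (Seq (Push 4 1) (Seq (xloop j) (Pop 4))))"

lemma run_xfer2: "run (xfer 2) (enc x @ r, ou, s2, s3, s4) (20 * tsz x + 20) (r, ou, rev (enc x) @ 3 # s2, s3, s4)"
proof -
 have "run (xloop 2) (enc x @ r, ou, 3 # s2, s3, 1 # 3 # s4) (1 + 20 * tsz x) (r, ou, rev (enc x) @ 3 # s2, s3, 3 # s4)"
  by (rule run_xloop2) (auto simp: xloop_def intro: run_WhileF[of 4, simplified])
 from run_Seq[OF run_Push2 run_Seq[OF run_Push4 run_Seq[OF run_Push4 run_Seq[OF this run_Pop4]]]]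
 have "run (xfer 2) (enc x @ r, ou, s2, s3, s4)
   (Suc (3 + Suc (3 + Suc (3 + Suc (1 + 20 * tsz x + 1))))) (r, ou, rev (enc x) @ 3 # s2, s3, s4)"
  unfolding xfer_def .
 then show ?thesis by (rule run_mono) simp
qed

lemma run_xfer3: "run (xfer 3) (enc x @ r, ou, s2, s3, s4) (20 * tsz x + 20) (r, ou, s2, rev (enc x) @ 3 # s3, s4)"
proof -
 have "run (xloop 3) (enc x @ r, ou, s2, 3 # s3, 1 # 3 # s4) (1 + 20 * tsz x) (r, ou, s2, rev (enc x) @ 3 # s3, 3 # s4)"
  by (rule run_xloop3) (auto simp: xloop_def intro: run_WhileF[of 4, simplified])
 from run_Seq[OF run_Push3 run_Seq[OF run_Push4 run_Seq[OF run_Push4 run_Seq[OF this run_Pop4]]]]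
 have "run (xfer 3) (enc x @ r, ou, s2, s3, s4)
   (Suc (3 + Suc (3 + Suc (3 + Suc (1 + 20 * tsz x + 1))))) (r, ou, s2, rev (enc x) @ 3 # s3, s4)"
  unfolding xfer_def .
 then show ?thesis by (rule run_mono) simp
qed

definition unload :: "nat => com => com => com" where
 "unload j p1 p2 = Seq (While j (%a. a ~= 3) (If j (%a. a = 2) (Seq (Pop j) p2) (Seq (Pop j) p1))) (Pop j)"

text \<open>Here \<open>f ys zs\<close> is the state with \<open>ys\<close> still above the marker
  and \<open>zs\<close> already moved; five unloading patterns are instances.\<close>

lemma run_unload:
 assumes j: "wtape j" and st: "!!ys zs. stack (f ys zs) j = ys @ 3 # s"
  and p2: "!!ys zs. run (Seq (Pop j) p2) (f (2 # ys) zs) t (f ys (2 # zs))"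
  and p1: "!!ys zs. run (Seq (Pop j) p1) (f (1 # ys) zs) t (f ys (1 # zs))"
  and fin: "run (Pop j) (f [] (rev xs)) 1 st'"
  and xs: "set xs \<subseteq> {1, 2}"
 shows "run (unload j p1 p2) (f xs []) ((t + 2) * length xs + 3) st'"
proof -
 let ?W = "While j (%a. a ~= 3) (If j (%a. a = 2) (Seq (Pop j) p2) (Seq (Pop j) p1))"
 have "run ?W (f xs zs) ((t + 2) * length xs + 1) (f [] (rev xs @ zs))" for zs
  using xs
 proof (induction xs arbitrary: zs)
  case Nil
  then show ?case using run_WhileF[OF j, of "%a. a ~= 3" "f [] zs"] st[of "[]" zs] by simp
 next
  case (Cons a xs)
  have IH: "run ?W (f xs (a # zs)) ((t + 2) * length xs + 1) (f [] (rev xs @ a # zs))"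
   using Cons by simp
  have a: "a = 1 \<or> a = 2" using Cons.prems by simp
  have hd: "hd0 (stack (f (a # xs) zs) j) = a" by (simp add: st)
  have body: "run (If j (%a. a = 2) (Seq (Pop j) p2) (Seq (Pop j) p1)) (f (a # xs) zs) (Suc t) (f xs (a # zs))"
  proof (cases "a = 2")
   case True
   then show ?thesis using p2 hd by (intro run_IfT[OF j]) simp_all
  next
   case False
   then have "a = 1" using a by simp
   then show ?thesis using p1 hd by (intro run_IfF[OF j]) simp_all
  qed
  have "hd0 (stack (f (a # xs) zs) j) ~= 3" using a hd by auto
  from run_mono[OF run_WhileT[OF j this body IH], of "(t + 2) * length (a # xs) + 1"]
  show ?case by simp
 qed
 from this[of "[]"] have "run ?W (f xs []) ((t + 2) * length xs + 1) (f [] (rev xs))" by simp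
 from run_mono[OF run_Seq[OF this fin], of "(t + 2) * length xs + 3"] show ?thesis
  unfolding unload_def by simp
qed

definition Skip :: com where
 "Skip = Seq (Push 4 1) (Pop 4)"

lemma run_Skip: "run Skip (s0, s1, s2, s3, s4) 5 (s0, s1, s2, s3, s4)"
 unfolding Skip_def using run_Seq[OF run_Push4 run_Pop4] by simp

definition push03 :: "nat => com" where
 "push03 a = Seq (Push 0 a) (Push 3 a)"

lemma run_push03: "run (push03 a) (s0, s1, s2, s3, s4) 7 (a # s0, s1, s2, a # s3, s4)"
 unfolding push03_def using run_Seq[OF run_Push0 run_Push3] by simp

lemma run_unload20:
 assumes "set xs \<subseteq> {1, 2}"
 shows "run (unload 2 (Push 0 1) (Push 0 2)) (s0, ou, xs @ 3 # s2, s3, s4) (10 * length xs + 3)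
  (rev xs @ s0, ou, s2, s3, s4)"
 using run_unload[of 2 "%ys zs. (zs @ s0, ou, ys @ 3 # s2, s3, s4)" s2 "Push 0 2" 8 "Push 0 1" xs,
   OF _ _ _ _ _ assms] run_Pop2 run_mono[OF run_Seq[OF run_Pop2 run_Push0]] by simp

lemma run_unload30:
 assumes "set xs \<subseteq> {1, 2}"
 shows "run (unload 3 (Push 0 1) (Push 0 2)) (s0, ou, s2, xs @ 3 # s3, s4) (10 * length xs + 3)
  (rev xs @ s0, ou, s2, s3, s4)"
 using run_unload[of 3 "%ys zs. (zs @ s0, ou, s2, ys @ 3 # s3, s4)" s3 "Push 0 2" 8 "Push 0 1" xs,
   OF _ _ _ _ _ assms] run_Pop3 run_mono[OF run_Seq[OF run_Pop3 run_Push0]] by simp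

lemma run_unload32:
 assumes "set xs \<subseteq> {1, 2}"
 shows "run (unload 3 (Push 2 1) (Push 2 2)) (s0, ou, s2, xs @ 3 # s3, s4) (10 * length xs + 3)
  (s0, ou, rev xs @ s2, s3, s4)"
 using run_unload[of 3 "%ys zs. (s0, ou, zs @ s2, ys @ 3 # s3, s4)" s3 "Push 2 2" 8 "Push 2 1" xs,
   OF _ _ _ _ _ assms] run_Pop3 run_mono[OF run_Seq[OF run_Pop3 run_Push2]] by simp

lemma run_unload203:
 assumes "set xs \<subseteq> {1, 2}"
 shows "run (unload 2 (push03 1) (push03 2)) (s0, ou, xs @ 3 # s2, s3, s4) (12 * length xs + 3)
  (rev xs @ s0, ou, s2, rev xs @ s3, s4)"
 using run_unload[of 2 "%ys zs. (zs @ s0, ou, ys @ 3 # s2, zs @ s3, s4)" s2 "push03 2" 10 "push03 1" xs,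
   OF _ _ _ _ _ assms] run_Pop2 run_mono[OF run_Seq[OF run_Pop2 run_push03]] by simp

lemma run_unload2:
 assumes "set xs \<subseteq> {1, 2}"
 shows "run (unload 2 Skip Skip) (s0, ou, xs @ 3 # s2, s3, s4) (10 * length xs + 3) (s0, ou, s2, s3, s4)"
 using run_unload[of 2 "%ys zs. (s0, ou, ys @ 3 # s2, s3, s4)" s2 Skip 8 Skip xs,
   OF _ _ _ _ _ assms] run_Pop2 run_mono[OF run_Seq[OF run_Pop2 run_Skip]] by simp

definition drop_c :: com where
 "drop_c = Seq (xfer 2) (unload 2 Skip Skip)"

definition swap_c :: com where
 "swap_c = Seq (xfer 2) (Seq (xfer 3) (Seq (unload 2 (Push 0 1) (Push 0 2)) (unload 3 (Push 0 1) (Push 0 2))))"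

text \<open>Every transfer reverses the code, so the second copy travels from tape 3 through tape 2
  before it is put on top of the first.\<close>

definition dup_c :: com where
 "dup_c = Seq (xfer 2) (Seq (Push 3 3) (Seq (unload 2 (push03 1) (push03 2))
  (Seq (Push 2 3) (Seq (unload 3 (Push 2 1) (Push 2 2)) (unload 2 (Push 0 1) (Push 0 2))))))"

lemma run_drop: "run drop_c (enc x @ r, ou, b, c, d) (100 * tsz x + 100) (r, ou, b, c, d)"
 unfolding drop_c_def
 by (rule run_mono, rule run_Seq, rule run_xfer2, rule run_unload2) (use set_enc[of x] in \<open>simp_all add: tsz_def\<close>)

lemma run_swap: "run swap_c (enc x @ enc y @ r, ou, b, c, d) (100 * (tsz x + tsz y) + 100) (enc y @ enc x @ r, ou, b, c, d)"
proof -
 have "run (unload 2 (Push 0 1) (Push 0 2)) (r, ou, rev (enc x) @ 3 # b, rev (enc y) @ 3 # c, d) (10 * tsz x + 3)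
  (enc x @ r, ou, b, rev (enc y) @ 3 # c, d)"
  using run_unload20[of "rev (enc x)"] set_enc[of x] by (simp add: tsz_def)
 moreover have "run (unload 3 (Push 0 1) (Push 0 2)) (enc x @ r, ou, b, rev (enc y) @ 3 # c, d) (10 * tsz y + 3)
  (enc y @ enc x @ r, ou, b, c, d)"
  using run_unload30[of "rev (enc y)"] set_enc[of y] by (simp add: tsz_def)
 ultimately show ?thesis
  unfolding swap_c_def by (intro run_mono[OF run_Seq[OF run_xfer2 run_Seq[OF run_xfer3 run_Seq]]]) auto
qed

lemma run_dup: "run dup_c (enc x @ r, ou, b, c, d) (100 * tsz x + 100) (enc x @ enc x @ r, ou, b, c, d)"
proof -
 have 1: "run (unload 2 (push03 1) (push03 2)) (r, ou, rev (enc x) @ 3 # b, 3 # c, d) (12 * tsz x + 3)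
  (enc x @ r, ou, b, enc x @ 3 # c, d)"
  using run_unload203[of "rev (enc x)"] set_enc[of x] by (simp add: tsz_def)
 have 2: "run (unload 3 (Push 2 1) (Push 2 2)) (enc x @ r, ou, 3 # b, enc x @ 3 # c, d) (10 * tsz x + 3)
  (enc x @ r, ou, rev (enc x) @ 3 # b, c, d)"
  using run_unload32[of "enc x"] set_enc[of x] by (simp add: tsz_def)
 have 3: "run (unload 2 (Push 0 1) (Push 0 2)) (enc x @ r, ou, rev (enc x) @ 3 # b, c, d) (10 * tsz x + 3)
  (enc x @ enc x @ r, ou, b, c, d)"
  using run_unload20[of "rev (enc x)"] set_enc[of x] by (simp add: tsz_def)
 show ?thesis
  unfolding dup_c_def
  by (rule run_mono[OF run_Seq[OF run_xfer2 run_Seq[OF run_Push3 run_Seq[OF 1 run_Seq[OF run_Push2 run_Seq[OF 2 3]]]]]]) simp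
qed

definition okc :: "com => bool" where
 "okc p \<longleftrightarrow> tapes_below 5 p & syms_below 4 p"

lemma okc_simps [simp]:
 "okc (Seq p q) \<longleftrightarrow> okc p & okc q" "okc (If j P p q) \<longleftrightarrow> j < 5 & okc p & okc q"
 "okc (While j P p) \<longleftrightarrow> j < 5 & okc p" "okc (Push j a) \<longleftrightarrow> j < 5 & a < 4" "okc (Pop j) \<longleftrightarrow> j < 5"
 "okc (Out a) \<longleftrightarrow> a < 4" "okc Skip" "okc drop_c" "okc dup_c" "okc swap_c"
 by (auto simp: okc_def Push_def Pop_def Out_def Skip_def drop_c_def dup_c_def swap_c_def xfer_def xloop_def
   unload_def push03_def)

text \<open>The rest \<open>r\<close> of the stack and the other tapes are arbitrary and preserved;
  this frame lets programs be composed while other values wait below.\<close>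

definition ct :: "com => (tree => tree) => (tree => nat) => bool" where
 "ct p F T \<longleftrightarrow> okc p &
  (\<forall>x r ou b c d. run p (enc x @ r, ou, b, c, d) (T x) (enc (F x) @ r, ou, b, c, d))"

lemma ctD: "ct p F T ==> run p (enc x @ r, ou, b, c, d) (T x) (enc (F x) @ r, ou, b, c, d)"
 by (simp add: ct_def)

lemma ct_okc: "ct p F T ==> okc p"
 by (simp add: ct_def)

lemma ct_comp:
 assumes "ct p F S" "ct q G T"
 shows "ct (Seq p q) (%x. G (F x)) (%x. Suc (S x + T (F x)))"
 unfolding ct_def using ct_okc[OF assms(1)] ct_okc[OF assms(2)]
 by (auto intro!: run_Seq[OF ctD[OF assms(1)] ctD[OF assms(2)]])

text \<open>The second component is computed first. After the swap the first one ends on top of it,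
  and a single node symbol completes the prefix code of the pair.\<close>

lemma ct_pair:
 assumes "ct p F S" "ct q G T"
 shows "ct (Seq dup_c (Seq q (Seq swap_c (Seq p (Push 0 2))))) (%x. Nd (F x) (G x))
  (%x. S x + T x + 200 * tsz x + 100 * tsz (G x) + 300)"
 unfolding ct_def
proof (intro conjI allI)
 fix x r ou b c d
 have "run (Push 0 2) (enc (F x) @ enc (G x) @ r, ou, b, c, d) 3 (enc (Nd (F x) (G x)) @ r, ou, b, c, d)"
  using run_Push0 by simp
 from run_Seq[OF run_dup run_Seq[OF ctD[OF assms(2)] run_Seq[OF run_swap run_Seq[OF ctD[OF assms(1)] this]]]]
 show "run (Seq dup_c (Seq q (Seq swap_c (Seq p (Push 0 2))))) (enc x @ r, ou, b, c, d)
  (S x + T x + 200 * tsz x + 100 * tsz (G x) + 300) (enc (Nd (F x) (G x)) @ r, ou, b, c, d)"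
  by (rule run_mono) simp
qed (use ct_okc[OF assms(1)] ct_okc[OF assms(2)] in simp)

lemma ct_cond:
 assumes "ct p B S" "ct q G T" "ct q' H T'"
 shows "ct (Seq dup_c (Seq p (If 0 (%a. a = 1) (Seq (Pop 0) q) (Seq drop_c q'))))
  (%x. if B x = Lf then G x else H x) (%x. S x + T x + T' x + 100 * tsz x + 100 * tsz (B x) + 300)"
 unfolding ct_def
proof (intro conjI allI)
 fix x r ou b c d
 let ?I = "If 0 (%a. a = 1) (Seq (Pop 0) q) (Seq drop_c q')"
 have "run ?I (enc (B x) @ enc x @ r, ou, b, c, d) (T x + T' x + 100 * tsz (B x) + 150)
  (enc (if B x = Lf then G x else H x) @ r, ou, b, c, d)"
 proof (cases "B x = Lf")
  case True
  from run_Seq[OF run_Pop0 ctD[OF assms(2)]]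
  have "run (Seq (Pop 0) q) (enc (B x) @ enc x @ r, ou, b, c, d) (Suc (1 + T x)) (enc (G x) @ r, ou, b, c, d)"
   by (simp add: True)
  then have "run ?I (enc (B x) @ enc x @ r, ou, b, c, d) (Suc (Suc (1 + T x))) (enc (G x) @ r, ou, b, c, d)"
   by (intro run_IfT) (simp_all add: True)
  then have "run ?I (enc (B x) @ enc x @ r, ou, b, c, d) (T x + T' x + 100 * tsz (B x) + 150) (enc (G x) @ r, ou, b, c, d)"
   by (rule run_mono) simp
  with True show ?thesis by simp
 next
  case False
  from run_Seq[OF run_drop ctD[OF assms(3)]]
  have "run ?I (enc (B x) @ enc x @ r, ou, b, c, d) (Suc (Suc (100 * tsz (B x) + 100 + T' x))) (enc (H x) @ r, ou, b, c, d)"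
   by (intro run_IfF) (simp_all add: False hd0_enc)
  then have "run ?I (enc (B x) @ enc x @ r, ou, b, c, d) (T x + T' x + 100 * tsz (B x) + 150) (enc (H x) @ r, ou, b, c, d)"
   by (rule run_mono) simp
  with False show ?thesis by simp
 qed
 from run_Seq[OF run_dup run_Seq[OF ctD[OF assms(1)] this]]
 show "run (Seq dup_c (Seq p ?I)) (enc x @ r, ou, b, c, d)
  (S x + T x + T' x + 100 * tsz x + 100 * tsz (B x) + 300) (enc (if B x = Lf then G x else H x) @ r, ou, b, c, d)"
  by (rule run_mono) simp
qed (use ct_okc[OF assms(1)] ct_okc[OF assms(2)] ct_okc[OF assms(3)] in simp)

fun tfst :: "tree => tree" where
 "tfst Lf = Lf" | "tfst (Nd a b) = a"

fun tsnd :: "tree => tree" where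
 "tsnd Lf = Lf" | "tsnd (Nd a b) = b"

lemma ct_id: "ct Skip (%x. x) (%x. 5)"
 unfolding ct_def using run_Skip by simp

lemma ct_fst: "ct (If 0 (%a. a = 2) (Seq (Pop 0) (Seq swap_c drop_c)) Skip) tfst (%x. 300 * tsz x + 300)"
 unfolding ct_def
proof (intro conjI allI)
 fix x r ou b c d
 show "run (If 0 (%a. a = 2) (Seq (Pop 0) (Seq swap_c drop_c)) Skip) (enc x @ r, ou, b, c, d) (300 * tsz x + 300)
  (enc (tfst x) @ r, ou, b, c, d)"
 proof (cases x)
  case Lf
  then show ?thesis by (auto intro!: run_mono[OF run_IfF[OF _ _ run_Skip]])
 next
  case (Nd y z)
  from run_Seq[OF run_Pop0 run_Seq[OF run_swap run_drop]]
  have "run (Seq (Pop 0) (Seq swap_c drop_c)) (enc x @ r, ou, b, c, d)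
   (Suc (1 + Suc (100 * (tsz y + tsz z) + 100 + (100 * tsz z + 100)))) (enc y @ r, ou, b, c, d)"
   by (simp add: Nd)
  then show ?thesis by (intro run_mono[OF run_IfT]) (auto simp: Nd)
 qed
qed simp

lemma ct_snd: "ct (If 0 (%a. a = 2) (Seq (Pop 0) drop_c) Skip) tsnd (%x. 300 * tsz x + 300)"
 unfolding ct_def
proof (intro conjI allI)
 fix x r ou b c d
 show "run (If 0 (%a. a = 2) (Seq (Pop 0) drop_c) Skip) (enc x @ r, ou, b, c, d) (300 * tsz x + 300)
  (enc (tsnd x) @ r, ou, b, c, d)"
 proof (cases x)
  case Lf
  then show ?thesis by (auto intro!: run_mono[OF run_IfF[OF _ _ run_Skip]])
 next
  case (Nd y z)
  from run_Seq[OF run_Pop0 run_drop]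
  have "run (Seq (Pop 0) drop_c) (enc x @ r, ou, b, c, d) (Suc (1 + (100 * tsz y + 100))) (enc z @ r, ou, b, c, d)"
   by (simp add: Nd)
  then show ?thesis by (intro run_mono[OF run_IfT]) (auto simp: Nd)
 qed
qed simp

lemma ct_const: "\<exists>p t. ct p (%_. a) (%x. 100 * tsz x + t)"
proof -
 have "\<exists>p t. okc p & (\<forall>r ou b c d. run p (r, ou, b, c, d) t (xs @ r, ou, b, c, d))" if "set xs \<subseteq> {1, 2}" for xs
  using that
 proof (induction xs)
  case Nil
  show ?case by (intro exI[of _ Skip] exI[of _ 5]) (simp add: run_Skip)
 next
  case (Cons a xs)
  then obtain p t where p: "okc p" "!!r ou b c d. run p (r, ou, b, c, d) t (xs @ r, ou, b, c, d)" by auto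
  show ?case using p(1) Cons.prems run_Seq[OF p(2) run_Push0]
   by (intro exI[of _ "Seq p (Push 0 a)"] exI[of _ "Suc (t + 3)"]) auto
 qed
 from this[OF set_enc[of a]] obtain p t
  where p: "okc p" "!!r ou b c d. run p (r, ou, b, c, d) t (enc a @ r, ou, b, c, d)" by auto
 have "ct (Seq drop_c p) (%_. a) (%x. 100 * tsz x + (t + 101))"
  unfolding ct_def using p(1) run_mono[OF run_Seq[OF run_drop p(2)]] by simp
 then show ?thesis by blast
qed

fun llen :: "tree => nat" where
 "llen Lf = 0" | "llen (Nd a b) = Suc (llen b)"

text \<open>The counter is the right spine of a tree, hence unary and bounded by the input size; a
  binary counter would allow exponentially many rounds.\<close>

definition titer :: "(tree => tree) => tree => tree" where
 "titer G x = (case x of Lf => Lf | Nd c y => (G ^^ llen c) y)"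

definition iter_c :: "com => com" where
 "iter_c g = If 0 (%a. a = 2) (Seq (Pop 0) (Seq
  (While 0 (%a. a = 2) (Seq (Pop 0) (Seq drop_c (Seq swap_c (Seq g swap_c))))) (Pop 0))) Skip"

text \<open>\<open>S\<close>, \<open>U\<close> and \<open>C\<close> are uniform along the iteration,
  so that every round costs at most the same amount and the rounds only have to be counted.\<close>

lemma run_iter_loop:
 assumes g: "ct g G T"
 shows "(!!i. i \<le> llen c ==> tsz ((G ^^ i) y) \<le> S) ==> (!!i. i < llen c ==> T ((G ^^ i) y) \<le> U) ==> tsz c \<le> C ==>
  run (While 0 (%a. a = 2) (Seq (Pop 0) (Seq drop_c (Seq swap_c (Seq g swap_c)))))
   (enc c @ enc y @ r, ou, b2, b3, b4) (llen c * (U + 300 * S + 300 * C + 500) + 1) (1 # enc ((G ^^ llen c) y) @ r, ou, b2, b3, b4)"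
proof (induction c arbitrary: y)
 case Lf
 have "run (While 0 (%a. a = 2) (Seq (Pop 0) (Seq drop_c (Seq swap_c (Seq g swap_c)))))
   (1 # enc y @ r, ou, b2, b3, b4) 1 (1 # enc y @ r, ou, b2, b3, b4)"
  by (rule run_WhileF) simp_all
 then show ?case by simp
next
 case (Nd a c)
 have sw: "(G ^^ i) (G y) = (G ^^ Suc i) y" for i by (simp add: funpow_swap1)
 from run_Seq[OF run_Pop0 run_Seq[OF run_drop run_Seq[OF run_swap run_Seq[OF ctD[OF g] run_swap]]]]
 have body: "run (Seq (Pop 0) (Seq drop_c (Seq swap_c (Seq g swap_c)))) (enc (Nd a c) @ enc y @ r, ou, b2, b3, b4)
  (Suc (1 + Suc (100 * tsz a + 100 + Suc (100 * (tsz c + tsz y) + 100 + Suc (T y + (100 * (tsz (G y) + tsz c) + 100))))))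
  (enc c @ enc (G y) @ r, ou, b2, b3, b4)" by simp
 have IH: "run (While 0 (%a. a = 2) (Seq (Pop 0) (Seq drop_c (Seq swap_c (Seq g swap_c)))))
   (enc c @ enc (G y) @ r, ou, b2, b3, b4) (llen c * (U + 300 * S + 300 * C + 500) + 1)
   (1 # enc ((G ^^ llen c) (G y)) @ r, ou, b2, b3, b4)"
 proof (rule Nd.IH(2))
  show "tsz ((G ^^ i) (G y)) \<le> S" if "i \<le> llen c" for i using Nd.prems(1)[of "Suc i"] that unfolding sw by simp
  show "T ((G ^^ i) (G y)) \<le> U" if "i < llen c" for i using Nd.prems(2)[of "Suc i"] that unfolding sw by simp
  show "tsz c \<le> C" using Nd.prems(3) by simp
 qed
 have fin: "(G ^^ llen c) (G y) = (G ^^ llen (Nd a c)) y" by (simp add: funpow_swap1)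
 have "T y \<le> U" using Nd.prems(2)[of 0] by simp
 moreover have "tsz y \<le> S" "tsz (G y) \<le> S" using Nd.prems(1)[of 0] Nd.prems(1)[of 1] by simp_all
 ultimately have "Suc (Suc (1 + Suc (100 * tsz a + 100 + Suc (100 * (tsz c + tsz y) + 100 +
   Suc (T y + (100 * (tsz (G y) + tsz c) + 100)))))) \<le> U + 300 * S + 300 * C + 500"
  using Nd.prems(3) by simp
 moreover have "Suc (t + (l * X + 1)) \<le> Suc l * X + 1" if "Suc t \<le> X" for t l X :: nat
  using that by simp
 ultimately have le: "Suc (Suc (1 + Suc (100 * tsz a + 100 + Suc (100 * (tsz c + tsz y) + 100 +
   Suc (T y + (100 * (tsz (G y) + tsz c) + 100))))) + (llen c * (U + 300 * S + 300 * C + 500) + 1))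
   \<le> llen (Nd a c) * (U + 300 * S + 300 * C + 500) + 1" by (simp only: llen.simps)
 have hd: "hd0 (stack (enc (Nd a c) @ enc y @ r, ou, b2, b3, b4) 0) = 2" by simp
 show ?case
  unfolding fin[symmetric] by (rule run_mono[OF run_WhileT[OF _ hd body IH] le]) simp
qed

lemma ct_iter:
 assumes g: "ct g G T" and S: "!!c y i. i \<le> llen c ==> tsz ((G ^^ i) y) \<le> S (Nd c y)"
  and U: "!!c y i. i < llen c ==> T ((G ^^ i) y) \<le> U (Nd c y)"
 shows "ct (iter_c g) (titer G) (%x. tsz x * (U x + 300 * S x + 300 * tsz x + 500) + 10)"
 unfolding ct_def
proof (intro conjI allI)
 show "okc (iter_c g)" using ct_okc[OF g] by (simp add: iter_c_def)
 fix x r ou b2 b3 b4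
 show "run (iter_c g) (enc x @ r, ou, b2, b3, b4) (tsz x * (U x + 300 * S x + 300 * tsz x + 500) + 10)
   (enc (titer G x) @ r, ou, b2, b3, b4)"
 proof (cases x)
  case Lf
  then show ?thesis unfolding iter_c_def by (auto intro!: run_mono[OF run_IfF[OF _ _ run_Skip]] simp: titer_def)
 next
  case (Nd c y)
  have len: "llen c \<le> tsz c" by (induction c) auto
  have "run (While 0 (%a. a = 2) (Seq (Pop 0) (Seq drop_c (Seq swap_c (Seq g swap_c)))))
   (enc c @ enc y @ r, ou, b2, b3, b4) (llen c * (U x + 300 * S x + 300 * tsz x + 500) + 1)
   (1 # enc ((G ^^ llen c) y) @ r, ou, b2, b3, b4)"
   using S[of _ c y] U[of _ c y] by (intro run_iter_loop[OF g]) (auto simp: Nd)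
  from run_Seq[OF run_Pop0 run_Seq[OF this run_Pop0], of 2]
  have "run (iter_c g) (enc x @ r, ou, b2, b3, b4)
   (Suc (Suc (1 + Suc (llen c * (U x + 300 * S x + 300 * tsz x + 500) + 1 + 1)))) (enc (titer G x) @ r, ou, b2, b3, b4)"
   unfolding iter_c_def by (intro run_IfT) (simp_all add: Nd titer_def)
  moreover have mx: "llen c * X \<le> tsz x * X" for X
   using len by (intro mult_right_mono) (auto simp: Nd)
  have "Suc (Suc (1 + Suc (llen c * X + 1 + 1))) \<le> tsz x * X + 10" for X
   using mx[of X] by linarith
  ultimately show ?thesis by (rule run_mono)
 qed
qed

section \<open>Polynomial bounds and running times\<close>

definition pbd :: "(nat => nat) => bool" where
 "pbd f \<longleftrightarrow> (\<exists>k. \<forall>n. f n \<le> (n + 2) ^ k)"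

lemma pbd_le: "pbd g ==> (!!n. f n \<le> g n) ==> pbd f"
 unfolding pbd_def using order_trans by blast

lemma pbd_pow: "pbd (%n. (n + 2) ^ k)"
 unfolding pbd_def by blast

lemma pbd_const: "pbd (%_. c)"
proof -
 have "c \<le> (n + 2) ^ c" for n :: nat
 proof -
  have "c \<le> 2 ^ c" by (rule less_imp_le[OF less_exp])
  also have "\<dots> \<le> (n + 2) ^ c" by (rule power_mono) auto
  finally show ?thesis .
 qed
 then show ?thesis unfolding pbd_def by blast
qed

lemma pbd_id: "pbd (%n. n)"
 by (rule pbd_le[OF pbd_pow[of 1]]) simp

lemma pbd_mult:
 assumes "pbd f" "pbd g"
 shows "pbd (%n. f n * g n)"
proof -
 obtain a b where "!!n. f n \<le> (n + 2) ^ a" "!!n. g n \<le> (n + 2) ^ b" using assms unfolding pbd_def by blast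
 then have "f n * g n \<le> (n + 2) ^ (a + b)" for n unfolding power_add by (intro mult_mono) auto
 then show ?thesis unfolding pbd_def by blast
qed

text \<open>The base \<open>n + 2\<close> is at least 2, so one more factor absorbs a sum; with base
  \<open>n\<close> this would fail at 0 and 1.\<close>

lemma pbd_add:
 assumes "pbd f" "pbd g"
 shows "pbd (%n. f n + g n)"
proof -
 obtain a b where ab: "!!n. f n \<le> (n + 2) ^ a" "!!n. g n \<le> (n + 2) ^ b" using assms unfolding pbd_def by blast
 have "f n + g n \<le> (n + 2) ^ (a + b + 1)" for n
 proof -
  have "(n + 2) ^ a \<le> (n + 2) ^ (a + b)" "(n + 2) ^ b \<le> (n + 2) ^ (a + b)" by (intro power_increasing; simp)+
  then have "f n + g n \<le> 2 * (n + 2) ^ (a + b)" using ab[of n] by linarith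
  also have "\<dots> \<le> (n + 2) * (n + 2) ^ (a + b)" by (rule mult_right_mono) auto
  finally show ?thesis by simp
 qed
 then show ?thesis unfolding pbd_def by blast
qed

lemma pbd_Suc: "pbd f ==> pbd (%n. Suc (f n))"
 using pbd_add[of f "%_. 1", OF _ pbd_const] by simp

lemma pbd_power: "pbd f ==> pbd (%n. f n ^ k)"
proof (induction k)
 case 0
 then show ?case using pbd_const[of 1] by simp
next
 case (Suc k)
 then show ?case using pbd_mult[of f "%n. f n ^ k"] by simp
qed

lemmas pbds = pbd_pow pbd_const pbd_id pbd_mult pbd_add pbd_Suc pbd_power

lemma pbd_comp:
 assumes "pbd f" "pbd g"
 shows "pbd (%n. f (g n))"
proof -
 obtain a b where a: "!!n. f n \<le> (n + 2) ^ a" and b: "!!n. g n \<le> (n + 2) ^ b" using assms unfolding pbd_def by blast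
 have "f (g n) \<le> ((n + 2) ^ b + 2) ^ a" for n
  using order_trans[OF a[of "g n"]] power_mono[of "g n + 2" "(n + 2) ^ b + 2" a] b[of n] by auto
 moreover have "pbd (%n. ((n + 2) ^ b + 2) ^ a)" by (intro pbds)
 ultimately show ?thesis by (rule pbd_le[rotated])
qed

lemma pbd_poly: "pbd (poly p)"
proof (induction p)
 case 0
 then show ?case using pbd_const[of 0] by simp
next
 case (pCons a p)
 from pbd_add[OF pbd_const[of a] pbd_mult[OF pbd_id pCons.IH]] show ?case by (rule pbd_le) simp
qed

lemma poly_pow2: "poly ([:2, 1:] ^ k) n = (n + 2 :: nat) ^ k"
 by (simp add: poly_power)

text \<open>Besides the size of the input, the time may depend polynomially on \<open>\<mu>\<close>; this is used
 for pseudo-polynomial time.\<close>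

definition rpt :: "(tree => nat) => (tree => tree) => bool" where
 "rpt \<mu> F \<longleftrightarrow> (\<exists>p k. ct p F (%x. (tsz x + \<mu> x + 2) ^ k) & (\<forall>x. tsz (F x) \<le> (tsz x + \<mu> x + 2) ^ k))"

abbreviation pt :: "(tree => tree) => bool" where
 "pt \<equiv> rpt (%_. 0)"

lemma rptI:
 assumes "ct p F T" "pbd t" "pbd s" "!!x. T x \<le> t (tsz x + \<mu> x)" "!!x. tsz (F x) \<le> s (tsz x + \<mu> x)"
 shows "rpt \<mu> F"
proof -
 obtain a b where a: "!!n. t n \<le> (n + 2) ^ a" and b: "!!n. s n \<le> (n + 2) ^ b"
  using assms(2,3) unfolding pbd_def by blast
 have le: "(n + 2) ^ a \<le> (n + 2) ^ (a + b)" "(n + 2) ^ b \<le> (n + 2) ^ (a + b)" for n :: nat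
  by (intro power_increasing; simp)+
 have "T x \<le> (tsz x + \<mu> x + 2) ^ (a + b)" for x
  using assms(4)[of x] a[of "tsz x + \<mu> x"] le(1)[of "tsz x + \<mu> x"] by linarith
 then have "ct p F (%x. (tsz x + \<mu> x + 2) ^ (a + b))"
  using ct_okc[OF assms(1)] run_mono[OF ctD[OF assms(1)]] unfolding ct_def by blast
 moreover have "tsz (F x) \<le> (tsz x + \<mu> x + 2) ^ (a + b)" for x
  using assms(5)[of x] b[of "tsz x + \<mu> x"] le(2)[of "tsz x + \<mu> x"] by linarith
 ultimately show ?thesis unfolding rpt_def by blast
qed

lemma rpt_comp:
 assumes "rpt \<mu> F" "rpt \<nu> G" "pbd j" "!!x. \<nu> (F x) \<le> j (tsz x + \<mu> x)"
 shows "rpt \<mu> (%x. G (F x))"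
proof -
 obtain p k where p: "ct p F (%x. (tsz x + \<mu> x + 2) ^ k)" "!!x. tsz (F x) \<le> (tsz x + \<mu> x + 2) ^ k"
  using assms(1) unfolding rpt_def by blast
 obtain q l where q: "ct q G (%x. (tsz x + \<nu> x + 2) ^ l)" "!!x. tsz (G x) \<le> (tsz x + \<nu> x + 2) ^ l"
  using assms(2) unfolding rpt_def by blast
 have le: "(tsz (F x) + \<nu> (F x) + 2) ^ l \<le> ((tsz x + \<mu> x + 2) ^ k + j (tsz x + \<mu> x) + 2) ^ l" for x
  using p(2)[of x] assms(4)[of x] by (intro power_mono) auto
 show ?thesis
 proof (rule rptI[OF ct_comp[OF p(1) q(1)]])
  show "pbd (%n. Suc ((n + 2) ^ k + ((n + 2) ^ k + j n + 2) ^ l))" using assms(3) by (intro pbds)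
  show "pbd (%n. ((n + 2) ^ k + j n + 2) ^ l)" using assms(3) by (intro pbds)
  show "tsz (G (F x)) \<le> ((tsz x + \<mu> x + 2) ^ k + j (tsz x + \<mu> x) + 2) ^ l" for x
   using q(2)[of "F x"] le[of x] by linarith
 qed (use le in simp)
qed

lemma pt_comp: "rpt \<mu> F ==> pt G ==> rpt \<mu> (%x. G (F x))"
 by (rule rpt_comp[OF _ _ pbd_const[of 0]]) auto

lemma rpt_pair:
 assumes "rpt \<mu> F" "rpt \<mu> G"
 shows "rpt \<mu> (%x. Nd (F x) (G x))"
proof -
 obtain p k where p: "ct p F (%x. (tsz x + \<mu> x + 2) ^ k)" "!!x. tsz (F x) \<le> (tsz x + \<mu> x + 2) ^ k"
  using assms(1) unfolding rpt_def by blast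
 obtain q l where q: "ct q G (%x. (tsz x + \<mu> x + 2) ^ l)" "!!x. tsz (G x) \<le> (tsz x + \<mu> x + 2) ^ l"
  using assms(2) unfolding rpt_def by blast
 show ?thesis
 proof (rule rptI[OF ct_pair[OF p(1) q(1)]])
  show "pbd (%n. (n + 2) ^ k + (n + 2) ^ l + 200 * n + 100 * (n + 2) ^ l + 300)" by (intro pbds)
  show "pbd (%n. Suc ((n + 2) ^ k + (n + 2) ^ l))" by (intro pbds)
  show "tsz (Nd (F x) (G x)) \<le> Suc ((tsz x + \<mu> x + 2) ^ k + (tsz x + \<mu> x + 2) ^ l)" for x
   using p(2)[of x] q(2)[of x] by simp
  show "(tsz x + \<mu> x + 2) ^ k + (tsz x + \<mu> x + 2) ^ l + 200 * tsz x + 100 * tsz (G x) + 300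
   \<le> (tsz x + \<mu> x + 2) ^ k + (tsz x + \<mu> x + 2) ^ l + 200 * (tsz x + \<mu> x) + 100 * (tsz x + \<mu> x + 2) ^ l + 300" for x
   using q(2)[of x] by simp
 qed
qed

lemma rpt_cond:
 assumes "rpt \<mu> B" "rpt \<mu> G" "rpt \<mu> H"
 shows "rpt \<mu> (%x. if B x = Lf then G x else H x)"
proof -
 obtain p k where p: "ct p B (%x. (tsz x + \<mu> x + 2) ^ k)" "!!x. tsz (B x) \<le> (tsz x + \<mu> x + 2) ^ k"
  using assms(1) unfolding rpt_def by blast
 obtain q l where q: "ct q G (%x. (tsz x + \<mu> x + 2) ^ l)" "!!x. tsz (G x) \<le> (tsz x + \<mu> x + 2) ^ l"
  using assms(2) unfolding rpt_def by blast
 obtain q' l' where q': "ct q' H (%x. (tsz x + \<mu> x + 2) ^ l')" "!!x. tsz (H x) \<le> (tsz x + \<mu> x + 2) ^ l'"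
  using assms(3) unfolding rpt_def by blast
 show ?thesis
 proof (rule rptI[OF ct_cond[OF p(1) q(1) q'(1)]])
  show "pbd (%n. (n + 2) ^ k + (n + 2) ^ l + (n + 2) ^ l' + 100 * n + 100 * (n + 2) ^ k + 300)" by (intro pbds)
  show "pbd (%n. (n + 2) ^ l + (n + 2) ^ l')" by (intro pbds)
  show "tsz (if B x = Lf then G x else H x) \<le> (tsz x + \<mu> x + 2) ^ l + (tsz x + \<mu> x + 2) ^ l'" for x
   using q(2)[of x] q'(2)[of x] by simp
  show "(tsz x + \<mu> x + 2) ^ k + (tsz x + \<mu> x + 2) ^ l + (tsz x + \<mu> x + 2) ^ l' + 100 * tsz x + 100 * tsz (B x) + 300
   \<le> (tsz x + \<mu> x + 2) ^ k + (tsz x + \<mu> x + 2) ^ l + (tsz x + \<mu> x + 2) ^ l' + 100 * (tsz x + \<mu> x) + 100 * (tsz x + \<mu> x + 2) ^ k + 300" for x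
   using p(2)[of x] by simp
 qed
qed

lemma rpt_id: "rpt \<mu> (%x. x)"
 by (rule rptI[OF ct_id pbd_const[of 5] pbd_id]) auto

lemma tsz_fst_snd: "tsz (tfst x) \<le> tsz x" "tsz (tsnd x) \<le> tsz x"
 by (cases x; simp)+

lemma rpt_fst: "rpt \<mu> tfst"
proof (rule rptI[OF ct_fst _ pbd_id])
 show "pbd (%n. 300 * n + 300)" by (intro pbds)
qed (auto intro: trans_le_add1 tsz_fst_snd)

lemma rpt_snd: "rpt \<mu> tsnd"
proof (rule rptI[OF ct_snd _ pbd_id])
 show "pbd (%n. 300 * n + 300)" by (intro pbds)
qed (auto intro: trans_le_add1 tsz_fst_snd)

lemma rpt_const: "rpt \<mu> (%_. a)"
proof -
 obtain p t where p: "ct p (%_. a) (%x. 100 * tsz x + t)" using ct_const by blast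
 show ?thesis
 proof (rule rptI[OF p _ pbd_const[of "tsz a"]])
  show "pbd (%n. 100 * n + t)" by (intro pbds)
 qed auto
qed

text \<open>Iterating a polynomial-time step can blow values up, so a bound on all intermediate
  sizes is demanded. It covers the measure \<open>\<nu>\<close> as well, since the time of each
  round depends on it.\<close>

lemma rpt_iter:
 assumes G: "rpt \<nu> G" and "pbd s"
  and S: "!!c y i. i \<le> llen c ==> tsz ((G ^^ i) y) + \<nu> ((G ^^ i) y) \<le> s (tsz (Nd c y) + \<mu> (Nd c y))"
 shows "rpt \<mu> (titer G)"
proof -
 obtain p k where p: "ct p G (%x. (tsz x + \<nu> x + 2) ^ k)" using G unfolding rpt_def by blast
 let ?S = "%x. s (tsz x + \<mu> x)"
 have U: "(tsz ((G ^^ i) y) + \<nu> ((G ^^ i) y) + 2) ^ k \<le> (?S (Nd c y) + 2) ^ k" if "i < llen c" for i c y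
  using S[of i c y] that by (intro power_mono) auto
 have S': "tsz ((G ^^ i) y) \<le> ?S (Nd c y)" if "i \<le> llen c" for i c y
  using S[OF that, of y] by simp
 have sz: "tsz (titer G x) \<le> ?S x + 1" for x
  using S'[of "llen (tfst x)" "tfst x" "tsnd x"] by (cases x) (auto simp: titer_def)
 show ?thesis
 proof (rule rptI[OF ct_iter[OF p, of ?S "%x. (?S x + 2) ^ k"]])
  show "pbd (%n. n * ((s n + 2) ^ k + 300 * s n + 300 * n + 500) + 10)" using assms(2) by (intro pbds)
  show "pbd (%n. s n + 1)" using assms(2) by (intro pbds)
  show "tsz x * ((?S x + 2) ^ k + 300 * ?S x + 300 * tsz x + 500) + 10
   \<le> (tsz x + \<mu> x) * ((?S x + 2) ^ k + 300 * ?S x + 300 * (tsz x + \<mu> x) + 500) + 10" for x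
   by (intro add_mono mult_mono) auto
 qed (use S' U sz in auto)
qed

lemma rpt_mono:
 assumes "rpt \<mu> F" "!!x. \<mu> x \<le> \<nu> x"
 shows "rpt \<nu> F"
proof -
 obtain p k where p: "ct p F (%x. (tsz x + \<mu> x + 2) ^ k)" "!!x. tsz (F x) \<le> (tsz x + \<mu> x + 2) ^ k"
  using assms(1) unfolding rpt_def by blast
 have le: "(tsz x + \<mu> x + 2) ^ k \<le> (tsz x + \<nu> x + 2) ^ k" for x
  using assms(2)[of x] by (intro power_mono) auto
 show ?thesis
  by (rule rptI[OF p(1) pbd_pow[of k] pbd_pow[of k]]) (use le p(2) order_trans in blast)+
qed

section \<open>Reading and writing bit strings\<close>

fun tb :: "bool => tree" where
 "tb False = Lf" | "tb True = Nd Lf Lf"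

fun tbl :: "bool list => tree" where
 "tbl [] = Lf" | "tbl (b # bs) = Nd (tb b) (tbl bs)"

definition raw :: "bool list => nat list" where
 "raw x = map (%b. if b then 2 else 1) x"

text \<open>The tree of a list is built from the end of the list, so the input is first moved to
  tape 2, which reverses it. Blanks signal the end on both tapes.\<close>

definition load_c :: com where
 "load_c = Seq (While 0 (%a. a ~= 0) (If 0 (%a. a = 2) (Seq (Pop 0) (Push 2 2)) (Seq (Pop 0) (Push 2 1))))
  (Seq (Push 0 1) (While 2 (%a. a ~= 0) (If 2 (%a. a = 2)
   (Seq (Pop 2) (Seq (Push 0 1) (Seq (Push 0 1) (Seq (Push 0 2) (Push 0 2))))) (Seq (Pop 2) (Seq (Push 0 1) (Push 0 2))))))"

definition store_c :: com where
 "store_c = While 0 (%a. a = 2) (Seq (Pop 0) (If 0 (%a. a = 2)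
  (Seq (Pop 0) (Seq (Pop 0) (Seq (Pop 0) (Out 2)))) (Seq (Pop 0) (Out 1))))"

lemma run_load: "run load_c (raw x, [], [], [], []) (40 * length x + 10) (enc (tbl x), [], [], [], [])"
proof -
 let ?W = "While 0 (%a. a ~= 0) (If 0 (%a. a = 2) (Seq (Pop 0) (Push 2 2)) (Seq (Pop 0) (Push 2 1)))"
 let ?V = "While 2 (%a. a ~= 0) (If 2 (%a. a = 2)
   (Seq (Pop 2) (Seq (Push 0 1) (Seq (Push 0 1) (Seq (Push 0 2) (Push 0 2))))) (Seq (Pop 2) (Seq (Push 0 1) (Push 0 2))))"
 have W: "run ?W (raw x, [], zs, [], []) (10 * length x + 1) ([], [], rev (raw x) @ zs, [], [])" for zs
 proof (induction x arbitrary: zs)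
  case Nil
  then show ?case using run_WhileF[of 0 "%a. a ~= 0" "([], [], zs, [], [])"] by (simp add: raw_def)
 next
  case (Cons a x)
  let ?a = "if a then 2 else 1 :: nat"
  have "run (If 0 (%a. a = 2) (Seq (Pop 0) (Push 2 2)) (Seq (Pop 0) (Push 2 1))) (?a # raw x, [], zs, [], [])
   (Suc (Suc (1 + 3))) (raw x, [], ?a # zs, [], [])"
   by (cases a, simp_all only: if_True if_False)
    ((rule run_IfT run_IfF, simp, simp, rule run_Seq, rule run_Pop0, rule run_Push2)+)
  from run_mono[OF run_WhileT[OF _ _ this Cons.IH], of "10 * length (a # x) + 1"]
  show ?case by (simp add: raw_def)
 qed
 have V: "run ?V (enc (tbl bs), [], raw xs, [], []) (30 * length xs + 1) (enc (tbl (rev xs @ bs)), [], [], [], [])" for bs xs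
 proof (induction xs arbitrary: bs)
  case Nil
  then show ?case using run_WhileF[of 2 "%a. a ~= 0" "(enc (tbl bs), [], [], [], [])"] by (simp add: raw_def)
 next
  case (Cons a xs)
  let ?a = "if a then 2 else 1 :: nat"
  have "run (If 2 (%a. a = 2)
   (Seq (Pop 2) (Seq (Push 0 1) (Seq (Push 0 1) (Seq (Push 0 2) (Push 0 2))))) (Seq (Pop 2) (Seq (Push 0 1) (Push 0 2))))
   (enc (tbl bs), [], ?a # raw xs, [], []) 25 (enc (tbl (a # bs)), [], raw xs, [], [])"
  proof (cases a)
   case True
   have "run (If 2 (%a. a = 2) (Seq (Pop 2) (Seq (Push 0 1) (Seq (Push 0 1) (Seq (Push 0 2) (Push 0 2))))) q)
    (enc (tbl bs), [], 2 # raw xs, [], []) 25 (2 # 2 # 1 # 1 # enc (tbl bs), [], raw xs, [], [])" for q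
    by (rule run_mono, rule run_IfT, simp, simp, (rule runs)+) simp
   then show ?thesis using True by simp
  next
   case False
   have "run (If 2 (%a. a = 2) q (Seq (Pop 2) (Seq (Push 0 1) (Push 0 2))))
    (enc (tbl bs), [], 1 # raw xs, [], []) 25 (2 # 1 # enc (tbl bs), [], raw xs, [], [])" for q
    by (rule run_mono, rule run_IfF, simp, simp, (rule runs)+) simp
   then show ?thesis using False by simp
  qed
  from run_mono[OF run_WhileT[OF _ _ this Cons.IH], of "30 * length (a # xs) + 1"]
  show ?case by (simp add: raw_def)
 qed
 have "rev (raw x) = raw (rev x)" by (simp add: raw_def rev_map)
 then have 1: "run ?W (raw x, [], [], [], []) (10 * length x + 1) ([], [], raw (rev x), [], [])" using W[of "[]"] by simp
 have 2: "run ?V ([1], [], raw (rev x), [], []) (30 * length x + 1) (enc (tbl x), [], [], [], [])"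
  using V[of "[]" "rev x"] by simp
 show ?thesis unfolding load_c_def by (rule run_mono[OF run_Seq[OF 1 run_Seq[OF run_Push0 2]]]) simp
qed

lemma run_store: "run store_c (enc (tbl y), ou, b, c, d) (20 * length y + 1) ([1], ou @ raw y, b, c, d)"
proof (induction y arbitrary: ou)
 case Nil
 then show ?case using run_WhileF[of 0 "%a. a = 2" "([1], ou, b, c, d)"] by (simp add: raw_def store_c_def)
next
 case (Cons a y)
 let ?p = "Seq (Pop 0) (If 0 (%a. a = 2)
  (Seq (Pop 0) (Seq (Pop 0) (Seq (Pop 0) (Out 2)))) (Seq (Pop 0) (Out 1)))"
 have "run ?p (enc (tbl (a # y)), ou, b, c, d) 15 (enc (tbl y), ou @ [if a then 2 else 1], b, c, d)"
 proof (cases a)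
  case True
  have "run ?p (2 # 2 # 1 # 1 # enc (tbl y), ou, b, c, d) 15 (enc (tbl y), ou @ [2], b, c, d)"
   by (rule run_mono, rule run_Seq, rule run_Pop0, rule run_IfT, simp, simp, (rule runs)+) simp
  then show ?thesis using True by simp
 next
  case False
  have "run ?p (2 # 1 # enc (tbl y), ou, b, c, d) 15 (enc (tbl y), ou @ [1], b, c, d)"
   by (rule run_mono, rule run_Seq, rule run_Pop0, rule run_IfF, simp, simp, (rule runs)+) simp
  then show ?thesis using False by simp
 qed
 from run_mono[OF run_WhileT[OF _ _ this Cons.IH[unfolded store_c_def]], of "20 * length (a # y) + 1"]
 show ?case by (auto simp: raw_def store_c_def)
qed

lemma tape_of_stk: "tape_of x = fst (stk (raw x) 0)"
 by (auto simp: tape_of_def stk_def raw_def fun_eq_iff)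

lemma tsz_tbl: "length x \<le> tsz (tbl x)" "tsz (tbl x) \<le> 4 * length x + 1"
proof (induction x)
 case (Cons a x)
 { case 1 show ?case using Cons by (cases a) auto next case 2 show ?case using Cons by (cases a) auto }
qed auto

text \<open>Loading and storing take linear time, and the tree of a bit string is larger than the
  string by a constant factor only; so a bound in the tree size becomes one in the length of the
  string.\<close>

theorem TM_of_rpt:
 assumes "rpt \<mu> F"
 obtains M k where "wf_tm M"
  "!!x y. F (tbl x) = tbl y ==> \<exists>n \<le> (length x + \<mu> (tbl x) + 2) ^ k. halts_with M x y n"
proof -
 obtain p k where p: "ct p F (%x. (tsz x + \<mu> x + 2) ^ k)" "!!x. tsz (F x) \<le> (tsz x + \<mu> x + 2) ^ k"
  using assms unfolding rpt_def by blast
 let ?p = "Seq load_c (Seq p store_c)"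
 have ok: "okc ?p" using ct_okc[OF p(1)] by (simp add: load_c_def store_c_def)
 obtain M where M: "wf_tm M" "ntapes M = 5"
  "!!ts n ts'. length ts = 5 ==> exec ?p ts n ts' ==> (step M ^^ n) (0, ts) = (nstates M, ts')"
  by (rule compile[of 5 ?p 4]) (use ok in \<open>auto simp: okc_def\<close>)
 let ?t = "%n :: nat. 40 * n + 10 + (4 * n + 1 + n + 2) ^ k + 20 * ((4 * n + 1 + n + 2) ^ k) + 10"
 have "pbd ?t" by (intro pbds)
 then obtain l where l: "!!n. ?t n \<le> (n + 2) ^ l" unfolding pbd_def by blast
 have "\<exists>n \<le> (length x + \<mu> (tbl x) + 2) ^ l. halts_with M x y n" if F: "F (tbl x) = tbl y" for x y
 proof -
  let ?n = "length x + \<mu> (tbl x)"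
  have pw: "(tsz (tbl x) + \<mu> (tbl x) + 2) ^ k \<le> (4 * ?n + 1 + ?n + 2) ^ k"
   using tsz_tbl(2)[of x] by (intro power_mono) auto
  have y: "length y \<le> (tsz (tbl x) + \<mu> (tbl x) + 2) ^ k" using p(2)[of "tbl x"] F tsz_tbl(1)[of y] by simp
  have "run p (enc (tbl x), [], [], [], []) ((tsz (tbl x) + \<mu> (tbl x) + 2) ^ k) (enc (tbl y), [], [], [], [])"
   using ctD[OF p(1), of "tbl x" "[]"] F by simp
  define A where "A = (4 * ?n + 1 + ?n + 2) ^ k"
  have lA: "40 * ?n + 10 + A + 20 * A + 10 \<le> (?n + 2) ^ l" unfolding A_def by (rule l)
  have pA: "(tsz (tbl x) + \<mu> (tbl x) + 2) ^ k \<le> A" unfolding A_def by (rule pw)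
  have arith: "Suc (40 * lx + 10 + Suc (P + (20 * ly + 1))) \<le> Z"
   if "P \<le> B" "ly \<le> P" "40 * (lx + m) + 10 + B + 20 * B + 10 \<le> Z" for P B Z lx m ly :: nat
  proof -
   have "P + 20 * ly + 40 * lx \<le> B + 20 * B + 40 * (lx + m)" using that by (intro add_mono mult_left_mono) auto
   then show ?thesis using that(3) by simp
  qed
  from run_Seq[OF run_load run_Seq[OF \<open>run p _ _ _\<close> run_store], unfolded append_Nil]
  have "run ?p (raw x, [], [], [], []) ((?n + 2) ^ l) ([1], raw y, [], [], [])"
   by (rule run_mono) (rule arith[OF pA y lA])
  moreover have "rep (snd (init_config M x)) (raw x, [], [], [], [])"
   using tape_of_stk[of x] M(2) by (auto simp: init_config_def otape_def stk_def numeral_eq_Suc intro!: exI[of _ 0])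
  ultimately obtain m ts' where m: "m \<le> (?n + 2) ^ l" "exec ?p (snd (init_config M x)) m ts'" "rep ts' ([1], raw y, [], [], [])"
   by (rule runE)
  have "(step M ^^ m) (init_config M x) = (nstates M, ts')"
   using M(3)[OF _ m(2)] M(2) by (simp add: init_config_def)
  moreover have "fst (ts' ! 1) = tape_of y" using m(3) by (auto simp: otape_def tape_of_stk)
  ultimately have "halts_with M x y m" by (simp add: halts_with_def)
  with m(1) show ?thesis by blast
 qed
 then show ?thesis using that[OF M(1)] by blast
qed

section \<open>Functions computable in polynomial time\<close>

text \<open>Injectivity lets a measure on values be carried over to trees, as is done for loops in
  \<open>rptf_iter\<close>.\<close>

class tr =
 fixes tr :: "'a => tree"
 assumes inj_tr: "inj tr"

instantiation bool :: tr begin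
definition "tr_bool = tb"
instance
proof
 show "inj (tr :: bool => tree)"
 proof (rule injI)
  show "x = y" if "tr x = tr y" for x y :: bool using that by (cases x; cases y) (auto simp: tr_bool_def)
 qed
qed
end

instantiation unit :: tr begin
definition "tr_unit (u :: unit) = Lf"
instance by standard (simp add: inj_def)
end

instantiation prod :: (tr, tr) tr begin
definition "tr_prod x = Nd (tr (fst x)) (tr (snd x))"
instance by standard (auto simp: inj_def tr_prod_def dest: injD[OF inj_tr])
end

instantiation list :: (tr) tr begin
definition "tr_list xs = foldr (%a t. Nd (tr a) t) xs Lf"
instance
proof
 show "inj (tr :: 'a list => tree)"
 proof (rule injI)
  show "tr xs = tr ys ==> xs = ys" for xs ys :: "'a list"
  proof (induction xs arbitrary: ys)
   case Nil
   then show ?case by (cases ys) (auto simp: tr_list_def)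
  next
   case (Cons x xs)
   then show ?case by (cases ys) (auto simp: tr_list_def dest: injD[OF inj_tr])
  qed
 qed
qed
end

text \<open>A number has the tree of its bit list. So \<open>bits\<close> is the identity on trees,
  and arithmetic can be programmed on bit lists.\<close>

instantiation nat :: tr begin
definition "tr_nat n = tr (bits n)"
instance by standard (auto simp: inj_def tr_nat_def bits_inject dest!: injD[OF inj_tr])
end

instantiation int :: tr begin
definition "tr_int z = tr (z < 0, nat \<bar>z\<bar>)"
instance
proof
 show "inj (tr :: int => tree)"
 proof (rule injI)
  fix x y :: int assume "tr x = tr y"
  then have "(x < 0, nat \<bar>x\<bar>) = (y < 0, nat \<bar>y\<bar>)" unfolding tr_int_def by (rule injD[OF inj_tr])
  then show "x = y" by (auto split: if_splits)
 qed
qed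
end

lemma tr_simps: "tr (a, b) = Nd (tr a) (tr b)" "tr ([] :: 'a::tr list) = Lf" "tr (x # xs) = Nd (tr x) (tr xs)"
 "tr False = Lf" "tr True = Nd Lf Lf" "tr () = Lf"
 for a :: "'b::tr" and b :: "'c::tr" and x :: "'a::tr"
 by (simp_all add: tr_prod_def tr_list_def tr_bool_def tr_unit_def)

lemma tr_bools: "tr (x :: bool list) = tbl x"
 by (induction x) (auto simp: tr_simps tr_bool_def)

definition sz :: "'a::tr => nat" where
 "sz x = tsz (tr x)"

lemma sz_simps [simp]: "sz (a, b) = Suc (sz a + sz b)" "sz ([] :: 'a::tr list) = 1" "sz (x # xs) = Suc (sz x + sz xs)"
 "sz () = 1" for a :: "'b::tr" and b :: "'c::tr" and x :: "'a::tr"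
 by (simp_all add: sz_def tr_simps)

lemma sz_pos [simp]: "0 < sz x"
 by (simp add: sz_def)

lemma sz_bool: "sz (b :: bool) \<le> 3"
 by (cases b) (simp_all add: sz_def tr_simps)

lemma llen_tr: "llen (tr xs) = length xs"
 by (induction xs) (auto simp: tr_simps)

text \<open>A measure \<open>m\<close> on values says nothing about trees that encode no value,
  whereas \<open>rpt\<close> bounds the time on all trees; hence the separate tree measure
  \<open>\<mu>\<close>.\<close>

definition rptf :: "('a::tr => nat) => ('a => 'b::tr) => bool" where
 "rptf m f \<longleftrightarrow> (\<exists>F \<mu>. rpt \<mu> F & (\<forall>x. \<mu> (tr x) \<le> m x & F (tr x) = tr (f x)))"

abbreviation ptf :: "('a::tr => 'b::tr) => bool" where
 "ptf \<equiv> rptf (%_. 0)"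

named_theorems ptfs

lemma rptfE:
 assumes "rptf m f"
 obtains \<mu> F where "rpt \<mu> F" "!!x. \<mu> (tr x) \<le> m x" "!!x. F (tr x) = tr (f x)"
 using assms unfolding rptf_def by blast

lemma rptfI: "rpt \<mu> F ==> (!!x. \<mu> (tr x) \<le> m x) ==> (!!x. F (tr x) = tr (f x)) ==> rptf m f"
 unfolding rptf_def by blast

lemma rptf_size:
 assumes "rptf m f"
 obtains s where "pbd s" "mono s" "!!x. sz (f x) \<le> s (sz x + m x)"
proof -
 obtain F \<mu> where F: "rpt \<mu> F" "!!x. \<mu> (tr x) \<le> m x" "!!x. F (tr x) = tr (f x)" using assms unfolding rptf_def by blast
 obtain k where k: "!!x. tsz (F x) \<le> (tsz x + \<mu> x + 2) ^ k" using F(1) unfolding rpt_def by blast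
 have "sz (f x) \<le> (sz x + m x + 2) ^ k" for x
  using k[of "tr x"] power_mono[of "tsz (tr x) + \<mu> (tr x) + 2" "tsz (tr x) + m x + 2" k] F(2)[of x]
  by (simp add: sz_def F(3))
 moreover have "mono (%n :: nat. (n + 2) ^ k)" by (intro monoI power_mono) auto
 ultimately show ?thesis using that[OF pbd_pow[of k]] by blast
qed

lemma rptf_comp:
 assumes "rptf m f" "rptf l g"
 shows "rptf (%z. m z + l (f z)) (%z. g (f z))"
proof -
 obtain F \<mu> where F: "rpt \<mu> F" "!!x. \<mu> (tr x) \<le> m x" "!!x. F (tr x) = tr (f x)" using assms(1) unfolding rptf_def by blast
 obtain G \<nu> where G: "rpt \<nu> G" "!!x. \<nu> (tr x) \<le> l x" "!!x. G (tr x) = tr (g x)" using assms(2) unfolding rptf_def by blast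
 have "rpt (%x. \<mu> x + \<nu> (F x)) F" by (rule rpt_mono[OF F(1)]) simp
 then have "rpt (%x. \<mu> x + \<nu> (F x)) (%x. G (F x))" by (rule rpt_comp[OF _ G(1) pbd_id]) simp
 then show ?thesis
 proof (rule rptfI)
  show "\<mu> (tr x) + \<nu> (F (tr x)) \<le> m x + l (f x)" for x using F(2)[of x] G(2)[of "f x"] F(3)[of x] by simp
  show "G (F (tr x)) = tr (g (f x))" for x by (simp add: F(3) G(3))
 qed
qed

lemma ptf_comp: "ptf f ==> ptf g ==> ptf (%z. g (f z))"
 using rptf_comp[of "%_. 0" f "%_. 0" g] by simp

lemma ptf_comp2: "ptf (%w. g (fst w) (snd w)) ==> ptf a ==> ptf b ==> ptf (%z. (a z, b z)) ==> ptf (%z. g (a z) (b z))"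
 using ptf_comp[of "%z. (a z, b z)" "%w. g (fst w) (snd w)"] by simp

lemma rptf_pair:
 assumes "rptf m f" "rptf m g"
 shows "rptf m (%z. (f z, g z))"
proof -
 obtain F \<mu> where F: "rpt \<mu> F" "!!x. \<mu> (tr x) \<le> m x" "!!x. F (tr x) = tr (f x)" using assms(1) unfolding rptf_def by blast
 obtain G \<nu> where G: "rpt \<nu> G" "!!x. \<nu> (tr x) \<le> m x" "!!x. G (tr x) = tr (g x)" using assms(2) unfolding rptf_def by blast
 have "rpt (%x. max (\<mu> x) (\<nu> x)) (%x. Nd (F x) (G x))"
  by (rule rpt_pair[OF rpt_mono[OF F(1)] rpt_mono[OF G(1)]]) auto
 then show ?thesis by (rule rptfI) (use F G in \<open>auto simp: tr_simps\<close>)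
qed

lemmas ptf_Pair [ptfs] = rptf_pair[of "%_. 0"]

lemma ptf_id [ptfs]: "ptf (%z. z)"
 by (rule rptfI[OF rpt_id[of "%_. 0"]]) auto

lemma ptf_const [ptfs]: "ptf (%z. c)"
 by (rule rptfI[OF rpt_const[of "%_. 0" "tr c"]]) auto

lemma ptf_fst [ptfs]: "ptf f ==> ptf (%z. fst (f z))"
 by (rule ptf_comp[of f fst]) (auto intro!: rptfI[OF rpt_fst[of "%_. 0"]] simp: tr_prod_def)

lemma ptf_snd [ptfs]: "ptf f ==> ptf (%z. snd (f z))"
 by (rule ptf_comp[of f snd]) (auto intro!: rptfI[OF rpt_snd[of "%_. 0"]] simp: tr_prod_def)

lemma ptf_if [ptfs]:
 assumes "ptf b" "ptf f" "ptf g"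
 shows "ptf (%z. if b z then f z else g z)"
proof -
 obtain B \<beta> where B: "rpt \<beta> B" "!!x. \<beta> (tr (x::'a)) \<le> 0" "!!x. B (tr x) = tr (b x)" using assms(1) unfolding rptf_def by blast
 obtain F \<mu> where F: "rpt \<mu> F" "!!x. \<mu> (tr (x::'a)) \<le> 0" "!!x. F (tr x) = tr (f x)" using assms(2) unfolding rptf_def by blast
 obtain G \<nu> where G: "rpt \<nu> G" "!!x. \<nu> (tr (x::'a)) \<le> 0" "!!x. G (tr x) = tr (g x)" using assms(3) unfolding rptf_def by blast
 have "rpt (%x. \<beta> x + \<mu> x + \<nu> x) (%x. if B x = Lf then G x else F x)"
  by (rule rpt_cond[OF rpt_mono[OF B(1)] rpt_mono[OF G(1)] rpt_mono[OF F(1)]]) auto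
 then show ?thesis
 proof (rule rptfI)
  show "\<beta> (tr x) + \<mu> (tr x) + \<nu> (tr x) \<le> 0" for x :: 'a using B(2)[of x] F(2)[of x] G(2)[of x] by simp
  show "(if B (tr x) = Lf then G (tr x) else F (tr x)) = tr (if b x then f x else g x)" for x :: 'a
   using B(3)[of x] F(3)[of x] G(3)[of x] by (cases "b x") (simp_all add: tr_simps)
 qed
qed

lemma ptf_Cons [ptfs]: "ptf f ==> ptf g ==> ptf (%z. f z # g z)"
proof -
 assume fg: "ptf f" "ptf g"
 have "ptf (%w :: 'b \<times> 'b list. fst w # snd w)"
  by (rule rptfI[OF rpt_id[of "%_. 0"]]) (auto simp: tr_simps)
 from ptf_comp[OF ptf_Pair[OF fg] this] show ?thesis by simp
qed

lemma ptf_null [ptfs]: "ptf f ==> ptf (%z. f z = [])"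
proof (rule ptf_comp[of f "%x. x = []"])
 show "ptf (%x :: 'b list. x = [])"
 proof (rule rptfI[OF rpt_cond[OF rpt_id rpt_const rpt_const]])
  show "(if tr x = Lf then Nd Lf Lf else Lf) = tr (x = [])" for x :: "'b list"
   by (cases x) (auto simp: tr_simps)
 qed auto
qed

lemma ptf_tl [ptfs]: "ptf f ==> ptf (%z. tl (f z))"
 by (rule ptf_comp[of f tl], assumption, rule rptfI[OF rpt_snd[of "%_. 0"]], simp)
  (metis list.exhaust_sel list.sel(2) tr_simps(2,3) tsnd.simps)

text \<open>On the empty list the tree function does not return the encoding of \<open>hd []\<close>; the default makes it total.\<close>

definition hd_or :: "'a => 'a list => 'a" where
 "hd_or d xs = (case xs of [] => d | a # _ => a)"

lemma hd_or_simps [simp]: "hd_or d [] = d" "hd_or d (a # xs) = a"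
 by (simp_all add: hd_or_def)

lemma ptf_hd_or [ptfs]:
 assumes "ptf d" "ptf f"
 shows "ptf (%z. hd_or (d z) (f z))"
proof -
 have "ptf (%w :: 'b \<times> 'b list. hd_or (fst w) (snd w))"
 proof (rule rptfI[OF rpt_cond[OF rpt_snd rpt_fst pt_comp[OF rpt_snd rpt_fst]]])
  show "(if tsnd (tr x) = Lf then tfst (tr x) else tfst (tsnd (tr x))) = tr (hd_or (fst x) (snd x))" for x :: "'b \<times> 'b list"
   by (cases "snd x") (auto simp: tr_prod_def tr_simps)
 qed auto
 from ptf_comp[OF ptf_Pair[OF assms] this] show ?thesis by simp
qed

lemma ptf_case_list [ptfs]:
 assumes "ptf l" "ptf n" "ptf (%w. c (fst w) (fst (snd w)) (snd (snd w)))"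
 shows "ptf (%z. case l z of [] => n z | a # b => c z a b)"
proof -
 \<comment> \<open>\<open>undefined\<close> is some fixed value of the type, hence has a fixed tree;
   the guard keeps it from reaching the result.\<close>
 have "ptf (%z. if l z = [] then n z else c z (hd_or undefined (l z)) (tl (l z)))"
  using ptf_comp[OF ptf_Pair[OF ptf_id ptf_Pair[OF ptf_hd_or[OF ptf_const[of undefined] assms(1)] ptf_tl[OF assms(1)]]] assms(3)]
  by (intro ptf_if ptf_null assms) simp
 moreover have "(if l z = [] then n z else c z (hd_or undefined (l z)) (tl (l z))) = (case l z of [] => n z | a # b => c z a b)" for z
  by (cases "l z") auto
 ultimately show ?thesis by simp
qed

lemma ptf_case_prod [ptfs]:
 assumes "ptf f" "ptf (%z. h z (fst (f z)) (snd (f z)))"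
 shows "ptf (%z. case f z of (a, b) => h z a b)"
 using assms(2) by (simp add: case_prod_beta)

lemma rptf_iter:
 fixes g :: "'a::tr => 'c::tr => 'c" and l :: "'a => 'b::tr list"
 assumes l: "rptf m l" and i: "rptf m i" and g: "ptf (%w. g (fst w) (snd w))" and s: "pbd s"
  and S: "!!z j. j \<le> length (l z) ==> sz ((g z ^^ j) (i z)) \<le> s (sz z + m z)"
 shows "rptf m (%z. (g z ^^ length (l z)) (i z))"
proof -
 obtain G \<nu> where G: "rpt \<nu> G" "!!x. \<nu> (tr (x::'a \<times> 'c)) \<le> 0" "!!x. G (tr x) = tr (g (fst x) (snd x))" using g unfolding rptf_def by blast
 obtain f :: "'a => 'b list \<times> ('a \<times> 'c)" where f: "f = (%z. (l z, (z, i z)))" by simp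
 have pf: "rptf m f" unfolding f
  by (intro rptf_pair l i) (rule rptfI[OF rpt_id[of "%_. 0"]]; simp)
 obtain F \<mu> where F: "rpt \<mu> F" "!!x. \<mu> (tr x) \<le> m x" "!!x. F (tr x) = tr (f x)" using pf unfolding rptf_def by blast
 \<comment> \<open>The loop state carries \<open>z\<close> along, since the body depends on
   it.\<close>
 let ?H = "%w. Nd (tfst w) (G w)"
 have H: "rpt \<nu> ?H" by (rule rpt_pair[OF rpt_fst G(1)])
 have H1: "?H (tr (z, y)) = tr (z, g z y)" for z y
  using G(3)[of "(z, y)"] by (simp add: tr_simps)
 have Hpow: "(?H ^^ j) (tr (z, y)) = tr (z, (g z ^^ j) y)" for j z y
  by (induction j) (simp_all only: funpow.simps id_apply o_apply H1)
 \<comment> \<open>A measure that bounds the iterates on every tree, simply by summing their sizes;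
   on encodings \<open>S\<close> makes it polynomial.\<close>
 define B where "B x = (case x of Lf => 0 | Nd c y => \<Sum>j\<le>llen c. tsz ((?H ^^ j) y) + \<nu> ((?H ^^ j) y))" for x
 have it: "rpt B (titer ?H)"
 proof (rule rpt_iter[OF H pbd_id])
  fix c y j assume "j \<le> llen c"
  then have "tsz ((?H ^^ j) y) + \<nu> ((?H ^^ j) y) \<le> B (Nd c y)"
   unfolding B_def by (simp, intro member_le_sum) auto
  then show "tsz ((?H ^^ j) y) + \<nu> ((?H ^^ j) y) \<le> tsz (Nd c y) + B (Nd c y)" by simp
 qed
 obtain t where t: "pbd t" "mono t" "!!x. sz (l x) \<le> t (sz x + m x)" using l by (rule rptf_size) blast
 have len: "length (l x) \<le> t (sz x + m x)" for x
 proof -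
  have "length ys \<le> sz ys" for ys :: "'b list" by (induction ys) auto
  then show ?thesis using t(3)[of x] order_trans by blast
 qed
 define b where "b n = Suc (t n) * (Suc (n + s n))" for n
 have pb: "pbd b" unfolding b_def using s t(1) by (intro pbds)
 have Bx: "B (F (tr x)) \<le> b (sz x + m x)" for x
 proof -
  have "B (F (tr x)) = (\<Sum>j\<le>length (l x). tsz (tr (x, (g x ^^ j) (i x))) + \<nu> (tr (x, (g x ^^ j) (i x))))"
   unfolding F(3) f tr_simps(1)[of "l x"] by (simp only: B_def tree.case llen_tr Hpow)
  also have "\<dots> \<le> (\<Sum>j\<le>length (l x). Suc (sz x + m x + s (sz x + m x)))"
  proof (rule sum_mono)
   fix j assume "j \<in> {..length (l x)}"
   then show "tsz (tr (x, (g x ^^ j) (i x))) + \<nu> (tr (x, (g x ^^ j) (i x))) \<le> Suc (sz x + m x + s (sz x + m x))"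
    using S[of j x] G(2)[of "(x, (g x ^^ j) (i x))"] by (simp add: sz_def[symmetric])
  qed
  also have "\<dots> \<le> b (sz x + m x)" unfolding b_def sum_constant card_atMost of_nat_id
   using len[of x] by (intro mult_right_mono) auto
  finally show ?thesis .
 qed
 \<comment> \<open>Off the encodings the measure is made large enough for the required bound to be
   trivial.\<close>
 define \<mu>' where "\<mu>' x = (if x \<in> range (tr :: 'a => tree) then m (inv tr x) else \<mu> x + B (F x))" for x
 have \<mu>'tr: "\<mu>' (tr x) = m x" for x unfolding \<mu>'_def by (simp add: inv_f_f[OF inj_tr])
 have "\<mu> x \<le> \<mu>' x" for x
 proof (cases "x \<in> range (tr :: 'a => tree)")
  case True
  then obtain y :: 'a where "x = tr y" by blast
  then show ?thesis using F(2)[of y] \<mu>'tr[of y] by simp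
 next
  case False
  then show ?thesis by (simp add: \<mu>'_def)
 qed
 then have "rpt \<mu>' F" by (rule rpt_mono[OF F(1)])
 moreover have "B (F x) \<le> b (tsz x + \<mu>' x) + (tsz x + \<mu>' x)" for x
 proof (cases "x \<in> range (tr :: 'a => tree)")
  case True
  then obtain y :: 'a where "x = tr y" by blast
  then show ?thesis using Bx[of y] \<mu>'tr[of y] by (simp add: sz_def)
 next
  case False
  then show ?thesis by (simp add: \<mu>'_def)
 qed
 moreover have "pbd (%n. b n + n)" using pb by (intro pbds)
 ultimately have "rpt \<mu>' (%x. titer ?H (F x))" using rpt_comp[OF _ it] by blast
 from pt_comp[OF this rpt_snd] have "rpt \<mu>' (%x. tsnd (titer ?H (F x)))" .
 then show ?thesis
 proof (rule rptfI)
  show "tsnd (titer ?H (F (tr x))) = tr ((g x ^^ length (l x)) (i x))" for x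
   unfolding F(3) f tr_simps(1)[of "l x"] by (simp only: titer_def tree.case llen_tr Hpow) (simp add: tr_simps)
 qed (simp add: \<mu>'tr)
qed

lemma ptf_iter:
 fixes g :: "'a::tr => 'c::tr => 'c" and l :: "'a => 'b::tr list"
 assumes "ptf l" "ptf i" "ptf (%w. g (fst w) (snd w))" "pbd s"
  "!!z j. j \<le> length (l z) ==> sz ((g z ^^ j) (i z)) \<le> s (sz z)"
 shows "ptf (%z. (g z ^^ length (l z)) (i z))"
 using assms by (intro rptf_iter) auto

lemma sz_list: "sz xs = Suc (\<Sum>x\<leftarrow>xs. Suc (sz x))"
 by (induction xs) auto

lemma length_le_sz: "length xs \<le> sz xs"
 by (induction xs) auto

lemma sz_append: "sz (xs @ ys) + 1 = sz xs + sz ys"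
 by (induction xs) auto

lemma sz_take_drop: "sz (take j xs) \<le> sz xs" "sz (drop j xs) \<le> sz xs"
proof -
 have "sz (take j xs @ drop j xs) + 1 = sz (take j xs) + sz (drop j xs)" by (rule sz_append)
 moreover have "0 < sz (take j xs)" "0 < sz (drop j xs)" by simp_all
 ultimately show "sz (take j xs) \<le> sz xs" "sz (drop j xs) \<le> sz xs" unfolding append_take_drop_id by linarith+
qed

lemma sz_elem: "x \<in> set xs ==> sz x \<le> sz xs"
 by (induction xs) auto

lemma ptf_foldl:
 assumes l: "ptf l" and i: "ptf i" and g: "ptf (%w. g (fst w) (fst (snd w)) (snd (snd w)))" and s: "pbd s"
  and S: "!!z j. j \<le> length (l z) ==> sz (foldl (g z) (i z) (take j (l z))) \<le> s (sz z)"
 shows "ptf (%z. foldl (g z) (i z) (l z))"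
proof -
 \<comment> \<open>Folding as iteration: the state holds the list still to be read and the
   accumulator, and an exhausted list leaves it unchanged.\<close>
 define h where "h z w = (case fst w of [] => w | a # r => (r, g z (snd w) a))" for z w
 have h: "(h z ^^ j) (xs, y) = (drop j xs, foldl (g z) y (take j xs))" for z j xs y
 proof (induction j)
  case (Suc j)
  then show ?case
   by (cases "j < length xs") (auto simp: h_def take_Suc_conv_app_nth Cons_nth_drop_Suc[symmetric])
 qed auto
 obtain t where t: "pbd t" "mono t" "!!x. sz (l x) \<le> t (sz x + 0)" using l by (rule rptf_size) blast
 have "ptf (%z. (h z ^^ length (l z)) (l z, i z))"
 proof (rule ptf_iter[OF l])
  show "ptf (%z. (l z, i z))" by (intro ptfs l i)
  show "ptf (%w. h (fst w) (snd w))"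
   unfolding h_def
   by (intro ptf_case_list ptfs ptf_comp[OF ptf_Pair[OF _ ptf_Pair] g, simplified])
  show "pbd (%n. Suc (t n + s n))" using t(1) s by (intro pbds)
  fix z j assume "j \<le> length (l z)"
  then show "sz ((h z ^^ j) (l z, i z)) \<le> Suc (t (sz z) + s (sz z))"
   using S[of j z] t(3)[of z] sz_take_drop(2)[of j "l z"] by (simp add: h)
 qed
 from ptf_snd[OF this] show ?thesis by (simp add: h)
qed

lemma ptf_size:
 assumes "ptf f"
 obtains s where "pbd s" "mono s" "!!x. sz (f x) \<le> s (sz x)"
 using rptf_size[OF assms] by (metis add.right_neutral)

lemma ptf_lift2: "ptf (%w. h (fst w) (snd w)) ==> ptf f ==> ptf g ==> ptf (%z. h (f z) (g z))"
 using ptf_comp[of "%z. (f z, g z)" "%w. h (fst w) (snd w)"] ptf_Pair[of f g] by simp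

lemma ptf_lift3: "ptf (%w. h (fst w) (fst (snd w)) (snd (snd w))) ==> ptf f ==> ptf g ==> ptf k ==> ptf (%z. h (f z) (g z) (k z))"
 using ptf_comp[of "%z. (f z, g z, k z)" "%w. h (fst w) (fst (snd w)) (snd (snd w))"] ptf_Pair[of f "%z. (g z, k z)"] ptf_Pair[of g k] by simp

lemma ptf_same_tr: "ptf g ==> (!!z. tr (g z) = tr (f z)) ==> ptf f"
 unfolding rptf_def by simp

lemma ptf_cong: "ptf g ==> (!!z. g z = f z) ==> ptf f"
proof -
 assume g: "ptf g" and eq: "!!z. g z = f z"
 from eq have "g = f" by (rule ext)
 with g show ?thesis by simp
qed

lemma foldl_Cons: "foldl (%acc a. a # acc) ys xs = rev xs @ ys"
 by (induction xs arbitrary: ys) auto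

lemma sz_append': "sz (xs @ ys) \<le> sz xs + sz ys"
 using sz_append[of xs ys] by simp

lemma sz_rev: "sz (rev xs) = sz xs"
proof (induction xs)
 case (Cons a xs)
 have "sz (rev xs @ [a]) + 1 = sz (rev xs) + sz [a]" by (rule sz_append)
 then show ?case using Cons by simp
qed simp

lemma ptf_rev [ptfs]: "ptf f ==> ptf (%z. rev (f z))"
proof (erule ptf_comp)
 have "ptf (%xs :: 'b list. foldl (%acc a. a # acc) [] xs)"
  by (rule ptf_foldl[OF ptf_id ptf_const _ pbd_id])
   (auto intro!: ptfs simp: foldl_Cons sz_rev sz_take_drop)
 then show "ptf (rev :: 'b list => 'b list)" by (simp add: foldl_Cons)
qed

lemma ptf_append [ptfs]:
 assumes "ptf f" "ptf g"
 shows "ptf (%z. f z @ g z)"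
proof -
 have "ptf (%w :: 'b list \<times> 'b list. foldl (%acc a. a # acc) (snd w) (rev (fst w)))"
 proof (rule ptf_foldl[OF _ _ _ pbd_id])
  fix w :: "'b list \<times> 'b list" and j
  show "sz (foldl (%acc a. a # acc) (snd w) (take j (rev (fst w)))) \<le> sz w"
   using sz_append'[of "rev (take j (rev (fst w)))" "snd w"] sz_take_drop(1)[of j "rev (fst w)"]
   by (cases w) (simp add: foldl_Cons sz_rev)
 qed (intro ptfs)+
 then have "ptf (%w :: 'b list \<times> 'b list. fst w @ snd w)" by (simp add: foldl_Cons)
 from ptf_lift2[OF this assms] show ?thesis .
qed

lemma sz_map_le: "(!!a. a \<in> set xs ==> sz (h a) \<le> B) ==> sz (map h xs) \<le> Suc (length xs * Suc B)"
proof (induction xs)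
 case (Cons a xs)
 have "sz (h a) \<le> B" "sz (map h xs) \<le> Suc (length xs * Suc B)" using Cons by auto
 then show ?case by simp
qed simp

lemma ptf_map [ptfs]:
 assumes "ptf (%w. g (fst w) (snd w))" "ptf l"
 shows "ptf (%z. map (g z) (l z))"
proof -
 have fold: "foldl (%acc a. g e a # acc) ys xs = rev (map (g e) xs) @ ys" for e ys xs
  by (induction xs arbitrary: ys) auto
 obtain s where s: "pbd s" "mono s" "!!x. sz (g (fst x) (snd x)) \<le> s (sz x)" using assms(1) by (rule ptf_size) blast
 have "ptf (%w. foldl (%acc a. g (fst w) a # acc) [] (snd w))"
 proof (rule ptf_foldl)
  show "pbd (%n. Suc (n * Suc (s n)))" using s(1) by (intro pbds)
  show "ptf (%w. g (fst (fst w)) (snd (snd w)) # fst (snd w))"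
   by (intro ptfs ptf_lift2[OF assms(1)])
  fix w :: "'a \<times> 'b list" and j
  have "sz (map (g (fst w)) (take j (snd w))) \<le> Suc (length (take j (snd w)) * Suc (s (sz w)))"
  proof (rule sz_map_le)
   fix a assume "a \<in> set (take j (snd w))"
   then have "sz a \<le> sz (snd w)" using sz_elem in_set_takeD by fast
   then have "sz (fst w, a) \<le> sz w" by (cases w) simp
   then show "sz (g (fst w) a) \<le> s (sz w)" using s(3)[of "(fst w, a)"] monoD[OF s(2)] by fastforce
  qed
  also have "\<dots> \<le> Suc (sz w * Suc (s (sz w)))"
   using length_le_sz[of "snd w"] by (intro Suc_le_mono[THEN iffD2] mult_right_mono) (cases w, auto)
  finally show "sz (foldl (%acc a. g (fst w) a # acc) [] (take j (snd w))) \<le> Suc (sz w * Suc (s (sz w)))"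
   by (simp add: fold sz_rev)
 qed (intro ptfs)+
 from ptf_rev[OF this] have "ptf (%w. map (g (fst w)) (snd w))" by (simp add: fold)
 from ptf_lift2[OF this ptf_id assms(2)] show ?thesis .
qed

lemma sz_concat: "sz (concat xss) \<le> sz xss"
proof (induction xss)
 case (Cons xs xss)
 then show ?case using sz_append'[of xs "concat xss"] by simp
qed simp

lemma ptf_concat [ptfs]:
 assumes "ptf f"
 shows "ptf (%z. concat (f z))"
proof -
 have fold: "foldl (%acc xs. acc @ xs) ys xss = ys @ concat xss" for ys and xss :: "'b list list"
  by (induction xss arbitrary: ys) auto
 have "ptf (%w :: 'b list list. foldl (%acc xs. acc @ xs) [] w)"
 proof (rule ptf_foldl[OF _ _ _ pbd_id])
  fix w :: "'b list list" and j
  show "sz (foldl (%acc xs. acc @ xs) [] (take j w)) \<le> sz w"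
   using sz_concat[of "take j w"] sz_take_drop(1)[of j w] by (simp add: fold)
 qed (intro ptfs)+
 from ptf_comp[OF assms this] show ?thesis by (simp add: fold)
qed

lemma ptf_not [ptfs]: "ptf f ==> ptf (%z. \<not> f z)"
 by (rule ptf_cong[OF ptf_if[OF _ ptf_const[of False] ptf_const[of True]]]) auto

lemma ptf_conj [ptfs]:
 assumes "ptf f" "ptf g"
 shows "ptf (%z. f z & g z)"
 by (rule ptf_cong[OF ptf_if[OF assms ptf_const[of False]]]) auto

lemma ptf_disj [ptfs]:
 assumes "ptf f" "ptf g"
 shows "ptf (%z. f z \<or> g z)"
 by (rule ptf_cong[OF ptf_if[OF assms(1) ptf_const[of True] assms(2)]]) auto

lemma ptf_imp [ptfs]:
 assumes "ptf f" "ptf g"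
 shows "ptf (%z. f z --> g z)"
 by (rule ptf_cong[OF ptf_if[OF assms ptf_const[of True]]]) auto

lemma ptf_filter [ptfs]:
 assumes "ptf (%w. P (fst w) (snd w))" "ptf l"
 shows "ptf (%z. filter (P z) (l z))"
proof -
 have "concat (map (%a. if P z a then [a] else []) xs) = filter (P z) xs" for z xs
  by (induction xs) auto
 moreover have "ptf (%z. concat (map (%a. if P z a then [a] else []) (l z)))"
  using assms by (intro ptfs)
 ultimately show ?thesis by simp
qed

lemma ptf_ball [ptfs]:
 assumes "ptf (%w. P (fst w) (snd w))" "ptf l"
 shows "ptf (%z. \<forall>a \<in> set (l z). P z a)"
proof -
 have "ptf (%z. filter (%a. \<not> P z a) (l z) = [])" using assms by (intro ptfs)
 then show ?thesis by (simp add: filter_empty_conv)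
qed

lemma ptf_bex [ptfs]:
 assumes "ptf (%w. P (fst w) (snd w))" "ptf l"
 shows "ptf (%z. \<exists>a \<in> set (l z). P z a)"
proof -
 have "ptf (%z. \<not> (\<forall>a \<in> set (l z). \<not> P z a))" using assms by (intro ptfs)
 then show ?thesis by simp
qed

lemma sz_zip: "sz (zip xs ys) \<le> sz xs + sz ys"
proof (induction xs ys rule: list_induct2')
 case (4 x xs y ys)
 then show ?case by simp
qed auto

lemma ptf_zip [ptfs]:
 assumes "ptf f" "ptf g"
 shows "ptf (%z. zip (f z) (g z))"
proof -
 let ?h = "%s a. if snd s = [] then s else ((a, hd_or undefined (snd s)) # fst s, tl (snd s))"
 have fold: "foldl ?h (acc, ys) xs = (rev (zip xs ys) @ acc, drop (length xs) ys)" for acc ys and xs :: "'b list"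
 proof (induction xs arbitrary: acc ys)
  case (Cons x xs)
  then show ?case by (cases ys) auto
 qed auto
 have "ptf (%w :: 'b list \<times> 'c list. foldl ?h ([], snd w) (fst w))"
 proof (rule ptf_foldl)
  show "pbd (%n. 2 * n)" by (intro pbds)
  fix w :: "'b list \<times> 'c list" and j
  show "sz (foldl ?h ([], snd w) (take j (fst w))) \<le> 2 * sz w"
   using sz_zip[of "take j (fst w)" "snd w"] sz_take_drop(1)[of j "fst w"]
    sz_take_drop(2)[of "length (take j (fst w))" "snd w"]
   unfolding fold by (cases w) (simp add: sz_rev)
 qed (intro ptfs)+
 from ptf_lift2[OF ptf_rev[OF ptf_fst[OF this], unfolded fold, simplified] assms] show ?thesis .
qed

lemma ptf_take_len: "ptf l ==> ptf f ==> ptf (%z. take (length (l z)) (f z))"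
proof -
 assume a: "ptf l" "ptf f"
 have "take (length ys) xs = map fst (zip xs ys)" for xs :: "'c list" and ys :: "'b list"
  by (rule nth_equalityI) auto
 moreover have "ptf (%z. map (%p. fst p) (zip (f z) (l z)))" using a by (intro ptfs)
 ultimately show ?thesis by simp
qed

lemma ptf_drop_len: "ptf l ==> ptf f ==> ptf (%z. drop (length (l z)) (f z))"
proof -
 assume a: "ptf l" "ptf f"
 have tl: "(tl ^^ n) xs = drop n xs" for n and xs :: "'c list"
  by (induction n) (auto simp: drop_Suc tl_drop)
 have "ptf (%w :: 'b list \<times> 'c list. ((%xs. tl xs) ^^ length (fst w)) (snd w))"
 proof (rule ptf_iter[OF _ _ _ pbd_id])
  fix w :: "'b list \<times> 'c list" and j
  show "sz (((%xs. tl xs) ^^ j) (snd w)) \<le> sz w"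
   using sz_take_drop(2)[of j "snd w"] by (cases w) (simp add: tl)
 qed (intro ptfs)+
 then have "ptf (%w :: 'b list \<times> 'c list. drop (length (fst w)) (snd w))" by (simp add: tl)
 from ptf_lift2[OF this a] show ?thesis .
qed

lemma ptf_replicate_len: "ptf l ==> ptf f ==> ptf (%z. replicate (length (l z)) (f z))"
proof -
 assume "ptf l" "ptf f"
 then have "ptf (%z. map (%a. f z) (l z))" by (intro ptfs ptf_comp[OF _ \<open>ptf f\<close>])
 then show ?thesis by (simp add: map_replicate_const)
qed

section \<open>Binary arithmetic\<close>

fun val :: "bool list => nat" where
 "val [] = 0" | "val (b # bs) = of_bool b + 2 * val bs"

lemma bits_0 [simp]: "bits 0 = []"
 by (subst bits.simps) simp

lemma bits_eq_Nil [simp]: "bits n = [] \<longleftrightarrow> n = 0"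
 by (subst bits.simps) simp

lemma bits_step: "bits (of_bool b + 2 * n) = (if b \<or> n ~= 0 then b # bits n else [])"
 by (subst bits.simps) auto

lemma val_bits [simp]: "val (bits n) = n"
proof (induction n rule: less_induct)
 case (less n)
 show ?case
 proof (cases "n = 0")
  case False
  then have "val (bits n) = of_bool (odd n) + 2 * (n div 2)" using less[of "n div 2"] by (subst bits.simps) simp
  then show ?thesis by (cases "odd n") (auto elim!: oddE evenE)
 qed simp
qed

lemma val_append: "val (xs @ ys) = val xs + 2 ^ length xs * val ys"
 by (induction xs) (auto simp: algebra_simps)

lemma val_less: "val xs < 2 ^ length xs"
 by (induction xs) (auto simp: of_bool_def)

lemma val_Falses [simp]: "val (replicate k False) = 0"
 by (induction k) auto

lemma val_drop: "val (drop k bs) = val bs div 2 ^ k"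
proof (cases "k \<le> length bs")
 case True
 have "val bs = val (take k bs) + 2 ^ k * val (drop k bs)"
  using val_append[of "take k bs" "drop k bs"] True by (simp add: min_absorb2)
 moreover have "val (take k bs) < 2 ^ k" using val_less[of "take k bs"] True by (simp add: min_absorb2)
 ultimately show ?thesis by (simp add: div_mult_self2)
next
 case False
 have "val bs < 2 ^ length bs" by (rule val_less)
 also have "\<dots> \<le> 2 ^ k" using False by (intro power_increasing) auto
 finally show ?thesis using False by simp
qed

lemma sz_bools: "sz (xs :: bool list) \<le> 4 * length xs + 1"
proof (induction xs)
 case (Cons a xs)
 then show ?case using sz_bool[of a] by simp
qed simp

lemma ptf_bits [ptfs]: "ptf f ==> ptf (%z. bits (f z))"
 by (erule ptf_same_tr) (simp add: tr_nat_def)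

lemma ptf_unbits: "ptf (%z. bits (f z)) ==> ptf f"
 by (erule ptf_same_tr) (simp add: tr_nat_def)

text \<open>A bit list has the tree of a number once its high-order zeros are removed; scanning from
  the high end drops them while the accumulator is empty.\<close>

lemma ptf_val [ptfs]: "ptf f ==> ptf (%z. val (f z))"
proof (erule ptf_comp, rule ptf_unbits)
 let ?h = "%acc b. if acc = [] & \<not> b then [] else b # acc"
 have strip: "foldl ?h [] (rev bs) = bits (val bs)" for bs
  by (induction bs) (auto simp: bits_step)
 have len: "length (foldl ?h ys bs) \<le> length ys + length bs" for ys bs
 proof (induction bs arbitrary: ys)
  case (Cons b bs)
  show ?case using Cons[of "if ys = [] & \<not> b then [] else b # ys"] by (auto split: if_splits)
 qed simp
 have "ptf (%bs. foldl ?h [] (rev bs))"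
 proof (rule ptf_foldl)
  show "pbd (%n. 4 * n + 1)" by (intro pbds)
  fix bs :: "bool list" and j
  show "sz (foldl ?h [] (take j (rev bs))) \<le> 4 * sz bs + 1"
   using sz_bools[of "foldl ?h [] (take j (rev bs))"] len[of "[]" "take j (rev bs)"] length_le_sz[of bs] by simp
 qed (intro ptfs)+
 then show "ptf (%bs. bits (val bs))" by (simp add: strip)
qed

text \<open>Each list is padded by the length of the other, so that zipping loses no bit and no
  maximum has to be computed.\<close>

definition zpad :: "bool list => bool list => (bool \<times> bool) list" where
 "zpad xs ys = zip (xs @ replicate (length ys) False) (ys @ replicate (length xs) False)"

lemma zpad: "map fst (zpad xs ys) = xs @ replicate (length ys) False" "map snd (zpad xs ys) = ys @ replicate (length xs) False"
 by (simp_all add: zpad_def)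

lemma val_zpad [simp]: "val (map fst (zpad xs ys)) = val xs" "val (map snd (zpad xs ys)) = val ys"
 by (simp_all add: zpad val_append)

lemma ptf_zpad: "ptf f ==> ptf g ==> ptf (%z. zpad (f z) (g z))"
 unfolding zpad_def by (intro ptfs ptf_replicate_len)

text \<open>Addition and subtraction have the same result bit and differ only in the rule
  \<open>c\<close> for the carry. The result bits come out high end first.\<close>

definition ripple :: "(bool => bool => bool => bool) => (bool \<times> bool) list => bool \<times> bool list" where
 "ripple c ps = foldl (%s p. (c (fst s) (fst p) (snd p), ((fst p ~= snd p) ~= fst s) # snd s)) (False, []) ps"

lemma ptf_xor: "ptf f ==> ptf g ==> ptf (%z. f z ~= (g z :: bool))"
proof -
 assume "ptf f" "ptf g"
 then have "ptf (%z. if f z then \<not> g z else g z)" by (intro ptfs)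
 moreover have "(if f z then \<not> g z else g z) = (f z ~= g z)" for z by auto
 ultimately show ?thesis by simp
qed

lemma ptf_ripple:
 assumes "ptf (%w. c (fst w) (fst (snd w)) (snd (snd w)))" "ptf f"
 shows "ptf (%z. ripple c (f z))"
proof -
 let ?h = "%s p. (c (fst s) (fst p) (snd p), ((fst p ~= snd p) ~= fst s) # snd s)"
 have len: "length (snd (foldl ?h s ps)) = length (snd s) + length ps" for s ps
  by (induction ps arbitrary: s) auto
 have "ptf (%ps. foldl ?h (False, []) ps)"
 proof (rule ptf_foldl)
  show "pbd (%n. 4 * n + 5)" by (intro pbds)
  fix ps :: "(bool \<times> bool) list" and j
  let ?r = "foldl ?h (False, []) (take j ps)"
  have "length (snd ?r) \<le> sz ps" using len[of "(False, [])" "take j ps"] length_le_sz[of ps] by simp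
  then show "sz ?r \<le> 4 * sz ps + 5" using sz_bools[of "snd ?r"] sz_bool[of "fst ?r"]
   by (cases ?r) simp
 qed (intro ptfs ptf_xor ptf_lift3[OF assms(1)])+
 from ptf_comp[OF assms(2) this] show ?thesis by (simp add: ripple_def)
qed

abbreviation "carry c a b \<equiv> (a & b) \<or> (c & (a \<or> b))"
abbreviation "borrow c a b \<equiv> (\<not> a & (b \<or> c)) \<or> (b & c)"

lemma ripple_length: "length (snd (ripple c ps)) = length ps"
proof -
 let ?h = "%s p. (c (fst s) (fst p) (snd p), ((fst p ~= snd p) ~= fst s) # snd s)"
 have "length (snd (foldl ?h s ps)) = length (snd s) + length ps" for s
  by (induction ps arbitrary: s) auto
 then show ?thesis by (simp add: ripple_def)
qed

lemma ripple_carry: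
 "val (rev (snd (ripple carry ps)) @ [fst (ripple carry ps)]) = val (map fst ps) + val (map snd ps)"
proof -
 let ?h = "%s p. (carry (fst s) (fst p) (snd p), ((fst p ~= snd p) ~= fst s) # snd s)"
 have "val (rev (snd (foldl ?h s ps))) + 2 ^ length (snd (foldl ?h s ps)) * of_bool (fst (foldl ?h s ps))
  = val (rev (snd s)) + 2 ^ length (snd s) * (of_bool (fst s) + val (map fst ps) + val (map snd ps))" for s
 proof (induction ps arbitrary: s)
  case (Cons p ps)
  obtain a b where p: "p = (a, b)" by fastforce
  show ?case using Cons[of "?h s p"] by (cases a; cases b; cases "fst s") (auto simp: p val_append algebra_simps)
 qed (auto simp: algebra_simps)
 from this[of "(False, [])"] show ?thesis by (simp add: ripple_def val_append)
qed

text \<open>A final borrow stands for \<open>- 2 ^ length ps\<close>. As the result bits denote less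
  than that power, the borrow alone decides the comparison, and in its absence the bits are the
  difference.\<close>

lemma ripple_borrow:
 "int (val (rev (snd (ripple borrow ps)))) - 2 ^ length ps * of_bool (fst (ripple borrow ps))
  = int (val (map fst ps)) - int (val (map snd ps))"
proof -
 let ?h = "%s p. (borrow (fst s) (fst p) (snd p), ((fst p ~= snd p) ~= fst s) # snd s)"
 have "int (val (rev (snd (foldl ?h s ps)))) - 2 ^ length (snd (foldl ?h s ps)) * of_bool (fst (foldl ?h s ps))
  = int (val (rev (snd s))) + 2 ^ length (snd s) * (int (val (map fst ps)) - int (val (map snd ps)) - of_bool (fst s))" for s
 proof (induction ps arbitrary: s)
  case (Cons p ps)
  obtain a b where p: "p = (a, b)" by fastforce
  show ?case using Cons[of "?h s p"] by (cases a; cases b; cases "fst s") (auto simp: p val_append algebra_simps)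
 qed (auto simp: algebra_simps)
 from this[of "(False, [])"] ripple_length[of borrow ps] show ?thesis by (simp add: ripple_def)
qed

lemma ptf_add [ptfs]:
 assumes "ptf f" "ptf g"
 shows "ptf (%z. f z + g z :: nat)"
proof -
 have "ptf (%z. ripple (%c a b. carry c a b) (zpad (bits (f z)) (bits (g z))))"
  by (rule ptf_ripple) (intro ptfs ptf_zpad assms)+
 then have "ptf (%z. val ((%r. rev (snd r) @ [fst r]) (ripple (%c a b. carry c a b) (zpad (bits (f z)) (bits (g z))))))"
  by (rule ptf_comp[where g = "%r. val (rev (snd r) @ [fst r])"]) (intro ptfs)
 then show ?thesis by (simp only: ripple_carry val_zpad val_bits)
qed

lemma ripple_borrow_less:
 fixes m n :: nat
 defines "r \<equiv> ripple borrow (zpad (bits m) (bits n))"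
 shows "fst r \<longleftrightarrow> m < n" "m - n = (if fst r then 0 else val (rev (snd r)))"
proof -
 define X P where "X = val (rev (snd r))" and "P = (2::nat) ^ length (zpad (bits m) (bits n))"
 have "int X - int P * of_bool (fst r) = int m - int n"
  unfolding r_def X_def P_def using ripple_borrow[of "zpad (bits m) (bits n)"] by simp
 moreover have "X < P"
  using val_less[of "rev (snd r)"] unfolding X_def P_def r_def by (simp add: ripple_length)
 ultimately have "(fst r \<longleftrightarrow> m < n) & m - n = (if fst r then 0 else X)"
  by (cases "fst r") auto
 then show "fst r \<longleftrightarrow> m < n" "m - n = (if fst r then 0 else val (rev (snd r)))"
  unfolding X_def by blast+
qed

lemma ptf_less [ptfs]:
 assumes "ptf f" "ptf g"
 shows "ptf (%z. f z < (g z :: nat))"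
proof -
 have "ptf (%z. fst (ripple borrow (zpad (bits (f z)) (bits (g z)))))"
  by (intro ptf_fst, rule ptf_ripple) (intro ptfs ptf_zpad assms)+
 then show ?thesis by (simp only: ripple_borrow_less(1))
qed

lemma ptf_diff [ptfs]:
 assumes "ptf f" "ptf g"
 shows "ptf (%z. f z - g z :: nat)"
proof -
 have r: "ptf (%z. ripple borrow (zpad (bits (f z)) (bits (g z))))"
  by (rule ptf_ripple) (intro ptfs ptf_zpad assms)+
 have "ptf (%z. if fst (ripple borrow (zpad (bits (f z)) (bits (g z)))) then 0 else
   val (rev (snd (ripple borrow (zpad (bits (f z)) (bits (g z)))))))"
  by (intro ptfs r)
 then show ?thesis by (simp only: ripple_borrow_less(2)[symmetric])
qed

lemma ptf_le [ptfs]: "ptf f ==> ptf g ==> ptf (%z. f z \<le> (g z :: nat))"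
 using ptf_not[OF ptf_less[of g f]] by (simp add: not_less)

lemma ptf_Suc [ptfs]: "ptf f ==> ptf (%z. Suc (f z))"
 using ptf_add[OF _ ptf_const[of 1], of f] by simp

lemma ptf_eq_bool [ptfs]:
 assumes "ptf f" "ptf g"
 shows "ptf (%z. f z = (g z :: bool))"
 by (rule ptf_cong[OF ptf_not[OF ptf_xor[OF assms]]]) auto

lemma ptf_eq_nat [ptfs]:
 assumes "ptf f" "ptf g"
 shows "ptf (%z. f z = (g z :: nat))"
 by (rule ptf_cong[OF ptf_conj[OF ptf_le[OF assms] ptf_le[OF assms(2,1)]]]) auto

lemma ptf_eq_prod [ptfs]:
 assumes "ptf (%w :: 'a::tr \<times> 'a. fst w = snd w)" "ptf (%w :: 'b::tr \<times> 'b. fst w = snd w)" "ptf f" "ptf g"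
 shows "ptf (%z. f z = (g z :: 'a \<times> 'b))"
proof -
 have "ptf (%z. fst (f z) = fst (g z) & snd (f z) = snd (g z))"
  by (rule ptf_conj[OF ptf_lift2[OF assms(1) ptf_fst[OF assms(3)] ptf_fst[OF assms(4)]]
     ptf_lift2[OF assms(2) ptf_snd[OF assms(3)] ptf_snd[OF assms(4)]]])
 then show ?thesis by (rule ptf_cong) (auto intro: prod_eqI)
qed

lemma ptf_eq_list [ptfs]:
 assumes "ptf (%w :: 'a::tr \<times> 'a. fst w = snd w)" "ptf f" "ptf g"
 shows "ptf (%z. f z = (g z :: 'a list))"
proof -
 have eq: "xs = ys \<longleftrightarrow> drop (length xs) ys = [] & drop (length ys) xs = [] & (\<forall>p \<in> set (zip xs ys). fst p = snd p)" for xs ys :: "'a list"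
  unfolding list_eq_iff_zip_eq[of xs ys] case_prod_beta drop_eq_Nil by (simp add: eq_iff conj_commute conj_left_commute)
 have "ptf (%z. drop (length (f z)) (g z) = [] & drop (length (g z)) (f z) = [] & (\<forall>p \<in> set (zip (f z) (g z)). fst p = snd p))"
  by (rule ptf_conj[OF ptf_null[OF ptf_drop_len[OF assms(2,3)]] ptf_conj[OF ptf_null[OF ptf_drop_len[OF assms(3,2)]]
     ptf_ball[OF ptf_comp[OF ptf_snd[OF ptf_id] assms(1)] ptf_zip[OF assms(2,3)]]]])
 then show ?thesis by (rule ptf_cong) (rule eq[symmetric])
qed

abbreviation nb :: "nat => nat" where
 "nb n \<equiv> length (bits n)"

lemma less_nb: "n < 2 ^ nb n"
 using val_less[of "bits n"] by simp

lemma nb_le: "n < 2 ^ k ==> nb n \<le> k"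
proof (induction k arbitrary: n)
 case (Suc k)
 show ?case
 proof (cases "n = 0")
  case False
  have "nb (n div 2) \<le> k" using Suc.prems by (intro Suc.IH) auto
  then show ?thesis using False by (subst bits.simps) simp
 qed simp
qed simp

lemma nb_mono: "m \<le> n ==> nb m \<le> nb n"
 using nb_le[of m "nb n"] less_nb[of n] by simp

lemma nb_mult: "nb (m * n) \<le> nb m + nb n"
proof (rule nb_le)
 show "m * n < 2 ^ (nb m + nb n)"
  unfolding power_add using less_nb[of m] less_nb[of n] by (intro mult_strict_mono) auto
qed

lemma nb_add: "nb (m + n) \<le> nb m + nb n"
proof (rule nb_le)
 define a b where "a = (2::nat) ^ nb m" and "b = (2::nat) ^ nb n"
 have "m < a" "n < b" using less_nb[of m] less_nb[of n] by (auto simp: a_def b_def)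
 moreover have "a + b \<le> a * b + 1"
 proof -
  have "(a - 1) * (b - 1) \<ge> 0" by simp
  obtain a' b' where "a = Suc a'" "b = Suc b'" using \<open>m < a\<close> \<open>n < b\<close> by (cases a; cases b) auto
  then show ?thesis by simp
 qed
 ultimately show "m + n < 2 ^ (nb m + nb n)" unfolding power_add a_def[symmetric] b_def[symmetric] by linarith
qed

lemma nb_le_self: "nb n \<le> n"
 using nb_le[of n n] less_exp[of n] by simp

lemma sz_nat_def: "sz (n::nat) = sz (bits n)"
 by (simp add: sz_def tr_nat_def)

lemma sz_nat: "sz (n::nat) \<le> 4 * nb n + 1"
 unfolding sz_nat_def by (rule sz_bools)

lemma nb_sz: "nb n \<le> sz n"
 unfolding sz_nat_def by (rule length_le_sz)

lemma nb_sum_list: "nb (sum_list xs) \<le> sz xs"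
proof (induction xs)
 case (Cons a xs)
 then show ?case using nb_add[of a "sum_list xs"] nb_sz[of a] by simp
qed simp

lemma foldl_plus: "foldl (+) a xs = a + sum_list xs" for a :: "'a::monoid_add"
 by (induction xs arbitrary: a) (auto simp: add.assoc)

lemma ptf_sum_list [ptfs]:
 assumes "ptf f"
 shows "ptf (%z. sum_list (f z) :: nat)"
proof -
 have "ptf (%xs :: nat list. foldl (%a b. a + b) 0 xs)"
 proof (rule ptf_foldl)
  show "pbd (%n. 4 * n + 1)" by (intro pbds)
  fix xs :: "nat list" and j
  show "sz (foldl (%a b. a + b) 0 (take j xs)) \<le> 4 * sz xs + 1"
   using sz_nat[of "sum_list (take j xs)"] nb_sum_list[of "take j xs"] sz_take_drop(1)[of j xs]
   by (simp add: foldl_plus)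
 qed (intro ptfs)+
 from ptf_comp[OF assms this] show ?thesis by (simp add: foldl_plus)
qed

text \<open>Horner's scheme on the bits of the second factor. Every intermediate value is the first
  factor times a high-order part of the second, so its bit length stays within the sum of the bit
  lengths of the factors.\<close>

lemma ptf_mult [ptfs]:
 assumes "ptf f" "ptf g"
 shows "ptf (%z. f z * g z :: nat)"
proof -
 let ?h = "%m acc b. acc + acc + (if b then m else 0)"
 have fold: "foldl (?h m) 0 (rev bs) = m * val bs" for m :: nat and bs
  by (induction bs) (auto simp: algebra_simps)
 have "ptf (%w :: nat \<times> nat. foldl (?h (fst w)) 0 (rev (bits (snd w))))"
 proof (rule ptf_foldl)
  show "pbd (%n. 4 * n + 1)" by (intro pbds)
  fix w :: "nat \<times> nat" and j
  let ?d = "drop (nb (snd w) - j) (bits (snd w))"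
  have "take j (rev (bits (snd w))) = rev ?d" by (simp add: take_rev)
  then have "foldl (?h (fst w)) 0 (take j (rev (bits (snd w)))) = fst w * val ?d" by (simp only: fold)
  moreover have "val ?d \<le> snd w" unfolding val_drop by simp
  then have "nb (fst w * val ?d) \<le> nb (fst w) + nb (snd w)"
   using nb_mult[of "fst w" "val ?d"] nb_mono[of "val ?d" "snd w"] by linarith
  moreover have "nb (fst w) + nb (snd w) \<le> sz w" using nb_sz[of "fst w"] nb_sz[of "snd w"] by (cases w) simp
  ultimately show "sz (foldl (?h (fst w)) 0 (take j (rev (bits (snd w))))) \<le> 4 * sz w + 1"
   using sz_nat[of "fst w * val ?d"] by (simp del: bits_eq_Nil)
 qed (intro ptfs)+
 then have "ptf (%w :: nat \<times> nat. fst w * snd w)" by (simp only: fold val_bits)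
 from ptf_lift2[OF this assms] show ?thesis .
qed

lemma ptf_pow2_len:
 assumes "ptf l"
 shows "ptf (%z. 2 ^ length (l z) :: nat)"
proof -
 have "ptf (%z. val (replicate (length (l z)) False @ [True]))" by (intro ptfs ptf_replicate_len assms)
 then show ?thesis by (simp add: val_append)
qed

lemma ptf_div_pow2_len:
 assumes "ptf l" "ptf f"
 shows "ptf (%z. f z div 2 ^ length (l z) :: nat)"
proof -
 have "ptf (%z. val (drop (length (l z)) (bits (f z))))" by (intro ptfs ptf_drop_len assms)
 then show ?thesis by (simp add: val_drop)
qed

lemma ptf_upt_len:
 assumes "ptf l"
 shows "ptf (%z. [0..<length (l z)])"
proof -
 let ?h = "%s a. (fst s @ [snd s], Suc (snd s))"
 have fold: "foldl ?h ([0..<k], k) xs = ([0..<k + length xs], k + length xs)" for k and xs :: "'b list"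
 proof (induction xs arbitrary: k)
  case (Cons a xs)
  have "foldl ?h ([0..<k], k) (a # xs) = foldl ?h ([0..<Suc k], Suc k) xs" by simp
  then show ?case using Cons[of "Suc k"] by (simp del: upt_Suc)
 qed simp
 have "ptf (%xs :: 'b list. foldl ?h ([], 0) xs)"
 proof (rule ptf_foldl)
  show "pbd (%n. Suc (Suc (n * Suc (4 * n + 1)) + (4 * n + 1)))" by (intro pbds)
  fix xs :: "'b list" and j
  let ?k = "length (take j xs)"
  have k: "?k \<le> sz xs" using length_le_sz[of xs] by simp
  have szi: "sz i \<le> 4 * sz xs + 1" if "i \<le> ?k" for i
   using sz_nat[of i] nb_le_self[of i] that k by linarith
  have "sz (map (%i. i) [0..<?k]) \<le> Suc (length [0..<?k] * Suc (4 * sz xs + 1))"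
   by (rule sz_map_le) (use szi in auto)
  also have "\<dots> \<le> Suc (sz xs * Suc (4 * sz xs + 1))" using k by (intro Suc_le_mono[THEN iffD2] mult_right_mono) auto
  finally have "sz [0..<?k] \<le> Suc (sz xs * Suc (4 * sz xs + 1))" by simp
  then have "sz ([0..<?k], ?k) \<le> Suc (Suc (sz xs * Suc (4 * sz xs + 1)) + (4 * sz xs + 1))" using szi[of ?k] by simp
  then show "sz (foldl ?h ([], 0) (take j xs)) \<le> Suc (Suc (sz xs * Suc (4 * sz xs + 1)) + (4 * sz xs + 1))"
   using fold[of 0 "take j xs"] by simp
 qed (intro ptfs)+
 from ptf_fst[OF ptf_comp[OF assms this]] fold[of 0] show ?thesis by simp
qed

lemma ptf_length [ptfs]:
 assumes "ptf l"
 shows "ptf (%z. length (l z))"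
proof -
 have "ptf (%z. sum_list (map (%_. 1) (l z)) :: nat)" by (intro ptfs assms)
 then show ?thesis by (simp add: sum_list_triv)
qed

definition nth_or :: "'a => 'a list => nat => 'a" where
 "nth_or d xs i = (if i < length xs then xs ! i else d)"

lemma ptf_nth_or [ptfs]:
 assumes "ptf d" "ptf f" "ptf i"
 shows "ptf (%z. nth_or (d z) (f z) (i z))"
proof -
 have eq: "hd_or d (map snd (filter (%p. fst p = i) (zip [0..<length xs] xs))) = nth_or d xs i" for d xs and i :: nat
 proof (induction xs rule: rev_induct)
  case (snoc x xs)
  have ne: "filter (%p. fst p = i) (zip [0..<length xs] xs) = [] \<longleftrightarrow> length xs \<le> i"
  proof -
   have "set (zip [0..<length xs] xs) = {(k, xs ! k) | k. k < length xs}" unfolding set_zip by force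
   then show ?thesis by (auto simp: filter_empty_conv not_less[symmetric])
  qed
  show ?case
  proof (cases "i < length xs")
   case True
   then obtain p ps where "filter (%p. fst p = i) (zip [0..<length xs] xs) = p # ps"
    using ne by (cases "filter (%p. fst p = i) (zip [0..<length xs] xs)") auto
   then show ?thesis using snoc True by (simp add: nth_or_def nth_append)
  next
   case False
   then show ?thesis using ne by (auto simp: nth_or_def nth_append)
  qed
 qed (simp add: nth_or_def)
 have "ptf (%z. hd_or (d z) (map (%p. snd p) (filter (%p. fst p = i z) (zip [0..<length (f z)] (f z)))))"
  by (intro ptfs ptf_upt_len assms ptf_comp[OF ptf_fst[OF ptf_id] assms(3)])
 then show ?thesis by (simp only: eq)
qed

definition mkint :: "bool => nat => int" where
 "mkint b n = (if b then - int n else int n)"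

lemma ptf_mkint [ptfs]: "ptf b ==> ptf n ==> ptf (%z. mkint (b z) (n z))"
proof -
 assume "ptf b" "ptf n"
 \<comment> \<open>The code of zero carries the sign \<open>False\<close>, so a negative zero is
   normalised.\<close>
 then have "ptf (%z. (b z & n z ~= 0, n z))" by (intro ptfs)
 then show ?thesis by (rule ptf_same_tr) (auto simp: tr_int_def mkint_def)
qed

lemma ptf_int_parts: "ptf f ==> ptf (%z. (f z < 0, nat \<bar>f z :: int\<bar>))"
 by (erule ptf_same_tr) (simp add: tr_int_def)

lemma ptf_neg [ptfs]: "ptf f ==> ptf (%z. f z < (0::int))"
 using ptf_fst[OF ptf_int_parts] by simp

lemma ptf_natabs [ptfs]: "ptf f ==> ptf (%z. nat \<bar>f z :: int\<bar>)"
 using ptf_snd[OF ptf_int_parts] by simp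

lemma ptf_of_nat [ptfs]: "ptf f ==> ptf (%z. int (f z))"
 using ptf_mkint[OF ptf_const[of False]] by (simp add: mkint_def)

lemma ptf_uminus_int [ptfs]: "ptf f ==> ptf (%z. - f z :: int)"
 by (rule ptf_cong[where g = "%z. mkint (\<not> f z < 0) (nat \<bar>f z\<bar>)"]) (intro ptfs, auto simp: mkint_def)

lemma ptf_nat [ptfs]: "ptf f ==> ptf (%z. nat (f z))"
 by (rule ptf_cong[where g = "%z. if f z < 0 then 0 else nat \<bar>f z\<bar>"]) (intro ptfs, auto)

lemma ptf_idiff: "ptf f ==> ptf g ==> ptf (%z. int (f z) - int (g z))"
 by (rule ptf_cong[where g = "%z. if g z \<le> f z then mkint False (f z - g z) else mkint True (g z - f z)"])
  (intro ptfs, auto simp: mkint_def)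

lemma ptf_add_int [ptfs]: "ptf f ==> ptf g ==> ptf (%z. f z + g z :: int)"
 by (rule ptf_cong[where g = "%z. int (nat (f z) + nat (g z)) - int (nat (- f z) + nat (- g z))"])
  (intro ptfs ptf_idiff, auto)

lemma ptf_minus_int [ptfs]: "ptf f ==> ptf g ==> ptf (%z. f z - g z :: int)"
 by (rule ptf_cong[where g = "%z. f z + - g z"]) (intro ptfs, auto)

lemma ptf_mult_int [ptfs]:
 assumes "ptf f" "ptf g"
 shows "ptf (%z. f z * g z :: int)"
proof (rule ptf_cong[where g = "%z. mkint ((f z < 0) ~= (g z < 0)) (nat \<bar>f z\<bar> * nat \<bar>g z\<bar>)"])
 show "ptf (%z. mkint ((f z < 0) ~= (g z < 0)) (nat \<bar>f z\<bar> * nat \<bar>g z\<bar>))" by (intro ptfs ptf_xor assms)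
 show "mkint ((f z < 0) ~= (g z < 0)) (nat \<bar>f z\<bar> * nat \<bar>g z\<bar>) = f z * g z" for z
  by (auto simp: mkint_def)
qed

lemma ptf_less_int [ptfs]: "ptf f ==> ptf g ==> ptf (%z. f z < (g z :: int))"
 by (rule ptf_cong[where g = "%z. f z - g z < 0"]) (intro ptfs, auto)

lemma ptf_le_int [ptfs]: "ptf f ==> ptf g ==> ptf (%z. f z \<le> (g z :: int))"
 by (rule ptf_cong[where g = "%z. \<not> (g z < f z)"]) (intro ptfs, auto)

lemma ptf_eq_int [ptfs]:
 assumes "ptf f" "ptf g"
 shows "ptf (%z. f z = (g z :: int))"
 by (rule ptf_cong[OF ptf_conj[OF ptf_le_int[OF assms] ptf_le_int[OF assms(2,1)]]]) auto

lemma sz_int: "sz (z::int) \<le> 4 * nb (nat \<bar>z\<bar>) + 5"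
 using sz_bool[of "z < 0"] sz_nat[of "nat \<bar>z\<bar>"] by (simp add: sz_def tr_int_def tr_simps)

lemma nb_sz_int: "nb (nat \<bar>z\<bar>) \<le> sz z"
 using nb_sz[of "nat \<bar>z\<bar>"] by (simp add: sz_def tr_int_def tr_simps)

lemma nb_sum_list_int: "nb (nat \<bar>sum_list xs\<bar>) \<le> sz (xs :: int list)"
proof (induction xs)
 case (Cons a xs)
 have "nb (nat \<bar>a + sum_list xs\<bar>) \<le> nb (nat \<bar>a\<bar> + nat \<bar>sum_list xs\<bar>)" by (intro nb_mono) simp
 then show ?case using Cons nb_add[of "nat \<bar>a\<bar>" "nat \<bar>sum_list xs\<bar>"] nb_sz_int[of a] by simp
qed simp

lemma ptf_sum_list_int [ptfs]:
 assumes "ptf f"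
 shows "ptf (%z. sum_list (f z) :: int)"
proof -
 have "ptf (%xs :: int list. foldl (%a b. a + b) 0 xs)"
 proof (rule ptf_foldl)
  show "pbd (%n. 4 * n + 5)" by (intro pbds)
  fix xs :: "int list" and j
  show "sz (foldl (%a b. a + b) 0 (take j xs)) \<le> 4 * sz xs + 5"
   using sz_int[of "sum_list (take j xs)"] nb_sum_list_int[of "take j xs"] sz_take_drop(1)[of j xs]
   by (simp add: foldl_plus)
 qed (intro ptfs)+
 from ptf_comp[OF assms this] show ?thesis by (simp add: foldl_plus)
qed

lemma ptf_imp_rptf: "ptf f ==> rptf m f"
proof -
 assume "ptf f"
 then obtain \<mu> F where F: "rpt \<mu> F" "\<forall>x. \<mu> (tr x) \<le> 0 & F (tr x) = tr (f x)" unfolding rptf_def by blast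
 show ?thesis
 proof (rule rptfI[OF F(1)])
  show "\<mu> (tr x) \<le> m x" "F (tr x) = tr (f x)" for x using F(2)[rule_format, of x] by simp_all
 qed
qed

text \<open>The one primitive whose time depends on the value of a number: the list is doubled once
  per bit, from the high end. The pseudo-polynomial bound comes from here.\<close>

lemma rptf_unary: "rptf (%n :: nat. n) (%n. replicate n ())"
proof -
 let ?h = "%w. (tl (fst w), snd w @ snd w @ (if hd_or False (fst w) then [()] else []))"
 have st: "(?h ^^ j) (rev bs, []) = (drop j (rev bs), replicate (val (drop (length bs - j) bs)) ())" if "j \<le> length bs" for bs j
  using that
 proof (induction j)
  case (Suc j)
  have dr: "drop j (rev bs) = (bs ! (length bs - Suc j)) # drop (Suc j) (rev bs)"
   using Suc.prems by (simp add: Cons_nth_drop_Suc[symmetric] rev_nth)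
  have "drop (length bs - Suc j) bs = (bs ! (length bs - Suc j)) # drop (length bs - j) bs"
   using Suc.prems Cons_nth_drop_Suc[of "length bs - Suc j" bs] by (simp add: Suc_diff_Suc)
  moreover have "xs = ys \<longleftrightarrow> length xs = length ys" for xs ys :: "unit list" by (simp add: list_eq_iff_nth_eq)
  moreover have "(?h ^^ j) (rev bs, []) = (drop j (rev bs), replicate (val (drop (length bs - j) bs)) ())"
   using Suc by simp
  ultimately show ?case by (cases "bs ! (length bs - Suc j)") (simp_all add: dr)
 qed auto
 have "rptf (%n :: nat. n) (%n. (?h ^^ length (bits n)) (rev (bits n), []))"
 proof (rule rptf_iter)
  have b: "ptf (%n. bits n)" "ptf (%n :: nat. (rev (bits n), [] :: unit list))" by (intro ptfs)+
  show "rptf (%n. n) (%n. bits n)" "rptf (%n. n) (%n :: nat. (rev (bits n), [] :: unit list))"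
   by (rule ptf_imp_rptf[OF b(1)], rule ptf_imp_rptf[OF b(2)])
  show "ptf (%w :: nat \<times> (bool list \<times> unit list). ?h (snd w))" by (intro ptfs)
  show "pbd (%n. Suc (n + (2 * n + 1)))" by (intro pbds)
  fix n j assume j: "j \<le> nb n"
  have "sz (replicate k ()) = 2 * k + 1" for k by (induction k) auto
  moreover have "val (drop (nb n - j) (bits n)) \<le> n" by (simp add: val_drop)
  moreover have "sz (drop j (rev (bits n))) \<le> sz n" using sz_take_drop(2)[of j "rev (bits n)"] by (simp add: sz_rev sz_nat_def)
  ultimately show "sz ((?h ^^ j) (rev (bits n), [])) \<le> Suc (sz n + n + (2 * (sz n + n) + 1))"
   unfolding st[OF j] by simp
 qed
 from rptf_comp[OF this ptf_snd[OF ptf_id]] show ?thesis by (simp add: st)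
qed

section \<open>Solving linear programs\<close>

lemma homogeneous_nontrivial:
 fixes b :: "'e => 'u => real"
 assumes "finite E" "finite U" "card E < card U"
 shows "\<exists>x. (\<exists>u \<in> U. x u ~= 0) & (\<forall>e \<in> E. (\<Sum>u \<in> U. b e u * x u) = 0)"
 using assms
proof (induction E arbitrary: U b rule: finite_induct)
 case empty
 then obtain u where "u \<in> U" by fastforce
 then show ?case by (intro exI[of _ "%_. 1"]) auto
next
 case (insert e E)
 show ?case
 proof (cases "\<forall>u \<in> U. b e u = 0")
  case True
  have "\<exists>x. (\<exists>u \<in> U. x u ~= 0) & (\<forall>e \<in> E. (\<Sum>u \<in> U. b e u * x u) = 0)"
   using insert by (intro insert.IH) auto
  then show ?thesis using True by auto
 next
  case False
  then obtain w where w: "w \<in> U" "b e w ~= 0" by blast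
  let ?V = "U - {w}"
  let ?b = "%e' u. b e' u - b e' w * b e u / b e w"
  \<comment> \<open>The equation \<open>e\<close> is solved for the pivot \<open>w\<close>;
    substitution leaves one equation and one unknown fewer, so the induction hypothesis applies to
    the coefficients \<open>?b\<close>.\<close>
  have "\<exists>x. (\<exists>u \<in> ?V. x u ~= 0) & (\<forall>e \<in> E. (\<Sum>u \<in> ?V. ?b e u * x u) = 0)"
   using insert w by (intro insert.IH) auto
  then obtain x where x: "\<exists>u \<in> ?V. x u ~= 0" "!!e'. e' \<in> E ==> (\<Sum>u \<in> ?V. ?b e' u * x u) = 0" by blast
  define y where "y = x(w := - (\<Sum>u \<in> ?V. b e u * x u) / b e w)"
  have sumV: "(\<Sum>u \<in> ?V. c u * y u) = (\<Sum>u \<in> ?V. c u * x u)" for c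
   by (rule sum.cong) (auto simp: y_def)
  have split: "(\<Sum>u \<in> U. c u * y u) = c w * y w + (\<Sum>u \<in> ?V. c u * x u)" for c
   using sum.remove[OF insert.prems(1) w(1), of "%u. c u * y u"] sumV[of c] by simp
  have "(\<Sum>u \<in> U. b e' u * y u) = 0" if "e' \<in> insert e E" for e'
  proof (cases "e' = e")
   case True
   then show ?thesis using w unfolding split by (simp add: y_def)
  next
   case False
   then have "(\<Sum>u \<in> ?V. ?b e' u * x u) = 0" using that x(2) by blast
   moreover have "(\<Sum>u \<in> ?V. ?b e' u * x u) = (\<Sum>u \<in> ?V. b e' u * x u) - b e' w / b e w * (\<Sum>u \<in> ?V. b e u * x u)"
    by (simp add: left_diff_distrib sum_subtractf sum_distrib_left mult.assoc)
   ultimately show ?thesis unfolding split by (simp add: y_def)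
  qed
  moreover have "\<exists>u \<in> U. y u ~= 0" using x(1) by (auto simp: y_def)
  ultimately show ?thesis by blast
 qed
qed

text \<open>A solution of minimal support spans the kernel on its support; Siegel's pigeonhole argument then
 yields a small integer vector in that kernel.\<close>

lemma small_integer_solution:
 fixes a :: "'r => 'c => int" and x \<phi> :: "'c => real"
 assumes fin: "finite I" "finite J" and k: "k \<in> J" "x k > 0"
  and x: "!!j. j \<in> J ==> 0 \<le> x j" "!!i. i \<in> I ==> (\<Sum>j \<in> J. a i j * x j) = 0"
  and \<phi>: "!!j. j \<in> J ==> 0 \<le> \<phi> j"
  and \<alpha>: "!!i j. i \<in> I ==> j \<in> J ==> \<bar>a i j\<bar> \<le> int \<alpha>" "1 \<le> \<alpha>"
 obtains c :: "'c => nat" where "1 \<le> c k" "!!j. c j \<le> (2 * (card I + 1) * \<alpha>) ^ card I"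
  "!!j. c j ~= 0 ==> j \<in> J & x j ~= 0" "card {j. c j ~= 0} \<le> card I + 1"
  "!!i. i \<in> I ==> (\<Sum>j \<in> J. a i j * int (c j)) = 0"
  "(\<Sum>j \<in> J. \<phi> j * c j) * x k \<le> (\<Sum>j \<in> J. \<phi> j * x j) * c k"
proof -
 define supp where "supp y = {j \<in> J. y j ~= 0}" for y :: "'c => real"
 \<comment> \<open>The last condition compares the ratio of the \<open>\<phi>\<close>-weight to
   entry \<open>k\<close>, so it is invariant under scaling.\<close>
 define good where "good y \<longleftrightarrow> (\<forall>j \<in> J. 0 \<le> y j) & (\<forall>i \<in> I. (\<Sum>j \<in> J. real_of_int (a i j) * y j) = 0) & y k > 0 &
  supp y \<subseteq> supp x & (\<Sum>j \<in> J. \<phi> j * y j) * x k \<le> (\<Sum>j \<in> J. \<phi> j * x j) * y k" for y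
 have "good x" using x k by (auto simp: good_def)
 then obtain y where y: "good y" and ymin: "!!z. good z ==> card (supp y) \<le> card (supp z)"
  using ex_has_least_nat[of good x "%y. card (supp y)"] by blast
 define S where "S = supp y"
 have SJ: "S \<subseteq> J" and finS: "finite S" using fin by (auto simp: S_def supp_def)
 have ypos: "y j > 0" if "j \<in> S" for j using that y by (force simp: S_def supp_def good_def)
 have y0: "y j = 0" if "j \<in> J - S" for j using that by (simp add: S_def supp_def)
 have yk: "y k > 0" "k \<in> S" using y k by (auto simp: good_def S_def supp_def)
 have sumS: "(\<Sum>j \<in> J. f j * v j) = (\<Sum>j \<in> S. f j * v j)" if "!!j. j \<in> J - S ==> v j = 0" for f v :: "'c => real"
  by (rule sum.mono_neutral_right[OF fin(2) SJ]) (use that in auto)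
 have yker: "(\<Sum>j \<in> S. real_of_int (a i j) * y j) = 0" if "i \<in> I" for i
  using that y sumS[of y] y0 by (simp add: good_def)
 \<comment> \<open>On a minimal support the kernel is the line spanned by \<open>y\<close>.
   Otherwise some nonzero kernel vector \<open>u\<close> vanishes at \<open>k\<close>; moving
   \<open>y\<close> against \<open>u\<close> or \<open>- u\<close> until an entry becomes zero
   shrinks the support, with the sign chosen so that the \<open>\<phi>\<close>-weight does not
   grow.\<close>
 have proportional: "\<exists>\<mu>. \<forall>j \<in> S. v j = \<mu> * y j" if v: "!!i. i \<in> I ==> (\<Sum>j \<in> S. real_of_int (a i j) * v j) = 0" for v
 proof (rule ccontr)
  assume no: "\<not> (\<exists>\<mu>. \<forall>j \<in> S. v j = \<mu> * y j)"
  define u where "u j = (if j \<in> S then v j - v k / y k * y j else 0)" for j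
  have u_ker: "(\<Sum>j \<in> S. real_of_int (a i j) * u j) = 0" if "i \<in> I" for i
  proof -
   have "(\<Sum>j \<in> S. real_of_int (a i j) * u j) = (\<Sum>j \<in> S. real_of_int (a i j) * v j) - v k / y k * (\<Sum>j \<in> S. real_of_int (a i j) * y j)"
    by (simp add: u_def right_diff_distrib sum_subtractf sum_distrib_left mult.left_commute)
   then show ?thesis using v[OF that] yker[OF that] by simp
  qed
  have uk: "u k = 0" using yk by (simp add: u_def)
  have "\<not> (\<forall>j \<in> S. v j = v k / y k * y j)" using no by blast
  then obtain j0 where "j0 \<in> S" "v j0 ~= v k / y k * y j0" by blast
  then have j0: "j0 \<in> S" "u j0 ~= 0" by (simp_all add: u_def)
  define \<Phi> where "\<Phi> w = (\<Sum>j \<in> S. \<phi> j * w j)" for w :: "'c => real"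
  have \<Phi>neg: "\<Phi> (%j. - w j) = - \<Phi> w" for w by (simp add: \<Phi>_def sum_negf)
  have \<Phi>pos: "\<Phi> w \<ge> 0" if "!!j. j \<in> S ==> 0 \<le> w j" for w
   unfolding \<Phi>_def using that \<phi> SJ by (intro sum_nonneg mult_nonneg_nonneg) auto
  have "\<exists>w. (w = u \<or> w = (%j. - u j)) & \<Phi> w \<ge> 0 & (\<exists>j \<in> S. w j > 0)"
  proof (cases "(\<exists>j \<in> S. u j > 0) & \<Phi> u \<ge> 0")
   case True then show ?thesis by blast
  next
   case False
   have "\<exists>j \<in> S. - u j > 0 & \<Phi> (%j. - u j) \<ge> 0"
   proof (cases "\<exists>j \<in> S. u j > 0")
    case True
    then have "\<Phi> u < 0" using False by auto
    then have "\<exists>j \<in> S. u j < 0" using \<Phi>pos[of u] by (meson not_less)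
    then show ?thesis using \<open>\<Phi> u < 0\<close> \<Phi>neg[of u] by auto
   next
    case False
    then have "\<Phi> (%j. - u j) \<ge> 0" by (intro \<Phi>pos) (auto simp: not_less)
    moreover have "- u j0 > 0" using False j0 by (auto simp: not_less less_le)
    ultimately show ?thesis using j0 by blast
   qed
   then show ?thesis by blast
  qed
  then obtain w where w: "w = u \<or> w = (%j. - u j)" "\<Phi> w \<ge> 0" "\<exists>j \<in> S. w j > 0" by blast
  have wk: "w k = 0" using w(1) uk by auto
  have w0: "w j = 0" if "j \<notin> S" for j using w(1) that by (auto simp: u_def)
  have w_ker: "(\<Sum>j \<in> S. real_of_int (a i j) * w j) = 0" if "i \<in> I" for i
   using w(1) u_ker[OF that] by (elim disjE) (simp_all only: mult_minus_right sum_negf neg_0_equal_iff_equal minus_zero)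
  define P where "P = {j \<in> S. w j > 0}"
  have P: "finite P" "P ~= {}" using finS w(3) by (auto simp: P_def)
  \<comment> \<open>The ratio test: the longest step against \<open>w\<close> that keeps
    \<open>y\<close> non-negative.\<close>
  define \<theta> where "\<theta> = Min ((%j. y j / w j) ` P)"
  have "\<theta> \<in> (%j. y j / w j) ` P" unfolding \<theta>_def using P by (intro Min_in) auto
  then obtain jm where jm: "jm \<in> P" "\<theta> = y jm / w jm" by blast
  have \<theta>pos: "\<theta> > 0" using jm ypos by (auto simp: P_def)
  define z where "z j = y j - \<theta> * w j" for j
  have z_nonneg: "0 \<le> z j" if "j \<in> J" for j
  proof (cases "w j > 0 & j \<in> S")
   case True
   then have "j \<in> P" by (simp add: P_def)
   then have "\<theta> \<le> y j / w j" unfolding \<theta>_def using P by (intro Min_le) auto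
   then show ?thesis using True by (simp add: z_def field_simps)
  next
   case False
   then have "\<theta> * w j \<le> 0" using w0[of j] \<theta>pos by (cases "j \<in> S") (auto simp: mult_le_0_iff)
   moreover have "0 \<le> y j" using y that by (simp add: good_def)
   ultimately show ?thesis by (simp add: z_def)
  qed
  have z0: "z j = 0" if "j \<in> J - S" for j using that y0 w0 by (simp add: z_def)
  have zS: "(\<Sum>j \<in> J. f j * z j) = (\<Sum>j \<in> S. f j * y j) - \<theta> * (\<Sum>j \<in> S. f j * w j)" for f
  proof -
   have "(\<Sum>j \<in> J. f j * z j) = (\<Sum>j \<in> S. f j * z j)" by (rule sumS) (use z0 in simp)
   then show ?thesis
    by (simp add: z_def right_diff_distrib sum_subtractf mult.left_commute[of _ \<theta>] sum_distrib_left[symmetric])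
  qed
  have zjm: "z jm = 0" using jm by (auto simp: z_def P_def)
  have "supp z \<subseteq> S - {jm}" using zjm z0 by (auto simp: supp_def)
  moreover have "jm \<in> S" using jm by (simp add: P_def)
  ultimately have "card (supp z) < card S" using finS by (meson card_Diff1_less card_mono finite_Diff le_less_trans)
  moreover have "good z"
  proof -
   have "(\<Sum>j \<in> J. real_of_int (a i j) * z j) = 0" if "i \<in> I" for i
    unfolding zS using yker[OF that] w_ker[OF that] by simp
   moreover have "(\<Sum>j \<in> J. \<phi> j * z j) \<le> (\<Sum>j \<in> J. \<phi> j * y j)"
   proof -
    have "(\<Sum>j \<in> J. \<phi> j * z j) = (\<Sum>j \<in> J. \<phi> j * y j) - \<theta> * \<Phi> w"
     unfolding zS \<Phi>_def using sumS[of y \<phi>] y0 by simp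
    then show ?thesis using \<theta>pos w(2) by simp
   qed
   then have "(\<Sum>j \<in> J. \<phi> j * z j) * x k \<le> (\<Sum>j \<in> J. \<phi> j * y j) * x k" using k by (intro mult_right_mono) auto
   moreover have "z k = y k" using wk by (simp add: z_def)
   moreover have "supp z \<subseteq> supp x" using \<open>supp z \<subseteq> S - {jm}\<close> y by (auto simp: good_def S_def)
   ultimately show ?thesis using y z_nonneg by (auto simp: good_def)
  qed
  ultimately show False using ymin[of z] by (simp add: S_def)
 qed
 \<comment> \<open>The pigeonhole count wants fewer equations than unknowns, so a smallest set
   \<open>R\<close> of equations implying all others is used. By minimality, for each
   \<open>i\<close> in \<open>R\<close> some vector \<open>V i\<close> violates equation
   \<open>i\<close> and satisfies the rest of \<open>R\<close>.\<close>
 define ess where "ess R \<longleftrightarrow> R \<subseteq> I & (\<forall>v :: 'c => real. (\<forall>i \<in> R. (\<Sum>j \<in> S. real_of_int (a i j) * v j) = 0) --> (\<forall>i \<in> I. (\<Sum>j \<in> S. real_of_int (a i j) * v j) = 0))"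
  for R
 have "ess I" by (simp add: ess_def)
 then obtain R where R: "ess R" and Rmin: "!!Q. ess Q ==> card R \<le> card Q"
  using ex_has_least_nat[of ess I card] by blast
 have finR: "finite R" and RI: "R \<subseteq> I" using R fin finite_subset by (auto simp: ess_def)
 have Rv: "\<exists>v. (\<Sum>j \<in> S. real_of_int (a i j) * v j) ~= 0 & (\<forall>i' \<in> R - {i}. (\<Sum>j \<in> S. real_of_int (a i' j) * v j) = 0)" if "i \<in> R" for i
 proof -
  have "\<not> ess (R - {i})" using Rmin[of "R - {i}"] card_Diff1_less[OF finR that] by auto
  then obtain v i' where "\<forall>i \<in> R - {i}. (\<Sum>j \<in> S. real_of_int (a i j) * v j) = 0" "(\<Sum>j \<in> S. real_of_int (a i' j) * v j) ~= 0" "i' \<in> I"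
   using RI unfolding ess_def by blast
  moreover have "\<not> (\<forall>i \<in> R. (\<Sum>j \<in> S. real_of_int (a i j) * v j) = 0)" using R calculation by (auto simp: ess_def)
  ultimately show ?thesis using that by (metis Diff_iff singletonD)
 qed
 then obtain V where V: "!!i. i \<in> R ==> (\<Sum>j \<in> S. real_of_int (a i j) * V i j) ~= 0"
  "!!i i'. i \<in> R ==> i' \<in> R - {i} ==> (\<Sum>j \<in> S. real_of_int (a i' j) * V i j) = (0::real)" by metis
 \<comment> \<open>Otherwise \<open>y\<close> and the vectors \<open>V i\<close> outnumber the
   dimension and are linearly dependent. Applying equation \<open>i\<close> isolates the coefficient
   of \<open>V i\<close>, which must vanish; then the coefficient of \<open>y\<close> vanishes
   too.\<close>
 have card1: "card R < card S"
 proof (rule ccontr)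
  assume "\<not> card R < card S"
  then have "card S < card (insert None (Some ` R))" using finR by (simp add: card_image)
  then have "\<exists>l. (\<exists>t \<in> insert None (Some ` R). l t ~= 0) &
   (\<forall>j \<in> S. (\<Sum>t \<in> insert None (Some ` R). (case t of None => y j | Some i => V i j) * l t) = 0)"
   using finR finS by (intro homogeneous_nontrivial) auto
  then obtain l where l: "\<exists>t \<in> insert None (Some ` R). l t ~= 0"
   "!!j. j \<in> S ==> (\<Sum>t \<in> insert None (Some ` R). (case t of None => y j | Some i => V i j) * l t) = 0"
   by blast
  have l': "y j * l None + (\<Sum>i \<in> R. V i j * l (Some i)) = 0" if "j \<in> S" for j
   using l(2)[OF that] finR by (simp add: sum.reindex image_iff)
  have ls: "l (Some i) = 0" if i: "i \<in> R" for i
  proof -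
   have "0 = (\<Sum>j \<in> S. real_of_int (a i j) * (y j * l None + (\<Sum>i' \<in> R. V i' j * l (Some i'))))" using l' by simp
   also have "\<dots> = (\<Sum>j \<in> S. real_of_int (a i j) * y j) * l None + (\<Sum>i' \<in> R. (\<Sum>j \<in> S. real_of_int (a i j) * V i' j) * l (Some i'))"
    by (simp add: distrib_left sum.distrib sum_distrib_left sum_distrib_right mult.assoc sum.swap[of _ R S])
   also have "(\<Sum>i' \<in> R. (\<Sum>j \<in> S. real_of_int (a i j) * V i' j) * l (Some i')) = (\<Sum>i' \<in> {i}. (\<Sum>j \<in> S. real_of_int (a i j) * V i' j) * l (Some i'))"
    using i finR V(2) by (intro sum.mono_neutral_right) auto
   finally show ?thesis using V(1)[OF i] yker[of i] RI i by auto
  qed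
  then have "y k * l None = 0" using l'[OF yk(2)] by simp
  then have "l None = 0" using yk by simp
  then show False using l(1) ls by auto
 qed
 \<comment> \<open>With more unknowns there would be a nonzero kernel vector with entry 0 at
   \<open>k\<close>, which is no multiple of \<open>y\<close>, as \<open>y k > 0\<close>.\<close>
 have card2: "card S \<le> card I + 1"
 proof (rule ccontr)
  assume "\<not> card S \<le> card I + 1"
  then have "card (insert None (Some ` I)) < card S" using fin by (simp add: card_image)
  then have "\<exists>l. (\<exists>j \<in> S. l j ~= 0) & (\<forall>e \<in> insert None (Some ` I).
   (\<Sum>j \<in> S. (case e of None => of_bool (j = k) | Some i => real_of_int (a i j)) * l j) = 0)"
   using fin finS by (intro homogeneous_nontrivial) auto
  then obtain l where l: "\<exists>j \<in> S. l j ~= 0" "!!e. e \<in> insert None (Some ` I) ==>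
   (\<Sum>j \<in> S. (case e of None => of_bool (j = k) | Some i => real_of_int (a i j)) * l j) = 0" by blast
  have "(\<Sum>j \<in> S. real_of_int (a i j) * l j) = 0" if "i \<in> I" for i using l(2)[of "Some i"] that by simp
  from proportional[OF this] obtain \<mu> where \<mu>: "!!j. j \<in> S ==> l j = \<mu> * y j" by blast
  have "(\<Sum>j \<in> S. of_bool (j = k) * l j) = (\<Sum>j \<in> {k}. of_bool (j = k) * l j)"
   using yk finS by (intro sum.mono_neutral_right) auto
  then have "l k = 0" using l(2)[of None] by simp
  then have "\<mu> = 0" using \<mu>[OF yk(2)] yk by simp
  then show False using l(1) \<mu> by auto
 qed
 define s where "s = card S"
 \<comment> \<open>Entries in \<open>{0..b}\<close> give every equation at most
   \<open>q * b + 1\<close> values. With \<open>b = q ^ (s - 1)\<close> and at most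
   \<open>s - 1\<close> equations there are fewer value vectors than arguments.\<close>
 define q where "q = 2 * s * \<alpha>"
 define b where "b = q ^ (s - 1)"
 have s1: "1 \<le> s" using yk finS by (auto simp: s_def Suc_le_eq card_gt_0_iff)
 have q1: "1 \<le> q" using s1 \<alpha>(2) by (simp add: q_def)
 define A where "A = (PiE S (%_. {0..b}))"
 define F where "F u = (\<lambda>i \<in> R. \<Sum>j \<in> S. a i j * int (u j))" for u
 define C where "C = int (s * \<alpha> * b)"
 have range: "F ` A \<subseteq> PiE R (%_. {-C..C})"
 proof
  fix g assume "g \<in> F ` A"
  then obtain u where u: "u \<in> A" "g = F u" by blast
  have "\<bar>\<Sum>j \<in> S. a i j * int (u j)\<bar> \<le> C" if i: "i \<in> R" for i
  proof -
   have "\<bar>\<Sum>j \<in> S. a i j * int (u j)\<bar> \<le> (\<Sum>j \<in> S. \<bar>a i j * int (u j)\<bar>)" by (rule sum_abs)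
   also have "\<dots> \<le> (\<Sum>j \<in> S. int \<alpha> * int b)"
    using u(1) i RI SJ \<alpha>(1) unfolding A_def abs_mult by (intro sum_mono mult_mono) (auto simp: PiE_def Pi_def)
   finally show ?thesis by (simp add: C_def s_def)
  qed
  then have "(\<Sum>j \<in> S. a i j * int (u j)) \<in> {-C..C}" if "i \<in> R" for i
   using that by (simp add: abs_le_iff minus_le_iff)
  then show "g \<in> PiE R (%_. {-C..C})" by (auto simp: u(2) F_def)
 qed
 have "card (F ` A) \<le> card (PiE R (%_. {-C..C}))"
  using range finR by (intro card_mono finite_PiE) auto
 also have "\<dots> = (q * b + 1) ^ card R"
  using finR by (simp add: card_PiE C_def q_def nat_add_distrib nat_mult_distrib mult_ac)
 also have "\<dots> \<le> (q * (b + 1)) ^ card R" using q1 by (intro power_mono) auto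
 also have "\<dots> \<le> (q * (b + 1)) ^ (s - 1)" using card1 q1 by (intro power_increasing) (auto simp: s_def)
 also have "\<dots> < (b + 1) ^ s"
 proof -
  have "(q * (b + 1)) ^ (s - 1) = b * (b + 1) ^ (s - 1)" by (simp only: power_mult_distrib b_def)
  also have "\<dots> < (b + 1) * (b + 1) ^ (s - 1)" by simp
  also have "\<dots> = (b + 1) ^ s" using s1 by (cases s) auto
  finally show ?thesis .
 qed
 also have "\<dots> = card A" using finS by (simp add: A_def card_PiE s_def)
 finally have "\<not> inj_on F A" by (intro pigeonhole)
 then obtain u u' where uu: "u \<in> A" "u' \<in> A" "u ~= u'" "F u = F u'" by (auto simp: inj_on_def)
 define v where "v j = int (u j) - int (u' j)" for j
 have vker: "(\<Sum>j \<in> S. real_of_int (a i j) * real_of_int (v j)) = 0" if "i \<in> R" for i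
 proof -
  have "(\<Sum>j \<in> S. a i j * v j) = 0"
   using fun_cong[OF uu(4), of i] that by (simp add: F_def v_def right_diff_distrib sum_subtractf)
  then have "real_of_int (\<Sum>j \<in> S. a i j * v j) = 0" by (simp only: of_int_0)
  then show ?thesis by simp
 qed
 then have "\<forall>i \<in> I. (\<Sum>j \<in> S. real_of_int (a i j) * real_of_int (v j)) = 0" using R by (simp add: ess_def)
 then obtain \<mu> where \<mu>: "!!j. j \<in> S ==> real_of_int (v j) = \<mu> * y j" using proportional[of "%j. v j"] by blast
 have "\<exists>j \<in> S. u j ~= u' j" using uu by (metis A_def PiE_ext)
 then have \<mu>0: "\<mu> ~= 0" using \<mu> by (force simp: v_def)
 have vb: "\<bar>v j\<bar> \<le> int b" if "j \<in> S" for j using uu that by (auto simp: v_def A_def PiE_def Pi_def abs_le_iff)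
 \<comment> \<open>The difference \<open>v\<close> of two colliding vectors is a nonzero multiple of
   the positive \<open>y\<close>. Its entries share one sign, so their absolute values still solve
   the system.\<close>
 define c where "c j = (if j \<in> S then nat \<bar>v j\<bar> else 0)" for j
 have c: "real (c j) = \<bar>\<mu>\<bar> * y j" if "j \<in> S" for j
 proof -
  have "real (c j) = \<bar>real_of_int (v j)\<bar>" using that by (simp add: c_def)
  then show ?thesis using \<mu>[OF that] ypos[OF that] by (simp add: abs_mult)
 qed
 have c0: "c j = 0" if "j \<notin> S" for j using that by (simp add: c_def)
 have cpos: "c j ~= 0 \<longleftrightarrow> j \<in> S" for j
  using c[of j] c0[of j] \<mu>0 ypos[of j] by (cases "j \<in> S") (auto simp del: of_nat_eq_0_iff simp: of_nat_eq_0_iff[where 'a = real, symmetric])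
 have sumc: "(\<Sum>j \<in> J. f j * real (c j)) = \<bar>\<mu>\<bar> * (\<Sum>j \<in> J. f j * y j)" for f
 proof -
  have "(\<Sum>j \<in> S. f j * real (c j)) = \<bar>\<mu>\<bar> * (\<Sum>j \<in> S. f j * y j)" using c by (simp add: sum_distrib_left mult.left_commute)
  then show ?thesis using sumS[of "%j. real (c j)" f] sumS[of y f] c0 y0 by simp
 qed
 show ?thesis
 proof (rule that[of c])
  have "c k ~= 0" using cpos yk by blast
  then show "1 \<le> c k" by simp
  show "c j \<le> (2 * (card I + 1) * \<alpha>) ^ card I" for j
  proof -
   have "c j \<le> b" using vb[of j] by (auto simp: c_def)
   also have "b \<le> (2 * (card I + 1) * \<alpha>) ^ (s - 1)" unfolding b_def q_def using card2 by (intro power_mono mult_mono) (auto simp: s_def)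
   also have "\<dots> \<le> (2 * (card I + 1) * \<alpha>) ^ card I" using card2 \<alpha>(2) by (intro power_increasing) (auto simp: s_def)
   finally show ?thesis .
  qed
  show "j \<in> J & x j ~= 0" if "c j ~= 0" for j using that cpos[of j] y by (auto simp: good_def S_def supp_def)
  have "{j. c j ~= 0} = S" using cpos by auto
  then show "card {j. c j ~= 0} \<le> card I + 1" using card2 by simp
  show "(\<Sum>j \<in> J. a i j * int (c j)) = 0" if "i \<in> I" for i
  proof -
   have "real_of_int (\<Sum>j \<in> J. a i j * int (c j)) = \<bar>\<mu>\<bar> * (\<Sum>j \<in> J. real_of_int (a i j) * y j)" using sumc[of "%j. real_of_int (a i j)"] by simp
   also have "\<dots> = 0" using y that by (simp add: good_def)
   finally show ?thesis by (simp only: of_int_eq_0_iff)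
  qed
  have "(\<Sum>j \<in> J. \<phi> j * c j) * x k = \<bar>\<mu>\<bar> * ((\<Sum>j \<in> J. \<phi> j * y j) * x k)" by (simp add: sumc)
  also have "\<dots> \<le> \<bar>\<mu>\<bar> * ((\<Sum>j \<in> J. \<phi> j * x j) * y k)" using y by (intro mult_left_mono) (auto simp: good_def)
  finally show "(\<Sum>j \<in> J. \<phi> j * c j) * x k \<le> (\<Sum>j \<in> J. \<phi> j * x j) * c k" using c[OF yk(2)] by (simp add: mult_ac)
 qed
qed

text \<open>Two slack columns per row, one for each sign, absorb the residual and make
  \<open>x\<close> part of an exact solution of a larger system. The integral solution obtained from
  it does not worsen the ratio of slack to entry \<open>k\<close>; since its entry \<open>k\<close>
  is bounded, its total slack is below 1 and hence zero.\<close>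

lemma approximate_solution_exact:
 fixes a :: "'r => 'c => int" and x :: "'c => real"
 assumes fin: "finite I" "finite J" and k: "k \<in> J"
  and x: "!!j. j \<in> J ==> 0 \<le> x j" "!!i. i \<in> I ==> \<bar>\<Sum>j \<in> J. real_of_int (a i j) * x j\<bar> \<le> \<epsilon>"
  and \<alpha>: "!!i j. i \<in> I ==> j \<in> J ==> \<bar>a i j\<bar> \<le> int \<alpha>" "1 \<le> \<alpha>"
  and eps: "real (card I) * \<epsilon> * real ((2 * (card I + 1) * \<alpha>) ^ card I) < x k" and xk: "0 < x k"
 obtains c :: "'c => nat" where "1 \<le> c k" "!!i. i \<in> I ==> (\<Sum>j \<in> J. a i j * int (c j)) = 0"
proof -
 define J' where "J' = Inl ` J \<union> Inr ` (I \<times> (UNIV :: bool set))"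
 define b :: "'r => 'c + 'r \<times> bool => int" where
  "b i t = (case t of Inl j => a i j | Inr (i', s) => if i = i' then (if s then 1 else -1) else 0)" for i t
 define row where "row i = (\<Sum>j \<in> J. real_of_int (a i j) * x j)" for i
 define y :: "'c + 'r \<times> bool => real" where
  "y t = (case t of Inl j => x j | Inr (i, s) => if s then max 0 (- row i) else max 0 (row i))" for t
 define \<phi> :: "'c + 'r \<times> bool => real" where "\<phi> t = (case t of Inl j => 0 | Inr p => 1)" for t
 have sumJ': "(\<Sum>t \<in> J'. f t) = (\<Sum>j \<in> J. f (Inl j)) + (\<Sum>i \<in> I. f (Inr (i, True)) + f (Inr (i, False)))" for f :: "_ => 'z::comm_monoid_add"
 proof -
  have "(\<Sum>t \<in> J'. f t) = (\<Sum>t \<in> Inl ` J. f t) + (\<Sum>t \<in> Inr ` (I \<times> (UNIV :: bool set)). f t)"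
   unfolding J'_def using fin by (intro sum.union_disjoint) auto
  also have "(\<Sum>t \<in> Inr ` (I \<times> (UNIV :: bool set)). f t) = (\<Sum>i \<in> I. \<Sum>s \<in> UNIV. f (Inr (i, s)))"
   by (simp add: sum.reindex sum.cartesian_product)
  finally show ?thesis by (simp add: sum.reindex UNIV_bool add.commute)
 qed
 have ker: "(\<Sum>t \<in> J'. real_of_int (b i t) * y t) = 0" if i: "i \<in> I" for i
 proof -
  have "(\<Sum>i' \<in> I. real_of_int (b i (Inr (i', True))) * y (Inr (i', True)) + real_of_int (b i (Inr (i', False))) * y (Inr (i', False)))
   = (\<Sum>i' \<in> I. if i' = i then - row i else 0)"
   by (rule sum.cong) (auto simp: b_def y_def max_def)
  also have "\<dots> = - row i" using i fin by simp
  finally show ?thesis unfolding sumJ' by (simp add: b_def y_def row_def)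
 qed
 have y0: "0 \<le> y t" if "t \<in> J'" for t using x(1) that by (auto simp: J'_def y_def)
 have b\<alpha>: "\<bar>b i t\<bar> \<le> int \<alpha>" if "i \<in> I" "t \<in> J'" for i t using \<alpha> that by (auto simp: J'_def b_def)
 have J': "finite J'" "Inl k \<in> J'" "y (Inl k) > 0" using fin k xk by (auto simp: J'_def y_def)
 have \<phi>0: "0 \<le> \<phi> t" for t by (auto simp: \<phi>_def split: sum.splits)
 obtain c where c: "1 \<le> c (Inl k)" "!!t. c t \<le> (2 * (card I + 1) * \<alpha>) ^ card I"
  "!!i. i \<in> I ==> (\<Sum>t \<in> J'. b i t * int (c t)) = 0"
  "(\<Sum>t \<in> J'. \<phi> t * c t) * y (Inl k) \<le> (\<Sum>t \<in> J'. \<phi> t * y t) * c (Inl k)"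
  by (rule small_integer_solution[where I = I and J = J' and k = "Inl k" and x = y and a = b and \<phi> = \<phi> and \<alpha> = \<alpha>,
     OF fin(1) J' y0 ker \<phi>0 b\<alpha> \<alpha>(2)]) blast+
 have "(\<Sum>t \<in> J'. \<phi> t * y t) = (\<Sum>i \<in> I. \<bar>row i\<bar>)" unfolding sumJ' by (simp add: \<phi>_def y_def max_def abs_if) (rule sum.cong, auto)
 also have "\<dots> \<le> real (card I) * \<epsilon>" using sum_bounded_above[of I "%i. \<bar>row i\<bar>" \<epsilon>] x(2) by (simp add: row_def)
 finally have up: "(\<Sum>t \<in> J'. \<phi> t * y t) \<le> real (card I) * \<epsilon>" .
 have nonneg: "0 \<le> (\<Sum>t \<in> J'. \<phi> t * y t)" using \<phi>0 y0 by (intro sum_nonneg mult_nonneg_nonneg) auto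
 have "(\<Sum>t \<in> J'. \<phi> t * c t) * x k \<le> (real (card I) * \<epsilon>) * real ((2 * (card I + 1) * \<alpha>) ^ card I)"
 proof -
  have "(\<Sum>t \<in> J'. \<phi> t * c t) * x k \<le> (\<Sum>t \<in> J'. \<phi> t * y t) * c (Inl k)" using c(4) by (simp add: y_def)
  also have "\<dots> \<le> (real (card I) * \<epsilon>) * real ((2 * (card I + 1) * \<alpha>) ^ card I)"
   using up nonneg c(2)[of "Inl k"] by (intro mult_mono) (auto simp only: of_nat_le_iff of_nat_0_le_iff)
  finally show ?thesis .
 qed
 also have "\<dots> < 1 * x k" using eps by simp
 finally have lt1: "(\<Sum>t \<in> J'. \<phi> t * c t) < 1" using xk by (simp only: mult_less_cancel_right_pos)
 have "c (Inr (i, s)) = 0" if i: "i \<in> I" for i s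
 proof (rule ccontr)
  assume "c (Inr (i, s)) ~= 0"
  then have "1 \<le> \<phi> (Inr (i, s)) * c (Inr (i, s))" by (simp add: \<phi>_def Suc_le_eq)
  also have "\<dots> \<le> (\<Sum>t \<in> J'. \<phi> t * c t)"
   using i J' \<phi>0 by (intro member_le_sum) (auto simp: J'_def)
  finally show False using lt1 by simp
 qed
 then have "(\<Sum>j \<in> J. a i j * int (c (Inl j))) = 0" if "i \<in> I" for i
  using c(3)[OF that] unfolding sumJ' by (simp add: b_def)
 then show ?thesis using that[of "%j. c (Inl j)"] c(1) by blast
qed

text \<open>Lagrange's identity: the difference of the two sides is half a sum of squares.\<close>

lemma cauchy_schwarz_sum:
 fixes u v :: "'a => real"
 shows "(\<Sum>i \<in> A. u i * v i)\<^sup>2 \<le> (\<Sum>i \<in> A. (u i)\<^sup>2) * (\<Sum>i \<in> A. (v i)\<^sup>2)"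
proof -
 have "0 \<le> (\<Sum>i \<in> A. \<Sum>j \<in> A. (u i * v j - u j * v i)\<^sup>2)" by (intro sum_nonneg) auto
 also have "\<dots> = 2 * ((\<Sum>i \<in> A. (u i)\<^sup>2) * (\<Sum>i \<in> A. (v i)\<^sup>2)) - 2 * (\<Sum>i \<in> A. u i * v i)\<^sup>2"
 proof -
  have "(u i * v j - u j * v i)\<^sup>2 = (u i)\<^sup>2 * (v j)\<^sup>2 + (v i)\<^sup>2 * (u j)\<^sup>2 - 2 * ((u i * v i) * (u j * v j))" for i j
   by (simp add: power2_eq_square algebra_simps)
  then show ?thesis
   by (simp add: sum_subtractf sum.distrib sum_distrib_left[symmetric] sum_distrib_right[symmetric] power2_eq_square[of "sum _ _"] mult.commute)
 qed
 finally show ?thesis by simp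
qed

section \<open>Approximate projection onto a kernel\<close>

locale contraction =
 fixes m n :: nat and M :: "nat => nat => real" and h :: real
 assumes h: "0 < h" and frob: "(\<Sum>i<m. \<Sum>j<n. (M i j)\<^sup>2) \<le> h"
begin

definition ip :: "(nat => real) => (nat => real) => real" where
 "ip u v = (\<Sum>j<n. u j * v j)"

definition mv :: "(nat => real) => nat => real" where
 "mv v i = (\<Sum>j<n. M i j * v j)"

definition mt :: "(nat => real) => nat => real" where
 "mt u j = (\<Sum>i<m. M i j * u i)"

text \<open>This is \<open>I - M' M / h\<close> with \<open>M'\<close> the transpose. The Frobenius
  bound keeps the spectrum of \<open>M' M\<close> in \<open>[0, h]\<close>, so the map is symmetric,
  does not increase length and fixes the kernel of \<open>M\<close> pointwise. Its high powers come
  close to the orthogonal projection onto the kernel.\<close>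

definition ev :: "(nat => real) => nat => real" where
 "ev v j = v j - mt (mv v) j / h"

abbreviation ipm :: "(nat => real) => (nat => real) => real" where
 "ipm u v \<equiv> (\<Sum>i<m. u i * v i)"

lemma adjoint: "ip (mt u) v = ipm u (mv v)"
 unfolding ip_def mt_def mv_def sum_distrib_left sum_distrib_right by (subst sum.swap) (simp add: mult_ac)

lemma mt_bound: "ip (mt u) (mt u) \<le> h * ipm u u"
proof -
 have "ip (mt u) (mt u) \<le> (\<Sum>j<n. (\<Sum>i<m. (M i j)\<^sup>2) * (\<Sum>i<m. (u i)\<^sup>2))"
  unfolding ip_def mt_def power2_eq_square[symmetric] by (intro sum_mono cauchy_schwarz_sum)
 also have "\<dots> = (\<Sum>i<m. \<Sum>j<n. (M i j)\<^sup>2) * ipm u u"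
  by (subst sum.swap) (simp add: sum_distrib_right power2_eq_square)
 also have "\<dots> \<le> h * ipm u u" using frob by (intro mult_right_mono) (auto intro: sum_nonneg)
 finally show ?thesis .
qed

lemma mv_bound: "ipm (mv v) (mv v) \<le> h * ip v v"
proof -
 have "ipm (mv v) (mv v) \<le> (\<Sum>i<m. (\<Sum>j<n. (M i j)\<^sup>2) * (\<Sum>j<n. (v j)\<^sup>2))"
  unfolding mv_def power2_eq_square[symmetric] by (intro sum_mono cauchy_schwarz_sum)
 also have "\<dots> = (\<Sum>i<m. \<Sum>j<n. (M i j)\<^sup>2) * ip v v"
  by (simp add: sum_distrib_right power2_eq_square ip_def)
 also have "\<dots> \<le> h * ip v v" using frob by (intro mult_right_mono) (auto intro: sum_nonneg simp: ip_def)
 finally show ?thesis .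
qed

lemma ip_commute: "ip u v = ip v u"
 by (simp add: ip_def mult.commute)

lemma ip_diff: "ip (%j. u j - w j / h) v = ip u v - ip w v / h"
 by (simp add: ip_def left_diff_distrib sum_subtractf sum_divide_distrib)

lemma ip_nonneg: "0 \<le> ip v v"
 by (simp add: ip_def sum_nonneg)

lemma ev_ip: "ip (ev u) v = ip u v - ipm (mv u) (mv v) / h"
 unfolding ev_def ip_diff by (simp add: adjoint)

lemma ev_sym: "ip (ev u) v = ip u (ev v)"
 using ev_ip[of u v] ev_ip[of v u] ip_commute[of u "ev v"] ip_commute[of u v] by (simp add: mult.commute)

text \<open>Expanding the square gives a loss of twice the squared residual over \<open>h\<close>;
  the quadratic term returns at most one of the two.\<close>

lemma ev_decrease: "ip (ev v) (ev v) \<le> ip v v - ipm (mv v) (mv v) / h"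
proof -
 have "ip (ev v) (ev v) = ip v (ev v) - ip (mt (mv v)) (ev v) / h"
  by (subst ev_def[abs_def]) (rule ip_diff)
 also have "ip v (ev v) = ip v v - ipm (mv v) (mv v) / h" using ev_ip[of v v] ip_commute[of v "ev v"] by simp
 also have "ip (mt (mv v)) (ev v) = ip (mt (mv v)) v - ip (mt (mv v)) (mt (mv v)) / h"
  using ip_diff[of v "mt (mv v)" "mt (mv v)"] by (simp add: ip_commute ev_def[abs_def])
 also have "ip (mt (mv v)) v = ipm (mv v) (mv v)" by (rule adjoint)
 finally have eq: "ip (ev v) (ev v) = ip v v - ipm (mv v) (mv v) / h - (ipm (mv v) (mv v) - ip (mt (mv v)) (mt (mv v)) / h) / h" .
 have "ip (mt (mv v)) (mt (mv v)) / h \<le> ipm (mv v) (mv v)" using mt_bound[of "mv v"] h by (simp add: field_simps)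
 then have "0 \<le> (ipm (mv v) (mv v) - ip (mt (mv v)) (mt (mv v)) / h) / h" using h by simp
 then show ?thesis using eq by simp
qed

lemma mv_diff: "mv (%j. u j - w j / h) i = mv u i - mv w i / h"
 by (simp add: mv_def right_diff_distrib sum_subtractf sum_divide_distrib)

text \<open>\<open>M\<close> intertwines the contraction with its counterpart
  \<open>I - M M' / h\<close> on the image side, which does not increase length either.\<close>

lemma mv_ev_decrease: "ipm (mv (ev v)) (mv (ev v)) \<le> ipm (mv v) (mv v)"
proof -
 let ?u = "mv v" and ?w = "mv (mt (mv v))"
 have "ipm (mv (ev v)) (mv (ev v)) = (\<Sum>i<m. (?u i - ?w i / h) * (?u i - ?w i / h))"
  unfolding ev_def[abs_def] mv_diff ..
 also have "\<dots> = ipm ?u ?u - 2 * ipm ?u ?w / h + ipm ?w ?w / h\<^sup>2"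
 proof -
  have "(p - q / h) * (p - q / h) = p * p - 2 * (p * q) / h + q * q / h\<^sup>2" for p q
   using h by (simp add: field_simps power2_eq_square)
  then show ?thesis by (simp add: sum_subtractf sum.distrib sum_divide_distrib sum_distrib_left)
 qed
 finally have eq: "ipm (mv (ev v)) (mv (ev v)) = ipm ?u ?u - 2 * ipm ?u ?w / h + ipm ?w ?w / h\<^sup>2" .
 have 1: "ipm ?u ?w = ip (mt ?u) (mt ?u)" by (simp add: adjoint)
 have "ipm ?w ?w / h\<^sup>2 \<le> (h * ip (mt ?u) (mt ?u)) / h\<^sup>2"
  using mv_bound[of "mt ?u"] h by (intro divide_right_mono) auto
 then have 2: "ipm ?w ?w / h\<^sup>2 \<le> ip (mt ?u) (mt ?u) / h" using h by (simp add: power2_eq_square)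
 have "2 * ip (mt ?u) (mt ?u) / h = ip (mt ?u) (mt ?u) / h + ip (mt ?u) (mt ?u) / h" by simp
 then have "ipm (mv (ev v)) (mv (ev v)) \<le> ipm ?u ?u - ip (mt ?u) (mt ?u) / h" using eq 2 unfolding 1 by linarith
 moreover have "0 \<le> ip (mt ?u) (mt ?u) / h" using ip_nonneg h by simp
 ultimately show ?thesis by linarith
qed

lemma pow_sym: "ip ((ev ^^ N) u) v = ip u ((ev ^^ N) v)"
proof (induction N arbitrary: u v)
 case (Suc N)
 have "ip ((ev ^^ Suc N) u) v = ip ((ev ^^ N) u) (ev v)" by (simp add: ev_sym)
 also have "\<dots> = ip u ((ev ^^ N) (ev v))" by (rule Suc)
 finally show ?case by (simp add: funpow_swap1)
qed simp

lemma pow_contract: "ip ((ev ^^ N) v) ((ev ^^ N) v) \<le> ip v v"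
proof (induction N)
 case (Suc N)
 have "0 \<le> ipm (mv ((ev ^^ N) v)) (mv ((ev ^^ N) v)) / h" using h by (intro divide_nonneg_pos sum_nonneg) auto
 then show ?case using ev_decrease[of "(ev ^^ N) v"] Suc by simp
qed simp

text \<open>The losses telescope and the residuals are monotone, so the residual after
  \<open>N\<close> steps is at most the average loss. It is only guaranteed to decay like
  \<open>1 / N\<close>; repeated squaring makes an exponentially large \<open>N\<close>
  affordable.\<close>

lemma pow_residual: "real N * ipm (mv ((ev ^^ N) v)) (mv ((ev ^^ N) v)) \<le> h * ip v v"
proof -
 let ?r = "%N. ipm (mv ((ev ^^ N) v)) (mv ((ev ^^ N) v))"
 have dec: "?r (Suc N) \<le> ?r N" for N using mv_ev_decrease by simp
 have main: "real N * ?r N + h * ip ((ev ^^ N) v) ((ev ^^ N) v) \<le> h * ip v v" for N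
 proof (induction N)
  case (Suc N)
  have "h * ip ((ev ^^ Suc N) v) ((ev ^^ Suc N) v) \<le> h * (ip ((ev ^^ N) v) ((ev ^^ N) v) - ?r N / h)"
   using ev_decrease[of "(ev ^^ N) v"] h by (intro mult_left_mono) auto
  also have "\<dots> = h * ip ((ev ^^ N) v) ((ev ^^ N) v) - ?r N" using h by (simp add: right_diff_distrib)
  finally have "h * ip ((ev ^^ Suc N) v) ((ev ^^ Suc N) v) \<le> h * ip ((ev ^^ N) v) ((ev ^^ N) v) - ?r N" .
  moreover have "real (Suc N) * ?r (Suc N) \<le> real (Suc N) * ?r N" using dec by (intro mult_left_mono) auto
  moreover have "real (Suc N) * ?r N = real N * ?r N + ?r N" by (simp add: distrib_right)
  ultimately show ?case using Suc by linarith
 qed simp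
 have "0 \<le> h * ip ((ev ^^ N) v) ((ev ^^ N) v)" using h ip_nonneg by simp
 then show ?thesis using main[of N] by linarith
qed

lemma pow_fix: "(!!i. i < m ==> mv x i = 0) ==> (ev ^^ N) x = x"
proof (induction N)
 case (Suc N)
 then show ?case by (simp add: ev_def[abs_def] mt_def)
qed simp

definition unit :: "nat => nat => real" where
 "unit l j = of_bool (j = l)"

lemma ev_linear: "ev (%j. \<Sum>l<k. c l * f l j) j = (\<Sum>l<k. c l * ev (f l) j)"
proof -
 have "mv (%j. \<Sum>l<k. c l * f l j) i = (\<Sum>l<k. c l * mv (f l) i)" for i
  unfolding mv_def sum_distrib_left by (subst sum.swap) (simp add: mult_ac)
 then have "mt (mv (%j. \<Sum>l<k. c l * f l j)) j = (\<Sum>l<k. c l * mt (mv (f l)) j)"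
  unfolding mt_def by (simp add: sum_distrib_left sum.swap[of _ "{..<k}"] mult_ac)
 then show ?thesis by (simp add: ev_def right_diff_distrib sum_subtractf sum_divide_distrib)
qed

lemma pow_linear: "(ev ^^ N) (%j. \<Sum>l<k. c l * f l j) = (%j. \<Sum>l<k. c l * (ev ^^ N) (f l) j)"
proof (induction N)
 case (Suc N)
 then show ?case by (simp add: ev_linear[abs_def])
qed simp

lemma ev_cong: "(!!j. j < n ==> u j = v j) ==> j < n ==> ev u j = ev v j"
proof -
 assume eq: "!!j. j < n ==> u j = v j" and "j < n"
 have "mv u i = mv v i" for i unfolding mv_def by (rule sum.cong) (use eq in auto)
 then have "mv u = mv v" by (rule ext)
 then show ?thesis using eq[OF \<open>j < n\<close>] by (simp add: ev_def)
qed

lemma pow_cong: "(!!j. j < n ==> u j = v j) ==> j < n ==> (ev ^^ N) u j = (ev ^^ N) v j"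
proof (induction N arbitrary: j)
 case (Suc N)
 show ?case unfolding funpow.simps o_apply by (rule ev_cong) (use Suc in auto)
qed simp

definition Q :: "nat => nat => nat => real" where
 "Q N j l = (ev ^^ N) (unit l) j"

lemma pow_matrix:
 assumes "j < n"
 shows "(ev ^^ N) v j = (\<Sum>l<n. Q N j l * v l)"
proof -
 have "v j' = (\<Sum>l<n. v l * unit l j')" if "j' < n" for j'
  using that by (simp add: unit_def)
 then have "(ev ^^ N) v j = (ev ^^ N) (%j. \<Sum>l<n. v l * unit l j) j" by (intro pow_cong assms)
 then show ?thesis unfolding pow_linear by (simp add: Q_def mult.commute)
qed

lemma ip_unit: "l < n ==> ip (unit l) v = v l"
 by (simp add: ip_def unit_def)

text \<open>A contraction maps unit vectors into the unit ball. Bounded entries keep the rounding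
  errors of repeated squaring under control.\<close>

lemma Q_le_1: assumes "j < n" "l < n" shows "\<bar>Q N j l\<bar> \<le> 1"
proof -
 have "(Q N j l)\<^sup>2 \<le> ip ((ev ^^ N) (unit l)) ((ev ^^ N) (unit l))"
  unfolding ip_def Q_def power2_eq_square[symmetric] using assms by (intro member_le_sum) auto
 also have "\<dots> \<le> ip (unit l) (unit l)" by (rule pow_contract)
 also have "\<dots> = 1" using assms by (simp add: ip_unit) (simp add: unit_def)
 finally show ?thesis by (simp add: abs_square_le_1)
qed

lemma Q_double: "j < n ==> Q (N + N) j l = (\<Sum>i<n. Q N j i * Q N i l)"
 unfolding Q_def[of "N + N"] funpow_add o_apply by (subst pow_matrix) (auto simp: Q_def)

lemma Q_one: "Q 1 j l = of_bool (j = l) - (\<Sum>i<m. M i j * M i l) / h" if "l < n"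
 using that by (simp add: Q_def ev_def mt_def mv_def unit_def)

text \<open>The perceptron step: adding a unit vector in whose direction the current image is small increases
 the potential by at most 2.\<close>

lemma potential_step:
 assumes k: "k < n" and small: "(ev ^^ (N + N)) y k \<le> 1 / 2"
 shows "ip ((ev ^^ N) (%j. y j + unit k j)) ((ev ^^ N) (%j. y j + unit k j)) \<le> ip ((ev ^^ N) y) ((ev ^^ N) y) + 2"
proof -
 have ev_add: "ev (%j. u j + v j) = (%j. ev u j + ev v j)" for u v
  by (simp add: ev_def[abs_def] mt_def mv_def distrib_left sum.distrib add_divide_distrib fun_eq_iff)
 have pow_add: "(ev ^^ N) (%j. u j + v j) = (%j. (ev ^^ N) u j + (ev ^^ N) v j)" for u v
  by (induction N) (auto simp: ev_add)
 have ip_sq: "ip (%j. u j + v j) (%j. u j + v j) = ip u u + 2 * ip u v + ip v v" for u v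
  by (simp add: ip_def distrib_left distrib_right sum.distrib mult.commute sum_distrib_left)
 have "ip ((ev ^^ N) y) ((ev ^^ N) (unit k)) = (ev ^^ (N + N)) y k"
  using k pow_sym[of N "(ev ^^ N) y" "unit k"] by (simp add: funpow_add ip_commute[of _ "unit k"] ip_unit)
 moreover have "ip ((ev ^^ N) (unit k)) ((ev ^^ N) (unit k)) \<le> 1"
  using pow_contract[of N "unit k"] k by (simp add: ip_unit) (simp add: unit_def)
 ultimately show ?thesis unfolding pow_add ip_sq using small by simp
qed

text \<open>A vector in the kernel is fixed by the contraction, so it pairs with \<open>y\<close> as with the short vector \<open>E\<^sup>2\<^sup>N y\<close>.\<close>

lemma kernel_pairing:
 assumes ker: "!!i. i < m ==> mv x i = 0" and x: "!!j. j < n ==> \<bar>x j\<bar> \<le> 1"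
  and y: "ip ((ev ^^ N) y) ((ev ^^ N) y) \<le> s"
 shows "(ip y x)\<^sup>2 \<le> s * real n"
proof -
 have "ip y x = ip ((ev ^^ N) y) x" using pow_sym[of N y x] pow_fix[of x N] ker by simp
 then have "(ip y x)\<^sup>2 \<le> ip ((ev ^^ N) y) ((ev ^^ N) y) * ip x x"
  using cauchy_schwarz_sum[of "(ev ^^ N) y" x "{..<n}"] by (simp add: ip_def power2_eq_square)
 also have "\<dots> \<le> s * real n"
 proof (intro mult_mono y)
  have "ip x x \<le> (\<Sum>j<n. 1)" unfolding ip_def power2_eq_square[symmetric] using x by (intro sum_mono) (auto simp: abs_square_le_1)
  then show "ip x x \<le> real n" by simp
  show "0 \<le> s" using ip_nonneg[of "(ev ^^ N) y"] y by linarith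
 qed (rule ip_nonneg)
 finally show ?thesis .
qed

end

section \<open>A rescaled perceptron in fixed-point arithmetic\<close>

definition rnd :: "nat => int => int" where
 "rnd p z = mkint (z < 0) (nat \<bar>z\<bar> div 2 ^ p)"

text \<open>Clipping bounds the entries for arbitrary parameters, so the size bound is independent
  of the error analysis. The true entries have modulus at most \<open>2 ^ p\<close>, so clipping
  moves no value away from them.\<close>

definition clip :: "nat => int => int" where
 "clip p z = mkint (z < 0) (if nat \<bar>z\<bar> \<le> 2 * 2 ^ p then nat \<bar>z\<bar> else 2 * 2 ^ p)"

definition mat :: "int list list => nat => nat => int" where
 "mat P j l = nth_or 0 (nth_or [] P j) l"

definition sqm :: "nat => int list list => int list list" where
 "sqm p P = map (%j. map (%l. clip p (rnd p (sum_list (map (%i. mat P j i * mat P i l) [0..<length P]))))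
  [0..<length P]) [0..<length P]"

text \<open>The matrix \<open>I - M' M / 2 ^ \<kappa>\<close> scaled by \<open>2 ^ p\<close>. A
  power of two as the Frobenius bound makes it exact as long as
  \<open>\<kappa> \<le> p\<close>.\<close>

definition P0 :: "int list list => nat list => nat => nat => int list list" where
 "P0 A D \<kappa> p = map (%j. map (%l. (if j = l then int (2 ^ p) else 0) -
  sum_list (map (%r. (nth_or 0 r j * int (nth_or 0 D j)) * (nth_or 0 r l * int (nth_or 0 D l))) A) * int (2 ^ (p - \<kappa>)))
  [0..<length D]) [0..<length D]"

definition zv :: "int list list => nat list => nat => int" where
 "zv P y j = sum_list (map (%l. mat P j l * int (nth_or 0 y l)) [0..<length P])"

text \<open>The threshold is 3/8 and the computed values are off by at most 1/8: a coordinate that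
  passes is truly at least 1/4, and one that fails is at most 1/2, which is what
  \<open>potential_step\<close> asks for.\<close>

definition bads :: "nat => nat list => int list list => nat list => nat list" where
 "bads p D P y = filter (%j. nth_or 0 D j ~= 0 & 8 * zv P y j < 3 * int (2 ^ p)) [0..<length D]"

definition ystep :: "nat => nat list => int list list => nat list => nat list" where
 "ystep p D P y = (if bads p D P y = [] then y else
  map (%j. if j = hd_or 0 (bads p D P y) then Suc (nth_or 0 y j) else nth_or 0 y j) [0..<length D])"

text \<open>The chosen coordinate carries at least the average \<open>t / n\<close> of the weight of
  \<open>y\<close>. A column weight 1 becomes 0, which removes the column.\<close>

definition halve :: "nat => nat list => nat list => nat list" where
 "halve t D y = map (%j. if j = hd_or 0 (filter (%k. nth_or 0 D k ~= 0 & t \<le> length D * nth_or 0 y k) [0..<length D])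
  then nth_or 0 D j div 2 ^ 1 else nth_or 0 D j) [0..<length D]"

text \<open>Both outcomes are stationary: the flag records success, and a weight 0 at coordinate 0
  means that no solution has \<open>x 0 > 0\<close>.\<close>

definition lpstep :: "int list list => nat => nat => nat => nat => bool \<times> nat list => bool \<times> nat list" where
 "lpstep A \<kappa> t K p s = (if fst s \<or> nth_or 0 (snd s) 0 = 0 then s else
  let P = (sqm p ^^ K) (P0 A (snd s) \<kappa> p); y = (ystep p (snd s) P ^^ t) (map (%_. 0) (snd s))
  in if bads p (snd s) P y = [] then (True, snd s) else (False, halve t (snd s) y))"

definition lpsolve :: "int list list => nat => nat => nat => nat => nat => nat => bool" where
 "lpsolve A n T \<kappa> t K p = fst ((lpstep A \<kappa> t K p ^^ (n * (T + 1))) (False, replicate n (2 ^ T)))"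

text \<open>Coordinate 0 plays the role of the homogenising variable: dividing by it turns a
  solution into one of an inhomogeneous system.\<close>

definition hf :: "int list list => nat => bool" where
 "hf A n \<longleftrightarrow> (\<exists>x :: nat => real. (\<forall>j<n. 0 \<le> x j) & (\<forall>i<length A. (\<Sum>j<n. real_of_int (mat A i j) * x j) = 0) & 0 < x 0)"

lemma nth_or_lt [simp]: "i < length xs ==> nth_or d xs i = xs ! i"
 by (simp add: nth_or_def)

lemma mat_tab: "j < n ==> l < n ==> mat (map (%j. map (f j) [0..<n]) [0..<n]) j l = f j l"
 by (simp add: mat_def)

lemma sum_list_upt: "sum_list (map f [0..<n]) = (\<Sum>i<n. f i)" for f :: "nat => 'a::comm_monoid_add"
 by (simp add: interv_sum_list_conv_sum_set_nat atLeast0LessThan)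

lemma mkint_abs: "mkint (z < 0) (nat \<bar>z\<bar>) = z"
 by (auto simp: mkint_def)

lemma rnd_close: "\<bar>real_of_int (rnd p z) - real_of_int z / 2 ^ p\<bar> \<le> 1"
proof -
 have "\<bar>real (w div 2 ^ p) - real w / 2 ^ p\<bar> \<le> 1" for w :: nat
 proof -
  have "real w / 2 ^ p = real (w div 2 ^ p) + real (w mod 2 ^ p) / 2 ^ p"
   using of_nat_add[of "w div 2 ^ p * 2 ^ p" "w mod 2 ^ p", where 'a = real] unfolding div_mult_mod_eq
   by (simp add: add_divide_distrib)
  moreover have "real (w mod 2 ^ p) \<le> 2 ^ p"
  proof -
   have "w mod 2 ^ p \<le> 2 ^ p" by (rule less_imp_le) simp
   then have "real (w mod 2 ^ p) \<le> real (2 ^ p)" by (simp only: of_nat_le_iff)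
   then show ?thesis by simp
  qed
  ultimately show ?thesis by simp
 qed
 from this[of "nat \<bar>z\<bar>"] show ?thesis by (cases "z < 0") (simp_all add: rnd_def mkint_def abs_minus_commute)
qed

lemma clip_close:
 assumes "\<bar>v\<bar> \<le> 2 * 2 ^ p"
 shows "\<bar>real_of_int (clip p z) - v\<bar> \<le> \<bar>real_of_int z - v\<bar>"
proof (cases "nat \<bar>z\<bar> \<le> 2 * 2 ^ p")
 case True
 then show ?thesis by (simp add: clip_def mkint_abs)
next
 case False
 then have "real (2 * 2 ^ p) < real (nat \<bar>z\<bar>)" by (simp only: of_nat_less_iff not_le)
 then have "real_of_int \<bar>z\<bar> > 2 * 2 ^ p" by simp
 then show ?thesis using False assms by (cases "z < 0") (auto simp: clip_def mkint_def)
qed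

text \<open>\<open>T\<close> bounds the bits of integral solutions, \<open>2 ^ \<kappa>\<close> is
  the Frobenius bound for \<open>A\<close> with weights up to \<open>2 ^ T\<close>, \<open>t\<close>
  counts perceptron steps, \<open>2 ^ K\<close> is the power of the contraction and \<open>p\<close>
  the number of fractional bits. The inequality on \<open>t\<close> serves the halving of weights,
  that on \<open>K\<close> the residual, and that on \<open>p\<close> the rounding.\<close>

locale lp =
 fixes A :: "int list list" and n T \<kappa> t K p \<alpha> :: nat
 assumes n: "1 \<le> n" and \<alpha>: "!!i j. i < length A ==> j < n ==> \<bar>mat A i j\<bar> \<le> int \<alpha>" "1 \<le> \<alpha>"
  and T: "(2 * (length A + 1) * \<alpha>) ^ length A \<le> 2 ^ T"
  and \<kappa>: "length A * n * (\<alpha> * 2 ^ T) ^ 2 \<le> 2 ^ \<kappa>" "\<kappa> \<le> p"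
  and t: "8 * n ^ 3 \<le> t"
  and K: "16 * (length A)\<^sup>2 * t\<^sup>2 * 2 ^ \<kappa> * (2 ^ T)\<^sup>2 < 2 ^ K" "1 \<le> K"
  and p: "(4 * n) ^ K * (8 * t) \<le> 2 ^ p"
begin

abbreviation "m \<equiv> length A"

lemma t1: "1 \<le> t"
proof -
 have "1 \<le> n ^ 3" using n by simp
 then show ?thesis using t by linarith
qed

definition sol :: "(nat => real) => bool" where
 "sol x \<longleftrightarrow> (\<forall>j<n. 0 \<le> x j) & (\<forall>i<m. (\<Sum>j<n. real_of_int (mat A i j) * x j) = 0)"

text \<open>\<open>D ! j / 2 ^ T\<close> bounds coordinate \<open>j\<close> of all solutions in the
  unit box. Divided by these bounds, such solutions still lie in the unit box, and in the kernel of
  \<open>MD D\<close>.\<close>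

definition inv_D :: "nat list => bool" where
 "inv_D D \<longleftrightarrow> length D = n & (\<forall>j<n. D ! j = 0 \<or> (\<exists>e\<le>T. D ! j = 2 ^ e)) &
  (\<forall>x. sol x & (\<forall>j<n. x j \<le> 1) --> (\<forall>j<n. x j * 2 ^ T \<le> real (D ! j)))"

definition MD :: "nat list => nat => nat => real" where
 "MD D i j = real_of_int (mat A i j) * real (D ! j)"

lemma inv_le: "inv_D D ==> j < n ==> D ! j \<le> 2 ^ T"
 unfolding inv_D_def by (metis one_le_numeral power_increasing zero_le)

lemma contraction_MD:
 assumes "inv_D D"
 shows "contraction m n (MD D) (2 ^ \<kappa>)"
proof
 have "(MD D i j)\<^sup>2 \<le> (real \<alpha> * 2 ^ T)\<^sup>2" if "i < m" "j < n" for i j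
 proof -
  have "\<bar>MD D i j\<bar> \<le> real \<alpha> * 2 ^ T"
   unfolding MD_def abs_mult
  proof (rule mult_mono)
   show "\<bar>real_of_int (mat A i j)\<bar> \<le> real \<alpha>" using \<alpha>(1)[OF that] by linarith
   have "real (D ! j) \<le> real (2 ^ T)" using inv_le[OF assms that(2)] of_nat_le_iff by blast
   then show "\<bar>real (D ! j)\<bar> \<le> 2 ^ T" by simp
  qed auto
  then show ?thesis using power_mono[of "\<bar>MD D i j\<bar>" _ 2] by simp
 qed
 then have "(\<Sum>i<m. \<Sum>j<n. (MD D i j)\<^sup>2) \<le> (\<Sum>i<m. \<Sum>j<n. (real \<alpha> * 2 ^ T)\<^sup>2)" by (intro sum_mono) auto
 also have "\<dots> = real (m * n * (\<alpha> * 2 ^ T) ^ 2)" by simp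
 also have "\<dots> \<le> real (2 ^ \<kappa>)" using \<kappa>(1) of_nat_le_iff by blast
 finally show "(\<Sum>i<m. \<Sum>j<n. (MD D i j)\<^sup>2) \<le> 2 ^ \<kappa>" by simp
qed simp

definition P :: "nat list => nat => int list list" where
 "P D r = (sqm p ^^ r) (P0 A D \<kappa> p)"

lemma length_P: "length D = n ==> length (P D r) = n"
 by (induction r) (auto simp: P_def P0_def sqm_def)

text \<open>One squaring turns an error \<open>e\<close> into at most
  \<open>n * (3 * e) + 1\<close>: two cross terms, a quadratic term that is dominated because
  \<open>e \<le> 2 ^ p\<close>, and the rounding. This is at most \<open>4 * n * e\<close>.\<close>

lemma P_approx:
 assumes D: "inv_D D" and r: "r \<le> K" and jl: "j < n" "l < n"
 shows "\<bar>real_of_int (mat (P D r) j l) - 2 ^ p * contraction.Q m n (MD D) (2 ^ \<kappa>) (2 ^ r) j l\<bar> \<le> real ((4 * n) ^ r)"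
 using r jl
proof (induction r arbitrary: j l)
 case 0
 interpret contraction m n "MD D" "2 ^ \<kappa>" by (rule contraction_MD[OF D])
 have len: "length D = n" using D by (simp add: inv_D_def)
 have pk: "(2::real) ^ (p - \<kappa>) = 2 ^ p / 2 ^ \<kappa>" using \<kappa>(2) by (simp add: power_diff)
 have "sum_list (map (%r. (nth_or 0 r j * int (nth_or 0 D j)) * (nth_or 0 r l * int (nth_or 0 D l))) A)
   = (\<Sum>i<m. (mat A i j * int (D ! j)) * (mat A i l * int (D ! l)))"
  using 0 len by (simp add: sum_list_sum_nth atLeast0LessThan mat_def)
 then have "real_of_int (mat (P D 0) j l) = of_bool (j = l) * 2 ^ p - (\<Sum>i<m. MD D i j * MD D i l) * 2 ^ (p - \<kappa>)"
  using 0 len by (simp add: P_def P0_def mat_tab MD_def)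
 also have "\<dots> = 2 ^ p * (of_bool (j = l) - (\<Sum>i<m. MD D i j * MD D i l) / 2 ^ \<kappa>)"
  by (simp add: pk right_diff_distrib mult.commute)
 also have "\<dots> = 2 ^ p * Q (2 ^ 0) j l" using 0 Q_one[of l j] by simp
 finally show ?case by simp
next
 case (Suc r)
 interpret contraction m n "MD D" "2 ^ \<kappa>" by (rule contraction_MD[OF D])
 have len: "length (P D r) = n" using D length_P by (simp add: inv_D_def)
 define w where "w = (2::real) ^ p"
 define e where "e = real ((4 * n) ^ r)"
 have w0: "w > 0" by (simp add: w_def)
 have ew: "e \<le> w"
 proof -
  have "(4 * n) ^ r \<le> (4 * n) ^ K" using Suc.prems n by (intro power_increasing) auto
  also have "\<dots> \<le> 2 ^ p" using p t1 mult_le_mono2[of 1 "8 * t" "(4 * n) ^ K"] by linarith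
  finally have "real ((4 * n) ^ r) \<le> real (2 ^ p)" by (simp only: of_nat_le_iff)
  then show ?thesis by (simp add: e_def w_def)
 qed
 define q where "q = Q (2 ^ r)"
 define d where "d j l = real_of_int (mat (P D r) j l)" for j l
 have IH: "\<bar>d j' l' - w * q j' l'\<bar> \<le> e" if "j' < n" "l' < n" for j' l'
  using Suc.IH[of j' l'] Suc.prems that by (simp add: d_def w_def q_def e_def)
 define S where "S = (\<Sum>i<n. mat (P D r) j i * mat (P D r) i l)"
 have "\<bar>real_of_int S / w - w * (\<Sum>i<n. q j i * q i l)\<bar> \<le> real n * (3 * e)"
 proof -
  have "real_of_int S / w - w * (\<Sum>i<n. q j i * q i l) = (\<Sum>i<n. (d j i * d i l - w * q j i * (w * q i l)) / w)"
  proof -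
   have "(d j i * d i l - w * q j i * (w * q i l)) / w = d j i * d i l / w - w * (q j i * q i l)" for i
    using w0 by (simp add: diff_divide_distrib)
   moreover have "real_of_int S = (\<Sum>i<n. d j i * d i l)" by (simp add: S_def d_def)
   ultimately show ?thesis by (simp only: sum_subtractf sum_distrib_left[symmetric] sum_divide_distrib[symmetric])
  qed
  moreover have "\<bar>(d j i * d i l - w * q j i * (w * q i l)) / w\<bar> \<le> 3 * e" if "i < n" for i
  proof -
   have 1: "\<bar>d j i - w * q j i\<bar> \<le> e" "\<bar>d i l - w * q i l\<bar> \<le> e" using IH that Suc.prems by auto
   have qq: "\<bar>w * q j i\<bar> \<le> w" "\<bar>w * q i l\<bar> \<le> w"
    using Q_le_1[of j i "2 ^ r"] Q_le_1[of i l "2 ^ r"] that Suc.prems w0 by (auto simp: q_def abs_mult)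
   have e0: "0 \<le> e" by (simp add: e_def)
   have "d j i * d i l - w * q j i * (w * q i l) = (d j i - w * q j i) * (d i l - w * q i l) +
    (d j i - w * q j i) * (w * q i l) + (w * q j i) * (d i l - w * q i l)" by (simp add: algebra_simps)
   then have "\<bar>d j i * d i l - w * q j i * (w * q i l)\<bar> \<le> \<bar>d j i - w * q j i\<bar> * \<bar>d i l - w * q i l\<bar> +
    \<bar>d j i - w * q j i\<bar> * \<bar>w * q i l\<bar> + \<bar>w * q j i\<bar> * \<bar>d i l - w * q i l\<bar>"
    by (simp only: abs_mult[symmetric])
   also have "\<dots> \<le> e * w + e * w + w * e"
    using 1 qq e0 ew w0 by (intro add_mono mult_mono) auto
   finally have "\<bar>d j i * d i l - w * q j i * (w * q i l)\<bar> \<le> 3 * e * w" by (simp add: algebra_simps)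
   then show ?thesis using w0 by (simp add: abs_divide divide_le_eq)
  qed
  ultimately show ?thesis
   using order_trans[OF sum_abs sum_bounded_above[of "{..<n}" "%i. \<bar>(d j i * d i l - w * q j i * (w * q i l)) / w\<bar>" "3 * e"]]
   by simp
 qed
 moreover have qq2: "(\<Sum>i<n. q j i * q i l) = Q (2 ^ Suc r) j l"
  using Q_double[of j "2 ^ r" l] Suc.prems by (simp add: q_def mult_2)
 ultimately have "\<bar>real_of_int S / w - w * Q (2 ^ Suc r) j l\<bar> \<le> real n * (3 * e)" by (simp only:)
 moreover have "\<bar>real_of_int (rnd p S) - real_of_int S / w\<bar> \<le> 1" unfolding w_def by (rule rnd_close)
 ultimately have "\<bar>real_of_int (rnd p S) - w * Q (2 ^ Suc r) j l\<bar> \<le> real n * (3 * e) + 1" by linarith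
 moreover have "\<bar>w * Q (2 ^ Suc r) j l\<bar> \<le> 2 * 2 ^ p"
  using Q_le_1[of j l "2 ^ Suc r"] Suc.prems w0 by (simp add: abs_mult w_def)
 then have "\<bar>real_of_int (clip p (rnd p S)) - w * Q (2 ^ Suc r) j l\<bar> \<le> \<bar>real_of_int (rnd p S) - w * Q (2 ^ Suc r) j l\<bar>"
  by (rule clip_close)
 moreover have "mat (P D (Suc r)) j l = clip p (rnd p S)"
  using Suc.prems len by (simp add: P_def sqm_def mat_tab S_def sum_list_upt)
 moreover have "real n * (3 * e) + 1 \<le> real ((4 * n) ^ Suc r)"
 proof -
  have "1 \<le> n * (4 * n) ^ r" using n by (simp add: Suc_le_eq)
  then have "1 \<le> real (n * (4 * n) ^ r)" unfolding of_nat_le_iff[of 1, where 'a = real, symmetric] of_nat_1 .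
  then have "1 \<le> real n * e" by (simp only: e_def of_nat_mult)
  moreover have "real ((4 * n) ^ Suc r) = 4 * (real n * e)" by (simp only: e_def power_Suc of_nat_mult of_nat_numeral mult.assoc)
  ultimately show ?thesis by linarith
 qed
 ultimately show ?case unfolding w_def by linarith
qed

text \<open>The entries of \<open>y\<close> sum to at most \<open>t\<close>, so an error of
  \<open>(4 * n) ^ K\<close> per matrix entry grows by the factor \<open>t\<close>; \<open>p\<close>
  is chosen to bring the result down to 1/8.\<close>

lemma zv_approx:
 assumes D: "inv_D D" and y: "length y = n" "sum_list y \<le> t" and j: "j < n"
 shows "\<bar>real_of_int (zv (P D K) y j) / 2 ^ p - (contraction.ev m n (MD D) (2 ^ \<kappa>) ^^ 2 ^ K) (%j. real (y ! j)) j\<bar> \<le> 1 / 8"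
proof -
 interpret contraction m n "MD D" "2 ^ \<kappa>" by (rule contraction_MD[OF D])
 have len: "length (P D K) = n" using D length_P by (simp add: inv_D_def)
 define w where "w = (2::real) ^ p"
 have w0: "w > 0" by (simp add: w_def)
 have "real_of_int (zv (P D K) y j) / w - (\<Sum>l<n. Q (2 ^ K) j l * real (y ! l)) =
   (\<Sum>l<n. (real_of_int (mat (P D K) j l) - w * Q (2 ^ K) j l) * real (y ! l)) / w"
  using w0 y len by (simp add: zv_def sum_list_upt sum_subtractf left_diff_distrib diff_divide_distrib sum_distrib_left mult.assoc sum_divide_distrib)
 moreover have "\<bar>\<Sum>l<n. (real_of_int (mat (P D K) j l) - w * Q (2 ^ K) j l) * real (y ! l)\<bar> \<le> real ((4 * n) ^ K) * real t"
 proof -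
  have "\<bar>\<Sum>l<n. (real_of_int (mat (P D K) j l) - w * Q (2 ^ K) j l) * real (y ! l)\<bar> \<le>
   (\<Sum>l<n. \<bar>real_of_int (mat (P D K) j l) - w * Q (2 ^ K) j l\<bar> * real (y ! l))"
   using sum_abs[of "%l. (real_of_int (mat (P D K) j l) - w * Q (2 ^ K) j l) * real (y ! l)" "{..<n}"] by (simp add: abs_mult)
  also have "\<dots> \<le> (\<Sum>l<n. real ((4 * n) ^ K) * real (y ! l))"
   using P_approx[OF D order_refl j] unfolding w_def by (intro sum_mono mult_right_mono) auto
  also have "\<dots> = real ((4 * n) ^ K) * real (sum_list y)"
   using y by (simp add: sum_distrib_left sum_list_sum_nth atLeast0LessThan)
  also have "\<dots> \<le> real ((4 * n) ^ K) * real t" using y by (intro mult_left_mono) auto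
  finally show ?thesis .
 qed
 moreover have "real ((4 * n) ^ K) * real t * 8 \<le> w"
 proof -
  have "real ((4 * n) ^ K * (8 * t)) \<le> real (2 ^ p)" using p by (simp only: of_nat_le_iff)
  then show ?thesis by (simp add: w_def mult_ac)
 qed
 ultimately have "\<bar>real_of_int (zv (P D K) y j) / w - (\<Sum>l<n. Q (2 ^ K) j l * real (y ! l))\<bar> \<le> 1 / 8"
  using w0 by (simp add: abs_divide divide_le_eq)
 then show ?thesis using pow_matrix[OF j, of "2 ^ K" "%j. real (y ! j)"] by (simp add: w_def)
qed

definition ys :: "nat list => nat => nat list" where
 "ys D s = (ystep p D (P D K) ^^ s) (map (%_. 0) D)"

lemma sum_list_update_Suc:
 assumes "length y = n" "k < n"
 shows "sum_list (map (%j. if j = k then Suc (nth_or 0 y j) else nth_or 0 y j) [0..<n]) = Suc (sum_list y)"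
proof -
 have "(\<Sum>j<n. if j = k then Suc (nth_or 0 y j) else nth_or 0 y j) = (\<Sum>j<n. y ! j + of_bool (j = k))"
  using assms by (intro sum.cong) auto
 also have "\<dots> = Suc (sum_list y)" using assms by (simp add: sum.distrib sum_list_sum_nth atLeast0LessThan)
 finally show ?thesis by (simp add: sum_list_upt)
qed

text \<open>The potential uses the power \<open>2 ^ (K - 1)\<close> and the test the power
  \<open>2 ^ K\<close>: by symmetry of the contraction the growth of the potential is governed by
  the doubled power. A step either adds exactly 1 to the sum of \<open>y\<close> or has stalled with
  no bad coordinate left.\<close>

lemma ys_inv:
 assumes D: "inv_D D" and s: "s \<le> t"
 defines "E \<equiv> contraction.ev m n (MD D) (2 ^ \<kappa>)"
 defines "ipd \<equiv> contraction.ip n"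
 shows "length (ys D s) = n & sum_list (ys D s) \<le> s & (\<forall>j<n. D ! j = 0 --> ys D s ! j = 0) &
  ipd ((E ^^ 2 ^ (K - 1)) (%j. real (ys D s ! j))) ((E ^^ 2 ^ (K - 1)) (%j. real (ys D s ! j))) \<le> 2 * real s &
  (bads p D (P D K) (ys D s) = [] \<or> sum_list (ys D s) = s)"
 using s
proof (induction s)
 case 0
 interpret contraction m n "MD D" "2 ^ \<kappa>" by (rule contraction_MD[OF D])
 have len: "length D = n" using D by (simp add: inv_D_def)
 have nth0: "j < n ==> ys D 0 ! j = 0" for j using len by (simp add: ys_def)
 have "ipd ((E ^^ 2 ^ (K - 1)) (%j. real (ys D 0 ! j))) ((E ^^ 2 ^ (K - 1)) (%j. real (ys D 0 ! j))) \<le> ip (%j. real (ys D 0 ! j)) (%j. real (ys D 0 ! j))"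
  unfolding E_def ipd_def by (rule pow_contract)
 also have "\<dots> = 0" using nth0 by (simp add: ip_def)
 finally show ?case using len nth0 by (simp add: ys_def sum_list_sum_nth)
next
 case (Suc s)
 interpret contraction m n "MD D" "2 ^ \<kappa>" by (rule contraction_MD[OF D])
 have len: "length D = n" using D by (simp add: inv_D_def)
 define y where "y = ys D s"
 define b where "b = bads p D (P D K) y"
 have IH: "length y = n" "sum_list y \<le> s" "!!j. j < n ==> D ! j = 0 ==> y ! j = 0"
  "ipd ((E ^^ 2 ^ (K - 1)) (%j. real (y ! j))) ((E ^^ 2 ^ (K - 1)) (%j. real (y ! j))) \<le> 2 * real s"
  "b = [] \<or> sum_list y = s" using Suc by (auto simp: y_def b_def)
 have ys_Suc: "ys D (Suc s) = ystep p D (P D K) y" by (simp add: ys_def y_def)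
 show ?case
 proof (cases "b = []")
  case True
  then have "ys D (Suc s) = y" unfolding ys_Suc by (simp add: ystep_def b_def)
  then show ?thesis using IH True by (simp add: b_def)
 next
  case False
  then obtain k r where kr: "b = k # r" by (cases b) auto
  then have "k \<in> set (bads p D (P D K) y)" by (simp add: b_def)
  then have k: "k < n" "D ! k ~= 0" "8 * zv (P D K) y k < 3 * int (2 ^ p)" using len by (auto simp: bads_def)
  have y': "ys D (Suc s) = map (%j. if j = k then Suc (nth_or 0 y j) else nth_or 0 y j) [0..<n]"
   unfolding ys_Suc using kr len by (simp add: ystep_def b_def)
  have nth: "real (ys D (Suc s) ! j) = real (y ! j) + unit k j" if "j < n" for j
   using that IH(1) by (simp add: y' unit_def)
  have 2: "(2::nat) ^ (K - 1) + 2 ^ (K - 1) = 2 ^ K" using K(2) by (cases K) auto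
  have small: "(E ^^ (2 ^ (K - 1) + 2 ^ (K - 1))) (%j. real (y ! j)) k \<le> 1 / 2"
  proof -
   have "sum_list y \<le> t" using IH(2) Suc.prems by simp
   from zv_approx[OF D IH(1) this k(1)]
   have "(E ^^ 2 ^ K) (%j. real (y ! j)) k \<le> real_of_int (zv (P D K) y k) / 2 ^ p + 1 / 8" unfolding E_def by linarith
   moreover have "real_of_int (8 * zv (P D K) y k) < real_of_int (3 * int (2 ^ p))" using k(3) of_int_less_iff by blast
   then have "real_of_int (zv (P D K) y k) / 2 ^ p < 3 / 8" by (simp add: divide_less_eq)
   ultimately show ?thesis unfolding 2 by linarith
  qed
  have cong: "ip ((E ^^ N) u) ((E ^^ N) u) = ip ((E ^^ N) v) ((E ^^ N) v)" if "!!j. j < n ==> u j = v j" for u v N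
   unfolding ip_def E_def using pow_cong[of u v _ N, OF that] by (intro sum.cong) auto
  have "ipd ((E ^^ 2 ^ (K - 1)) (%j. real (ys D (Suc s) ! j))) ((E ^^ 2 ^ (K - 1)) (%j. real (ys D (Suc s) ! j)))
   = ip ((E ^^ 2 ^ (K - 1)) (%j. real (y ! j) + unit k j)) ((E ^^ 2 ^ (K - 1)) (%j. real (y ! j) + unit k j))"
   unfolding ipd_def by (rule cong) (rule nth)
  also have "\<dots> \<le> ip ((E ^^ 2 ^ (K - 1)) (%j. real (y ! j))) ((E ^^ 2 ^ (K - 1)) (%j. real (y ! j))) + 2"
   unfolding E_def by (rule potential_step[OF k(1)]) (use small in \<open>simp add: E_def\<close>)
  also have "\<dots> \<le> 2 * real (Suc s)" using IH(4) unfolding ipd_def by simp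
  finally have pot: "ipd ((E ^^ 2 ^ (K - 1)) (%j. real (ys D (Suc s) ! j))) ((E ^^ 2 ^ (K - 1)) (%j. real (ys D (Suc s) ! j))) \<le> 2 * real (Suc s)" .
  have "sum_list (ys D (Suc s)) = Suc s" unfolding y' using sum_list_update_Suc[OF IH(1) k(1)] IH(5) False by simp
  moreover have "\<forall>j<n. D ! j = 0 --> ys D (Suc s) ! j = 0" using IH(1,3) k by (auto simp: y')
  ultimately show ?thesis using pot by (simp add: y')
 qed
qed

text \<open>Columns of weight 0 contribute nothing to \<open>x = D z\<close>, and the other entries
  are positive, with \<open>x 0 \<ge> 1 / 4\<close>. The residual of \<open>z\<close> is small by
  \<open>pow_residual\<close>, and \<open>K\<close> is large enough for
  \<open>approximate_solution_exact\<close>.\<close>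

lemma found:
 assumes D: "inv_D D" "D ! 0 ~= 0" and bad: "bads p D (P D K) (ys D t) = []"
 shows "hf A n"
proof -
 interpret contraction m n "MD D" "2 ^ \<kappa>" by (rule contraction_MD[OF D(1)])
 have len: "length D = n" using D by (simp add: inv_D_def)
 define y where "y j = real (ys D t ! j)" for j
 define z where "z = (ev ^^ 2 ^ K) y"
 define x where "x j = real (D ! j) * z j" for j
 note inv = ys_inv[OF D(1) order_refl]
 have z4: "1 / 4 \<le> z j" if "j < n" "D ! j ~= 0" for j
 proof -
  have "\<not> 8 * zv (P D K) (ys D t) j < 3 * int (2 ^ p)" 
  proof -
   have "j \<notin> set (bads p D (P D K) (ys D t))" using bad by simp
   then show ?thesis using that len by (simp add: bads_def)
  qed
  then have "real_of_int (3 * int (2 ^ p)) \<le> real_of_int (8 * zv (P D K) (ys D t) j)" by linarith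
  then have "3 / 8 \<le> real_of_int (zv (P D K) (ys D t) j) / 2 ^ p" by (simp add: le_divide_eq)
  moreover have "\<bar>real_of_int (zv (P D K) (ys D t) j) / 2 ^ p - z j\<bar> \<le> 1 / 8"
   unfolding z_def y_def using inv by (intro zv_approx[OF D(1) _ _ that(1)]) auto
  ultimately show ?thesis by linarith
 qed
 have x0: "0 \<le> x j" if "j < n" for j using z4[of j] that by (cases "D ! j = 0") (auto simp: x_def)
 have "1 / 4 \<le> x 0"
 proof -
  have "1 * (1 / 4) \<le> real (D ! 0) * z 0" using z4[of 0] n D(2) by (intro mult_mono) (auto simp: Suc_le_eq)
  then show ?thesis by (simp add: x_def)
 qed
 have row: "(\<Sum>j<n. real_of_int (mat A i j) * x j) = mv z i" for i
  by (simp add: x_def mv_def MD_def mult.assoc)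
 define h where "h = (2::real) ^ \<kappa>"
 define \<epsilon> where "\<epsilon> = sqrt (h * (real t)\<^sup>2 / 2 ^ K)"
 have ipy: "ip y y \<le> (real t)\<^sup>2"
 proof -
  have "ip y y \<le> (\<Sum>j<n. y j * real t)"
   unfolding ip_def
  proof (intro sum_mono mult_left_mono)
   fix j assume "j \<in> {..<n}"
   then have "ys D t ! j \<le> sum_list (ys D t)" using inv by (intro member_le_sum_list) auto
   then show "y j \<le> real t" using inv by (simp add: y_def)
  qed (simp add: y_def)
  also have "\<dots> = real (sum_list (ys D t)) * real t"
   using inv by (simp add: sum_distrib_right[symmetric] y_def sum_list_sum_nth atLeast0LessThan)
  also have "\<dots> \<le> real t * real t" using inv by (intro mult_right_mono) auto
  finally show ?thesis by (simp add: power2_eq_square)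
 qed
 have mvz: "\<bar>mv z i\<bar> \<le> \<epsilon>" if "i < m" for i
 proof -
  have "(mv z i)\<^sup>2 \<le> ipm (mv z) (mv z)" unfolding power2_eq_square[symmetric] using that by (intro member_le_sum) auto
  also have "\<dots> \<le> h * (real t)\<^sup>2 / 2 ^ K"
  proof -
   have "real (2 ^ K) * ipm (mv z) (mv z) \<le> h * ip y y" unfolding z_def h_def by (rule pow_residual)
   also have "\<dots> \<le> h * (real t)\<^sup>2" using ipy by (intro mult_left_mono) (auto simp: h_def)
   finally show ?thesis by (simp add: field_simps)
  qed
  finally have "sqrt ((mv z i)\<^sup>2) \<le> \<epsilon>" unfolding \<epsilon>_def by (rule real_sqrt_le_mono)
  then show ?thesis by simp
 qed
 define B where "B = real ((2 * (m + 1) * \<alpha>) ^ m)"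
 have "real m * \<epsilon> * B < 1 / 4"
 proof -
  have B: "B \<le> 2 ^ T" "0 \<le> B"
  proof -
   have "real ((2 * (m + 1) * \<alpha>) ^ m) \<le> real (2 ^ T)" using T of_nat_le_iff by blast
   then show "B \<le> 2 ^ T" by (simp add: B_def)
   show "0 \<le> B" by (simp add: B_def)
  qed
  have "(real m * \<epsilon> * B)\<^sup>2 = (real m)\<^sup>2 * (h * (real t)\<^sup>2 / 2 ^ K) * B\<^sup>2"
   by (simp add: power_mult_distrib \<epsilon>_def h_def)
  also have "\<dots> \<le> (real m)\<^sup>2 * (h * (real t)\<^sup>2 / 2 ^ K) * (2 ^ T)\<^sup>2"
   using B by (intro mult_left_mono power_mono) (auto simp: h_def)
  also have "\<dots> < (1 / 4)\<^sup>2"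
  proof -
   have "real (16 * m\<^sup>2 * t\<^sup>2 * 2 ^ \<kappa> * (2 ^ T)\<^sup>2) < real (2 ^ K)" using K(1) of_nat_less_iff by blast
   then have "16 * ((real m)\<^sup>2 * (h * (real t)\<^sup>2) * (2 ^ T)\<^sup>2) < 2 ^ K" by (simp add: h_def mult_ac)
   then show ?thesis by (simp add: power_divide field_simps)
  qed
  finally show ?thesis by (rule power_less_imp_less_base) simp
 qed
 then have eps: "real (card {..<m}) * \<epsilon> * real ((2 * (card {..<m} + 1) * \<alpha>) ^ card {..<m}) < x 0"
  using \<open>1 / 4 \<le> x 0\<close> by (simp only: card_lessThan B_def)
 obtain c :: "nat => nat" where c: "1 \<le> c 0" "!!i. i \<in> {..<m} ==> (\<Sum>j \<in> {..<n}. mat A i j * int (c j)) = 0"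
  by (rule approximate_solution_exact[where I = "{..<m}" and J = "{..<n}" and k = 0 and x = x and a = "mat A" and \<alpha> = \<alpha> and \<epsilon> = \<epsilon>])
   (use n x0 row mvz \<alpha> eps \<open>1 / 4 \<le> x 0\<close> in auto)
 have "(\<Sum>j<n. real_of_int (mat A i j) * real (c j)) = 0" if "i < m" for i
 proof -
  have "real_of_int (\<Sum>j<n. mat A i j * int (c j)) = 0" using c(2)[of i] that by simp
  then show ?thesis by simp
 qed
 then show ?thesis unfolding hf_def using c(1) by (intro exI[of _ "%j. real (c j)"]) auto
qed

text \<open>Pairing \<open>y\<close> with the rescaled solution \<open>\<xi>\<close> bounds the
  square of \<open>y k * \<xi> k\<close> by \<open>2 * t * n\<close>, while
  \<open>y k \<ge> t / n\<close>. With \<open>t \<ge> 8 * n ^ 3\<close> this leaves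
  \<open>\<xi> k \<le> 1 / 2\<close>.\<close>

lemma half_bound:
 assumes D: "inv_D D" and bad: "bads p D (P D K) (ys D t) ~= []"
  and k: "k < n" "D ! k ~= 0" "t \<le> n * ys D t ! k" and x: "sol x" "!!j. j < n ==> x j \<le> 1"
 shows "x k * 2 ^ T \<le> real (D ! k) / 2"
proof -
 interpret contraction m n "MD D" "2 ^ \<kappa>" by (rule contraction_MD[OF D])
 note inv = ys_inv[OF D order_refl]
 define y where "y j = real (ys D t ! j)" for j
 define \<xi> where "\<xi> j = (if D ! j = 0 then 0 else x j * 2 ^ T / real (D ! j))" for j
 have xb: "x j * 2 ^ T \<le> real (D ! j)" "0 \<le> x j" if "j < n" for j using D x that by (auto simp: inv_D_def sol_def)
 have \<xi>: "0 \<le> \<xi> j" "\<xi> j \<le> 1" if "j < n" for j using xb[OF that] by (auto simp: \<xi>_def divide_le_eq)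
 have D\<xi>: "real (D ! j) * \<xi> j = x j * 2 ^ T" if "j < n" for j
 proof (cases "D ! j = 0")
  case True
  then have "x j * 2 ^ T = 0" by (intro antisym) (use xb[OF that] True in auto)
  then show ?thesis using True by simp
 qed (simp add: \<xi>_def)
 have "mv \<xi> i = 0" if "i < m" for i
 proof -
  have "mv \<xi> i = (\<Sum>j<n. (real_of_int (mat A i j) * x j) * 2 ^ T)"
   unfolding mv_def MD_def by (rule sum.cong) (auto simp: mult.assoc D\<xi>)
  also have "\<dots> = 0" using x(1) that by (simp add: sum_distrib_right[symmetric] sol_def)
  finally show ?thesis .
 qed
 moreover have "ip ((ev ^^ 2 ^ (K - 1)) y) ((ev ^^ 2 ^ (K - 1)) y) \<le> 2 * real t" using inv unfolding y_def by blast
 ultimately have ub: "(ip y \<xi>)\<^sup>2 \<le> 2 * real t * real n" using \<xi> by (intro kernel_pairing) auto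
 have "y k * \<xi> k \<le> ip y \<xi>" unfolding ip_def using k(1) \<xi> by (intro member_le_sum) (auto simp: y_def)
 moreover have "0 \<le> y k * \<xi> k" using \<xi>(1)[OF k(1)] by (simp add: y_def)
 ultimately have "(y k * \<xi> k)\<^sup>2 \<le> 2 * real t * real n" using ub power_mono[of "y k * \<xi> k" "ip y \<xi>" 2] by linarith
 then have "(real n)\<^sup>2 * (y k * \<xi> k)\<^sup>2 \<le> (real n)\<^sup>2 * (2 * real t * real n)" by (intro mult_left_mono) auto
 moreover have "(real t * \<xi> k)\<^sup>2 \<le> (real n)\<^sup>2 * (y k * \<xi> k)\<^sup>2"
 proof -
  have "real t \<le> real (n * ys D t ! k)" using k(3) by (simp only: of_nat_le_iff)
  then have "real t * \<xi> k \<le> real n * y k * \<xi> k" using \<xi>(1)[OF k(1)] by (intro mult_right_mono) (auto simp: y_def)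
  then have "(real t * \<xi> k)\<^sup>2 \<le> (real n * y k * \<xi> k)\<^sup>2" using \<xi>(1)[OF k(1)] by (intro power_mono) auto
  then show ?thesis by (simp add: power_mult_distrib mult.assoc)
 qed
 moreover have "(real n)\<^sup>2 * (2 * real t * real n) \<le> real t * (real t / 4)"
 proof -
  have "real (8 * n ^ 3) \<le> real t" using t by (simp only: of_nat_le_iff)
  then have "2 * real n ^ 3 \<le> real t / 4" by simp
  then have "real t * (2 * real n ^ 3) \<le> real t * (real t / 4)" by (intro mult_left_mono) auto
  then show ?thesis by (simp add: power2_eq_square power3_eq_cube mult_ac)
 qed
 ultimately have "(real t * \<xi> k)\<^sup>2 \<le> (real t / 2)\<^sup>2" by (simp add: power2_eq_square)
 then have "real t * \<xi> k \<le> real t / 2" by (rule power2_le_imp_le) simp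
 then have "\<xi> k \<le> 1 / 2" using t1 by simp
 then have "real (D ! k) * \<xi> k \<le> real (D ! k) * (1 / 2)" by (intro mult_left_mono) auto
 then show ?thesis using D\<xi>[OF k(1)] by simp
qed

text \<open>An integral solution divided by \<open>2 ^ T\<close>. A coordinate that can be positive
  at all can thus reach \<open>1 / 2 ^ T\<close> within the unit box, so an upper bound below that
  value may be replaced by zero.\<close>

lemma scaled_solution:
 assumes "sol x" "k < n" "0 < x k"
 obtains x' where "sol x'" "!!j. j < n ==> x' j \<le> 1" "1 \<le> x' k * 2 ^ T"
proof -
 obtain c :: "nat => nat" where c: "1 \<le> c k" "!!j. c j \<le> (2 * (card {..<m} + 1) * \<alpha>) ^ card {..<m}"
  "!!i. i \<in> {..<m} ==> (\<Sum>j \<in> {..<n}. mat A i j * int (c j)) = 0"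
  by (rule small_integer_solution[where I = "{..<m}" and J = "{..<n}" and k = k and x = x and a = "mat A" and \<alpha> = \<alpha> and \<phi> = "%_. 0"])
   (use assms \<alpha> in \<open>auto simp: sol_def\<close>)
 have cT: "real (c j) \<le> 2 ^ T" for j
 proof -
  have "c j \<le> 2 ^ T" using c(2)[of j] T by simp
  then have "real (c j) \<le> real (2 ^ T)" by (simp only: of_nat_le_iff)
  then show ?thesis by simp
 qed
 have "(\<Sum>j<n. real_of_int (mat A i j) * (real (c j) / 2 ^ T)) = 0" if "i < m" for i
 proof -
  have "real_of_int (\<Sum>j<n. mat A i j * int (c j)) = 0" using c(3)[of i] that by simp
  then have "(\<Sum>j<n. real_of_int (mat A i j) * real (c j)) / 2 ^ T = 0" by simp
  then show ?thesis unfolding sum_divide_distrib by simp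
 qed
 then have "sol (%j. real (c j) / 2 ^ T)" by (simp add: sol_def)
 then show ?thesis by (rule that) (use cT c(1) in \<open>auto simp: divide_le_eq\<close>)
qed

lemma not_found:
 assumes D: "inv_D D" and bad: "bads p D (P D K) (ys D t) ~= []"
 shows "inv_D (halve t D (ys D t)) & (\<Sum>j<n. nb (halve t D (ys D t) ! j)) < (\<Sum>j<n. nb (D ! j))"
proof -
 note inv = ys_inv[OF D order_refl]
 have len: "length D = n" using D by (simp add: inv_D_def)
 define y where "y = ys D t"
 have y: "length y = n" "sum_list y = t" "!!j. j < n ==> D ! j = 0 ==> y ! j = 0" using inv bad by (auto simp: y_def)
 define ks where "ks = filter (%k. nth_or 0 D k ~= 0 & t \<le> length D * nth_or 0 y k) [0..<length D]"
 have "ks ~= []"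
 proof
  assume "ks = []"
  then have "!!k. k \<in> set ks ==> False" by simp
  then have no: "D ! k = 0 \<or> n * y ! k < t" if "k < n" for k using that len y(1) by (force simp: ks_def)
  have "(\<Sum>k<n. n * y ! k) < (\<Sum>k<n. t)"
  proof (rule sum_strict_mono)
   show "n * y ! k < t" if "k \<in> {..<n}" for k using no[of k] y(3)[of k] that t1 by auto
   show "{..<n} ~= {}" using n by (simp add: lessThan_empty_iff)
  qed simp
  moreover have "(\<Sum>k<n. n * y ! k) = n * t" using y(1,2) by (simp add: sum_distrib_left[symmetric] sum_list_sum_nth atLeast0LessThan)
  ultimately show False by simp
 qed
 then obtain k r where kr: "ks = k # r" by (cases ks) auto
 then have "k \<in> set ks" by simp
 then have k: "k < n" "D ! k ~= 0" "t \<le> n * y ! k" using len y(1) by (auto simp: ks_def)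
 define D' where "D' = halve t D y"
 have D': "D' = map (%j. if j = k then nth_or 0 D j div 2 ^ 1 else nth_or 0 D j) [0..<n]"
  unfolding D'_def halve_def ks_def[symmetric] kr using len by simp
 have D'k: "D' ! k = D ! k div 2" and D'j: "!!j. j < n ==> j ~= k ==> D' ! j = D ! j" using k(1) len by (auto simp: D')
 obtain e where e: "e \<le> T" "D ! k = 2 ^ e" using D k by (auto simp: inv_D_def)
 have hb: "x k * 2 ^ T \<le> real (D ! k) / 2" if "sol x" "!!j. j < n ==> x j \<le> 1" for x
  using half_bound[OF D bad k(1,2) _ that] k(3) by (simp add: y_def)
 have bound: "x k * 2 ^ T \<le> real (D' ! k)" if x: "sol x" "!!j. j < n ==> x j \<le> 1" for x
 \<comment> \<open>Halving weight 1 yields 0. This is sound because the bound 1/2 on the scaled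
   coordinate excludes a positive value by \<open>scaled_solution\<close>.\<close>
 proof (cases e)
  case 0
  have "\<not> 0 < x k"
  proof
   assume "0 < x k"
   then obtain x' where x': "sol x'" "!!j. j < n ==> x' j \<le> 1" "1 \<le> x' k * 2 ^ T" using scaled_solution[OF x(1) k(1)] by blast
   show False using hb[OF x'(1,2)] x'(3) e 0 by simp
  qed
  then have "x k = 0" using x(1) k(1) by (auto simp: sol_def not_less intro: order_antisym)
  then show ?thesis by simp
 next
  case (Suc e')
  then show ?thesis using hb[OF x] e by (simp add: D'k)
 qed
 have "inv_D D'"
  unfolding inv_D_def
 proof (intro conjI allI impI)
  show "length D' = n" by (simp add: D')
  show "D' ! j = 0 \<or> (\<exists>e\<le>T. D' ! j = 2 ^ e)" if "j < n" for j
  proof (cases "j = k")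
   case True
   show ?thesis using e by (cases e) (auto simp: True D'k intro: exI[of _ "e - 1"])
  next
   case False
   then show ?thesis using D that D'j by (auto simp: inv_D_def)
  qed
  show "x j * 2 ^ T \<le> real (D' ! j)" if "sol x & (\<forall>j<n. x j \<le> 1)" "j < n" for x j
   using that bound[of x] D'j[of j] D by (cases "j = k") (auto simp: inv_D_def)
 qed
 moreover have "(\<Sum>j<n. nb (D' ! j)) < (\<Sum>j<n. nb (D ! j))"
 proof (rule sum_strict_mono_ex1)
  have lt: "nb (D ! k div 2) < nb (D ! k)" using k(2) by (subst (2) bits.simps) simp
  show "\<forall>j\<in>{..<n}. nb (D' ! j) \<le> nb (D ! j)"
  proof
   fix j assume "j \<in> {..<n}"
   then show "nb (D' ! j) \<le> nb (D ! j)" using D'j[of j] D'k lt by (cases "j = k") auto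
  qed
  show "\<exists>j\<in>{..<n}. nb (D' ! j) < nb (D ! j)" using k(1) D'k lt by (intro bexI[of _ k]) auto
 qed simp
 ultimately show ?thesis unfolding D'_def y_def by blast
qed

text \<open>Every unsuccessful round shortens one weight by a bit, so the total bit length,
  initially at most \<open>n * (T + 1)\<close>, bounds the rounds. When it reaches zero all weights
  vanish, in particular that of coordinate 0.\<close>

theorem lpsolve_correct: "lpsolve A n T \<kappa> t K p \<longleftrightarrow> hf A n"
proof -
 define st where "st s = (lpstep A \<kappa> t K p ^^ s) (False, replicate n (2 ^ T))" for s
 have nb2: "nb (2 ^ T) \<le> T + 1" by (rule nb_le) simp
 have inv: "inv_D (snd (st s)) & (fst (st s) --> hf A n) &
  (fst (st s) \<or> snd (st s) ! 0 = 0 \<or> (\<Sum>j<n. nb (snd (st s) ! j)) + s \<le> n * (T + 1))" for s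
 proof (induction s)
  case 0
  have "(\<Sum>j<n. nb (replicate n (2 ^ T) ! j)) = (\<Sum>j<n. nb (2 ^ T))" by (intro sum.cong) auto
  also have "\<dots> \<le> n * (T + 1)" using mult_le_mono2[OF nb2, of n] by simp
  finally show ?case by (auto simp: st_def inv_D_def)
 next
  case (Suc s)
  obtain f D where fD: "st s = (f, D)" by fastforce
  have D: "inv_D D" using Suc fD by simp
  have len: "length D = n" using D by (simp add: inv_D_def)
  have st: "st (Suc s) = lpstep A \<kappa> t K p (f, D)" using fD by (simp add: st_def)
  show ?case
  proof (cases "f \<or> D ! 0 = 0")
   case True
   then have "st (Suc s) = (f, D)" unfolding st lpstep_def using len n by simp
   then show ?thesis using Suc fD True by auto
  next
   case False
   have zero: "map (%_. 0 :: nat) D = map (%_. 0) D" ..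
   have eq: "st (Suc s) = (if bads p D (P D K) (ys D t) = [] then (True, D) else (False, halve t D (ys D t)))"
    unfolding st lpstep_def Let_def using False len n by (simp add: P_def ys_def)
   show ?thesis
   proof (cases "bads p D (P D K) (ys D t) = []")
    case True
    then show ?thesis using eq found[OF D _ True] False D by simp
   next
    case F: False
    have "(\<Sum>j<n. nb (D ! j)) + s \<le> n * (T + 1)" using Suc fD False by simp
    then show ?thesis using eq F not_found[OF D F] by simp
   qed
  qed
 qed
 define f D where "f = fst (st (n * (T + 1)))" and "D = snd (st (n * (T + 1)))"
 have fin: "inv_D D" "f ==> hf A n" "f \<or> D ! 0 = 0 \<or> (\<Sum>j<n. nb (D ! j)) = 0"
  using inv[of "n * (T + 1)"] by (auto simp: f_def D_def)
 have "f" if h: "hf A n"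
 proof (rule ccontr)
  assume "\<not> f"
  then have D0: "D ! 0 = 0" using fin(3) n by auto
  obtain x where "sol x" "0 < x 0" using h by (auto simp: hf_def sol_def)
  then obtain x' where x': "sol x'" "!!j. j < n ==> x' j \<le> 1" "1 \<le> x' 0 * 2 ^ T"
   using scaled_solution[of x 0] n by (metis less_eq_Suc_le One_nat_def)
  have "x' 0 * 2 ^ T \<le> real (D ! 0)" using fin(1) x' n by (simp add: inv_D_def)
  then show False using x'(3) D0 by simp
 qed
 then show ?thesis using fin(2) by (auto simp: lpsolve_def f_def st_def)
qed

end

section \<open>Running time of the linear programming algorithm\<close>

lemma ptf_rnd: "ptf l ==> ptf f ==> ptf (%z. rnd (length (l z)) (f z))"
 unfolding rnd_def by (intro ptfs ptf_div_pow2_len)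

lemma ptf_clip: "ptf l ==> ptf f ==> ptf (%z. clip (length (l z)) (f z))"
 unfolding clip_def by (intro ptfs ptf_pow2_len)

lemma ptf_mat: "ptf f ==> ptf j ==> ptf l ==> ptf (%z. mat (f z) (j z) (l z))"
 unfolding mat_def by (intro ptfs)

lemma ptf_sqm: "ptf (%w :: unit list \<times> int list list. sqm (length (fst w)) (snd w))"
 unfolding sqm_def by (intro ptfs ptf_upt_len ptf_rnd ptf_clip ptf_mat)

lemma ptf_P0: "ptf (%w :: int list list \<times> nat list \<times> unit list \<times> unit list.
 P0 (fst w) (fst (snd w)) (length (fst (snd (snd w)))) (length (snd (snd (snd w)))))"
proof -
 have "ptf (%w :: int list list \<times> nat list \<times> unit list \<times> unit list.
  map (%j. map (%l. (if j = l then int (2 ^ length (snd (snd (snd w)))) else 0) -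
  sum_list (map (%r. (nth_or 0 r j * int (nth_or 0 (fst (snd w)) j)) * (nth_or 0 r l * int (nth_or 0 (fst (snd w)) l))) (fst w)) *
   int (2 ^ length (drop (length (fst (snd (snd w)))) (snd (snd (snd w))))))
  [0..<length (fst (snd w))]) [0..<length (fst (snd w))])"
  by (intro ptfs ptf_upt_len ptf_pow2_len ptf_drop_len)
 then show ?thesis by (simp add: P0_def)
qed

lemma ptf_zv:
 assumes "ptf f" "ptf y" "ptf j"
 shows "ptf (%z. zv (f z) (y z) (j z))"
proof -
 have "ptf (%w. zv (fst w) (fst (snd w)) (snd (snd w)))"
  unfolding zv_def by (intro ptfs ptf_upt_len ptf_mat)
 from ptf_lift3[OF this assms] show ?thesis .
qed

lemma ptf_bads: "ptf (%w :: unit list \<times> nat list \<times> int list list \<times> nat list.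
  bads (length (fst w)) (fst (snd w)) (fst (snd (snd w))) (snd (snd (snd w))))"
 unfolding bads_def by (intro ptfs ptf_upt_len ptf_zv ptf_pow2_len)

lemma ptf_bads':
 fixes l :: "'a::tr => unit list"
 assumes "ptf l" "ptf D" "ptf P" "ptf y"
 shows "ptf (%z. bads (length (l z)) (D z) (P z) (y z))"
 using ptf_comp[OF ptf_Pair[OF assms(1) ptf_Pair[OF assms(2) ptf_Pair[OF assms(3,4)]]] ptf_bads] by simp

lemma ptf_ystep: "ptf (%w :: (unit list \<times> nat list \<times> int list list) \<times> nat list.
  ystep (length (fst (fst w))) (fst (snd (fst w))) (snd (snd (fst w))) (snd w))"
 unfolding ystep_def by (intro ptfs ptf_upt_len ptf_bads')

lemma ptf_halve: "ptf (%w :: unit list \<times> nat list \<times> nat list. halve (length (fst w)) (fst (snd w)) (snd (snd w)))"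
proof -
 have "ptf (%w :: unit list \<times> nat list \<times> nat list.
  map (%j. if j = hd_or 0 (filter (%k. nth_or 0 (fst (snd w)) k ~= 0 & length (fst w) \<le> length (fst (snd w)) * nth_or 0 (snd (snd w)) k) [0..<length (fst (snd w))])
  then nth_or 0 (fst (snd w)) j div 2 ^ length [()] else nth_or 0 (fst (snd w)) j) [0..<length (fst (snd w))])"
  by (intro ptfs ptf_upt_len ptf_div_pow2_len)
 then show ?thesis by (rule ptf_cong) (simp add: halve_def)
qed

lemma nb_clip: "nb (nat \<bar>clip p z\<bar>) \<le> p + 2"
proof (rule nb_le)
 have "nat \<bar>clip p z\<bar> \<le> 2 * 2 ^ p" by (simp add: clip_def mkint_def)
 also have "\<dots> < 2 ^ (p + 2)" by simp
 finally show "nat \<bar>clip p z\<bar> < 2 ^ (p + 2)" .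
qed

lemma sz_sqm: "sz (sqm p P) \<le> Suc (length P * Suc (Suc (length P * Suc (4 * (p + 2) + 5))))"
proof -
 let ?B = "4 * (p + 2) + 5"
 have el: "sz (clip p x) \<le> ?B" for x
  by (rule order_trans[OF sz_int]) (use nb_clip[of p x] in simp)
 have row: "sz (map (%l. clip p (f l)) [0..<length P]) \<le> Suc (length P * Suc ?B)" for f
  using sz_map_le[of "[0..<length P]" "%l. clip p (f l)" ?B, OF el] by simp
 show ?thesis unfolding sqm_def
  using sz_map_le[of "[0..<length P]" _ "Suc (length P * Suc ?B)", OF row] by simp
qed

lemma length_sqm_pow: "length ((sqm p ^^ j) P) = length P"
 by (induction j) (auto simp: sqm_def)

lemma ptf_Ppow: "ptf (%w :: (int list list \<times> nat list \<times> unit list \<times> unit list) \<times> unit list.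
 (sqm (length (snd (snd (snd (fst w))))) ^^ length (snd w)) (P0 (fst (fst w)) (fst (snd (fst w))) (length (fst (snd (snd (fst w))))) (length (snd (snd (snd (fst w)))))))"
proof -
 let ?i = "%w :: (int list list \<times> nat list \<times> unit list \<times> unit list) \<times> unit list. P0 (fst (fst w)) (fst (snd (fst w))) (length (fst (snd (snd (fst w))))) (length (snd (snd (snd (fst w)))))"
 have i: "ptf ?i" by (rule ptf_comp[OF ptf_fst[OF ptf_id] ptf_P0])
 obtain s where s: "pbd s" "mono s" "!!w. sz (?i w) \<le> s (sz w)" using i by (rule ptf_size) blast
 show ?thesis
 proof (rule ptf_iter[where s = "%n. s n + Suc (n * Suc (Suc (n * Suc (4 * (n + 2) + 5))))"])
  show "ptf (%w :: ((int list list \<times> nat list \<times> unit list \<times> unit list) \<times> unit list) \<times> int list list.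
    sqm (length (snd (snd (snd (fst (fst w)))))) (snd w))"
   by (rule ptf_lift2[OF ptf_sqm]) (intro ptfs)+
  show "pbd (%n. s n + Suc (n * Suc (Suc (n * Suc (4 * (n + 2) + 5)))))" using s(1) by (intro pbds)
  fix w :: "(int list list \<times> nat list \<times> unit list \<times> unit list) \<times> unit list" and j
  let ?p = "length (snd (snd (snd (fst w))))" and ?n = "length (fst (snd (fst w)))"
  obtain a D uk up v where w: "w = ((a, D, uk, up), v)" by (metis prod.collapse)
  have pn: "?p \<le> sz w" "?n \<le> sz w" using length_le_sz[of up] length_le_sz[of D] by (simp_all add: w)
  show "sz ((sqm ?p ^^ j) (?i w)) \<le> s (sz w) + Suc (sz w * Suc (Suc (sz w * Suc (4 * (sz w + 2) + 5))))"
  \<comment> \<open>The initial matrix is not clipped and is bounded by \<open>s\<close>; every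
    later one is bounded by clipping.\<close>
  proof (cases j)
   case 0
   then show ?thesis using s(3)[of w] by simp
  next
   case (Suc j')
   have len: "length ((sqm ?p ^^ j') (?i w)) = ?n" by (simp add: length_sqm_pow P0_def)
   have "sz ((sqm ?p ^^ j) (?i w)) \<le> Suc (?n * Suc (Suc (?n * Suc (4 * (?p + 2) + 5))))"
    using sz_sqm[of ?p "(sqm ?p ^^ j') (?i w)"] unfolding len Suc by simp
   also have "\<dots> \<le> Suc (sz w * Suc (Suc (sz w * Suc (4 * (sz w + 2) + 5))))"
    using pn by (intro Suc_le_mono[THEN iffD2] mult_le_mono add_le_mono) auto
   finally show ?thesis by simp
  qed
 qed (intro ptfs i)+
qed

lemma ystep_pow_le: "length y = length D ==> (!!a. a \<in> set y ==> a \<le> c) ==>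
 length ((ystep p D P ^^ j) y) = length D & (\<forall>a \<in> set ((ystep p D P ^^ j) y). a \<le> c + j)"
proof (induction j)
 case (Suc j)
 define x where "x = (ystep p D P ^^ j) y"
 have x: "length x = length D" "!!a. a \<in> set x ==> a \<le> c + j" using Suc by (auto simp: x_def)
 have "length (ystep p D P x) = length D & (\<forall>a \<in> set (ystep p D P x). a \<le> Suc (c + j))"
  using x nth_mem[of _ x] unfolding ystep_def by (auto simp: le_SucI)
 then show ?case by (simp add: x_def)
qed auto

lemma sz_nats:
 assumes "!!a. a \<in> set xs ==> nb a \<le> c"
 shows "sz xs \<le> Suc (length xs * Suc (4 * c + 1))"
proof -
 have "sz a \<le> 4 * c + 1" if "a \<in> set xs" for a using sz_nat[of a] assms[OF that] by linarith
 from sz_map_le[of xs "%x. x", OF this] show ?thesis by simp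
qed

lemma ptf_ypow: "ptf (%w :: (unit list \<times> nat list \<times> int list list) \<times> unit list.
 (ystep (length (fst (fst w))) (fst (snd (fst w))) (snd (snd (fst w))) ^^ length (snd w)) (map (%_. 0) (fst (snd (fst w)))))"
proof (rule ptf_iter[where s = "%n. Suc (n * Suc (4 * n + 1))"])
 show "ptf (%w :: ((unit list \<times> nat list \<times> int list list) \<times> unit list) \<times> nat list.
   ystep (length (fst (fst (fst w)))) (fst (snd (fst (fst w)))) (snd (snd (fst (fst w)))) (snd w))"
  using ptf_comp[OF _ ptf_ystep, of "%w :: ((unit list \<times> nat list \<times> int list list) \<times> unit list) \<times> nat list. (fst (fst w), snd w)"]
   ptf_Pair[OF ptf_fst[OF ptf_fst[OF ptf_id]] ptf_snd[OF ptf_id]] by simp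
 show "pbd (%n. Suc (n * Suc (4 * n + 1)))" by (intro pbds)
 fix w :: "(unit list \<times> nat list \<times> int list list) \<times> unit list" and j
 assume j: "j \<le> length (snd w)"
 obtain up D P v where w: "w = ((up, D, P), v)" by (metis prod.collapse)
 let ?y = "(ystep (length up) D P ^^ j) (map (%_. 0) D)"
 have y: "length ?y = length D" "!!a. a \<in> set ?y ==> a \<le> j"
  using ystep_pow_le[where y = "map (%_. 0) D" and D = D and c = 0 and p = "length up" and P = P and j = j] by auto
 have jn: "j \<le> sz w" "length D \<le> sz w" using j length_le_sz[of v] length_le_sz[of D] by (simp_all add: w)
 have "nb a \<le> sz w" if "a \<in> set ?y" for a using y(2)[OF that] nb_le_self[of a] jn by linarith
 then have "sz ?y \<le> Suc (length ?y * Suc (4 * sz w + 1))" by (rule sz_nats)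
 also have "\<dots> \<le> Suc (sz w * Suc (4 * sz w + 1))" using jn y(1) by (intro Suc_le_mono[THEN iffD2] mult_le_mono) auto
 finally show "sz ((ystep (length (fst (fst w))) (fst (snd (fst w))) (snd (snd (fst w))) ^^ j) (map (%_. 0) (fst (snd (fst w))))) \<le> Suc (sz w * Suc (4 * sz w + 1))"
  by (simp add: w)
qed (intro ptfs)+

type_synonym lp_env = "int list list \<times> unit list \<times> unit list \<times> unit list \<times> unit list"

abbreviation "env_A e \<equiv> fst (e :: lp_env)"
abbreviation "env_k e \<equiv> fst (snd (e :: lp_env))"
abbreviation "env_t e \<equiv> fst (snd (snd (e :: lp_env)))"
abbreviation "env_K e \<equiv> fst (snd (snd (snd (e :: lp_env))))"
abbreviation "env_p e \<equiv> snd (snd (snd (snd (e :: lp_env))))"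

lemma ptf_lpstep: "ptf (%w :: lp_env \<times> bool \<times> nat list.
 lpstep (env_A (fst w)) (length (env_k (fst w))) (length (env_t (fst w))) (length (env_K (fst w))) (length (env_p (fst w))) (snd w))"
proof -
 let ?P = "%w :: lp_env \<times> bool \<times> nat list. (sqm (length (env_p (fst w))) ^^ length (env_K (fst w)))
  (P0 (env_A (fst w)) (snd (snd w)) (length (env_k (fst w))) (length (env_p (fst w))))"
 have P: "ptf ?P"
 proof -
  have "ptf (%w :: lp_env \<times> bool \<times> nat list. ((env_A (fst w), snd (snd w), env_k (fst w), env_p (fst w)), env_K (fst w)))"
   by (intro ptf_Pair ptf_fst ptf_snd ptf_id)
  from ptf_comp[OF this ptf_Ppow] show ?thesis by simp
 qed
 let ?y = "%w :: lp_env \<times> bool \<times> nat list. (ystep (length (env_p (fst w))) (snd (snd w)) (?P w) ^^ length (env_t (fst w))) (map (%_. 0) (snd (snd w)))"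
 have y: "ptf ?y"
 proof -
  have "ptf (%w :: lp_env \<times> bool \<times> nat list. ((env_p (fst w), snd (snd w), ?P w), env_t (fst w)))"
   by (intro ptf_Pair ptf_fst ptf_snd ptf_id P)
  from ptf_comp[OF this ptf_ypow] show ?thesis by simp
 qed
 have h: "ptf (%w :: lp_env \<times> bool \<times> nat list. halve (length (env_t (fst w))) (snd (snd w)) (?y w))"
  by (rule ptf_lift3[OF ptf_halve _ _ y]) (intro ptfs)+
 show ?thesis unfolding lpstep_def Let_def
  by (intro ptf_if ptf_disj ptf_eq_nat ptf_nth_or ptf_null ptf_bads' P y h ptf_Pair ptf_const ptf_fst ptf_snd ptf_id)
qed

lemma lpstep_le:
 assumes "length (snd s) = n" "!!a. a \<in> set (snd s) ==> a \<le> c"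
 shows "length (snd ((lpstep A \<kappa> t K p ^^ j) s)) = n & (\<forall>a \<in> set (snd ((lpstep A \<kappa> t K p ^^ j) s)). a \<le> c)"
proof (induction j)
 case (Suc j)
 obtain f D where fD: "(lpstep A \<kappa> t K p ^^ j) s = (f, D)" by fastforce
 have D: "length D = n" "!!a. a \<in> set D ==> a \<le> c" using Suc fD by auto
 have "length (halve t D y) = n & (\<forall>a \<in> set (halve t D y). a \<le> c)" for y
  using D nth_mem[of _ D] unfolding halve_def by (auto intro: order_trans[OF div_le_dividend])
 then have "length (snd (lpstep A \<kappa> t K p (f, D))) = n & (\<forall>a \<in> set (snd (lpstep A \<kappa> t K p (f, D))). a \<le> c)"
  using D by (simp add: lpstep_def Let_def)
 then show ?case by (simp add: fD)
qed (use assms in auto)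

text \<open>Parameters occur as exponents and as iteration counts, so they are computed in unary, as
  lists of units whose lengths add and multiply.\<close>

definition uprod :: "unit list => unit list => unit list" where
 "uprod a b = concat (map (%_. b) a)"

lemma length_uprod [simp]: "length (uprod a b) = length a * length b"
 by (induction a) (auto simp: uprod_def)

lemma ptf_uprod [ptfs]: "ptf f ==> ptf g ==> ptf (%z. uprod (f z) (g z))"
 by (rule ptf_lift2) (unfold uprod_def, intro ptfs)

type_synonym lp_input = "int list list \<times> unit list"

text \<open>Its length exceeds the number of rows, the number of columns and the bit length of every
  entry, so that all parameters become polynomials in it.\<close>

definition ul :: "lp_input => unit list" where
 "ul z = () # snd z @ map (%_. ()) (fst z) @ concat (map (%r. concat (map (%a. map (%_. ()) (bits (nat \<bar>a\<bar>))) r)) (fst z))"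

definition uT :: "lp_input => unit list" where
 "uT z = uprod [(), (), ()] (uprod (ul z) (ul z))"

definition uk :: "lp_input => unit list" where
 "uk z = uprod [(), (), (), ()] (ul z) @ uprod [(), ()] (uT z)"

definition ut :: "lp_input => unit list" where
 "ut z = uprod (replicate 8 ()) (uprod (ul z) (uprod (ul z) (ul z)))"

definition uK :: "lp_input => unit list" where
 "uK z = replicate 11 () @ uprod (replicate 8 ()) (ul z) @ uk z @ uprod [(), ()] (uT z)"

definition up :: "lp_input => unit list" where
 "up z = uprod ([(), ()] @ ul z) (uK z) @ replicate 6 () @ uprod [(), (), ()] (ul z)"

definition lpdec :: "lp_input => bool" where
 "lpdec z = lpsolve (fst z) (length (snd z)) (length (uT z)) (length (uk z)) (length (ut z)) (length (uK z)) (length (up z))"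

lemma ptf_params: "ptf ul" "ptf uT" "ptf uk" "ptf ut" "ptf uK" "ptf up"
proof -
 show ul: "ptf ul" unfolding ul_def[abs_def] by (intro ptfs)
 show uT: "ptf uT" unfolding uT_def[abs_def] by (intro ptf_uprod ptf_const ul)
 show uk: "ptf uk" unfolding uk_def[abs_def] by (intro ptf_uprod ptf_append ptf_const ul uT)
 show "ptf ut" unfolding ut_def[abs_def] by (intro ptf_uprod ptf_append ptf_const ul uT)
 show uK: "ptf uK" unfolding uK_def[abs_def] by (intro ptf_uprod ptf_append ptf_const ul uT uk)
 show "ptf up" unfolding up_def[abs_def] by (intro ptf_uprod ptf_append ptf_const ul uT uk uK)
qed

lemma ptf_lpdec: "ptf lpdec"
proof -
 let ?l = "%z :: lp_input. uprod (snd z) (() # uT z)"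
 let ?i = "%z :: lp_input. (False, replicate (length (snd z)) (2 ^ length (uT z) :: nat))"
 let ?e = "%z :: lp_input. (fst z, uk z, ut z, uK z, up z)"
 obtain s where s: "pbd s" "mono s" "!!w. sz (uT w) \<le> s (sz w)" using ptf_params(2) by (rule ptf_size) blast
 have e: "ptf ?e" by (intro ptf_Pair ptf_fst ptf_id ptf_params)
 have "ptf (%z. ((%z. lpstep (fst z) (length (uk z)) (length (ut z)) (length (uK z)) (length (up z))) z ^^ length (?l z)) (?i z))"
 proof (rule ptf_iter[where s = "%n. Suc (3 + Suc (n * Suc (4 * (s n + 1) + 1)))"])
  show "ptf ?l" "ptf ?i" by (intro ptfs ptf_params ptf_replicate_len ptf_pow2_len)+
  show "ptf (%w :: lp_input \<times> bool \<times> nat list. lpstep (fst (fst w)) (length (uk (fst w))) (length (ut (fst w))) (length (uK (fst w))) (length (up (fst w))) (snd w))"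
   using ptf_comp[OF ptf_Pair[OF ptf_comp[OF ptf_fst[OF ptf_id] e] ptf_snd[OF ptf_id]] ptf_lpstep] by simp
  show "pbd (%n. Suc (3 + Suc (n * Suc (4 * (s n + 1) + 1))))" using s(1) by (intro pbds)
  fix z :: lp_input and j
  let ?r = "(lpstep (fst z) (length (uk z)) (length (ut z)) (length (uK z)) (length (up z)) ^^ j) (?i z)"
  have r: "length (snd ?r) = length (snd z)" "!!a. a \<in> set (snd ?r) ==> a \<le> 2 ^ length (uT z)"
   using lpstep_le[of "?i z" "length (snd z)" "2 ^ length (uT z)"] by auto
  have "nb a \<le> s (sz z) + 1" if "a \<in> set (snd ?r)" for a
  proof -
   have "(2::nat) ^ length (uT z) < 2 ^ (length (uT z) + 1)" by simp
   then have "nb a \<le> length (uT z) + 1" by (intro nb_le le_less_trans[OF r(2)[OF that]])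
   then show ?thesis using length_le_sz[of "uT z"] s(3)[of z] by linarith
  qed
  then have "sz (snd ?r) \<le> Suc (length (snd ?r) * Suc (4 * (s (sz z) + 1) + 1))" by (rule sz_nats)
  also have "\<dots> \<le> Suc (sz z * Suc (4 * (s (sz z) + 1) + 1))"
   using length_le_sz[of "snd z"] r(1) by (intro Suc_le_mono[THEN iffD2] mult_le_mono) (cases z, auto)
  finally show "sz ?r \<le> Suc (3 + Suc (sz z * Suc (4 * (s (sz z) + 1) + 1)))"
   using sz_bool[of "fst ?r"] by (cases ?r) simp
 qed
 from ptf_fst[OF this] show ?thesis by (simp add: lpdec_def[abs_def] lpsolve_def mult.commute)
qed

theorem lpdec_correct:
 assumes "snd z ~= []"
 shows "lpdec z \<longleftrightarrow> hf (fst z) (length (snd z))"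
proof -
 define l where "l = length (ul z)"
 define A where "A = fst z"
 define n where "n = length (snd z)"
 have m: "length A < l" "n < l" "length A + n < l" by (auto simp: l_def ul_def A_def n_def)
 have l2: "l \<le> 2 ^ l" by (rule less_imp_le[OF less_exp])
 have ent: "\<bar>mat A i j\<bar> \<le> int (2 ^ l)" for i j
 proof (cases "i < length A & j < length (A ! i)")
  case True
  have "nb (nat \<bar>A ! i ! j\<bar>) \<le> l"
  proof -
   have sub: "length y \<le> length (concat xs)" if "y \<in> set xs" for y :: "unit list" and xs
    using that by (induction xs) auto
   let ?row = "%r. concat (map (%a. map (%_. ()) (bits (nat \<bar>a\<bar>))) r)"
   have "nb (nat \<bar>A ! i ! j\<bar>) = length (map (%_. ()) (bits (nat \<bar>A ! i ! j\<bar>)))" by simp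
   also have "\<dots> \<le> length (?row (A ! i))" using True by (intro sub) auto
   also have "\<dots> \<le> length (concat (map ?row A))" using True by (intro sub) auto
   also have "\<dots> \<le> l" by (simp add: l_def ul_def A_def)
   finally show ?thesis .
  qed
  then have "nat \<bar>A ! i ! j\<bar> \<le> 2 ^ l" using less_nb[of "nat \<bar>A ! i ! j\<bar>"]
   by (meson less_imp_le_nat le_trans one_le_numeral power_increasing)
  then show ?thesis using True by (simp add: mat_def nat_le_iff)
 next
  case False
  then show ?thesis by (auto simp: mat_def nth_or_def)
 qed
 have lens: "length (uT z) = 3 * l ^ 2" "length (uk z) = 4 * l + 2 * (3 * l ^ 2)" "length (ut z) = 8 * l ^ 3"
  "length (uK z) = 11 + 8 * l + (4 * l + 2 * (3 * l ^ 2)) + 2 * (3 * l ^ 2)"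
  "length (up z) = (2 + l) * (11 + 8 * l + (4 * l + 2 * (3 * l ^ 2)) + 2 * (3 * l ^ 2)) + 6 + 3 * l"
  by (simp_all add: uT_def uk_def ut_def uK_def up_def l_def power2_eq_square power3_eq_cube)
 \<comment> \<open>Except for \<open>t\<close>, these are base-2 logarithms of the bounds in the
   locale, with \<open>2 ^ l\<close> as the bound on the entries. The 11 in \<open>K\<close> is 4
   for the factor 16, 6 from the square of \<open>t \<le> 2 ^ (3 + 3 * l)\<close>, and 1 for
   strictness.\<close>
 define T \<kappa> t K p where defs: "T = 3 * l ^ 2" "\<kappa> = 4 * l + 2 * T" "t = 8 * l ^ 3" "K = 11 + 8 * l + \<kappa> + 2 * T" "p = (2 + l) * K + 6 + 3 * l"
 have mn: "length A \<le> 2 ^ l" "length A + 1 \<le> 2 ^ l" "n \<le> 2 ^ l" using m l2 by linarith+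
 have t2: "t \<le> 2 ^ (3 + 3 * l)"
 proof -
  have "l ^ 3 \<le> (2 ^ l) ^ 3" using l2 by (rule power_mono) simp
  then show ?thesis by (simp add: defs(3) power_add power_mult[symmetric] mult.commute)
 qed
 interpret lp A n T \<kappa> t K p "2 ^ l"
 proof
  show "1 \<le> n" using assms by (cases "snd z") (auto simp: n_def)
  show "\<bar>mat A i j\<bar> \<le> int (2 ^ l)" for i j by (rule ent)
  show "1 \<le> (2::nat) ^ l" by simp
  show "(2 * (length A + 1) * 2 ^ l) ^ length A \<le> 2 ^ T"
  proof -
   have "(2 * (length A + 1) * 2 ^ l) ^ length A \<le> (2 * 2 ^ l * 2 ^ l) ^ length A" using mn by (intro power_mono mult_mono) auto
   also have "\<dots> = 2 ^ ((1 + l + l) * length A)" by (simp only: power_add power_mult power_one_right)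
   also have "\<dots> \<le> 2 ^ T"
   proof (rule power_increasing)
    have "(1 + l + l) * length A \<le> (3 * l) * l" using m by (intro mult_le_mono) auto
    then show "(1 + l + l) * length A \<le> T" by (simp add: defs(1) power2_eq_square)
   qed simp
   finally show ?thesis .
  qed
  show "length A * n * (2 ^ l * 2 ^ T) ^ 2 \<le> 2 ^ \<kappa>"
  proof -
   have "length A * n * (2 ^ l * 2 ^ T) ^ 2 \<le> 2 ^ l * 2 ^ l * (2 ^ l * 2 ^ T) ^ 2" using mn by (intro mult_le_mono) auto
   also have "\<dots> = 2 ^ (l + l + (l + T) * 2)" by (simp only: power_add power_mult)
   also have "\<dots> = 2 ^ \<kappa>" unfolding defs(2) by (rule arg_cong[where f = "%k. 2 ^ k"]) simp
   finally show ?thesis .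
  qed
  show "\<kappa> \<le> p"
  proof -
   have "\<kappa> \<le> K" by (simp add: defs(4))
   also have "K \<le> (2 + l) * K" by simp
   finally show ?thesis by (simp add: defs(5))
  qed
  show "8 * n ^ 3 \<le> t" using power_mono[of n l 3] m by (simp add: defs(3))
  show "16 * (length A)\<^sup>2 * t\<^sup>2 * 2 ^ \<kappa> * (2 ^ T)\<^sup>2 < 2 ^ K"
  proof -
   have "16 * (length A)\<^sup>2 * t\<^sup>2 * 2 ^ \<kappa> * (2 ^ T)\<^sup>2 \<le> 2 ^ 4 * (2 ^ l)\<^sup>2 * (2 ^ (3 + 3 * l))\<^sup>2 * 2 ^ \<kappa> * (2 ^ T)\<^sup>2"
    using mn t2 by (intro mult_le_mono power_mono) auto
   also have "\<dots> = 2 ^ (4 + l * 2 + (3 + 3 * l) * 2 + \<kappa> + T * 2)" by (simp only: power_add power_mult)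
   also have "\<dots> < 2 ^ K" by (rule power_strict_increasing) (auto simp: defs(4))
   finally show ?thesis .
  qed
  show "1 \<le> K" by (simp add: defs(4))
  show "(4 * n) ^ K * (8 * t) \<le> 2 ^ p"
  proof -
   have "(4 * n) ^ K * (8 * t) \<le> (2 ^ 2 * 2 ^ l) ^ K * (2 ^ 3 * 2 ^ (3 + 3 * l))"
    using mn t2 by (intro mult_le_mono power_mono) auto
   also have "\<dots> = 2 ^ ((2 + l) * K + (3 + (3 + 3 * l)))" by (simp only: power_add power_mult)
   also have "\<dots> = 2 ^ p" unfolding defs(5) by (rule arg_cong[where f = "%k. 2 ^ k"]) simp
   finally show ?thesis .
  qed
 qed
 show ?thesis using lpsolve_correct unfolding lpdec_def lens A_def[symmetric] n_def[symmetric] by (simp only: defs)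
qed

section \<open>Flows as lists of paths\<close>

lemma st_paths_iff:
 "p \<in> st_paths G s t \<longleftrightarrow> s \<in> pverts G & set p \<subseteq> parcs G & pcas s p t & distinct (pawalk_verts s p)"
 by (auto simp: st_paths_def pre_digraph.apath_def pre_digraph.awalk_def cas_with_proj_eq awalk_verts_with_proj_eq)

lemma finite_st_paths:
 assumes "pair_fin_digraph G"
 shows "finite (st_paths G s t)"
proof -
 interpret pair_fin_digraph G by fact
 show ?thesis using apaths_finite[of s t] by (simp add: st_paths_def)
qed

lemma walk_contains_path:
 assumes "pair_fin_digraph G" "s \<in> pverts G" "set p \<subseteq> parcs G" "pcas s p t"
 obtains q where "q \<in> st_paths G s t" "set q \<subseteq> set p"
proof -
 interpret pair_fin_digraph G by fact
 have "awalk s p t" using assms by (simp add: awalk_def)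
 then have "apath s (awalk_to_apath p) t" "set (awalk_to_apath p) \<subseteq> set p"
  by (rule apath_awalk_to_apath, rule awalk_to_apath_subset)
 then show ?thesis using that by (simp add: st_paths_def)
qed

text \<open>Paths may repeat and weights may vanish, so the walks of a decomposition can be listed
  directly. Requiring every listed path to respect the delay bound replaces the maximum over the
  support.\<close>

definition flowlist :: "mmd_instance => (real \<times> (nat \<times> nat) list) list => bool" where
 "flowlist I ws \<longleftrightarrow> (\<forall>wp \<in> set ws. 0 \<le> fst wp & snd wp \<in> st_paths (graph_of I) (source I) (sink I) &
   int (path_delay (delay I) (snd wp)) \<le> delay_bound I) &
  (\<Sum>wp\<leftarrow>ws. fst wp) = real (rate I) &
  (\<forall>e \<in> parcs (graph_of I). (\<Sum>wp\<leftarrow>ws. if e \<in> set (snd wp) then fst wp else 0) \<le> real (capacity I e))"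

lemma sum_sum_list: "finite A ==> (\<Sum>x \<in> A. \<Sum>y\<leftarrow>ys. f x y) = (\<Sum>y\<leftarrow>ys. \<Sum>x \<in> A. f x y)" for f :: "'a => 'b => real"
 by (induction ys) (auto simp: sum.distrib)

lemma mmd_yes_iff_flowlist:
 assumes I: "I \<in> mmd_instances"
 shows "mmd_yes I \<longleftrightarrow> (\<exists>ws. flowlist I ws)"
proof
 have fin: "finite (st_paths (graph_of I) (source I) (sink I))" (is "finite ?P")
  using I by (intro finite_st_paths) (simp add: mmd_instances_def)
 {
  assume "mmd_yes I"
  then obtain f where f: "feasible_flow (graph_of I) (capacity I) (source I) (sink I) (rate I) f"
   and D: "int (max_delay (graph_of I) (delay I) (source I) (sink I) f) \<le> delay_bound I" by (auto simp: mmd_yes_def)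
  let ?S = "{p \<in> ?P. f p > 0}"
  have finS: "finite ?S" using fin by simp
  obtain ps where ps: "set ps = ?S" "distinct ps" using finite_distinct_list[OF finS] by blast
  have sumS: "(\<Sum>p \<in> ?S. g p) = (\<Sum>p \<in> ?P. g p)" if "!!p. f p = 0 ==> g p = 0" for g :: "_ => real"
  proof (rule sum.mono_neutral_left[OF fin])
   show "\<forall>p \<in> ?P - ?S. g p = 0"
   proof
    fix p assume "p \<in> ?P - ?S"
    then have "0 \<le> f p" "\<not> 0 < f p" using f by (auto simp: feasible_flow_def)
    then show "g p = 0" using that[of p] by simp
   qed
  qed auto
  have list: "(\<Sum>p\<leftarrow>ps. g p) = (\<Sum>p \<in> ?S. g p)" for g :: "_ => real"
   using ps by (simp add: sum_list_distinct_conv_sum_set)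
  have mem: "0 \<le> fst wp & snd wp \<in> ?S" if wpm: "wp \<in> set (map (%p. (f p, p)) ps)" for wp
  proof -
   obtain p where p: "p \<in> set ps" "wp = (f p, p)" using wpm by auto
   then have "p \<in> ?S" unfolding ps(1)[symmetric] by simp
   then show ?thesis using p(2) by simp
  qed
  have "flowlist I (map (%p. (f p, p)) ps)"
   unfolding flowlist_def
  proof (intro conjI ballI)
   show "0 \<le> fst wp" "snd wp \<in> ?P" if "wp \<in> set (map (%p. (f p, p)) ps)" for wp
    using mem[OF that] by simp_all
   show "int (path_delay (delay I) (snd wp)) \<le> delay_bound I" if "wp \<in> set (map (%p. (f p, p)) ps)" for wp
   proof -
    have "snd wp \<in> ?S" using mem[OF that] by simp
    then have "path_delay (delay I) (snd wp) \<le> max_delay (graph_of I) (delay I) (source I) (sink I) f"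
     unfolding max_delay_def using finS by (intro Max_ge) auto
    then show ?thesis using D by simp
   qed
   show "(\<Sum>wp\<leftarrow>map (%p. (f p, p)) ps. fst wp) = real (rate I)"
    using f by (simp add: o_def list sumS feasible_flow_def)
   fix e assume e: "e \<in> parcs (graph_of I)"
   have "(\<Sum>wp\<leftarrow>map (%p. (f p, p)) ps. if e \<in> set (snd wp) then fst wp else 0) = (\<Sum>p \<in> ?P. if e \<in> set p then f p else 0)"
    by (simp add: o_def list sumS cong: if_cong)
   also have "\<dots> = (\<Sum>p \<in> {p \<in> ?P. e \<in> set p}. f p)" using fin by (simp add: sum.inter_filter)
   finally show "(\<Sum>wp\<leftarrow>map (%p. (f p, p)) ps. if e \<in> set (snd wp) then fst wp else 0) \<le> real (capacity I e)"
    using f e by (simp add: feasible_flow_def)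
  qed
  then show "\<exists>ws. flowlist I ws" by blast
 }
 assume "\<exists>ws. flowlist I ws"
 then obtain ws where ws: "flowlist I ws" by blast
 define f where "f p = (\<Sum>wp\<leftarrow>ws. if snd wp = p then fst wp else 0)" for p
 have nonneg: "0 \<le> f p" for p
  unfolding f_def using ws by (intro sum_list_nonneg) (auto simp: flowlist_def)
 have swap: "(\<Sum>p \<in> A. f p) = (\<Sum>wp\<leftarrow>ws. if snd wp \<in> A then fst wp else 0)" if "finite A" for A
  unfolding f_def sum_sum_list[OF that] using that by simp
 have all: "(\<Sum>p \<in> ?P. f p) = real (rate I)"
 proof -
  have "(\<Sum>wp\<leftarrow>ws. if snd wp \<in> ?P then fst wp else 0) = (\<Sum>wp\<leftarrow>ws. fst wp)"
   using ws by (intro arg_cong[where f = sum_list] map_cong) (auto simp: flowlist_def)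
  then show ?thesis using ws swap[OF fin] by (simp add: flowlist_def)
 qed
 have "feasible_flow (graph_of I) (capacity I) (source I) (sink I) (rate I) f"
  unfolding feasible_flow_def
 proof (intro conjI ballI nonneg all)
  fix e assume e: "e \<in> parcs (graph_of I)"
  have "(\<Sum>p \<in> {p \<in> ?P. e \<in> set p}. f p) = (\<Sum>wp\<leftarrow>ws. if snd wp \<in> {p \<in> ?P. e \<in> set p} then fst wp else 0)"
   using fin by (intro swap) simp
  also have "\<dots> = (\<Sum>wp\<leftarrow>ws. if e \<in> set (snd wp) then fst wp else 0)"
   using ws by (intro arg_cong[where f = sum_list] map_cong) (auto simp: flowlist_def)
  finally show "(\<Sum>p \<in> {p \<in> ?P. e \<in> set p}. f p) \<le> real (capacity I e)" using ws e by (simp add: flowlist_def)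
 qed
 moreover have "int (max_delay (graph_of I) (delay I) (source I) (sink I) f) \<le> delay_bound I"
 proof -
  let ?S = "{p \<in> ?P. f p > 0}"
  \<comment> \<open>A positive rate forces some path to carry flow, so the maximum delay is
    attained.\<close>
  have "?S ~= {}"
  proof
   assume "?S = {}"
   then have "(\<Sum>p \<in> ?P. f p) \<le> 0" by (intro sum_nonpos) (auto simp: not_less)
   then show False using all I by (simp add: mmd_instances_def)
  qed
  then have "max_delay (graph_of I) (delay I) (source I) (sink I) f \<in> path_delay (delay I) ` ?S"
   unfolding max_delay_def using fin by (intro Max_in) auto
  then obtain p where p: "f p > 0" "max_delay (graph_of I) (delay I) (source I) (sink I) f = path_delay (delay I) p" by auto
  have "\<exists>wp \<in> set ws. snd wp = p"
  proof (rule ccontr)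
   assume "\<not> (\<exists>wp \<in> set ws. snd wp = p)"
   then have "f p = (\<Sum>wp\<leftarrow>ws. 0)" unfolding f_def by (intro arg_cong[where f = sum_list] map_cong) auto
   then show False using p by simp
  qed
  then show ?thesis using ws p by (auto simp: flowlist_def)
 qed
 ultimately show "mmd_yes I" by (auto simp: mmd_yes_def)
qed

section \<open>Decomposition of a flow into walks\<close>

fun wk :: "('b => 'v) => ('b => 'v) => 'v => 'b list => 'v => bool" where
 "wk ta he u [] v \<longleftrightarrow> u = v"
| "wk ta he u (a # p) v \<longleftrightarrow> ta a = u & wk ta he (he a) p v"

lemma wk_append: "wk ta he u (p @ q) v \<longleftrightarrow> (\<exists>w. wk ta he u p w & wk ta he w q v)"
 by (induction p arbitrary: u) auto

lemma walk_balance: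
 assumes "finite As" "set p \<subseteq> As" "wk ta he u p w"
 shows "(\<Sum>a | a \<in> As & ta a = v. real (count_list p a)) - (\<Sum>a | a \<in> As & he a = v. real (count_list p a))
  = of_bool (v = u) - of_bool (v = w)"
 using assms(2,3)
proof (induction p arbitrary: u)
 case (Cons b p)
 have cnt: "real (count_list (b # p) a) = real (count_list p a) + of_bool (a = b)" for a by simp
 have b: "b \<in> As" "set p \<subseteq> As" "ta b = u" "wk ta he (he b) p w" using Cons.prems by auto
 have 1: "(\<Sum>a | a \<in> As & ta a = v. of_bool (a = b) :: real) = of_bool (v = u)"
  "(\<Sum>a | a \<in> As & he a = v. of_bool (a = b) :: real) = of_bool (v = he b)"
  using assms(1) b by auto
 show ?case unfolding cnt sum.distrib 1 using Cons.IH[OF b(2,4)] by simp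
qed auto

text \<open>Some walk along positive arcs leads from \<open>\<sigma>\<close> into \<open>Z\<close>;
  subtracting as much of it as possible either exhausts \<open>F\<close> or makes an arc zero, which
  decreases the induction measure. The walk may repeat arcs, hence the multiplicities; circulations
  may stay behind, hence only an inequality at the end.\<close>

lemma flow_decomposition:
 fixes x :: "'b => real"
 assumes "finite As" "\<sigma> \<notin> Z" "!!a. a \<in> As ==> 0 \<le> x a" "0 \<le> F"
  and "!!v. v \<notin> Z ==> (\<Sum>a | a \<in> As & ta a = v. x a) - (\<Sum>a | a \<in> As & he a = v. x a) = (if v = \<sigma> then F else 0)"
 shows "\<exists>ws. (\<forall>wp \<in> set ws. 0 \<le> fst wp & set (snd wp) \<subseteq> As & (\<exists>z \<in> Z. wk ta he \<sigma> (snd wp) z)) &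
  (\<Sum>wp\<leftarrow>ws. fst wp) = F & (\<forall>a \<in> As. (\<Sum>wp\<leftarrow>ws. fst wp * real (count_list (snd wp) a)) \<le> x a)"
 using assms(3,4,5)
proof (induction "card {a \<in> As. x a > 0}" arbitrary: x F rule: less_induct)
 case less
 show ?case
 proof (cases "F = 0")
  case True
  then show ?thesis using less.prems by (intro exI[of _ "[]"]) auto
 next
  case False
  then have F: "F > 0" using less.prems by simp
  define U where "U = {v. \<exists>p. set p \<subseteq> {a \<in> As. x a > 0} & wk ta he \<sigma> p v}"
  have \<sigma>U: "\<sigma> \<in> U" unfolding U_def by (intro CollectI exI[of _ "[]"]) simp
  have closed: "he a \<in> U" if a: "a \<in> As" "x a > 0" "ta a \<in> U" for a
  proof -
   obtain p where "set p \<subseteq> {a \<in> As. x a > 0}" "wk ta he \<sigma> p (ta a)" using a(3) by (auto simp: U_def)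
   then show ?thesis unfolding U_def using a by (intro CollectI exI[of _ "p @ [a]"]) (auto simp: wk_append)
  qed
  have "U \<inter> Z ~= {}"
  proof
   \<comment> \<open>No positive arc leaves the reachable set \<open>U\<close>. Summing the balance
     over \<open>U\<close> expresses \<open>F\<close> as flow on arcs starting in \<open>U\<close>
     minus flow on arcs ending in \<open>U\<close>, which is at most zero.\<close>
   assume UZ: "U \<inter> Z = {}"
   define W where "W = U \<inter> insert \<sigma> (ta ` As \<union> he ` As)"
   have finW: "finite W" using assms(1) by (simp add: W_def)
   have "F = (\<Sum>v \<in> W. if v = \<sigma> then F else 0)" using finW \<sigma>U by (simp add: W_def)
   also have "\<dots> = (\<Sum>v \<in> W. (\<Sum>a | a \<in> As & ta a = v. x a) - (\<Sum>a | a \<in> As & he a = v. x a))"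
   proof (rule sum.cong[OF refl])
    fix v assume "v \<in> W"
    then have "v \<notin> Z" using UZ by (auto simp: W_def)
    then show "(if v = \<sigma> then F else 0) = (\<Sum>a | a \<in> As & ta a = v. x a) - (\<Sum>a | a \<in> As & he a = v. x a)"
     using less.prems(3)[of v] by simp
   qed
   also have "\<dots> = (\<Sum>v \<in> W. \<Sum>a | a \<in> As & ta a = v. x a) - (\<Sum>v \<in> W. \<Sum>a | a \<in> As & he a = v. x a)"
    by (rule sum_subtractf)
   also have "(\<Sum>v \<in> W. \<Sum>a | a \<in> As & ta a = v. x a) = (\<Sum>a | a \<in> As & ta a \<in> U. x a)"
   proof -
    have "(\<Sum>v \<in> W. \<Sum>a | a \<in> As & ta a = v. x a) = (\<Sum>v \<in> W. \<Sum>a | a \<in> {a \<in> As. ta a \<in> U} & ta a = v. x a)"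
     by (intro sum.cong refl) (auto simp: W_def)
    also have "\<dots> = (\<Sum>a \<in> {a \<in> As. ta a \<in> U}. x a)" using assms(1) finW by (intro sum.group) (auto simp: W_def)
    finally show ?thesis .
   qed
   also have "(\<Sum>v \<in> W. \<Sum>a | a \<in> As & he a = v. x a) = (\<Sum>a | a \<in> As & he a \<in> U. x a)"
   proof -
    have "(\<Sum>v \<in> W. \<Sum>a | a \<in> As & he a = v. x a) = (\<Sum>v \<in> W. \<Sum>a | a \<in> {a \<in> As. he a \<in> U} & he a = v. x a)"
     by (intro sum.cong refl) (auto simp: W_def)
    also have "\<dots> = (\<Sum>a \<in> {a \<in> As. he a \<in> U}. x a)" using assms(1) finW by (intro sum.group) (auto simp: W_def)
    finally show ?thesis .
   qed
   also have "(\<Sum>a | a \<in> As & ta a \<in> U. x a) = (\<Sum>a | a \<in> As & ta a \<in> U & x a > 0. x a)"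
    using assms(1) less.prems(1) by (intro sum.mono_neutral_right) (auto simp: not_less intro: antisym)
   finally have "F = (\<Sum>a | a \<in> As & ta a \<in> U & x a > 0. x a) - (\<Sum>a | a \<in> As & he a \<in> U. x a)" .
   moreover have "(\<Sum>a | a \<in> As & ta a \<in> U & x a > 0. x a) \<le> (\<Sum>a | a \<in> As & he a \<in> U. x a)"
    using assms(1) less.prems(1) closed by (intro sum_mono2) auto
   ultimately show False using F by simp
  qed
  then obtain z p where p: "z \<in> Z" "set p \<subseteq> {a \<in> As. x a > 0}" "wk ta he \<sigma> p z" by (auto simp: U_def)
  have pAs: "set p \<subseteq> As" using p(2) by auto
  have pne: "p ~= []" using p(1,3) assms(2) by auto
  define r where "r a = x a / real (count_list p a)" for a
  define \<theta> where "\<theta> = min F (Min (r ` set p))"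
  have cpos: "count_list p a > 0" if "a \<in> set p" for a using that by (metis count_list_0_iff gr0I)
  have rpos: "r a > 0" if "a \<in> set p" for a using p(2) that cpos[OF that] by (auto simp: r_def)
  have Mr: "Min (r ` set p) \<in> r ` set p" using pne by (intro Min_in) auto
  have \<theta>: "0 < \<theta>" using F rpos Mr by (auto simp: \<theta>_def)
  have \<theta>r: "\<theta> * real (count_list p a) \<le> x a" if "a \<in> As" for a
  proof (cases "a \<in> set p")
   case True
   then have "\<theta> \<le> r a" unfolding \<theta>_def by (intro min.coboundedI2 Min_le) auto
   then show ?thesis using cpos[OF True] by (simp add: r_def field_simps)
  next
   case False
   then show ?thesis using less.prems(1)[OF that] by (simp add: count_list_0_iff)
  qed
  define x' where "x' a = x a - \<theta> * real (count_list p a)" for a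
  have x'0: "0 \<le> x' a" if "a \<in> As" for a using \<theta>r[OF that] by (simp add: x'_def)
  have bal: "(\<Sum>a | a \<in> As & ta a = v. x' a) - (\<Sum>a | a \<in> As & he a = v. x' a) = (if v = \<sigma> then F - \<theta> else 0)" if v: "v \<notin> Z" for v
  proof -
   have "(\<Sum>a | a \<in> As & ta a = v. x' a) - (\<Sum>a | a \<in> As & he a = v. x' a) =
    ((\<Sum>a | a \<in> As & ta a = v. x a) - (\<Sum>a | a \<in> As & he a = v. x a)) -
    \<theta> * ((\<Sum>a | a \<in> As & ta a = v. real (count_list p a)) - (\<Sum>a | a \<in> As & he a = v. real (count_list p a)))"
    by (simp add: x'_def sum_subtractf sum_distrib_left[symmetric] algebra_simps)
   also have "\<dots> = (if v = \<sigma> then F else 0) - \<theta> * (of_bool (v = \<sigma>) - of_bool (v = z))"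
    unfolding less.prems(3)[OF v] walk_balance[OF assms(1) pAs p(3), of v] ..
   also have "\<dots> = (if v = \<sigma> then F - \<theta> else 0)" using v p(1) by auto
   finally show ?thesis .
  qed
  have base: "0 \<le> \<theta> & set p \<subseteq> As & (\<exists>z \<in> Z. wk ta he \<sigma> p z)" using \<theta> p by auto
  have "\<exists>ws. (\<forall>wp \<in> set ws. 0 \<le> fst wp & set (snd wp) \<subseteq> As & (\<exists>z \<in> Z. wk ta he \<sigma> (snd wp) z)) &
   (\<Sum>wp\<leftarrow>ws. fst wp) = F - \<theta> & (\<forall>a \<in> As. (\<Sum>wp\<leftarrow>ws. fst wp * real (count_list (snd wp) a)) \<le> x' a)"
  proof (cases "\<theta> = F")
   case True
   then show ?thesis using x'0 by (intro exI[of _ "[]"]) auto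
  next
   case False
   then have "\<theta> = Min (r ` set p)" by (auto simp: \<theta>_def min_def split: if_splits)
   then obtain a where a: "a \<in> set p" "\<theta> = r a" using Mr by auto
   have "x' a = 0" using a cpos[OF a(1)] by (simp add: x'_def r_def)
   then have "{a \<in> As. x' a > 0} \<subset> {a \<in> As. x a > 0}"
   proof (intro psubsetI)
    show "{a \<in> As. x' a > 0} \<subseteq> {a \<in> As. x a > 0}"
     using \<theta> by (auto simp: x'_def) (smt (verit) mult_nonneg_nonneg of_nat_0_le_iff)
    show "{a \<in> As. x' a > 0} ~= {a \<in> As. x a > 0}" using \<open>x' a = 0\<close> a(1) p(2) by force
   qed
   then have "card {a \<in> As. x' a > 0} < card {a \<in> As. x a > 0}" using assms(1) by (intro psubset_card_mono) auto
   then show ?thesis by (rule less.hyps) (use x'0 bal in \<open>auto simp: \<theta>_def\<close>)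
  qed
  then obtain ws where ws: "\<forall>wp \<in> set ws. 0 \<le> fst wp & set (snd wp) \<subseteq> As & (\<exists>z \<in> Z. wk ta he \<sigma> (snd wp) z)"
   "(\<Sum>wp\<leftarrow>ws. fst wp) = F - \<theta>" "\<forall>a \<in> As. (\<Sum>wp\<leftarrow>ws. fst wp * real (count_list (snd wp) a)) \<le> x' a" by blast
  show ?thesis
  proof (intro exI[of _ "(\<theta>, p) # ws"] conjI ballI)
   show "0 \<le> fst wp" "set (snd wp) \<subseteq> As" "\<exists>z \<in> Z. wk ta he \<sigma> (snd wp) z" if "wp \<in> set ((\<theta>, p) # ws)" for wp
    using that ws(1) base by auto
   show "(\<Sum>wp\<leftarrow>(\<theta>, p) # ws. fst wp) = F" using ws(2) by simp
   show "(\<Sum>wp\<leftarrow>(\<theta>, p) # ws. fst wp * real (count_list (snd wp) a)) \<le> x a" if "a \<in> As" for a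
    using ws(3) that by (force simp: x'_def)
  qed
 qed
qed

section \<open>Membership in NP\<close>

definition pstep :: "(bool list => 'a \<times> bool list) => 'a list \<times> bool list \<times> bool => 'a list \<times> bool list \<times> bool" where
 "pstep P s = (if snd (snd s) then s else if hd_or False (fst (snd s))
  then (fst (P (tl (fst (snd s)))) # fst s, snd (P (tl (fst (snd s)))), False) else (fst s, tl (fst (snd s)), True))"

text \<open>The length of the input serves as fuel: every element consumes at least its marker bit,
  and a finished state is stationary.\<close>

definition plist :: "(bool list => 'a \<times> bool list) => bool list => 'a list \<times> bool list" where
 "plist P xs = (let s = (pstep P ^^ length xs) ([], xs, False) in (rev (fst s), fst (snd s)))"

lemma pstep_eq: "pstep P (acc, r, d) = (if d then (acc, r, d) else if hd_or False r
  then (fst (P (tl r)) # acc, snd (P (tl r)), False) else (acc, tl r, True))"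
 by (simp add: pstep_def)

lemma pstep_done: "(pstep P ^^ k) (acc, r, True) = (acc, r, True)"
 by (induction k) (auto simp: pstep_eq)

lemma plist_enc_list:
 assumes "!!x v. P (e x @ v) = (x, v)"
 shows "plist P (enc_list e xs @ v) = (xs, v)"
proof -
 have "(pstep P ^^ k) (acc, enc_list e xs @ v, False) = (rev xs @ acc, v, True)" if "length (enc_list e xs) \<le> k" for k acc
  using that
 proof (induction xs arbitrary: k acc)
  case Nil
  then obtain k' where "k = Suc k'" by (cases k) (auto simp: enc_list_def)
  then show ?case by (simp add: enc_list_def funpow_Suc_right pstep_eq pstep_done del: funpow.simps)
 next
  case (Cons x xs)
  have e: "enc_list e (x # xs) = True # e x @ enc_list e xs" by (simp add: enc_list_def)
  obtain k' where k: "k = Suc k'" using Cons.prems e by (cases k) auto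
  have "pstep P (acc, enc_list e (x # xs) @ v, False) = (x # acc, enc_list e xs @ v, False)"
   unfolding e by (simp add: pstep_eq assms)
  then have "(pstep P ^^ k) (acc, enc_list e (x # xs) @ v, False) = (pstep P ^^ k') (x # acc, enc_list e xs @ v, False)"
   by (simp add: k funpow_Suc_right del: funpow.simps)
  also have "\<dots> = (rev xs @ x # acc, v, True)" using Cons.prems by (intro Cons.IH) (simp add: e k)
  finally show ?case by simp
 qed
 from this[of "length (enc_list e xs @ v)" "[]"] show ?thesis by (simp add: plist_def)
qed

text \<open>Nested parsers then never see a rest longer than the input, which bounds the sizes in
  their loops.\<close>

definition shrinks :: "(bool list => 'a \<times> bool list) => bool" where
 "shrinks P \<longleftrightarrow> (\<forall>xs. length (snd (P xs)) \<le> length xs)"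

lemma pstep_inv:
 assumes P: "shrinks P" and B: "!!ys. length ys \<le> n ==> sz (fst (P ys)) \<le> B" and xs: "length xs \<le> n"
 shows "length (fst (snd ((pstep P ^^ j) ([], xs, False)))) \<le> length xs & sz (fst ((pstep P ^^ j) ([], xs, False))) \<le> Suc (j * Suc B)"
proof (induction j)
 case (Suc j)
 obtain acc r d where s: "(pstep P ^^ j) ([], xs, False) = (acc, r, d)" by (metis prod.collapse)
 have IH: "length r \<le> length xs" "sz acc \<le> Suc (j * Suc B)" using Suc by (auto simp: s)
 have "length (tl r) \<le> n" using IH xs by simp
 then have "sz (fst (P (tl r))) \<le> B" by (rule B)
 moreover have "length (snd (P (tl r))) \<le> length (tl r)" using P[unfolded shrinks_def] by blast
 ultimately show ?case using IH by (auto simp: s pstep_eq)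
qed simp

lemma shrinks_plist: "shrinks P ==> shrinks (plist P)"
proof -
 assume P: "shrinks P"
 have "length (fst (snd ((pstep P ^^ j) ([], xs, False)))) \<le> length xs" for j xs
 proof (induction j)
  case (Suc j)
  obtain acc r d where s: "(pstep P ^^ j) ([], xs, False) = (acc, r, d)" by (metis prod.collapse)
  have "length (snd (P (tl r))) \<le> length (tl r)" using P[unfolded shrinks_def] by blast
  then show ?case using Suc by (auto simp: s pstep_eq)
 qed simp
 then show ?thesis by (simp add: shrinks_def plist_def Let_def)
qed

lemma ptf_plist:
 assumes P: "ptf P" "shrinks P"
 shows "ptf (plist P)"
proof -
 obtain s where s: "pbd s" "mono s" "!!x. sz (P x) \<le> s (sz x)" using P(1) by (rule ptf_size) blast
 have iter: "ptf (%xs. (pstep P ^^ length xs) ([], xs, False))"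
 proof (rule ptf_iter[where s = "%n. Suc (Suc (n * Suc (s (4 * n + 1))) + Suc ((4 * n + 1) + 3))"])
  show "ptf (%w :: bool list \<times> 'a list \<times> bool list \<times> bool. pstep P (snd w))"
   unfolding pstep_def by (intro ptfs ptf_comp[OF _ P(1)])
  have "pbd (%n. s (4 * n + 1))" by (rule pbd_comp[OF s(1)]) (intro pbds)
  then show "pbd (%n. Suc (Suc (n * Suc (s (4 * n + 1))) + Suc ((4 * n + 1) + 3)))" by (intro pbds)
  fix xs :: "bool list" and j assume j: "j \<le> length xs"
  obtain acc r d where st: "(pstep P ^^ j) ([], xs, False) = (acc, r, d)" by (metis prod.collapse)
  have B: "sz (fst (P ys)) \<le> s (4 * sz xs + 1)" if "length ys \<le> length xs" for ys
  proof -
   have "sz ys \<le> 4 * sz xs + 1" using sz_bools[of ys] that length_le_sz[of xs] by linarith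
   then have "s (sz ys) \<le> s (4 * sz xs + 1)" by (rule monoD[OF s(2)])
   moreover have "sz (fst (P ys)) \<le> sz (P ys)" by (cases "P ys") simp
   ultimately show ?thesis using s(3)[of ys] by linarith
  qed
  have inv: "length r \<le> length xs" "sz acc \<le> Suc (j * Suc (s (4 * sz xs + 1)))"
   using pstep_inv[where P = P and n = "length xs" and B = "s (4 * sz xs + 1)" and xs = xs and j = j, OF P(2) B order_refl] by (simp_all add: st)
  have "j * Suc (s (4 * sz xs + 1)) \<le> sz xs * Suc (s (4 * sz xs + 1))"
   using j length_le_sz[of xs] by (intro mult_le_mono1) simp
  moreover have "sz r \<le> 4 * sz xs + 1" using sz_bools[of r] inv(1) length_le_sz[of xs] by linarith
  ultimately show "sz ((pstep P ^^ j) ([], xs, False)) \<le> Suc (Suc (sz xs * Suc (s (4 * sz xs + 1))) + Suc ((4 * sz xs + 1) + 3))"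
   using inv(2) sz_bool[of d] by (simp add: st)
 qed (intro ptfs)+
 show ?thesis unfolding plist_def[abs_def] Let_def by (intro ptf_Pair ptf_rev ptf_fst ptf_snd iter)
qed

definition pbit :: "bool list => bool \<times> bool list" where
 "pbit xs = (hd_or False xs, tl xs)"

definition pnat :: "bool list => nat \<times> bool list" where
 "pnat xs = (val (fst (plist pbit xs)), snd (plist pbit xs))"

definition seqp :: "(bool list => 'a \<times> bool list) => (bool list => 'b \<times> bool list) => bool list => ('a \<times> 'b) \<times> bool list" where
 "seqp P Q xs = ((fst (P xs), fst (Q (snd (P xs)))), snd (Q (snd (P xs))))"

lemma ptf_pbit: "ptf pbit" "shrinks pbit"
proof -
 show "ptf pbit" unfolding pbit_def[abs_def] by (intro ptfs)
 show "shrinks pbit" by (simp add: shrinks_def pbit_def)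
qed

lemma ptf_pnat: "ptf pnat" "shrinks pnat"
proof -
 show "ptf pnat" unfolding pnat_def[abs_def] by (intro ptf_Pair ptf_val ptf_fst ptf_snd ptf_plist ptf_pbit)
 show "shrinks pnat" using shrinks_plist[OF ptf_pbit(2)] by (simp add: shrinks_def pnat_def)
qed

lemma ptf_seqp: assumes "ptf P" "ptf Q" shows "ptf (seqp P Q)"
proof -
 have "ptf (%xs. Q (snd (P xs)))" by (rule ptf_comp[OF ptf_snd[OF assms(1)] assms(2)])
 then show ?thesis unfolding seqp_def[abs_def] by (intro ptf_Pair ptf_fst ptf_snd assms)
qed

lemma shrinks_seqp: "shrinks P ==> shrinks Q ==> shrinks (seqp P Q)"
 unfolding shrinks_def seqp_def by (auto intro: order_trans)

lemma pnat_enc: "pnat (enc_nat n @ v) = (n, v)"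
proof -
 have "plist pbit (enc_list (%b. [b]) (bits n) @ v) = (bits n, v)"
  by (rule plist_enc_list) (simp add: pbit_def)
 then show ?thesis by (simp add: pnat_def enc_nat_def)
qed

lemma seqp_enc: "P (a @ b @ v) = (x, b @ v) ==> Q (b @ v) = (y, v) ==> seqp P Q (a @ b @ v) = ((x, y), v)"
 by (simp add: seqp_def)

definition pedge :: "bool list => ((nat \<times> nat) \<times> (nat \<times> nat)) \<times> bool list" where
 "pedge = seqp (seqp pnat pnat) (seqp pnat pnat)"

lemma pedge_enc: "pedge (enc_edge x @ v) = (x, v)"
 by (cases x rule: enc_edge.cases) (simp add: pedge_def seqp_def pnat_enc)

lemma ptf_pedge: "ptf pedge" "shrinks pedge"
 unfolding pedge_def by (intro ptf_seqp shrinks_seqp ptf_pnat)+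

text \<open>The unary number of vertices is an \<open>enc_list\<close> of empty code words, so the
  list parser applies with an element parser that consumes nothing.\<close>

definition pvert :: "bool list => unit \<times> bool list" where
 "pvert xs = ((), xs)"

type_synonym inst = "unit list \<times> ((nat \<times> nat) \<times> (nat \<times> nat)) list \<times> (nat \<times> nat) \<times> nat \<times> int"

definition dec :: "bool list => inst" where
 "dec xs = (let r = plist pvert xs; e = plist pedge (snd r); st = seqp pnat pnat (snd e); R = pnat (snd st);
   sg = hd_or False (snd R); d = fst (pnat (tl (snd R))) in (fst r, fst e, fst st, fst R, mkint sg d))"

definition mk :: "inst => mmd_instance" where
 "mk z = \<lparr>num_verts = length (fst z), edge_list = fst (snd z), source = fst (fst (snd (snd z))), sink = snd (fst (snd (snd z))),
  rate = fst (snd (snd (snd z))), delay_bound = snd (snd (snd (snd z)))\<rparr>"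

lemma mk_simps [simp]: "num_verts (mk (u, es, (s, t), R, D)) = length u" "edge_list (mk (u, es, (s, t), R, D)) = es"
 "source (mk (u, es, (s, t), R, D)) = s" "sink (mk (u, es, (s, t), R, D)) = t"
 "rate (mk (u, es, (s, t), R, D)) = R" "delay_bound (mk (u, es, (s, t), R, D)) = D"
 by (simp_all add: mk_def)

lemma dec_encode: "dec (mmd_encode I) = (replicate (num_verts I) (), edge_list I, (source I, sink I), rate I, delay_bound I)"
proof -
 have u: "enc_list (%_ :: unit. []) (replicate n ()) @ v = replicate n True @ [False] @ v" for n v
  by (induction n) (auto simp: enc_list_def)
 have v: "plist pvert (replicate n True @ [False] @ v) = (replicate n (), v)" for n v
  unfolding u[symmetric] by (rule plist_enc_list) (simp add: pvert_def)
 have "mkint (z < 0) (nat \<bar>z\<bar>) = z" for z by (simp add: mkint_abs)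
 then show ?thesis
  using pnat_enc[of _ "[]"]
  by (simp add: dec_def Let_def mmd_encode_def v[simplified] plist_enc_list[of pedge enc_edge, OF pedge_enc] seqp_def pnat_enc enc_int_def)
qed

lemma mk_dec_encode: "mk (dec (mmd_encode I)) = I"
 by (simp add: dec_encode mk_def)

lemma ptf_dec: "ptf dec"
proof -
 have v: "ptf pvert" "shrinks pvert" unfolding pvert_def[abs_def] shrinks_def by (intro ptfs, simp)
 have r: "ptf (plist pvert)" by (rule ptf_plist[OF v])
 have e: "ptf (%xs. plist pedge (snd (plist pvert xs)))" by (rule ptf_comp[OF ptf_snd[OF r] ptf_plist[OF ptf_pedge]])
 have st: "ptf (%xs. seqp pnat pnat (snd (plist pedge (snd (plist pvert xs)))))"
  by (rule ptf_comp[OF ptf_snd[OF e] ptf_seqp[OF ptf_pnat(1) ptf_pnat(1)]])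
 have R: "ptf (%xs. pnat (snd (seqp pnat pnat (snd (plist pedge (snd (plist pvert xs)))))))"
  by (rule ptf_comp[OF ptf_snd[OF st] ptf_pnat(1)])
 have d: "ptf (%xs. pnat (tl (snd (pnat (snd (seqp pnat pnat (snd (plist pedge (snd (plist pvert xs))))))))))"
  by (rule ptf_comp[OF ptf_tl[OF ptf_snd[OF R]] ptf_pnat(1)])
 show ?thesis unfolding dec_def[abs_def] Let_def
  by (intro ptf_Pair ptf_mkint ptf_hd_or ptf_const ptf_fst ptf_snd r e st R d)
qed

lemma ptf_enc_list:
 assumes "ptf e" "ptf l"
 shows "ptf (%z. enc_list e (l z))"
 unfolding enc_list_def by (intro ptfs assms(2) ptf_comp[OF ptf_snd[OF ptf_id] assms(1)])

lemma ptf_enc_nat: "ptf f ==> ptf (%z. enc_nat (f z))"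
 unfolding enc_nat_def by (rule ptf_enc_list) (intro ptfs)+

lemma ptf_enc_edge: "ptf enc_edge"
proof -
 have "ptf (%x. enc_nat (fst (fst x)) @ enc_nat (snd (fst x)) @ enc_nat (fst (snd x)) @ enc_nat (snd (snd x)))"
  by (intro ptfs ptf_enc_nat)
 then show ?thesis by (rule ptf_cong) (metis enc_edge.simps prod.collapse)
qed

lemma ptf_encode_mk: "ptf (%z. mmd_encode (mk z))"
proof -
 have "ptf (%z :: inst. map (%_. True) (fst z) @ [False] @ enc_list enc_edge (fst (snd z)) @
  enc_nat (fst (fst (snd (snd z)))) @ enc_nat (snd (fst (snd (snd z)))) @ enc_nat (fst (snd (snd (snd z)))) @
  ((snd (snd (snd (snd z))) < 0) # enc_nat (nat \<bar>snd (snd (snd (snd z)))\<bar>)))"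
  by (intro ptfs ptf_enc_list ptf_enc_nat ptf_enc_edge)
 then show ?thesis by (rule ptf_cong) (simp add: mmd_encode_def mk_def enc_int_def map_replicate_const)
qed

definition valid :: "inst => bool" where
 "valid z \<longleftrightarrow> (\<forall>e \<in> set (fst (snd z)). fst (fst e) < length (fst z) & snd (fst e) < length (fst z)) &
  (\<forall>i \<in> set [0..<length (fst (snd z))]. \<forall>j \<in> set [0..<length (fst (snd z))].
   fst (nth_or ((0, 0), (0, 0)) (fst (snd z)) i) = fst (nth_or ((0, 0), (0, 0)) (fst (snd z)) j) --> i = j) &
  fst (fst (snd (snd z))) < length (fst z) & snd (fst (snd (snd z))) < length (fst z) &
  fst (fst (snd (snd z))) ~= snd (fst (snd (snd z))) & 0 < fst (snd (snd (snd z)))"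

lemma ptf_valid: "ptf valid"
 unfolding valid_def[abs_def] by (intro ptfs ptf_upt_len)

lemma valid_iff: "valid z \<longleftrightarrow> mk z \<in> mmd_instances"
proof -
 obtain u es s t R D where z: "z = (u, es, (s, t), R, D)" by (metis prod.collapse)
 have "pair_fin_digraph (graph_of (mk z)) \<longleftrightarrow> (\<forall>e \<in> set es. fst (fst e) < length u & snd (fst e) < length u)"
 proof -
  have im: "(\<forall>e. e \<in> fst ` set es --> Q e) \<longleftrightarrow> (\<forall>e \<in> set es. Q (fst e))" for Q by blast
  show ?thesis
   unfolding pair_fin_digraph_def pair_wf_digraph_def pair_fin_digraph_axioms_def graph_of_def z mk_simps
    pair_pre_digraph.select_convs im lessThan_iff by blast
 qed
 moreover have "distinct (map fst es) \<longleftrightarrow> (\<forall>i \<in> set [0..<length es]. \<forall>j \<in> set [0..<length es].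
   fst (nth_or ((0, 0), (0, 0)) es i) = fst (nth_or ((0, 0), (0, 0)) es j) --> i = j)"
 proof -
  have "distinct (map fst es) \<longleftrightarrow> (\<forall>i < length es. \<forall>j < length es. i ~= j --> fst (es ! i) ~= fst (es ! j))"
   unfolding distinct_conv_nth by (simp cong: conj_cong imp_cong)
  also have "\<dots> \<longleftrightarrow> (\<forall>i < length es. \<forall>j < length es. fst (es ! i) = fst (es ! j) --> i = j)" by blast
  finally show ?thesis by (simp cong: imp_cong add: Ball_def)
 qed
 ultimately show ?thesis by (auto simp: valid_def z mmd_instances_def graph_of_def)
qed

text \<open>The decoder is total and returns something on malformed strings too; re-encoding and
  comparing detects them.\<close>

lemma language_dec:
 "x \<in> language_of mmd_instances mmd_encode mmd_yes \<longleftrightarrow> mmd_encode (mk (dec x)) = x & valid (dec x) & mmd_yes (mk (dec x))"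
 unfolding language_of_def valid_iff using mk_dec_encode by (auto 4 3 intro: rev_image_eqI)

lemma ptf_distinct:
 assumes "ptf f"
 shows "ptf (%z. distinct (f z :: nat list))"
proof -
 have eq: "distinct xs \<longleftrightarrow> (\<forall>i \<in> set [0..<length xs]. \<forall>j \<in> set [0..<length xs]. nth_or 0 xs i = nth_or 0 xs j --> i = j)" for xs :: "nat list"
 proof -
  have "distinct xs \<longleftrightarrow> (\<forall>i < length xs. \<forall>j < length xs. xs ! i = xs ! j --> i = j)"
   unfolding distinct_conv_nth by blast
  then show ?thesis by (simp cong: imp_cong add: Ball_def)
 qed
 have "ptf (%xs :: nat list. \<forall>i \<in> set [0..<length xs]. \<forall>j \<in> set [0..<length xs]. nth_or 0 xs i = nth_or 0 xs j --> i = j)"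
  by (intro ptfs ptf_upt_len)
 then have "ptf (distinct :: nat list => bool)" by (rule ptf_cong) (rule eq[symmetric])
 from ptf_comp[OF assms this] show ?thesis .
qed

lemma pcas_iff: "pcas s p t \<longleftrightarrow> map fst p @ [t] = s # map snd p"
 by (induction p arbitrary: s) auto

lemma pawalk_verts_eq: "pcas s p t ==> pawalk_verts s p = s # map snd p"
 by (induction p arbitrary: s) auto

section \<open>Certificates for flows\<close>

type_synonym edges = "((nat \<times> nat) \<times> (nat \<times> nat)) list"

text \<open>A sum over the list instead of a lookup; on instances, where edges are distinct, the two
  agree.\<close>

definition dl :: "edges => nat \<times> nat => nat" where
 "dl es e = (\<Sum>x\<leftarrow>es. if fst x = e then snd (snd x) else 0)"

definition pathok :: "inst => (nat \<times> nat) list => bool" where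
 "pathok z p \<longleftrightarrow> (\<forall>e \<in> set p. \<exists>x \<in> set (fst (snd z)). fst x = e) &
  map fst p @ [snd (fst (snd (snd z)))] = fst (fst (snd (snd z))) # map snd p & distinct (fst (fst (snd (snd z))) # map snd p) &
  int (\<Sum>e\<leftarrow>p. dl (fst (snd z)) e) \<le> snd (snd (snd (snd z)))"

type_synonym cert = "nat \<times> (nat \<times> (nat \<times> nat) list) list"

text \<open>\<open>fst c\<close> is the common denominator of the flow rates, so the check compares
  natural numbers only.\<close>

definition check :: "inst => cert => bool" where
 "check z c \<longleftrightarrow> 0 < fst c & (\<forall>wp \<in> set (snd c). pathok z (snd wp)) &
  (\<Sum>wp\<leftarrow>snd c. fst wp) = fst (snd (snd (snd z))) * fst c &
  (\<forall>x \<in> set (fst (snd z)). (\<Sum>wp\<leftarrow>snd c. if \<exists>e \<in> set (snd wp). e = fst x then fst wp else 0) \<le> fst (snd x) * fst c)"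

lemma ptf_dl: "ptf f ==> ptf g ==> ptf (%z. dl (f z) (g z))"
proof -
 assume fg: "ptf f" "ptf g"
 have "ptf (%w. dl (fst w) (snd w))" unfolding dl_def by (intro ptfs)
 from ptf_lift2[where h = dl, OF this fg] show ?thesis .
qed

lemma ptf_pathok: "ptf (%w. pathok (fst w) (snd w))"
 unfolding pathok_def by (intro ptfs ptf_distinct ptf_dl)

lemma ptf_check: "ptf (%w. check (fst w) (snd w))"
 unfolding check_def by (intro ptfs ptf_lift2[OF ptf_pathok])

lemma sum_list_key:
 assumes "distinct (map fst es)" "x \<in> set es"
 shows "(\<Sum>y\<leftarrow>es. if fst y = fst x then f y else 0) = (f x :: nat)"
 using assms
proof (induction es)
 case (Cons y es)
 show ?case
 proof (cases "x = y")
  case True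
  then have "(\<Sum>y\<leftarrow>es. if fst y = fst x then f y else 0) = (\<Sum>y\<leftarrow>es. 0)"
   using Cons.prems by (intro arg_cong[where f = sum_list] map_cong refl) (auto simp: rev_image_eqI)
  then show ?thesis using True by simp
 next
  case False
  then have "fst y ~= fst x" using Cons.prems by (auto simp: rev_image_eqI)
  then show ?thesis using Cons False by simp
 qed
qed simp

lemma instance_edges:
 assumes "mk z \<in> mmd_instances" "x \<in> set (fst (snd z))"
 shows "capacity (mk z) (fst x) = fst (snd x)" "delay (mk z) (fst x) = snd (snd x)" "dl (fst (snd z)) (fst x) = delay (mk z) (fst x)"
proof -
 have d: "distinct (map fst (fst (snd z)))" using assms(1) by (simp add: mmd_instances_def mk_def)
 have "map_of (fst (snd z)) (fst x) = Some (snd x)" using d assms(2) by (intro map_of_is_SomeI) auto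
 then show "capacity (mk z) (fst x) = fst (snd x)" "delay (mk z) (fst x) = snd (snd x)"
  by (simp_all add: capacity_def delay_def mk_def)
 then show "dl (fst (snd z)) (fst x) = delay (mk z) (fst x)" unfolding dl_def using sum_list_key[OF d assms(2)] by simp
qed

lemma arcs_mk: "parcs (graph_of (mk z)) = fst ` set (fst (snd z))"
 by (simp add: graph_of_def mk_def)

text \<open>The delay of a path is a sum over a set, whereas the check sums over a list; they agree
  because the edges of a path are distinct.\<close>

lemma pathok_iff:
 assumes "mk z \<in> mmd_instances"
 shows "pathok z p \<longleftrightarrow> p \<in> st_paths (graph_of (mk z)) (source (mk z)) (sink (mk z)) &
  int (path_delay (delay (mk z)) p) \<le> delay_bound (mk z)"
proof -
 have s: "source (mk z) \<in> pverts (graph_of (mk z))" using assms by (simp add: mmd_instances_def)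
 have mkz: "source (mk z) = fst (fst (snd (snd z)))" "sink (mk z) = snd (fst (snd (snd z)))" "delay_bound (mk z) = snd (snd (snd (snd z)))"
  by (simp_all add: mk_def)
 have ex: "(\<forall>e \<in> set p. \<exists>x \<in> set (fst (snd z)). fst x = e) \<longleftrightarrow> set p \<subseteq> parcs (graph_of (mk z))" unfolding arcs_mk subset_eq image_iff by metis
 have A: "pathok z p \<longleftrightarrow> (set p \<subseteq> parcs (graph_of (mk z)) & pcas (source (mk z)) p (sink (mk z)) & distinct (source (mk z) # map snd p)) &
  int (\<Sum>e\<leftarrow>p. dl (fst (snd z)) e) \<le> delay_bound (mk z)"
  unfolding pathok_def ex mkz pcas_iff by blast
 have B: "p \<in> st_paths (graph_of (mk z)) (source (mk z)) (sink (mk z)) \<longleftrightarrow>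
  set p \<subseteq> parcs (graph_of (mk z)) & pcas (source (mk z)) p (sink (mk z)) & distinct (source (mk z) # map snd p)"
  unfolding st_paths_iff using s pawalk_verts_eq[of "source (mk z)" p "sink (mk z)"] by metis
 show ?thesis
 proof (cases "set p \<subseteq> parcs (graph_of (mk z)) & pcas (source (mk z)) p (sink (mk z)) & distinct (source (mk z) # map snd p)")
  case True
  have "distinct p" using True by (auto simp: distinct_map)
  then have "path_delay (delay (mk z)) p = (\<Sum>e\<leftarrow>p. delay (mk z) e)" by (simp add: path_delay_def sum_list_distinct_conv_sum_set)
  also have "\<dots> = (\<Sum>e\<leftarrow>p. dl (fst (snd z)) e)"
  proof (intro arg_cong[where f = sum_list] map_cong refl)
   fix e assume "e \<in> set p"
   then obtain x where "x \<in> set (fst (snd z))" "e = fst x" using True by (auto simp: arcs_mk)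
   then show "delay (mk z) e = dl (fst (snd z)) e" using instance_edges(3)[OF assms] by simp
  qed
  finally show ?thesis unfolding A B by simp
 next
  case False
  then show ?thesis unfolding A B by blast
 qed
qed

lemma real_sum_list: "real (\<Sum>x\<leftarrow>xs. f x) = (\<Sum>x\<leftarrow>xs. real (f x))"
 by (induction xs) auto

lemma check_sound:
 assumes I: "mk z \<in> mmd_instances" and c: "check z (q, ws)"
 shows "mmd_yes (mk z)"
proof -
 define vs where "vs = map (%wp. (real (fst wp) / real q, snd wp)) ws"
 have q: "0 < q" using c by (simp add: check_def)
 have div: "(\<Sum>wp\<leftarrow>ws. real (f wp) / real q) = real (\<Sum>wp\<leftarrow>ws. f wp) / real q" for f :: "_ => nat"
  by (induction ws) (auto simp: add_divide_distrib)
 have "flowlist (mk z) vs"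
  unfolding flowlist_def
 proof (intro conjI ballI)
  fix wp assume "wp \<in> set vs"
  then obtain wp' where wp': "wp' \<in> set ws" "wp = (real (fst wp') / real q, snd wp')" by (auto simp: vs_def)
  have "pathok z (snd wp')" using c wp' by (simp add: check_def)
  then show "0 \<le> fst wp" "snd wp \<in> st_paths (graph_of (mk z)) (source (mk z)) (sink (mk z))"
   "int (path_delay (delay (mk z)) (snd wp)) \<le> delay_bound (mk z)"
   using wp' pathok_iff[OF I] by simp_all
 next
  have "(\<Sum>wp\<leftarrow>vs. fst wp) = real (\<Sum>wp\<leftarrow>ws. fst wp) / real q" by (simp add: vs_def o_def div)
  also have "\<dots> = real (rate (mk z))" using c q by (simp add: check_def mk_def)
  finally show "(\<Sum>wp\<leftarrow>vs. fst wp) = real (rate (mk z))" .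
 next
  fix e assume "e \<in> parcs (graph_of (mk z))"
  then obtain x where x: "x \<in> set (fst (snd z))" "e = fst x" by (auto simp: arcs_mk)
  have "(\<Sum>wp\<leftarrow>vs. if e \<in> set (snd wp) then fst wp else 0) = (\<Sum>wp\<leftarrow>ws. real (if \<exists>e' \<in> set (snd wp). e' = fst x then fst wp else 0) / real q)"
   unfolding vs_def map_map o_def by (intro arg_cong[where f = sum_list] map_cong refl) (auto simp: x(2))
  also have "\<dots> = real (\<Sum>wp\<leftarrow>ws. if \<exists>e' \<in> set (snd wp). e' = fst x then fst wp else 0) / real q" by (rule div)
  also have "\<dots> \<le> real (fst (snd x) * q) / real q"
   using c x(1) by (intro divide_right_mono of_nat_mono) (auto simp: check_def)
  also have "\<dots> = real (capacity (mk z) e)" using q instance_edges(1)[OF I x(1)] x(2) by simp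
  finally show "(\<Sum>wp\<leftarrow>vs. if e \<in> set (snd wp) then fst wp else 0) \<le> real (capacity (mk z) e)" .
 qed
 then show ?thesis using mmd_yes_iff_flowlist[OF I] by blast
qed

text \<open>The flow as a homogeneous system: column \<open>Inr None\<close> is the common
  denominator, \<open>Inr (Some e)\<close> the slack of edge \<open>e\<close>, and the rows are the
  rate and the capacities. There may be exponentially many path columns, but the bounds of
  \<open>small_integer_solution\<close> depend on the number of rows and the size of the entries
  only.\<close>

lemma check_complete:
 assumes I: "mk z \<in> mmd_instances" and yes: "mmd_yes (mk z)"
  and \<alpha>: "!!x. x \<in> set (fst (snd z)) ==> fst (snd x) \<le> \<alpha>" "rate (mk z) \<le> \<alpha>"
 defines "m \<equiv> Suc (length (fst (snd z)))"
 obtains q ws where "check z (q, ws)" "q \<le> (2 * (m + 1) * \<alpha>) ^ m" "length ws \<le> m + 1"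
  "!!wp. wp \<in> set ws ==> fst wp \<le> (2 * (m + 1) * \<alpha>) ^ m"
proof -
 let ?P = "st_paths (graph_of (mk z)) (source (mk z)) (sink (mk z))"
 define P where "P = {p \<in> ?P. int (path_delay (delay (mk z)) p) \<le> delay_bound (mk z)}"
 define E where "E = parcs (graph_of (mk z))"
 have finE: "finite E" by (simp add: E_def arcs_mk)
 have finP: "finite P" unfolding P_def using I by (intro finite_subset[OF _ finite_st_paths[of "graph_of (mk z)"]]) (auto simp: mmd_instances_def)
 have R1: "1 \<le> \<alpha>" using I \<alpha>(2) by (auto simp: mmd_instances_def)
 obtain vs where vs: "flowlist (mk z) vs" using yes mmd_yes_iff_flowlist[OF I] by blast
 define f where "f p = (\<Sum>wp\<leftarrow>vs. if snd wp = p then fst wp else 0)" for p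
 have f0: "0 \<le> f p" for p unfolding f_def using vs by (intro sum_list_nonneg) (auto simp: flowlist_def)
 have vsP: "snd wp \<in> P" if "wp \<in> set vs" for wp using vs that by (auto simp: flowlist_def P_def)
 have swap: "(\<Sum>p \<in> P. b p * f p) = (\<Sum>wp\<leftarrow>vs. b (snd wp) * fst wp)" for b :: "_ => real"
 proof -
  have "(\<Sum>p \<in> P. b p * f p) = (\<Sum>p \<in> P. \<Sum>wp\<leftarrow>vs. if snd wp = p then b p * fst wp else 0)"
   unfolding f_def sum_list_const_mult[symmetric] by (intro sum.cong arg_cong[where f = sum_list] map_cong refl) auto
  also have "\<dots> = (\<Sum>wp\<leftarrow>vs. \<Sum>p \<in> P. if snd wp = p then b p * fst wp else 0)" by (rule sum_sum_list[OF finP])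
  also have "\<dots> = (\<Sum>wp\<leftarrow>vs. b (snd wp) * fst wp)"
   using vsP finP by (intro arg_cong[where f = sum_list] map_cong refl) auto
  finally show ?thesis .
 qed
 define J where "J = Inl ` P \<union> Inr ` (insert None (Some ` E))"
 define Rw where "Rw = insert None (Some ` E)"
 define a :: "(nat \<times> nat) option => (nat \<times> nat) list + (nat \<times> nat) option => int" where
  "a r j = (case (r, j) of (None, Inl p) => 1 | (None, Inr None) => - int (rate (mk z)) | (None, Inr (Some e)) => 0
   | (Some e, Inl p) => of_bool (e \<in> set p) | (Some e, Inr None) => - int (capacity (mk z) e) | (Some e, Inr (Some e')) => of_bool (e = e'))" for r j
 define sl where "sl e = real (capacity (mk z) e) - (\<Sum>wp\<leftarrow>vs. if e \<in> set (snd wp) then fst wp else 0)" for e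
 define x :: "(nat \<times> nat) list + (nat \<times> nat) option => real" where
  "x j = (case j of Inl p => f p | Inr None => 1 | Inr (Some e) => sl e)" for j
 have sumJ: "(\<Sum>j \<in> J. g j) = (\<Sum>p \<in> P. g (Inl p)) + (g (Inr None) + (\<Sum>e \<in> E. g (Inr (Some e))))" for g :: "_ => 'z::comm_monoid_add"
 proof -
  have "(\<Sum>j \<in> J. g j) = (\<Sum>j \<in> Inl ` P. g j) + (\<Sum>j \<in> Inr ` (insert None (Some ` E)). g j)"
   unfolding J_def using finP finE by (intro sum.union_disjoint) auto
  then show ?thesis using finE by (simp add: sum.reindex image_iff)
 qed
 have finJ: "finite J" "finite Rw" using finP finE by (auto simp: J_def Rw_def)
 have cardR: "card Rw = m"
 proof -
  have "distinct (map fst (fst (snd z)))" using I by (simp add: mmd_instances_def mk_def)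
  then have "card E = length (fst (snd z))" unfolding E_def arcs_mk by (metis distinct_card length_map set_map)
  then show ?thesis using finE by (simp add: Rw_def card_image m_def)
 qed
 have x0: "0 \<le> x j" if "j \<in> J" for j
  using that f0 vs by (auto simp: J_def x_def sl_def flowlist_def E_def)
 have ker: "(\<Sum>j \<in> J. real_of_int (a r j) * x j) = 0" if "r \<in> Rw" for r
 proof (cases r)
  case None
  then show ?thesis using swap[of "%_. 1"] vs unfolding sumJ by (simp add: a_def x_def flowlist_def)
 next
  case (Some e)
  then have e: "e \<in> E" using that by (auto simp: Rw_def)
  have "(\<Sum>p \<in> P. of_bool (e \<in> set p) * f p) = (\<Sum>wp\<leftarrow>vs. if e \<in> set (snd wp) then fst wp else 0)"
   unfolding swap by (intro arg_cong[where f = sum_list] map_cong refl) auto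
  moreover have "(\<Sum>e' \<in> E. of_bool (e = e') * sl e') = sl e" using e finE by simp
  ultimately show ?thesis unfolding sumJ using Some by (simp add: a_def x_def sl_def)
 qed
 have a\<alpha>: "\<bar>a r j\<bar> \<le> int \<alpha>" if "r \<in> Rw" "j \<in> J" for r j
 proof -
  have "capacity (mk z) e \<le> \<alpha>" if "e \<in> E" for e
   using that \<alpha>(1) instance_edges(1)[OF I] by (auto simp: E_def arcs_mk)
  then show ?thesis using that R1 \<alpha>(2) by (auto simp: a_def Rw_def J_def split: option.splits sum.splits)
 qed
 obtain c where c: "1 \<le> c (Inr None)" "!!j. c j \<le> (2 * (card Rw + 1) * \<alpha>) ^ card Rw"
  "!!j. c j ~= 0 ==> j \<in> J & x j ~= 0" "card {j. c j ~= 0} \<le> card Rw + 1"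
  "!!r. r \<in> Rw ==> (\<Sum>j \<in> J. a r j * int (c j)) = 0"
  by (rule small_integer_solution[where I = Rw and J = J and k = "Inr None" and x = x and a = a and \<alpha> = \<alpha> and \<phi> = "%_. 0", OF finJ(2,1) _ _ x0 ker _ a\<alpha> R1])
   (auto simp: J_def x_def)
 define S where "S = {p \<in> P. c (Inl p) ~= 0}"
 have finS: "finite S" using finP by (simp add: S_def)
 obtain ps where ps: "set ps = S" "distinct ps" using finite_distinct_list[OF finS] by blast
 define ws where "ws = map (%p. (c (Inl p), p)) ps"
 have sumw: "(\<Sum>wp\<leftarrow>ws. if Q (snd wp) then fst wp else 0) = (\<Sum>p \<in> P. if Q p then c (Inl p) else 0)" for Q
 proof -
  have "(\<Sum>wp\<leftarrow>ws. if Q (snd wp) then fst wp else 0) = (\<Sum>p \<in> S. if Q p then c (Inl p) else 0)"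
   using ps by (simp add: ws_def o_def sum_list_distinct_conv_sum_set cong: if_cong)
  also have "\<dots> = (\<Sum>p \<in> P. if Q p then c (Inl p) else 0)" using finP by (intro sum.mono_neutral_left) (auto simp: S_def)
  finally show ?thesis .
 qed
 have "check z (c (Inr None), ws)"
  unfolding check_def
 proof (intro conjI ballI)
  show "0 < fst (c (Inr None), ws)" using c(1) by simp
  fix wp assume "wp \<in> set (snd (c (Inr None), ws))"
  then have "snd wp \<in> S" using ps(1) by (auto simp: ws_def)
  then show "pathok z (snd wp)" using pathok_iff[OF I] by (simp add: S_def P_def)
 next
  have "(\<Sum>p \<in> P. int (c (Inl p))) = int (rate (mk z)) * int (c (Inr None))"
   using c(5)[of None] unfolding sumJ by (simp add: a_def Rw_def)
  then have "int (\<Sum>p \<in> P. c (Inl p)) = int (rate (mk z) * c (Inr None))" by simp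
  then have "(\<Sum>p \<in> P. c (Inl p)) = rate (mk z) * c (Inr None)" by (simp only: of_nat_eq_iff)
  then show "(\<Sum>wp\<leftarrow>snd (c (Inr None), ws). fst wp) = fst (snd (snd (snd z))) * fst (c (Inr None), ws)"
   using sumw[of "%_. True"] by (simp add: mk_def)
 next
  fix y assume y: "y \<in> set (fst (snd z))"
  then have e: "fst y \<in> E" by (simp add: E_def arcs_mk)
  have "(\<Sum>p \<in> P. of_bool (fst y \<in> set p) * int (c (Inl p))) + int (c (Inr (Some (fst y)))) = int (capacity (mk z) (fst y)) * int (c (Inr None))"
   using c(5)[of "Some (fst y)"] e finE unfolding sumJ by (simp add: a_def Rw_def)
  moreover have "(\<Sum>p \<in> P. of_bool (fst y \<in> set p) * int (c (Inl p))) = int (\<Sum>p \<in> P. if fst y \<in> set p then c (Inl p) else 0)"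
   unfolding of_nat_sum by (intro sum.cong) auto
  ultimately have "int (\<Sum>p \<in> P. if fst y \<in> set p then c (Inl p) else 0) \<le> int (capacity (mk z) (fst y) * c (Inr None))" by simp
  then have "(\<Sum>p \<in> P. if fst y \<in> set p then c (Inl p) else 0) \<le> capacity (mk z) (fst y) * c (Inr None)" by (simp only: of_nat_le_iff)
  then show "(\<Sum>wp\<leftarrow>snd (c (Inr None), ws). if \<exists>e \<in> set (snd wp). e = fst y then fst wp else 0) \<le> fst (snd y) * fst (c (Inr None), ws)"
   using sumw[of "%p. fst y \<in> set p"] instance_edges(1)[OF I y] by (simp add: Bex_def)
 qed
 moreover have "length ws \<le> m + 1"
 proof -
  have "length ws = card S" using ps by (simp add: ws_def distinct_card[symmetric])
  also have "\<dots> = card (Inl ` S :: ((nat \<times> nat) list + (nat \<times> nat) option) set)" by (simp add: card_image)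
  also have "\<dots> \<le> card {j. c j ~= 0}"
  proof (rule card_mono)
   show "finite {j. c j ~= 0}" using finJ(1) c(3) by (rule_tac finite_subset) auto
  qed (auto simp: S_def)
  finally show ?thesis using c(4) cardR by simp
 qed
 moreover have "fst wp \<le> (2 * (m + 1) * \<alpha>) ^ m" if "wp \<in> set ws" for wp using that c(2) unfolding cardR by (auto simp: ws_def simp del: mult_Suc mult_Suc_right)
 ultimately show ?thesis using that[of "c (Inr None)" ws] c(2) unfolding cardR by blast
qed

lemma ptf_computable:
 assumes "ptf f"
 shows "poly_time_computable (f :: bool list => bool list)"
proof -
 obtain \<mu> F where F: "rpt \<mu> F" "!!x :: bool list. \<mu> (tr x) \<le> 0" "!!x :: bool list. F (tr x) = tr (f x)"
  using assms by (rule rptfE) blast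
 obtain M k where M: "wf_tm M" "!!x y. F (tbl x) = tbl y ==> \<exists>n \<le> (length x + \<mu> (tbl x) + 2) ^ k. halts_with M x y n"
  by (rule TM_of_rpt[OF F(1)]) blast
 have "\<exists>n \<le> poly ([:2, 1:] ^ k) (length x). halts_with M x (f x) n" for x
  unfolding poly_pow2 using M(2)[of x "f x"] F(2)[of x] F(3)[of x] by (simp add: tr_bools)
 then show ?thesis using M(1) unfolding poly_time_computable_def by blast
qed

lemma ptf_class_P:
 assumes "ptf Q"
 shows "{v. Q v} \<in> class_P"
proof -
 have "ptf (%v. [Q v])" by (intro ptfs assms)
 then have "poly_time_computable (%v. [Q v])" by (rule ptf_computable)
 then show ?thesis by (simp add: class_P_def)
qed

text \<open>The word is read in pairs: equal bits stand for one bit of the first component, and the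
  first unequal pair is the separator.\<close>

definition ustep :: "bool list \<times> bool list \<times> bool => bool list \<times> bool list \<times> bool" where
 "ustep s = (if snd (snd s) then s else if hd_or False (fst (snd s)) = hd_or False (tl (fst (snd s)))
  then (hd_or False (fst (snd s)) # fst s, tl (tl (fst (snd s))), False) else (fst s, tl (tl (fst (snd s))), True))"

definition unpair :: "bool list => bool list \<times> bool list" where
 "unpair v = (let s = (ustep ^^ length v) ([], v, False) in (rev (fst s), fst (snd s)))"

lemma ustep_done: "(ustep ^^ k) (acc, r, True) = (acc, r, True)"
 by (induction k) (auto simp: ustep_def)

lemma unpair_pair_word: "unpair (pair_word x w) = (x, w)"
proof -
 have "(ustep ^^ k) (acc, pair_word x w, False) = (rev x @ acc, w, True)" if "length x < k" for k acc
  using that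
 proof (induction x arbitrary: k acc)
  case Nil
  then obtain k' where "k = Suc k'" by (cases k) auto
  moreover have "ustep (acc, pair_word [] w, False) = (acc, w, True)" by (simp add: pair_word_def ustep_def)
  ultimately show ?case by (simp add: funpow_Suc_right ustep_done del: funpow.simps)
 next
  case (Cons b x)
  then obtain k' where k: "k = Suc k'" by (cases k) auto
  have "ustep (acc, pair_word (b # x) w, False) = (b # acc, pair_word x w, False)"
   by (simp add: pair_word_def ustep_def)
  then have "(ustep ^^ k) (acc, pair_word (b # x) w, False) = (ustep ^^ k') (b # acc, pair_word x w, False)"
   by (simp add: k funpow_Suc_right del: funpow.simps)
  also have "\<dots> = (rev x @ b # acc, w, True)" using Cons k by simp
  finally show ?case by simp
 qed
 moreover have "length x < length (pair_word x w)" by (induction x) (auto simp: pair_word_def)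
 ultimately show ?thesis by (simp add: unpair_def)
qed

lemma ptf_unpair: "ptf unpair"
proof -
 have "ptf (%v. (ustep ^^ length v) ([], v, False))"
 proof (rule ptf_iter[where s = "%n. Suc ((4 * n + 1) + Suc ((4 * n + 1) + 3))"])
  show "ptf (%w :: bool list \<times> bool list \<times> bool list \<times> bool. ustep (snd w))"
   unfolding ustep_def by (intro ptfs)
  show "pbd (%n. Suc ((4 * n + 1) + Suc ((4 * n + 1) + 3)))" by (intro pbds)
  fix v :: "bool list" and j assume j: "j \<le> length v"
  have inv: "length (fst ((ustep ^^ j) ([], v, False))) \<le> j & length (fst (snd ((ustep ^^ j) ([], v, False)))) \<le> length v"
  proof (induction j)
   case (Suc j)
   then show ?case by (auto simp: ustep_def)
  qed simp
  obtain acc r d where st: "(ustep ^^ j) ([], v, False) = (acc, r, d)" by (metis prod.collapse)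
  show "sz ((ustep ^^ j) ([], v, False)) \<le> Suc ((4 * sz v + 1) + Suc ((4 * sz v + 1) + 3))"
   using inv j length_le_sz[of v] sz_bools[of acc] sz_bools[of r] sz_bool[of d] by (simp add: st)
 qed (intro ptfs)+
 then show ?thesis unfolding unpair_def[abs_def] Let_def by (intro ptf_Pair ptf_rev ptf_fst ptf_snd)
qed

definition pcert :: "bool list => cert \<times> bool list" where
 "pcert = seqp pnat (plist (seqp pnat (plist (seqp pnat pnat))))"

definition epath :: "(nat \<times> nat) list => bool list" where
 "epath = enc_list (%e. enc_nat (fst e) @ enc_nat (snd e))"

definition ecert :: "cert => bool list" where
 "ecert c = enc_nat (fst c) @ enc_list (%wp. enc_nat (fst wp) @ epath (snd wp)) (snd c)"

lemma pcert_ecert: "pcert (ecert c @ v) = (c, v)"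
proof -
 have "seqp pnat pnat ((enc_nat (fst e) @ enc_nat (snd e)) @ v) = (e, v)" for e v by (simp add: seqp_def pnat_enc)
 then have p: "plist (seqp pnat pnat) (epath p @ v) = (p, v)" for p v unfolding epath_def by (rule plist_enc_list)
 have "seqp pnat (plist (seqp pnat pnat)) ((enc_nat (fst wp) @ epath (snd wp)) @ v) = (wp, v)" for wp v by (simp add: seqp_def pnat_enc p)
 then have "plist (seqp pnat (plist (seqp pnat pnat))) (enc_list (%wp. enc_nat (fst wp) @ epath (snd wp)) ws @ v) = (ws, v)" for ws v
  by (rule plist_enc_list)
 then show ?thesis by (simp add: pcert_def ecert_def seqp_def pnat_enc)
qed

lemma ptf_pcert: "ptf pcert"
 unfolding pcert_def by (intro ptf_seqp ptf_plist shrinks_seqp shrinks_plist ptf_pnat)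

definition verify :: "bool list \<times> bool list => bool" where
 "verify u \<longleftrightarrow> mmd_encode (mk (dec (fst u))) = fst u & valid (dec (fst u)) & check (dec (fst u)) (fst (pcert (snd u)))"

lemma ptf_verify: "ptf verify"
proof -
 have d: "ptf (%u :: bool list \<times> bool list. dec (fst u))" by (rule ptf_comp[OF ptf_fst[OF ptf_id] ptf_dec])
 have e: "ptf (%u :: bool list \<times> bool list. mmd_encode (mk (dec (fst u))))" by (rule ptf_comp[OF d ptf_encode_mk])
 have v: "ptf (%u :: bool list \<times> bool list. valid (dec (fst u)))" by (rule ptf_comp[OF d ptf_valid])
 have c: "ptf (%u :: bool list \<times> bool list. fst (pcert (snd u)))"
  by (rule ptf_fst[OF ptf_comp[OF ptf_snd[OF ptf_id] ptf_pcert]])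
 have ch: "ptf (%u :: bool list \<times> bool list. check (dec (fst u)) (fst (pcert (snd u))))" by (rule ptf_lift2[OF ptf_check d c])
 have eq: "ptf (%u :: bool list \<times> bool list. mmd_encode (mk (dec (fst u))) = fst u)"
  by (intro ptf_eq_list e) (intro ptfs)+
 show ?thesis unfolding verify_def[abs_def] by (rule ptf_conj[OF eq ptf_conj[OF v ch]])
qed

lemma length_enc_list: "length (enc_list e xs) = Suc (\<Sum>x\<leftarrow>xs. Suc (length (e x)))"
 by (induction xs) (auto simp: enc_list_def)

lemma length_enc_nat: "length (enc_nat n) = 2 * nb n + 1"
proof -
 have "(\<Sum>b\<leftarrow>bs. Suc (length [b])) = 2 * length bs" for bs :: "bool list" by (induction bs) auto
 then show ?thesis unfolding enc_nat_def length_enc_list by simp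
qed

lemma length_enc_list_le:
 assumes "!!x. x \<in> set xs ==> length (e x) \<le> B" "length xs \<le> k"
 shows "length (enc_list e xs) \<le> Suc (k * Suc B)"
proof -
 have "(\<Sum>x\<leftarrow>xs. Suc (length (e x))) \<le> (\<Sum>x\<leftarrow>xs. Suc B)" using assms(1) by (intro sum_list_mono) auto
 also have "\<dots> = length xs * Suc B" by (simp add: sum_list_triv del: mult_Suc_right)
 also have "\<dots> \<le> k * Suc B" using assms(2) by (intro mult_le_mono1)
 finally show ?thesis by (simp add: length_enc_list)
qed

lemma length_enc_list_ge:
 shows "length xs \<le> length (enc_list e xs)" "x \<in> set xs ==> length (e x) \<le> length (enc_list e xs)"
proof -
 show "length xs \<le> length (enc_list e xs)" unfolding length_enc_list by (induction xs) auto
 show "x \<in> set xs ==> length (e x) \<le> length (enc_list e xs)" unfolding length_enc_list by (induction xs) auto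
qed

lemma encode_bounds:
 fixes I
 defines "n \<equiv> length (mmd_encode I)"
 shows "num_verts I \<le> n" "length (edge_list I) \<le> n" "nb (rate I) \<le> n" "nb (nat \<bar>delay_bound I\<bar>) \<le> n"
  "x \<in> set (edge_list I) ==> nb (fst (fst x)) \<le> n & nb (snd (fst x)) \<le> n & nb (fst (snd x)) \<le> n & nb (snd (snd x)) \<le> n"
proof -
 have l: "n = num_verts I + 1 + length (enc_list enc_edge (edge_list I)) + length (enc_nat (source I)) + length (enc_nat (sink I))
  + length (enc_nat (rate I)) + length (enc_int (delay_bound I))" by (simp add: n_def mmd_encode_def)
 show "num_verts I \<le> n" using l by simp
 show "length (edge_list I) \<le> n" using l length_enc_list_ge(1)[of "edge_list I" enc_edge] by linarith
 show "nb (rate I) \<le> n" using l length_enc_nat[of "rate I"] by linarith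
 show "nb (nat \<bar>delay_bound I\<bar>) \<le> n" using l length_enc_nat[of "nat \<bar>delay_bound I\<bar>"] by (simp add: enc_int_def)
 assume x: "x \<in> set (edge_list I)"
 have "length (enc_edge x) \<le> n" using length_enc_list_ge(2)[OF x, of enc_edge] l by linarith
 then show "nb (fst (fst x)) \<le> n & nb (snd (fst x)) \<le> n & nb (fst (snd x)) \<le> n & nb (snd (snd x)) \<le> n"
  by (cases x rule: enc_edge.cases) (simp add: length_enc_nat)
qed

lemma certificate_exists:
 assumes yes: "mmd_yes I" and I: "I \<in> mmd_instances"
 defines "n \<equiv> length (mmd_encode I)"
 obtains w where "verify (mmd_encode I, w)"
  "length w \<le> (2 * ((2 * n + 3) * (n + 1) + 1) + 1) + Suc ((n + 2) * Suc ((2 * ((2 * n + 3) * (n + 1) + 1) + 1) + Suc (n * Suc (4 * n + 2))))"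
proof -
 define z where "z = dec (mmd_encode I)"
 have mkz: "mk z = I" by (simp add: z_def mk_dec_encode)
 have es: "fst (snd z) = edge_list I" by (simp add: z_def dec_encode)
 have Iz: "mk z \<in> mmd_instances" "mmd_yes (mk z)" using I yes mkz by simp_all
 note eb = encode_bounds[where I = I, folded n_def]
 have pw: "k \<le> 2 ^ n" if "nb k \<le> n" for k :: nat
 proof -
  have "(2::nat) ^ nb k \<le> 2 ^ n" using that by (intro power_increasing) auto
  then show ?thesis using less_nb[of k] by linarith
 qed
 have cap: "!!x. x \<in> set (fst (snd z)) ==> fst (snd x) \<le> 2 ^ n" using eb(5) pw unfolding es by blast
 have rt: "rate (mk z) \<le> 2 ^ n" using eb(3) pw mkz by simp
 define m where "m = Suc (length (fst (snd z)))"
 have m: "m \<le> n + 1" using eb(2) by (simp add: m_def es)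
 have "\<exists>q ws. check z (q, ws) & q \<le> (2 * (m + 1) * 2 ^ n) ^ m & length ws \<le> m + 1 &
  (\<forall>wp \<in> set ws. fst wp \<le> (2 * (m + 1) * 2 ^ n) ^ m)"
 proof (rule check_complete[OF Iz cap rt, folded m_def])
  fix q ws assume "check z (q, ws)" "q \<le> (2 * (m + 1) * 2 ^ n) ^ m" "length ws \<le> m + 1"
   and "!!wp. wp \<in> set ws ==> fst wp \<le> (2 * (m + 1) * 2 ^ n) ^ m"
  then show ?thesis by (intro exI[of _ q] exI[of _ ws] conjI ballI)
 qed
 then obtain q ws where c: "check z (q, ws)" "q \<le> (2 * (m + 1) * 2 ^ n) ^ m" "length ws \<le> m + 1"
  "!!wp. wp \<in> set ws ==> fst wp \<le> (2 * (m + 1) * 2 ^ n) ^ m" by blast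
 \<comment> \<open>Bounds the bit length of the denominator and of the weights. It comes from
   \<open>m + 1 \<le> 2 ^ m\<close> and \<open>m \<le> n + 1\<close> and is quadratic in
   \<open>n\<close>.\<close>
 define \<kappa> where "\<kappa> = (2 * n + 3) * (n + 1) + 1"
 have nbK: "nb k \<le> \<kappa>" if "k \<le> (2 * (m + 1) * 2 ^ n) ^ m" for k
 proof -
  have "m + 1 \<le> 2 ^ m" using less_exp[of m] by linarith
  then have "2 * (m + 1) * 2 ^ n \<le> 2 * 2 ^ m * 2 ^ n" by (intro mult_le_mono le_refl)
  also have "\<dots> = 2 ^ (m + n + 1)" by (simp add: power_add)
  finally have "(2 * (m + 1) * 2 ^ n) ^ m \<le> (2 ^ (m + n + 1)) ^ m" by (intro power_mono) auto
  also have "\<dots> = 2 ^ ((m + n + 1) * m)" by (simp only: power_mult)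
  also have "\<dots> < 2 ^ ((m + n + 1) * m + 1)" by simp
  finally have "k < 2 ^ ((m + n + 1) * m + 1)" using that by linarith
  then have "nb k \<le> (m + n + 1) * m + 1" by (rule nb_le)
  moreover have "(m + n + 1) * m \<le> (2 * n + 3) * (n + 1)" using m by (intro mult_le_mono) auto
  ultimately show ?thesis unfolding \<kappa>_def by linarith
 qed
 have ep: "length (epath (snd wp)) \<le> Suc (n * Suc (4 * n + 2))" if "wp \<in> set ws" for wp
 proof -
  have ok: "pathok z (snd wp)" using c(1) that by (simp add: check_def)
  have sub: "set (snd wp) \<subseteq> fst ` set (edge_list I)" using ok unfolding pathok_def es subset_eq image_iff by metis
  have "distinct (snd wp)" using ok unfolding pathok_def by (auto simp: distinct_map)
  then have "length (snd wp) = card (set (snd wp))" by (simp add: distinct_card)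
  also have "\<dots> \<le> card (fst ` set (edge_list I))" using sub by (intro card_mono) auto
  also have "\<dots> \<le> length (edge_list I)" using card_image_le[of "set (edge_list I)" fst] card_length[of "edge_list I"] by simp
  also have "\<dots> \<le> n" by (rule eb(2))
  finally have len: "length (snd wp) \<le> n" .
  show ?thesis unfolding epath_def
  proof (rule length_enc_list_le[OF _ len])
   fix e assume "e \<in> set (snd wp)"
   then obtain x where "x \<in> set (edge_list I)" "e = fst x" using sub by blast
   then show "length (enc_nat (fst e) @ enc_nat (snd e)) \<le> 4 * n + 2" using eb(5)[of x] by (simp add: length_enc_nat)
  qed
 qed
 have "length (enc_list (%wp. enc_nat (fst wp) @ epath (snd wp)) ws) \<le> Suc ((n + 2) * Suc ((2 * \<kappa> + 1) + Suc (n * Suc (4 * n + 2))))"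
 proof (rule length_enc_list_le)
  fix wp assume w: "wp \<in> set ws"
  have "length (enc_nat (fst wp)) \<le> 2 * \<kappa> + 1" using nbK[OF c(4)[OF w]] by (simp add: length_enc_nat)
  then show "length (enc_nat (fst wp) @ epath (snd wp)) \<le> (2 * \<kappa> + 1) + Suc (n * Suc (4 * n + 2))" using ep[OF w] unfolding length_append by linarith
 qed (use c(3) m in simp)
 moreover have "length (enc_nat q) \<le> 2 * \<kappa> + 1" using nbK[OF c(2)] by (simp add: length_enc_nat)
 ultimately have "length (ecert (q, ws)) \<le> (2 * \<kappa> + 1) + Suc ((n + 2) * Suc ((2 * \<kappa> + 1) + Suc (n * Suc (4 * n + 2))))"
  unfolding ecert_def length_append fst_conv snd_conv by linarith
 moreover have "verify (mmd_encode I, ecert (q, ws))"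
  using c(1) Iz(1) pcert_ecert[of "(q, ws)" "[]"] mkz by (simp add: verify_def valid_iff z_def mk_dec_encode)
 ultimately show ?thesis using that unfolding \<kappa>_def by blast
qed

lemma mmd_in_NP: "language_of mmd_instances mmd_encode mmd_yes \<in> class_NP"
proof -
 have "pbd (%n. (2 * ((2 * n + 3) * (n + 1) + 1) + 1) + Suc ((n + 2) * Suc ((2 * ((2 * n + 3) * (n + 1) + 1) + 1) + Suc (n * Suc (4 * n + 2)))))"
  (is "pbd ?W") by (intro pbds)
 then obtain k where k: "!!n. ?W n \<le> (n + 2) ^ k" unfolding pbd_def by blast
 let ?p = "[:2, 1:] ^ k :: nat poly" and ?L = "language_of mmd_instances mmd_encode mmd_yes" and ?V = "{v. verify (unpair v)}"
 have "x \<in> ?L \<longleftrightarrow> (\<exists>w. length w \<le> poly ?p (length x) & pair_word x w \<in> ?V)" for x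
 proof
  assume "x \<in> ?L"
  then obtain I where I: "I \<in> mmd_instances" "mmd_yes I" "x = mmd_encode I" by (auto simp: language_of_def)
  obtain w where w: "verify (mmd_encode I, w)" "length w \<le> ?W (length (mmd_encode I))" by (rule certificate_exists[OF I(2,1)]) blast
  have "length w \<le> poly ?p (length x)" unfolding poly_pow2 I(3) using w(2) k order_trans by blast
  then show "\<exists>w. length w \<le> poly ?p (length x) & pair_word x w \<in> ?V" using w(1) I(3) by (auto simp: unpair_pair_word)
 next
  assume "\<exists>w. length w \<le> poly ?p (length x) & pair_word x w \<in> ?V"
  then obtain w where w: "verify (x, w)" by (auto simp: unpair_pair_word)
  obtain q ws where qw: "fst (pcert w) = (q, ws)" by (cases "fst (pcert w)")
  have "mk (dec x) \<in> mmd_instances" using w by (simp add: verify_def valid_iff)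
  moreover have "check (dec x) (q, ws)" using w qw by (simp add: verify_def)
  ultimately have "mmd_yes (mk (dec x))" by (rule check_sound)
  then show "x \<in> ?L" unfolding language_dec using w by (simp add: verify_def)
 qed
 moreover have "?V \<in> class_P" by (rule ptf_class_P[OF ptf_comp[OF ptf_unpair ptf_verify]])
 ultimately show ?thesis unfolding class_NP_def by blast
qed

section \<open>A pseudo-polynomial algorithm\<close>

type_synonym edge = "(nat \<times> nat) \<times> (nat \<times> nat)"

text \<open>The arc \<open>(x, \<tau>)\<close> of the time-expanded graph leaves the tail of the edge \<open>x\<close> at time \<open>\<tau>\<close>.\<close>

definition tarcs :: "edges => nat => (edge \<times> nat) set" where
 "tarcs es D = {a. fst a \<in> set es & snd a + snd (snd (fst a)) \<le> D}"

definition ttail :: "edge \<times> nat => nat \<times> nat" where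
 "ttail a = (fst (fst (fst a)), snd a)"

definition thead :: "edge \<times> nat => nat \<times> nat" where
 "thead a = (snd (fst (fst a)), snd a + snd (snd (fst a)))"

lemma finite_tarcs: "finite (tarcs es D)"
proof (rule finite_subset)
 show "tarcs es D \<subseteq> set es \<times> {..D}" by (auto simp: tarcs_def)
qed simp

text \<open>The copies of the sink are left unbalanced, so flow may end at any time up to
  \<open>D\<close>. One capacity is shared by all time copies of an edge; this coupling is why
  linear programming and not a maximum flow computation is used.\<close>

definition tflow :: "mmd_instance => nat => bool" where
 "tflow I D \<longleftrightarrow> (\<exists>y. (\<forall>a \<in> tarcs (edge_list I) D. 0 \<le> y a) &
  (\<forall>v. fst v ~= sink I --> (\<Sum>a | a \<in> tarcs (edge_list I) D & ttail a = v. y a) - (\<Sum>a | a \<in> tarcs (edge_list I) D & thead a = v. y a)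
    = (if v = (source I, 0) then real (rate I) else 0)) &
  (\<forall>x \<in> set (edge_list I). (\<Sum>a | a \<in> tarcs (edge_list I) D & fst a = x. y a) \<le> real (fst (snd x))))"

lemma wk_tarcs:
 assumes "wk ttail thead u p v" "set p \<subseteq> tarcs es D" "snd u \<le> D"
 shows "pcas (fst u) (map (%a. fst (fst a)) p) (fst v)" "snd u + (\<Sum>a\<leftarrow>p. snd (snd (fst a))) \<le> D"
proof -
 have "pcas (fst u) (map (%a. fst (fst a)) p) (fst v) & snd u + (\<Sum>a\<leftarrow>p. snd (snd (fst a))) \<le> D"
  using assms
 proof (induction p arbitrary: u)
  case (Cons a p)
  have a: "ttail a = u" "wk ttail thead (thead a) p v" "a \<in> tarcs es D" "set p \<subseteq> tarcs es D" using Cons.prems by auto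
  have "snd (thead a) \<le> D" using a(3) by (simp add: thead_def tarcs_def)
  from Cons.IH[OF a(2,4) this] show ?case using a(1) by (auto simp: thead_def ttail_def)
 qed auto
 then show "pcas (fst u) (map (%a. fst (fst a)) p) (fst v)" "snd u + (\<Sum>a\<leftarrow>p. snd (snd (fst a))) \<le> D" by simp_all
qed

fun tx :: "(nat \<times> nat => nat \<times> nat) => nat => (nat \<times> nat) list => (edge \<times> nat) list" where
 "tx w \<tau> [] = []"
| "tx w \<tau> (e # p) = ((e, w e), \<tau>) # tx w (\<tau> + snd (w e)) p"

lemma wk_tx: "pcas u p v ==> wk ttail thead (u, \<tau>) (tx w \<tau> p) (v, \<tau> + (\<Sum>e\<leftarrow>p. snd (w e)))"
proof (induction p arbitrary: u \<tau>)
 case (Cons e p)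
 have "pcas (snd e) p v" "fst e = u" using Cons.prems by (cases e; simp)+
 from Cons.IH[OF this(1), of "\<tau> + snd (w e)"] this(2) show ?case by (simp add: ttail_def thead_def add.assoc)
qed simp

lemma tx_tarcs: "(!!e. e \<in> set p ==> (e, w e) \<in> set es) ==> \<tau> + (\<Sum>e\<leftarrow>p. snd (w e)) \<le> D ==> set (tx w \<tau> p) \<subseteq> tarcs es D"
proof (induction p arbitrary: \<tau>)
 case (Cons e p)
 have "set (tx w (\<tau> + snd (w e)) p) \<subseteq> tarcs es D" using Cons.prems by (intro Cons.IH) (auto simp: add.assoc)
 then show ?case using Cons.prems by (simp add: tarcs_def)
qed simp

lemma map_fst_tx: "map fst (tx w \<tau> p) = map (%e. (e, w e)) p"
 by (induction p arbitrary: \<tau>) auto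

lemma sum_count_list:
 assumes "finite A"
 shows "(\<Sum>a | a \<in> A & f a = x. real (count_list l a)) \<le> real (count_list (map f l) x)"
proof (induction l)
 case (Cons b l)
 have "(\<Sum>a | a \<in> A & f a = x. real (count_list (b # l) a)) = (\<Sum>a | a \<in> A & f a = x. real (count_list l a) + of_bool (a = b))"
  by (intro sum.cong) auto
 also have "\<dots> = (\<Sum>a | a \<in> A & f a = x. real (count_list l a)) + (\<Sum>a | a \<in> A & f a = x. of_bool (a = b))" by (rule sum.distrib)
 also have "(\<Sum>a | a \<in> A & f a = x. of_bool (a = b) :: real) \<le> of_bool (f b = x)"
  using assms by (simp add: of_bool_def if_distrib)
 finally show ?case using Cons.IH by (auto split: if_splits)
qed simp

lemma count_list_distinct: "distinct l ==> count_list l x \<le> of_bool (x \<in> set l)"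
 by (induction l) auto

lemma st_path_distinct: "p \<in> st_paths G s t ==> distinct p"
 using pawalk_verts_eq[of s p t] by (auto simp: st_paths_iff distinct_map)

lemma instance_map_of:
 assumes "I \<in> mmd_instances" "x \<in> set (edge_list I)"
 shows "x = (fst x, (capacity I (fst x), delay I (fst x)))" "capacity I (fst x) = fst (snd x)" "delay I (fst x) = snd (snd x)"
proof -
 have "map_of (edge_list I) (fst x) = Some (snd x)" using assms by (intro map_of_is_SomeI) (auto simp: mmd_instances_def)
 then show "x = (fst x, (capacity I (fst x), delay I (fst x)))" "capacity I (fst x) = fst (snd x)" "delay I (fst x) = snd (snd x)"
  by (simp_all add: capacity_def delay_def)
qed

text \<open>Each path is unrolled in time by \<open>tx\<close>. As a path it uses every edge at most
  once, so its load on all time copies of an edge together is its load on the edge.\<close>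

lemma mmd_yes_imp_tflow:
 assumes I: "I \<in> mmd_instances" and yes: "mmd_yes I"
 shows "0 \<le> delay_bound I & tflow I (nat (delay_bound I))"
proof -
 let ?D = "nat (delay_bound I)"
 let ?As = "tarcs (edge_list I) ?D"
 obtain ws where ws: "flowlist I ws" using yes mmd_yes_iff_flowlist[OF I] by blast
 have R: "0 < rate I" using I by (simp add: mmd_instances_def)
 have "ws ~= []" using ws R by (auto simp: flowlist_def)
 then obtain wp where "wp \<in> set ws" by (cases ws) auto
 then have D0: "0 \<le> delay_bound I" using ws by (fastforce simp: flowlist_def)
 define w where "w e = (capacity I e, delay I e)" for e
 define y where "y a = (\<Sum>wp\<leftarrow>ws. fst wp * real (count_list (tx w 0 (snd wp)) a))" for a
 have path: "snd wp \<in> st_paths (graph_of I) (source I) (sink I)" "0 \<le> fst wp" "path_delay (delay I) (snd wp) \<le> ?D" if "wp \<in> set ws" for wp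
  using ws that by (auto simp: flowlist_def)
 have arcs: "(e, w e) \<in> set (edge_list I)" if "e \<in> parcs (graph_of I)" for e
 proof -
  obtain x where x: "x \<in> set (edge_list I)" "e = fst x" using \<open>e \<in> parcs (graph_of I)\<close> by (auto simp: graph_of_def)
  then show ?thesis using instance_map_of(1)[OF I x(1)] by (simp add: w_def)
 qed
 have txs: "set (tx w 0 (snd wp)) \<subseteq> ?As" "wk ttail thead (source I, 0) (tx w 0 (snd wp)) (sink I, \<Sum>e\<leftarrow>snd wp. snd (w e))" if "wp \<in> set ws" for wp
 proof -
  have "path_delay (delay I) (snd wp) = (\<Sum>e\<leftarrow>snd wp. snd (w e))"
   using st_path_distinct[OF path(1)[OF that]] by (simp add: path_delay_def sum_list_distinct_conv_sum_set w_def)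
  then show "set (tx w 0 (snd wp)) \<subseteq> ?As"
   using path(1,3)[OF that] arcs by (intro tx_tarcs) (auto simp: st_paths_iff)
  show "wk ttail thead (source I, 0) (tx w 0 (snd wp)) (sink I, \<Sum>e\<leftarrow>snd wp. snd (w e))"
   using wk_tx[of "source I" "snd wp" "sink I" 0 w] path(1)[OF that] by (simp add: st_paths_iff)
 qed
 have sy: "(\<Sum>a | a \<in> ?As & Q a. y a) = (\<Sum>wp\<leftarrow>ws. fst wp * (\<Sum>a | a \<in> ?As & Q a. real (count_list (tx w 0 (snd wp)) a)))" for Q
  unfolding y_def by (subst sum_sum_list) (auto simp: finite_tarcs sum_distrib_left)
 have "tflow I ?D"
  unfolding tflow_def
 proof (intro exI[of _ y] conjI ballI allI impI)
  show "0 \<le> y a" for a unfolding y_def using path(2) by (intro sum_list_nonneg) auto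
  fix v :: "nat \<times> nat" assume v: "fst v ~= sink I"
  have "(\<Sum>a | a \<in> ?As & ttail a = v. y a) - (\<Sum>a | a \<in> ?As & thead a = v. y a)
   = (\<Sum>wp\<leftarrow>ws. fst wp * ((\<Sum>a | a \<in> ?As & ttail a = v. real (count_list (tx w 0 (snd wp)) a)) -
     (\<Sum>a | a \<in> ?As & thead a = v. real (count_list (tx w 0 (snd wp)) a))))"
   unfolding sy by (simp add: sum_list_subtractf right_diff_distrib)
  also have "\<dots> = (\<Sum>wp\<leftarrow>ws. fst wp * of_bool (v = (source I, 0)))"
  proof (intro arg_cong[where f = sum_list] map_cong refl)
   fix wp assume wp: "wp \<in> set ws"
   show "fst wp * ((\<Sum>a | a \<in> ?As & ttail a = v. real (count_list (tx w 0 (snd wp)) a)) -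
     (\<Sum>a | a \<in> ?As & thead a = v. real (count_list (tx w 0 (snd wp)) a))) = fst wp * of_bool (v = (source I, 0))"
    using walk_balance[OF finite_tarcs txs(1,2)[OF wp], of v] v by auto
  qed
  also have "\<dots> = (if v = (source I, 0) then real (rate I) else 0)" using ws by (simp add: flowlist_def)
  finally show "(\<Sum>a | a \<in> ?As & ttail a = v. y a) - (\<Sum>a | a \<in> ?As & thead a = v. y a) = (if v = (source I, 0) then real (rate I) else 0)" .
 next
  fix x assume x: "x \<in> set (edge_list I)"
  have "(\<Sum>a | a \<in> ?As & fst a = x. y a) \<le> (\<Sum>wp\<leftarrow>ws. if fst x \<in> set (snd wp) then fst wp else 0)"
   unfolding sy
  proof (rule sum_list_mono)
   fix wp assume wp: "wp \<in> set ws"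
   have "distinct (map (%e. (e, w e)) (snd wp))"
    using st_path_distinct[OF path(1)[OF wp]] by (simp add: distinct_map inj_on_def)
   from count_list_distinct[OF this, of x]
   have "count_list (map fst (tx w 0 (snd wp))) x \<le> of_bool (fst x \<in> set (snd wp))" unfolding map_fst_tx by (auto simp: of_bool_def split: if_splits)
   then have "real (count_list (map fst (tx w 0 (snd wp))) x) \<le> of_bool (fst x \<in> set (snd wp))" by (auto simp: of_bool_def split: if_splits)
   then have "(\<Sum>a | a \<in> ?As & fst a = x. real (count_list (tx w 0 (snd wp)) a)) \<le> of_bool (fst x \<in> set (snd wp))"
    using sum_count_list[where A = ?As and f = fst and x = x and l = "tx w 0 (snd wp)", OF finite_tarcs] by linarith
   from mult_left_mono[OF this path(2)[OF wp]]
   show "fst wp * (\<Sum>a | a \<in> ?As & fst a = x. real (count_list (tx w 0 (snd wp)) a)) \<le> (if fst x \<in> set (snd wp) then fst wp else 0)"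
    by (auto split: if_splits)
  qed
  also have "\<dots> \<le> real (capacity I (fst x))" using ws x by (simp add: flowlist_def graph_of_def)
  finally show "(\<Sum>a | a \<in> ?As & fst a = x. y a) \<le> real (fst (snd x))" using instance_map_of(2)[OF I x] by simp
 qed
 with D0 show ?thesis by blast
qed

lemma sum_list_member_le: "x \<in> set xs ==> (f x :: nat) \<le> (\<Sum>x\<leftarrow>xs. f x)"
 by (induction xs) auto

lemma sum_set_le_sum_list: "(\<Sum>x \<in> set xs. f x) \<le> (\<Sum>x\<leftarrow>xs. f x :: nat)"
proof (induction xs)
 case (Cons x xs)
 then show ?case by (cases "x \<in> set xs") (auto simp: insert_absorb)
qed simp

text \<open>A walk in the time-expanded graph may revisit a vertex at a later time. Shortcutting it
  to a path only removes edges, so delays do not grow; nor do loads, since a walk loads an edge as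
  often as it passes, and a path at most once.\<close>

lemma tflow_imp_mmd_yes:
 assumes I: "I \<in> mmd_instances" and D: "0 \<le> delay_bound I" "tflow I (nat (delay_bound I))"
 shows "mmd_yes I"
proof -
 let ?D = "nat (delay_bound I)"
 let ?As = "tarcs (edge_list I) ?D"
 let ?P = "st_paths (graph_of I) (source I) (sink I)"
 have g: "pair_fin_digraph (graph_of I)" "source I \<in> pverts (graph_of I)" "source I ~= sink I"
  using I by (auto simp: mmd_instances_def)
 obtain y where y: "!!a. a \<in> ?As ==> 0 \<le> y a"
  "!!v. fst v ~= sink I ==> (\<Sum>a | a \<in> ?As & ttail a = v. y a) - (\<Sum>a | a \<in> ?As & thead a = v. y a)
    = (if v = (source I, 0) then real (rate I) else 0)"
  "!!x. x \<in> set (edge_list I) ==> (\<Sum>a | a \<in> ?As & fst a = x. y a) \<le> real (fst (snd x))"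
  using D(2) unfolding tflow_def by blast
 have "\<exists>ws. (\<forall>wp \<in> set ws. 0 \<le> fst wp & set (snd wp) \<subseteq> ?As & (\<exists>z \<in> {v. fst v = sink I}. wk ttail thead (source I, 0) (snd wp) z)) &
  (\<Sum>wp\<leftarrow>ws. fst wp) = real (rate I) & (\<forall>a \<in> ?As. (\<Sum>wp\<leftarrow>ws. fst wp * real (count_list (snd wp) a)) \<le> y a)"
  by (rule flow_decomposition[OF finite_tarcs]) (use g(3) y(1,2) in auto)
 then obtain ws where ws: "!!wp. wp \<in> set ws ==> 0 \<le> fst wp & set (snd wp) \<subseteq> ?As & (\<exists>z \<in> {v. fst v = sink I}. wk ttail thead (source I, 0) (snd wp) z)"
  "(\<Sum>wp\<leftarrow>ws. fst wp) = real (rate I)" "!!a. a \<in> ?As ==> (\<Sum>wp\<leftarrow>ws. fst wp * real (count_list (snd wp) a)) \<le> y a" by blast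
 define Q where "Q p = (SOME q. q \<in> ?P & set q \<subseteq> (%a. fst (fst a)) ` set p)" for p :: "(edge \<times> nat) list"
 have Q: "Q (snd wp) \<in> ?P" "set (Q (snd wp)) \<subseteq> (%a. fst (fst a)) ` set (snd wp)" "path_delay (delay I) (Q (snd wp)) \<le> ?D" if wp: "wp \<in> set ws" for wp
 proof -
  obtain v where v: "fst v = sink I" "wk ttail thead (source I, 0) (snd wp) v" "set (snd wp) \<subseteq> ?As" using ws(1)[OF wp] by blast
  have pc: "pcas (source I) (map (%a. fst (fst a)) (snd wp)) (sink I)" "(\<Sum>a\<leftarrow>snd wp. snd (snd (fst a))) \<le> ?D"
   using wk_tarcs[OF v(2,3)] v(1) by simp_all
  have "set (map (%a. fst (fst a)) (snd wp)) \<subseteq> parcs (graph_of I)" using v(3) by (auto simp: graph_of_def tarcs_def)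
  from walk_contains_path[OF g(1,2) this pc(1)] obtain q where "q \<in> ?P" "set q \<subseteq> set (map (%a. fst (fst a)) (snd wp))" .
  then have ex: "\<exists>q. q \<in> ?P & set q \<subseteq> (%a. fst (fst a)) ` set (snd wp)" unfolding set_map by blast
  from someI_ex[OF ex] show q: "Q (snd wp) \<in> ?P" "set (Q (snd wp)) \<subseteq> (%a. fst (fst a)) ` set (snd wp)" unfolding Q_def by blast+
  have "path_delay (delay I) (Q (snd wp)) \<le> (\<Sum>e \<in> set (map (%a. fst (fst a)) (snd wp)). delay I e)"
   unfolding path_delay_def using q(2) by (intro sum_mono2) auto
  also have "\<dots> \<le> (\<Sum>e\<leftarrow>map (%a. fst (fst a)) (snd wp). delay I e)" by (rule sum_set_le_sum_list)
  also have "\<dots> = (\<Sum>a\<leftarrow>snd wp. snd (snd (fst a)))"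
   unfolding map_map o_def using v(3) instance_map_of(3)[OF I]
   by (intro arg_cong[where f = sum_list] map_cong refl) (auto simp: tarcs_def)
  finally show "path_delay (delay I) (Q (snd wp)) \<le> ?D" using pc(2) by linarith
 qed
 have "flowlist I (map (%wp. (fst wp, Q (snd wp))) ws)"
  unfolding flowlist_def
 proof (intro conjI ballI)
  fix wp assume "wp \<in> set (map (%wp. (fst wp, Q (snd wp))) ws)"
  then obtain wp' where wp: "wp' \<in> set ws" "wp = (fst wp', Q (snd wp'))" by auto
  show "0 \<le> fst wp" "snd wp \<in> ?P" using wp ws(1) Q(1) by auto
  show "int (path_delay (delay I) (snd wp)) \<le> delay_bound I" using Q(3)[OF wp(1)] D(1) wp(2) by (simp add: le_nat_iff)
 next
  show "(\<Sum>wp\<leftarrow>map (%wp. (fst wp, Q (snd wp))) ws. fst wp) = real (rate I)" using ws(2) by (simp add: o_def)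
 next
  fix e assume "e \<in> parcs (graph_of I)"
  then obtain x where x: "x \<in> set (edge_list I)" "e = fst x" by (auto simp: graph_of_def)
  have "(\<Sum>wp\<leftarrow>map (%wp. (fst wp, Q (snd wp))) ws. if e \<in> set (snd wp) then fst wp else 0)
   \<le> (\<Sum>wp\<leftarrow>ws. \<Sum>a | a \<in> ?As & fst a = x. fst wp * real (count_list (snd wp) a))"
   unfolding map_map o_def fst_conv snd_conv
  proof (rule sum_list_mono)
   fix wp assume wp: "wp \<in> set ws"
   show "(if e \<in> set (Q (snd wp)) then fst wp else 0) \<le> (\<Sum>a | a \<in> ?As & fst a = x. fst wp * real (count_list (snd wp) a))"
   proof (cases "e \<in> set (Q (snd wp))")
    case True
    then obtain a where a: "a \<in> set (snd wp)" "fst (fst a) = e" using Q(2)[OF wp] by auto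
    have aA: "a \<in> ?As" using a(1) ws(1)[OF wp] by auto
    then have "fst a \<in> set (edge_list I)" by (simp add: tarcs_def)
    then have "fst a = x" using instance_map_of(1)[OF I] x a(2) by metis
    then have "fst wp * real (count_list (snd wp) a) \<le> (\<Sum>a | a \<in> ?As & fst a = x. fst wp * real (count_list (snd wp) a))"
     using aA ws(1)[OF wp] by (intro member_le_sum) (auto simp: finite_tarcs)
    moreover have "1 \<le> real (count_list (snd wp) a)" using a(1) count_list_0_iff[of "snd wp" a] by linarith
    then have "fst wp * 1 \<le> fst wp * real (count_list (snd wp) a)" using ws(1)[OF wp] by (intro mult_left_mono) auto
    ultimately show ?thesis using True by simp
   next
    case False
    then show ?thesis using ws(1)[OF wp] by (auto intro!: sum_nonneg)
   qed
  qed
  also have "\<dots> = (\<Sum>a | a \<in> ?As & fst a = x. \<Sum>wp\<leftarrow>ws. fst wp * real (count_list (snd wp) a))"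
   by (rule sum_sum_list[symmetric]) (simp add: finite_tarcs)
  also have "\<dots> \<le> (\<Sum>a | a \<in> ?As & fst a = x. y a)" using ws(3) by (intro sum_mono) auto
  also have "\<dots> \<le> real (capacity I e)" using y(3)[OF x(1)] instance_map_of(2)[OF I x(1)] x(2) by simp
  finally show "(\<Sum>wp\<leftarrow>map (%wp. (fst wp, Q (snd wp))) ws. if e \<in> set (snd wp) then fst wp else 0) \<le> real (capacity I e)" .
 qed
 then show ?thesis using mmd_yes_iff_flowlist[OF I] by blast
qed

text \<open>Lets rows and columns be indexed by structured data; only the first column is
  distinguished, as the homogenising one.\<close>

lemma hf_columns:
 assumes "distinct cols" "cols ~= []"
 shows "hf (map (%r. map (g r) cols) rows) (length cols) \<longleftrightarrow>
  (\<exists>X. (\<forall>c \<in> set cols. 0 \<le> X c) & (\<forall>r \<in> set rows. (\<Sum>c \<in> set cols. real_of_int (g r c) * X c) = 0) & 0 < X (hd cols))"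
proof
 let ?A = "map (%r. map (g r) cols) rows"
 have bij: "bij_betw (%j. cols ! j) {..<length cols} (set cols)" by (rule bij_betw_nth[OF assms(1) refl refl])
 have re: "(\<Sum>j<length cols. h (cols ! j)) = (\<Sum>c \<in> set cols. h c)" for h :: "_ => real" by (rule sum.reindex_bij_betw[OF bij])
 have m: "mat ?A i j = g (rows ! i) (cols ! j)" if "i < length rows" "j < length cols" for i j using that by (simp add: mat_def)
 {
  assume "hf ?A (length cols)"
  then obtain x where x: "!!j. j < length cols ==> 0 \<le> x j" "!!i. i < length ?A ==> (\<Sum>j<length cols. real_of_int (mat ?A i j) * x j) = 0" "0 < x 0"
   unfolding hf_def by blast
  define X where "X c = x (the_inv_into {..<length cols} (%j. cols ! j) c)" for c
  have X: "X (cols ! j) = x j" if "j < length cols" for j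
   unfolding X_def using the_inv_into_f_f[of "%j. cols ! j" "{..<length cols}" j] bij that by (simp add: bij_betw_def)
  have "\<forall>c \<in> set cols. 0 \<le> X c" using x(1) X by (auto simp: in_set_conv_nth)
  moreover have "(\<Sum>c \<in> set cols. real_of_int (g r c) * X c) = 0" if r: "r \<in> set rows" for r
  proof -
   obtain i where i: "i < length rows" "r = rows ! i" using r by (auto simp: in_set_conv_nth)
   have "(\<Sum>c \<in> set cols. real_of_int (g r c) * X c) = (\<Sum>j<length cols. real_of_int (g r (cols ! j)) * X (cols ! j))" by (rule re[symmetric])
   also have "\<dots> = (\<Sum>j<length cols. real_of_int (mat ?A i j) * x j)" using m[OF i(1)] X i(2) by (intro sum.cong) auto
   finally show ?thesis using x(2)[of i] i(1) by simp
  qed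
  moreover have "0 < X (hd cols)" using X[of 0] x(3) assms(2) by (simp add: hd_conv_nth)
  ultimately show "\<exists>X. (\<forall>c \<in> set cols. 0 \<le> X c) & (\<forall>r \<in> set rows. (\<Sum>c \<in> set cols. real_of_int (g r c) * X c) = 0) & 0 < X (hd cols)" by blast
 }
 assume "\<exists>X. (\<forall>c \<in> set cols. 0 \<le> X c) & (\<forall>r \<in> set rows. (\<Sum>c \<in> set cols. real_of_int (g r c) * X c) = 0) & 0 < X (hd cols)"
 then obtain X where X: "\<forall>c \<in> set cols. 0 \<le> X c" "\<forall>r \<in> set rows. (\<Sum>c \<in> set cols. real_of_int (g r c) * X c) = 0" "0 < X (hd cols)" by blast
 show "hf ?A (length cols)"
  unfolding hf_def
 proof (intro exI[of _ "%j. X (cols ! j)"] conjI allI impI)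
  show "0 < X (cols ! 0)" using X(3) assms(2) by (simp add: hd_conv_nth)
  show "0 \<le> X (cols ! j)" if "j < length cols" for j using X(1) that by simp
  fix i assume "i < length ?A"
  then have i: "i < length rows" by simp
  have "(\<Sum>j<length cols. real_of_int (mat ?A i j) * X (cols ! j)) = (\<Sum>j<length cols. real_of_int (g (rows ! i) (cols ! j)) * X (cols ! j))"
   using m[OF i] by (intro sum.cong) auto
  also have "\<dots> = (\<Sum>c \<in> set cols. real_of_int (g (rows ! i) c) * X c)" by (rule re)
  finally show "(\<Sum>j<length cols. real_of_int (mat ?A i j) * X (cols ! j)) = 0" using X(2) i by simp
 qed
qed

section \<open>The linear program of the time-expanded graph\<close>

type_synonym col = "nat \<times> edge \<times> nat"

text \<open>Tag 0 is the homogenising column, placed first; tag 1 is a time copy of an edge and tag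
  2 the capacity slack of an edge.\<close>

definition cols :: "inst \<times> unit list => col list" where
 "cols w = (0, ((0, 0), (0, 0)), 0) # map (%x. (2, x, 0)) (fst (snd (fst w))) @
  concat (map (%x. map (%\<tau>. (1, x, \<tau>)) (filter (%\<tau>. \<tau> + snd (snd x) < length (snd w)) [0..<length (snd w)])) (fst (snd (fst w))))"

text \<open>Tag 1 is the capacity row of an edge, tag 0 the balance of a vertex at a time. The
  vertex sits in the tail of a dummy edge, so that rows and columns share one type.\<close>

definition rows :: "inst \<times> unit list => col list" where
 "rows w = map (%x. (1, x, 0)) (fst (snd (fst w))) @
  concat (map (%v. map (%\<tau>. (0, ((v, 0), (0, 0)), \<tau>)) [0..<length (snd w)])
   (filter (%v. v ~= snd (fst (snd (snd (fst w))))) [0..<length (fst (fst w))]))"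

definition coef :: "inst => col => col => int" where
 "coef z r c = (if fst r = 0
  then (if fst c = 0 then (if (fst (fst (fst (snd r))), snd (snd r)) = (fst (fst (snd (snd z))), 0) then - int (fst (snd (snd (snd z)))) else 0)
   else if fst c = 1 then (if (fst (fst (fst (snd c))), snd (snd c)) = (fst (fst (fst (snd r))), snd (snd r)) then 1 else 0)
     - (if (snd (fst (fst (snd c))), snd (snd c) + snd (snd (fst (snd c)))) = (fst (fst (fst (snd r))), snd (snd r)) then 1 else 0)
   else 0)
  else (if fst c = 0 then - int (fst (snd (fst (snd r)))) else if fst (snd c) = fst (snd r) then 1 else 0))"

definition lpin :: "inst \<times> unit list => int list list \<times> unit list" where
 "lpin w = (map (%r. map (coef (fst w) r) (cols w)) (rows w), map (%_. ()) (cols w))"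

lemma ptf_cols: "ptf cols"
 unfolding cols_def[abs_def] by (intro ptfs ptf_upt_len)

lemma ptf_rows: "ptf rows"
 unfolding rows_def[abs_def] by (intro ptfs ptf_upt_len)

lemma ptf_coef: "ptf (%w. coef (fst w) (fst (snd w)) (snd (snd w)))"
 unfolding coef_def by (intro ptfs)

lemma ptf_lpin: "ptf lpin"
proof -
 have "ptf (%w. map (%r. map (coef (fst w) r) (cols w)) (rows w))"
  by (intro ptf_map ptf_lift3[OF ptf_coef] ptf_rows ptf_comp[OF _ ptf_cols] ptf_fst ptf_snd ptf_id)
 moreover have "ptf (%w. map (%_. ()) (cols w))" by (intro ptf_map ptf_cols ptf_const)
 ultimately show ?thesis unfolding lpin_def[abs_def] by (rule ptf_Pair)
qed

lemma distinct_concat_map: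
 assumes "distinct xs" "!!x. x \<in> set xs ==> distinct (f x)" "!!x y c. c \<in> set (f x) ==> c \<in> set (f y) ==> x = y"
 shows "distinct (concat (map f xs))"
 using assms(1,2)
proof (induction xs)
 case (Cons x xs)
 then show ?case using assms(3) by auto
qed simp

lemma lp_iff_tflow:
 assumes I: "mk z \<in> mmd_instances"
 shows "lpdec (lpin (z, replicate (Suc D) ())) \<longleftrightarrow> tflow (mk z) D"
proof -
 let ?w = "(z, replicate (Suc D) ())" and ?es = "fst (snd z)" and ?x0 = "(0, ((0, 0), (0, 0)), 0) :: col"
 let ?As = "tarcs ?es D"
 have mkz: "source (mk z) = fst (fst (snd (snd z)))" "sink (mk z) = snd (fst (snd (snd z)))" "rate (mk z) = fst (snd (snd (snd z)))"
  "edge_list (mk z) = ?es" "num_verts (mk z) = length (fst z)" by (simp_all add: mk_def)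
 have des: "distinct ?es" using I by (simp add: mmd_instances_def mkz distinct_map)
 have ends: "fst (fst x) < length (fst z)" "snd (fst x) < length (fst z)" if "x \<in> set ?es" for x
  using I that unfolding valid_iff[symmetric] valid_def by auto
 have st: "source (mk z) < length (fst z)" "source (mk z) ~= sink (mk z)" using I by (auto simp: mmd_instances_def graph_of_def mkz(5))
 have dc: "distinct (cols ?w)"
 proof -
  have "distinct (concat (map (%x. map (%\<tau>. (1, x, \<tau>)) (filter (%\<tau>. \<tau> + snd (snd x) < Suc D) [0..<Suc D])) ?es) :: col list)"
   by (rule distinct_concat_map[OF des]) (auto simp: distinct_map inj_on_def simp del: upt_Suc)
  then show ?thesis using des by (auto simp: cols_def distinct_map inj_on_def simp del: upt_Suc)
 qed
 have setc: "set (cols ?w) = insert ?x0 ((%x. (2, x, 0)) ` set ?es \<union> (%a. (1, a)) ` ?As)"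
  by (auto simp: cols_def tarcs_def image_iff simp del: upt_Suc)
 have sumc: "(\<Sum>c \<in> set (cols ?w). h c) = h ?x0 + ((\<Sum>x \<in> set ?es. h (2, x, 0)) + (\<Sum>a \<in> ?As. h (1, a)))" for h :: "col => real"
 proof -
  have "(\<Sum>c \<in> (%x. (2, x, 0)) ` set ?es \<union> (%a. (1, a)) ` ?As. h c) = (\<Sum>x \<in> set ?es. h (2, x, 0)) + (\<Sum>a \<in> ?As. h (1, a))"
   by (subst sum.union_disjoint) (auto simp: finite_tarcs sum.reindex inj_on_def)
  then show ?thesis unfolding setc by (subst sum.insert) (auto simp: finite_tarcs)
 qed
 have setr: "set (rows ?w) = (%x. (1, x, 0)) ` set ?es \<union> {(0, ((v, 0), (0, 0)), \<tau>) | v \<tau>. v < length (fst z) & v ~= sink (mk z) & \<tau> \<le> D}"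
  by (auto simp: rows_def mkz(2) image_iff less_Suc_eq_le simp del: upt_Suc)
 have edge_row: "(\<Sum>c \<in> set (cols ?w). real_of_int (coef z (1, x, 0) c) * X c)
  = - real (fst (snd x)) * X ?x0 + (X (2, x, 0) + (\<Sum>a | a \<in> ?As & fst a = x. X (1, a)))" if x: "x \<in> set ?es" for x X
 proof -
  have "(\<Sum>y \<in> set ?es. real_of_int (coef z (1, x, 0) (2, y, 0)) * X (2, y, 0)) = (\<Sum>y \<in> set ?es. if y = x then X (2, y, 0) else 0)"
   by (intro sum.cong) (auto simp: coef_def)
  also have "\<dots> = X (2, x, 0)" using x by simp
  finally have 1: "(\<Sum>y \<in> set ?es. real_of_int (coef z (1, x, 0) (2, y, 0)) * X (2, y, 0)) = X (2, x, 0)" .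
  have 2: "(\<Sum>a \<in> ?As. real_of_int (coef z (1, x, 0) (1, a)) * X (1, a)) = (\<Sum>a | a \<in> ?As & fst a = x. X (1, a))"
   by (rule sum.mono_neutral_cong_right) (auto simp: finite_tarcs coef_def)
  show ?thesis unfolding sumc 1 2 by (simp add: coef_def)
 qed
 have node_row: "(\<Sum>c \<in> set (cols ?w). real_of_int (coef z (0, ((fst v, 0), (0, 0)), snd v) c) * X c)
  = (\<Sum>a | a \<in> ?As & ttail a = v. X (1, a)) - (\<Sum>a | a \<in> ?As & thead a = v. X (1, a))
   - (if v = (source (mk z), 0) then real (rate (mk z)) else 0) * X ?x0" for v X
 proof -
  have "(\<Sum>a \<in> ?As. real_of_int (coef z (0, ((fst v, 0), (0, 0)), snd v) (1, a)) * X (1, a))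
   = (\<Sum>a \<in> ?As. (if ttail a = v then X (1, a) else 0) - (if thead a = v then X (1, a) else 0))"
   by (rule sum.cong[OF refl]) (auto simp: coef_def ttail_def thead_def)
  also have "\<dots> = (\<Sum>a | a \<in> ?As & ttail a = v. X (1, a)) - (\<Sum>a | a \<in> ?As & thead a = v. X (1, a))"
   unfolding sum_subtractf by (simp add: sum.inter_filter[symmetric] finite_tarcs)
  finally have 1: "(\<Sum>a \<in> ?As. real_of_int (coef z (0, ((fst v, 0), (0, 0)), snd v) (1, a)) * X (1, a))
   = (\<Sum>a | a \<in> ?As & ttail a = v. X (1, a)) - (\<Sum>a | a \<in> ?As & thead a = v. X (1, a))" .
  have 2: "(\<Sum>x \<in> set ?es. real_of_int (coef z (0, ((fst v, 0), (0, 0)), snd v) (2, x, 0)) * X (2, x, 0)) = 0"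
   by (intro sum.neutral) (auto simp: coef_def)
  have 3: "real_of_int (coef z (0, ((fst v, 0), (0, 0)), snd v) ?x0) = - (if v = (source (mk z), 0) then real (rate (mk z)) else 0)"
   by (cases v) (simp add: coef_def mkz)
  show ?thesis unfolding sumc 1 2 3 by simp
 qed
 have "lpdec (lpin ?w) \<longleftrightarrow> hf (map (%r. map (coef z r) (cols ?w)) (rows ?w)) (length (cols ?w))"
  by (subst lpdec_correct) (simp_all add: lpin_def cols_def del: upt_Suc replicate_Suc)
 also have "\<dots> \<longleftrightarrow> (\<exists>X. (\<forall>c \<in> set (cols ?w). 0 \<le> X c) & (\<forall>r \<in> set (rows ?w). (\<Sum>c \<in> set (cols ?w). real_of_int (coef z r c) * X c) = 0) & 0 < X ?x0)"
  using hf_columns[OF dc, of "coef z" "rows ?w"] by (simp add: cols_def del: upt_Suc replicate_Suc)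
 also have "\<dots> \<longleftrightarrow> tflow (mk z) D"
 proof
  assume "\<exists>X. (\<forall>c \<in> set (cols ?w). 0 \<le> X c) & (\<forall>r \<in> set (rows ?w). (\<Sum>c \<in> set (cols ?w). real_of_int (coef z r c) * X c) = 0) & 0 < X ?x0"
  then obtain X where X: "!!c. c \<in> set (cols ?w) ==> 0 \<le> X c" "!!r. r \<in> set (rows ?w) ==> (\<Sum>c \<in> set (cols ?w). real_of_int (coef z r c) * X c) = 0" "0 < X ?x0"
   by blast
  show "tflow (mk z) D"
   unfolding tflow_def mkz(4)
  proof (intro exI[of _ "%a. X (1, a) / X ?x0"] conjI ballI allI impI)
   show "0 \<le> X (1, a) / X ?x0" if "a \<in> ?As" for a using X(1)[of "(1, a)"] X(3) that by (simp add: setc del: replicate_Suc)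
   fix x assume x: "x \<in> set ?es"
   have "(1, x, 0) \<in> set (rows ?w)" using x by (simp add: setr del: replicate_Suc)
   from X(2)[OF this] have "(\<Sum>a | a \<in> ?As & fst a = x. X (1, a)) + X (2, x, 0) = real (fst (snd x)) * X ?x0"
    unfolding edge_row[OF x] by simp
   moreover have "0 \<le> X (2, x, 0)" using X(1)[of "(2, x, 0)"] x by (simp add: setc del: replicate_Suc)
   ultimately have "(\<Sum>a | a \<in> ?As & fst a = x. X (1, a)) \<le> real (fst (snd x)) * X ?x0" by linarith
   then show "(\<Sum>a | a \<in> ?As & fst a = x. X (1, a) / X ?x0) \<le> real (fst (snd x))"
    unfolding sum_divide_distrib[symmetric] using X(3) by (simp add: divide_le_eq)
  next
   fix v :: "nat \<times> nat" assume v: "fst v ~= sink (mk z)"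
   let ?d = "(\<Sum>a | a \<in> ?As & ttail a = v. X (1, a)) - (\<Sum>a | a \<in> ?As & thead a = v. X (1, a))"
   have "?d = (if v = (source (mk z), 0) then real (rate (mk z)) else 0) * X ?x0"
   proof (cases "fst v < length (fst z) & snd v \<le> D")
    case True
    then have "(0, ((fst v, 0), (0, 0)), snd v) \<in> set (rows ?w)" using v by (simp add: setr del: replicate_Suc)
    from X(2)[OF this] show ?thesis unfolding node_row by simp
   next
    case False
    \<comment> \<open>No arc touches a node outside the grid, and the source at time 0 lies inside,
      so the balance there is trivial.\<close>
    have "ttail a ~= v & thead a ~= v" if "a \<in> ?As" for a
     using that False ends[of "fst a"] by (auto simp: tarcs_def ttail_def thead_def)
    then have e: "{a. a \<in> ?As & ttail a = v} = {}" "{a. a \<in> ?As & thead a = v} = {}" by blast+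
    have "v ~= (source (mk z), 0)" using False st(1) by auto
    then show ?thesis unfolding e by simp
   qed
   then show "(\<Sum>a | a \<in> ?As & ttail a = v. X (1, a) / X ?x0) - (\<Sum>a | a \<in> ?As & thead a = v. X (1, a) / X ?x0)
    = (if v = (source (mk z), 0) then real (rate (mk z)) else 0)"
    unfolding sum_divide_distrib[symmetric] diff_divide_distrib[symmetric] using X(3) by (simp split del: if_split)
  qed
 next
  assume "tflow (mk z) D"
  then obtain y where y: "!!a. a \<in> ?As ==> 0 \<le> y a"
   "!!v. fst v ~= sink (mk z) ==> (\<Sum>a | a \<in> ?As & ttail a = v. y a) - (\<Sum>a | a \<in> ?As & thead a = v. y a)
     = (if v = (source (mk z), 0) then real (rate (mk z)) else 0)"
   "!!x. x \<in> set ?es ==> (\<Sum>a | a \<in> ?As & fst a = x. y a) \<le> real (fst (snd x))"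
   unfolding tflow_def mkz(4) by blast
  define X where "X c = (if fst c = 0 then 1 else if fst c = 1 then y (snd c)
   else real (fst (snd (fst (snd c)))) - (\<Sum>a | a \<in> ?As & fst a = fst (snd c). y a))" for c :: col
  have X1: "X (1, a) = y a" and X0: "X ?x0 = 1" for a by (simp_all add: X_def)
  have "\<forall>c \<in> set (cols ?w). 0 \<le> X c" unfolding setc using y(1,3) by (auto simp: X_def)
  moreover have "(\<Sum>c \<in> set (cols ?w). real_of_int (coef z r c) * X c) = 0" if "r \<in> set (rows ?w)" for r
  proof -
   from that consider x where "x \<in> set ?es" "r = (1, x, 0)" | v where "r = (0, ((fst v, 0), (0, 0)), snd v)" "fst v ~= sink (mk z)"
    unfolding setr by fastforce
   then show ?thesis
   proof cases
    case 1
    show ?thesis unfolding 1(2) edge_row[OF 1(1)] X1 X0 by (simp add: X_def)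
   next
    case 2
    show ?thesis unfolding 2(1) node_row X1 X0 y(2)[OF 2(2)] by simp
   qed
  qed
  ultimately show "\<exists>X. (\<forall>c \<in> set (cols ?w). 0 \<le> X c) & (\<forall>r \<in> set (rows ?w). (\<Sum>c \<in> set (cols ?w). real_of_int (coef z r c) * X c) = 0) & 0 < X ?x0"
   using X0 by (intro exI[of _ X]) simp
 qed
 finally show ?thesis .
qed

definition bnd :: "bool list => nat" where
 "bnd x = Suc (nat (snd (snd (snd (snd (dec x))))))"

text \<open>A negative delay bound is rejected explicitly, since \<open>nat\<close> in
  \<open>bnd\<close> would turn it into 0.\<close>

definition decide :: "bool list \<times> unit list => bool" where
 "decide u \<longleftrightarrow> mmd_encode (mk (dec (fst u))) = fst u & valid (dec (fst u)) & 0 \<le> snd (snd (snd (snd (dec (fst u))))) &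
  lpdec (lpin (dec (fst u), snd u))"

lemma ptf_decide: "ptf decide"
proof -
 have d: "ptf (%u :: bool list \<times> unit list. dec (fst u))" by (rule ptf_comp[OF ptf_fst[OF ptf_id] ptf_dec])
 have e: "ptf (%u :: bool list \<times> unit list. mmd_encode (mk (dec (fst u))))" by (rule ptf_comp[OF d ptf_encode_mk])
 have v: "ptf (%u :: bool list \<times> unit list. valid (dec (fst u)))" by (rule ptf_comp[OF d ptf_valid])
 have l: "ptf (%u :: bool list \<times> unit list. lpdec (lpin (dec (fst u), snd u)))"
  by (rule ptf_comp[OF ptf_comp[OF ptf_Pair[OF d ptf_snd[OF ptf_id]] ptf_lpin] ptf_lpdec])
 have eq: "ptf (%u :: bool list \<times> unit list. mmd_encode (mk (dec (fst u))) = fst u)"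
  by (intro ptf_eq_list e) (intro ptfs)+
 have D: "ptf (%u :: bool list \<times> unit list. 0 \<le> snd (snd (snd (snd (dec (fst u))))))"
  by (intro ptf_le_int ptf_const ptf_snd d)
 show ?thesis unfolding decide_def[abs_def] by (rule ptf_conj[OF eq ptf_conj[OF v ptf_conj[OF D l]]])
qed

lemma decide_correct: "decide (x, replicate (bnd x) ()) \<longleftrightarrow> x \<in> language_of mmd_instances mmd_encode mmd_yes"
proof (cases "valid (dec x)")
 case True
 then have I: "mk (dec x) \<in> mmd_instances" by (simp add: valid_iff)
 have D: "delay_bound (mk (dec x)) = snd (snd (snd (snd (dec x))))" by (simp add: mk_def)
 have "mmd_yes (mk (dec x)) \<longleftrightarrow> 0 \<le> delay_bound (mk (dec x)) & tflow (mk (dec x)) (nat (delay_bound (mk (dec x))))"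
  using mmd_yes_imp_tflow[OF I] tflow_imp_mmd_yes[OF I] by blast
 then show ?thesis unfolding decide_def language_dec bnd_def fst_conv snd_conv lp_iff_tflow[OF I] D by blast
next
 case False
 then show ?thesis unfolding decide_def language_dec by simp
qed

lemma mmd_pseudo_poly: "pseudo_poly_solvable mmd_instances mmd_encode mmd_yes mmd_max"
proof -
 let ?L = "language_of mmd_instances mmd_encode mmd_yes"
 have b: "ptf bnd" unfolding bnd_def[abs_def] by (intro ptf_Suc ptf_nat ptf_snd ptf_dec)
 have u: "rptf bnd (%x. replicate (bnd x) ())" using rptf_comp[OF b rptf_unary] by simp
 have "rptf bnd (%x. (x, replicate (bnd x) ()))" by (rule rptf_pair[OF ptf_imp_rptf[OF ptf_id] u])
 moreover have "ptf (%v. [decide v])" by (intro ptf_Cons ptf_decide ptf_const)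
 ultimately have "rptf (%x. bnd x + 0) (%x. [decide (x, replicate (bnd x) ())])" by (rule rptf_comp)
 then have "rptf bnd (%x. [x \<in> ?L])" by (simp add: decide_correct)
 then obtain \<mu> F where F: "rpt \<mu> F" "!!x :: bool list. \<mu> (tr x) \<le> bnd x" "!!x :: bool list. F (tr x) = tr [x \<in> ?L]"
  by (rule rptfE) blast
 obtain M k where M: "wf_tm M" "!!x y. F (tbl x) = tbl y ==> \<exists>n \<le> (length x + \<mu> (tbl x) + 2) ^ k. halts_with M x y n"
  by (rule TM_of_rpt[OF F(1)]) blast
 \<comment> \<open>This covers every string: malformed input is decoded as well, so the machine
   always halts, in time depending on the decoded bound.\<close>
 have halt: "\<exists>n \<le> (length x + bnd x + 2) ^ k. halts_with M x [x \<in> ?L] n" for x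
 proof -
  obtain n where n: "n \<le> (length x + \<mu> (tbl x) + 2) ^ k" "halts_with M x [x \<in> ?L] n"
   using M(2)[of x "[x \<in> ?L]"] F(3)[of x] by (auto simp: tr_bools)
  have "(length x + \<mu> (tbl x) + 2) ^ k \<le> (length x + bnd x + 2) ^ k" using F(2)[of x] by (intro power_mono) (auto simp: tr_bools)
  then show ?thesis using n by (meson order_trans)
 qed
 have "\<exists>n \<le> poly ([:3, 1:] ^ k) (length (mmd_encode I) + mmd_max I). halts_with M (mmd_encode I) [mmd_yes I] n" if I: "I \<in> mmd_instances" for I
 proof -
  have L: "mmd_encode I \<in> ?L \<longleftrightarrow> mmd_yes I" unfolding language_dec mk_dec_encode valid_iff using I by simp
  have "finite (parcs (graph_of I))" by (simp add: graph_of_def)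
  then have "nat \<bar>delay_bound I\<bar> \<le> mmd_max I" unfolding mmd_max_def by (intro Max_ge) auto
  then have "bnd (mmd_encode I) \<le> Suc (mmd_max I)" by (simp add: bnd_def dec_encode)
  \<comment> \<open>There is one layer more than the delay bound, hence 3 instead of 2 in the
    polynomial.\<close>
  then have "(length (mmd_encode I) + bnd (mmd_encode I) + 2) ^ k \<le> (length (mmd_encode I) + mmd_max I + 3) ^ k" by (intro power_mono) auto
  moreover have "poly ([:3, 1:] ^ k) n = (n + 3) ^ k" for n :: nat by (simp add: poly_power add.commute)
  ultimately show ?thesis using halt[of "mmd_encode I"] unfolding L by (metis order_trans)
 qed
 then show ?thesis using M(1) halt unfolding pseudo_poly_solvable_def by blast
qed

section \<open>NP-hardness\<close>

definition seg :: "nat => bool => (nat \<times> nat) list" where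
 "seg j b = (if b then [(2 * j, 2 * j + 1), (2 * j + 1, 2 * j + 2)] else [(2 * j, 2 * j + 2)])"

lemma seg_disjoint: "e \<in> set (seg i b) ==> e \<in> set (seg j b') ==> i = j & b = b'"
 by (auto simp: seg_def split: if_splits)

definition cpath :: "nat => (nat => bool) => (nat \<times> nat) list" where
 "cpath n \<sigma> = concat (map (%j. seg j (\<sigma> j)) [0..<n])"

lemma cpath_simps: "cpath 0 \<sigma> = []" "cpath (Suc n) \<sigma> = cpath n \<sigma> @ seg n (\<sigma> n)"
 by (simp_all add: cpath_def)

lemma cpath_cong: "(!!j. j < n ==> \<sigma> j = \<rho> j) ==> cpath n \<sigma> = cpath n \<rho>"
 by (induction n) (auto simp: cpath_simps)

definition carc :: "nat \<times> nat => bool" where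
 "carc e \<longleftrightarrow> (\<exists>j. e = (2 * j, 2 * j + 1) \<or> e = (2 * j + 1, 2 * j + 2) \<or> e = (2 * j, 2 * j + 2))"

lemma pcas_snoc: "pcas u (p @ [e]) v \<longleftrightarrow> pcas u p (fst e) & snd e = v"
 by (induction p arbitrary: u) auto

lemma carc_increasing: "(!!e. e \<in> set p ==> carc e) ==> pcas u p v ==> u \<le> v & (p ~= [] --> u < v)"
proof (induction p arbitrary: u)
 case (Cons e p)
 have "carc e" using Cons.prems(1) by simp
 then have "fst e < snd e" by (auto simp: carc_def)
 moreover have "pcas (snd e) p v" "fst e = u" using Cons.prems(2) by (cases e; simp)+
 ultimately show ?case using Cons.IH[of "snd e"] Cons.prems(1) by fastforce
qed simp

text \<open>The last arc is peeled off: node \<open>2 * n + 2\<close> is entered only by the two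
  branches of the last diamond, and node \<open>2 * n + 1\<close> by a single arc.\<close>

lemma carc_walk:
 assumes "!!e. e \<in> set p ==> carc e" "pcas 0 p (2 * n)"
 shows "\<exists>\<sigma>. p = cpath n \<sigma>"
 using assms
proof (induction n arbitrary: p)
 case 0
 then have "p = []" using carc_increasing[of p 0 0] by fastforce
 then show ?case by (simp add: cpath_simps)
next
 case (Suc n)
 have "p ~= []" using Suc.prems(2) by auto
 then obtain q e where p: "p = q @ [e]" by (metis append_butlast_last_id)
 have q: "pcas 0 q (fst e)" "snd e = 2 * n + 2" using Suc.prems(2) by (simp_all add: p pcas_snoc)
 have arcs: "!!e. e \<in> set q ==> carc e" "carc e" using Suc.prems(1) by (auto simp: p)
 from arcs(2) q(2) have "e = (2 * n + 1, 2 * n + 2) \<or> e = (2 * n, 2 * n + 2)" unfolding carc_def by auto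
 then show ?case
 proof
  assume e: "e = (2 * n + 1, 2 * n + 2)"
  have "q ~= []" using q(1) e by auto
  then obtain r e' where r: "q = r @ [e']" by (metis append_butlast_last_id)
  have r': "pcas 0 r (fst e')" "snd e' = 2 * n + 1" using q(1) e by (simp_all add: r pcas_snoc)
  have "carc e'" using arcs(1) by (simp add: r)
  then have e': "e' = (2 * n, 2 * n + 1)" using r'(2) unfolding carc_def by (auto; presburger)
  obtain \<sigma> where "r = cpath n \<sigma>" using Suc.IH[of r] arcs(1) r' e' by (auto simp: r)
  then have "p = cpath (Suc n) (\<sigma>(n := True))" using cpath_cong[of n \<sigma> "\<sigma>(n := True)"] by (simp add: p r e e' cpath_simps seg_def)
  then show ?thesis by blast
 next
  assume e: "e = (2 * n, 2 * n + 2)"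
  obtain \<sigma> where "q = cpath n \<sigma>" using Suc.IH[of q] arcs(1) q(1) e by auto
  then have "p = cpath (Suc n) (\<sigma>(n := False))" using cpath_cong[of n \<sigma> "\<sigma>(n := False)"] by (simp add: p e cpath_simps seg_def)
  then show ?thesis by blast
 qed
qed

lemma pcas_cpath: "pcas 0 (cpath n \<sigma>) (2 * n)"
proof (induction n)
 case (Suc n)
 have "pcas 0 ((cpath n \<sigma> @ [(2 * n, 2 * n + 1)]) @ [(2 * n + 1, 2 * n + 2)]) (2 * n + 2)" "pcas 0 (cpath n \<sigma> @ [(2 * n, 2 * n + 2)]) (2 * n + 2)"
  unfolding pcas_snoc using Suc by simp_all
 then show ?case by (simp add: cpath_simps seg_def)
qed (simp add: cpath_simps)

lemma set_cpath: "e \<in> set (cpath n \<sigma>) \<longleftrightarrow> (\<exists>j < n. e \<in> set (seg j (\<sigma> j)))"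
 unfolding cpath_def by auto

lemma distinct_cpath: "distinct (0 # map snd (cpath n \<sigma>)) & (\<forall>v \<in> snd ` set (cpath n \<sigma>). v \<le> 2 * n)"
proof (induction n)
 case (Suc n)
 then have le: "!!v. v \<in> set (map snd (cpath n \<sigma>)) ==> v \<le> 2 * n" and d: "distinct (0 # map snd (cpath n \<sigma>))" by auto
 have new: "2 * n + 1 \<notin> set (map snd (cpath n \<sigma>))" "2 * n + 2 \<notin> set (map snd (cpath n \<sigma>))"
  using le[of "2 * n + 1"] le[of "2 * n + 2"] by linarith+
 have c: "map snd (cpath (Suc n) \<sigma>) = map snd (cpath n \<sigma>) @ (if \<sigma> n then [2 * n + 1, 2 * n + 2] else [2 * n + 2])"
  by (simp add: cpath_simps seg_def)
 have 1: "distinct (0 # map snd (cpath (Suc n) \<sigma>))" unfolding c using d new by (cases "\<sigma> n") simp_all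
 have 2: "v \<le> 2 * Suc n" if "v \<in> set (map snd (cpath (Suc n) \<sigma>))" for v
  using that unfolding c set_append Un_iff by (elim disjE) (use le in \<open>fastforce split: if_splits\<close>)+
 show ?case using 1 2 unfolding set_map[symmetric] by blast
qed (simp add: cpath_simps)

text \<open>Arcs are pairs of vertices, so a diamond cannot consist of two parallel arcs. One branch
  is subdivided, and its whole delay sits on the first half.\<close>

definition cedges :: "(nat \<times> nat) list => edges" where
 "cedges ds = concat (map (%x. [((2 * fst x, 2 * fst x + 1), (1, fst (snd x))), ((2 * fst x + 1, 2 * fst x + 2), (1, 0)),
  ((2 * fst x, 2 * fst x + 2), (1, snd (snd x)))]) (zip [0..<length ds] ds))"

definition cinst :: "(nat \<times> nat) list => nat => inst" where
 "cinst ds D = (() # concat (map (%_. [(), ()]) ds), cedges ds, (0, 2 * length ds), 2, int D)"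

lemma ptf_cinst: "ptf f ==> ptf g ==> ptf (%z. cinst (f z) (g z))"
 unfolding cinst_def cedges_def by (intro ptfs ptf_upt_len)

lemma set_cedges: "x \<in> set (cedges ds) \<longleftrightarrow> (\<exists>j < length ds. x = ((2 * j, 2 * j + 1), (1, fst (ds ! j))) \<or>
  x = ((2 * j + 1, 2 * j + 2), (1, 0)) \<or> x = ((2 * j, 2 * j + 2), (1, snd (ds ! j))))"
proof -
 have "zip [0..<length ds] ds = map (%j. (j, ds ! j)) [0..<length ds]" by (rule nth_equalityI) simp_all
 then show ?thesis unfolding cedges_def by (auto simp: image_iff)
qed

lemma cinst_instance:
 assumes "ds ~= []"
 shows "mk (cinst ds D) \<in> mmd_instances"
proof -
 let ?g = "%j :: nat. [(2 * j, 2 * j + 1), (2 * j + 1, 2 * j + 2), (2 * j, 2 * j + 2)]"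
 have "map fst (cedges ds) = concat (map ?g (map fst (zip [0..<length ds] ds)))"
  unfolding cedges_def map_concat map_map o_def by simp
 then have m: "map fst (cedges ds) = concat (map ?g [0..<length ds])" by simp
 have "distinct (concat (map ?g [0..<length ds]))"
 proof (rule distinct_concat_map)
  fix x y c assume "c \<in> set (?g x)" "c \<in> set (?g y)"
  then show "x = y" by (auto; presburger)
 qed auto
 moreover have len: "length (() # concat (map (%_. [(), ()]) ds)) = 2 * length ds + 1" by (induction ds) auto
 moreover have "fst (fst e) < 2 * length ds + 1 & snd (fst e) < 2 * length ds + 1" if "e \<in> set (cedges ds)" for e
  using that by (auto simp: set_cedges)
 moreover have "pair_fin_digraph (graph_of (mk (cinst ds D)))" if "!!e. e \<in> set (cedges ds) ==> fst (fst e) < 2 * length ds + 1 & snd (fst e) < 2 * length ds + 1"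
  unfolding pair_fin_digraph_def pair_wf_digraph_def pair_fin_digraph_axioms_def graph_of_def cinst_def mk_simps len pair_pre_digraph.select_convs
  using that by fastforce
 ultimately show ?thesis using assms by (simp add: mmd_instances_def graph_of_def cinst_def m)
qed

lemma chain_correct:
 assumes ne: "ds ~= []" and total: "(\<Sum>d\<leftarrow>ds. fst d + snd d) = 2 * D"
 shows "mmd_yes (mk (cinst ds D)) \<longleftrightarrow> (\<exists>\<sigma>. (\<Sum>j < length ds. if \<sigma> j then fst (ds ! j) else snd (ds ! j)) = D)"
proof -
 let ?I = "mk (cinst ds D)" and ?n = "length ds"
 define cs where "cs \<sigma> = (\<Sum>j < ?n. if \<sigma> j then fst (ds ! j) else snd (ds ! j))" for \<sigma>
 have I: "?I \<in> mmd_instances" by (rule cinst_instance[OF ne])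
 have sel: "source ?I = 0" "sink ?I = 2 * ?n" "rate ?I = 2" "delay_bound ?I = int D" "edge_list ?I = cedges ds" by (simp_all add: cinst_def)
 have arcs: "parcs (graph_of ?I) = fst ` set (cedges ds)" by (simp add: graph_of_def sel)
 have carcs: "carc e" if "e \<in> parcs (graph_of ?I)" for e using that unfolding arcs carc_def by (auto simp: set_cedges)
 have dl: "delay ?I (2 * j, 2 * j + 1) = fst (ds ! j)" "delay ?I (2 * j + 1, 2 * j + 2) = 0" "delay ?I (2 * j, 2 * j + 2) = snd (ds ! j)"
  "capacity ?I (2 * j, 2 * j + 1) = 1" "capacity ?I (2 * j + 1, 2 * j + 2) = 1" "capacity ?I (2 * j, 2 * j + 2) = 1"
  "(2 * j, 2 * j + 1) \<in> parcs (graph_of ?I)" "(2 * j + 1, 2 * j + 2) \<in> parcs (graph_of ?I)" "(2 * j, 2 * j + 2) \<in> parcs (graph_of ?I)" if "j < ?n" for j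
 proof -
  have m: "((2 * j, 2 * j + 1), (1, fst (ds ! j))) \<in> set (cedges ds)" "((2 * j + 1, 2 * j + 2), (1, 0)) \<in> set (cedges ds)"
   "((2 * j, 2 * j + 2), (1, snd (ds ! j))) \<in> set (cedges ds)" using that unfolding set_cedges by blast+
  note k = instance_map_of(2,3)[OF I, unfolded sel(5), OF m(1)] instance_map_of(2,3)[OF I, unfolded sel(5), OF m(2)] instance_map_of(2,3)[OF I, unfolded sel(5), OF m(3)]
  show "delay ?I (2 * j, 2 * j + 1) = fst (ds ! j)" "delay ?I (2 * j + 1, 2 * j + 2) = 0" "delay ?I (2 * j, 2 * j + 2) = snd (ds ! j)"
  "capacity ?I (2 * j, 2 * j + 1) = 1" "capacity ?I (2 * j + 1, 2 * j + 2) = 1" "capacity ?I (2 * j, 2 * j + 2) = 1" using k by simp_all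
  show "(2 * j, 2 * j + 1) \<in> parcs (graph_of ?I)" "(2 * j + 1, 2 * j + 2) \<in> parcs (graph_of ?I)" "(2 * j, 2 * j + 2) \<in> parcs (graph_of ?I)"
   unfolding arcs using m by (force intro: rev_image_eqI)+
 qed
 have paths: "p \<in> st_paths (graph_of ?I) (source ?I) (sink ?I) \<longleftrightarrow> (\<exists>\<sigma>. p = cpath ?n \<sigma>)" for p
 proof
  assume "p \<in> st_paths (graph_of ?I) (source ?I) (sink ?I)"
  then have p: "set p \<subseteq> parcs (graph_of ?I)" "pcas 0 p (2 * ?n)" unfolding st_paths_iff sel by blast+
  show "\<exists>\<sigma>. p = cpath ?n \<sigma>" using p carcs by (intro carc_walk) auto
 next
  assume "\<exists>\<sigma>. p = cpath ?n \<sigma>"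
  then obtain \<sigma> where p: "p = cpath ?n \<sigma>" by blast
  have "set p \<subseteq> parcs (graph_of ?I)" using dl(7-9) unfolding p by (auto simp: set_cpath seg_def split: if_splits)
  moreover have "source ?I \<in> pverts (graph_of ?I)" using I by (simp add: mmd_instances_def)
  moreover have "distinct (pawalk_verts 0 p)" unfolding p pawalk_verts_eq[OF pcas_cpath] using distinct_cpath by blast
  ultimately show "p \<in> st_paths (graph_of ?I) (source ?I) (sink ?I)" unfolding st_paths_iff sel using p pcas_cpath by simp
 qed
 have delays: "path_delay (delay ?I) (cpath ?n \<sigma>) = cs \<sigma>" for \<sigma>
 proof -
  have "distinct (cpath ?n \<sigma>)" using distinct_cpath[of ?n \<sigma>] by (simp add: distinct_map)
  then have "path_delay (delay ?I) (cpath ?n \<sigma>) = (\<Sum>e\<leftarrow>cpath ?n \<sigma>. delay ?I e)" by (simp add: path_delay_def sum_list_distinct_conv_sum_set)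
  moreover have "(\<Sum>e\<leftarrow>cpath m \<sigma>. delay ?I e) = (\<Sum>j < m. if \<sigma> j then fst (ds ! j) else snd (ds ! j))" if "m \<le> ?n" for m
   using that
  proof (induction m)
   case (Suc m)
   then have "m < ?n" by simp
   from dl(1-3)[OF this] Suc show ?case by (simp add: cpath_simps seg_def)
  qed (simp add: cpath_simps)
  ultimately show ?thesis by (simp add: cs_def)
 qed
 have top: "(2 * j, 2 * j + 1) \<in> set (cpath ?n \<sigma>) \<longleftrightarrow> \<sigma> j" if "j < ?n" for j \<sigma>
 proof -
  have "(2 * j, 2 * j + 1) \<in> set (seg j True)" by (simp add: seg_def)
  then show ?thesis unfolding set_cpath using seg_disjoint that by (metis (full_types))
 qed
 have bot: "(2 * j, 2 * j + 2) \<in> set (cpath ?n \<sigma>) \<longleftrightarrow> \<not> \<sigma> j" if "j < ?n" for j \<sigma>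
 proof -
  have "(2 * j, 2 * j + 2) \<in> set (seg j False)" by (simp add: seg_def)
  then show ?thesis unfolding set_cpath using seg_disjoint that by (metis (full_types))
 qed
 have tot: "(\<Sum>j < ?n. fst (ds ! j) + snd (ds ! j)) = 2 * D"
  using total by (simp add: sum_list_sum_nth atLeast0LessThan)
 show ?thesis
  unfolding cs_def[symmetric]
 proof
  assume "mmd_yes ?I"
  then obtain ws where ws: "flowlist ?I ws" using mmd_yes_iff_flowlist[OF I] by blast
  have "\<exists>\<sigma>. snd wp = cpath ?n \<sigma>" if "wp \<in> set ws" for wp using ws that unfolding flowlist_def paths by blast
  then obtain \<sigma> where \<sigma>: "!!wp. wp \<in> set ws ==> snd wp = cpath ?n (\<sigma> wp)" by metis
  have w0: "0 \<le> fst wp" "cs (\<sigma> wp) \<le> D" if "wp \<in> set ws" for wp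
   using ws that \<sigma>[OF that] delays[of "\<sigma> wp"] unfolding flowlist_def sel by auto
  have sw: "(\<Sum>wp\<leftarrow>ws. fst wp) = 2" using ws by (simp add: flowlist_def sel)
  \<comment> \<open>Each branch carries at most 1 and together they carry the rate 2, so each
    carries exactly 1.\<close>
  have cross: "(\<Sum>wp\<leftarrow>ws. fst wp * real (if \<sigma> wp j then fst (ds ! j) else snd (ds ! j))) = real (fst (ds ! j) + snd (ds ! j))" if j: "j < ?n" for j
  proof -
   let ?F = "\<Sum>wp\<leftarrow>ws. if \<sigma> wp j then fst wp else 0" and ?G = "\<Sum>wp\<leftarrow>ws. if \<sigma> wp j then 0 else fst wp"
   have "?F = (\<Sum>wp\<leftarrow>ws. if (2 * j, 2 * j + 1) \<in> set (snd wp) then fst wp else 0)"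
    using \<sigma> top[OF j] by (intro arg_cong[where f = sum_list] map_cong refl) simp
   also have "\<dots> \<le> real (capacity ?I (2 * j, 2 * j + 1))" using ws dl(7)[OF j] unfolding flowlist_def by blast
   finally have F: "?F \<le> 1" using dl(4)[OF j] by simp
   have "?G = (\<Sum>wp\<leftarrow>ws. if (2 * j, 2 * j + 2) \<in> set (snd wp) then fst wp else 0)"
    using \<sigma> bot[OF j] by (intro arg_cong[where f = sum_list] map_cong refl) simp
   also have "\<dots> \<le> real (capacity ?I (2 * j, 2 * j + 2))" using ws dl(9)[OF j] unfolding flowlist_def by blast
   finally have G: "?G \<le> 1" using dl(6)[OF j] by simp
   have "?F + ?G = (\<Sum>wp\<leftarrow>ws. fst wp)" unfolding sum_list_addf[symmetric] by (intro arg_cong[where f = sum_list] map_cong refl) simp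
   then have FG: "?F = 1" "?G = 1" using F G sw by linarith+
   have "(\<Sum>wp\<leftarrow>ws. fst wp * real (if \<sigma> wp j then fst (ds ! j) else snd (ds ! j))) = ?F * real (fst (ds ! j)) + ?G * real (snd (ds ! j))"
    unfolding sum_list_mult_const[symmetric] sum_list_addf[symmetric] by (intro arg_cong[where f = sum_list] map_cong refl) simp
   then show ?thesis unfolding FG by simp
  qed
  have "(\<Sum>wp\<leftarrow>ws. fst wp * real (cs (\<sigma> wp))) = (\<Sum>j < ?n. \<Sum>wp\<leftarrow>ws. fst wp * real (if \<sigma> wp j then fst (ds ! j) else snd (ds ! j)))"
   by (subst sum_sum_list) (simp_all add: cs_def sum_distrib_left of_nat_sum)
  also have "\<dots> = (\<Sum>j < ?n. real (fst (ds ! j) + snd (ds ! j)))" using cross by (intro sum.cong) auto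
  also have "\<dots> = real (2 * D)" unfolding tot[symmetric] by simp
  finally have e: "(\<Sum>wp\<leftarrow>ws. fst wp * real (cs (\<sigma> wp))) = (\<Sum>wp\<leftarrow>ws. fst wp) * real D" unfolding sw by simp
  show "\<exists>\<sigma>. cs \<sigma> = D"
  proof (rule ccontr)
   assume "\<nexists>\<sigma>. cs \<sigma> = D"
   \<comment> \<open>Delays are integers: if none equals \<open>D\<close>, all are at most
     \<open>D - 1\<close>, which contradicts their weighted average \<open>D\<close>.\<close>
   then have lt: "real (cs (\<sigma> wp)) + 1 \<le> real D" if "wp \<in> set ws" for wp using w0(2)[OF that] by (metis le_neq_implies_less Suc_leI of_nat_Suc of_nat_le_iff add.commute)
   have "(\<Sum>wp\<leftarrow>ws. fst wp * real (cs (\<sigma> wp))) \<le> (\<Sum>wp\<leftarrow>ws. fst wp * (real D - 1))"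
    using lt w0(1) by (intro sum_list_mono mult_left_mono) fastforce+
   also have "\<dots> = (\<Sum>wp\<leftarrow>ws. fst wp) * (real D - 1)" by (rule sum_list_mult_const)
   finally show False using e sw by (simp add: algebra_simps)
  qed
 next
  assume "\<exists>\<sigma>. cs \<sigma> = D"
  then obtain \<sigma> where s: "cs \<sigma> = D" by blast
  \<comment> \<open>The complementary path takes the other branch everywhere and has delay
    \<open>D\<close> too; one unit along each of the two saturates the chain.\<close>
  have "cs \<sigma> + cs (%j. \<not> \<sigma> j) = 2 * D" unfolding tot[symmetric] cs_def sum.distrib[symmetric] by (intro sum.cong) auto
  then have s': "cs (%j. \<not> \<sigma> j) = D" using s by simp
  have "flowlist ?I [(1, cpath ?n \<sigma>), (1, cpath ?n (%j. \<not> \<sigma> j))]"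
   unfolding flowlist_def
  proof (intro conjI ballI)
   fix wp :: "real \<times> (nat \<times> nat) list" assume "wp \<in> set [(1, cpath ?n \<sigma>), (1, cpath ?n (%j. \<not> \<sigma> j))]"
   then show "0 \<le> fst wp" "snd wp \<in> st_paths (graph_of ?I) (source ?I) (sink ?I)" "int (path_delay (delay ?I) (snd wp)) \<le> delay_bound ?I"
    unfolding paths using s s' delays sel(4) by auto
  next
   fix e assume e: "e \<in> parcs (graph_of ?I)"
   have "\<not> (e \<in> set (cpath ?n \<sigma>) & e \<in> set (cpath ?n (%j. \<not> \<sigma> j)))"
    unfolding set_cpath using seg_disjoint by blast
   moreover have "capacity ?I e = 1"
   proof -
    obtain x where x: "x \<in> set (cedges ds)" "e = fst x" using e unfolding arcs by blast
    have "fst (snd x) = 1" using x(1) by (auto simp: set_cedges)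
    then show ?thesis using instance_map_of(2)[OF I, unfolded sel(5), OF x(1)] x(2) by simp
   qed
   ultimately show "(\<Sum>wp\<leftarrow>[(1, cpath ?n \<sigma>), (1, cpath ?n (%j. \<not> \<sigma> j))]. if e \<in> set (snd wp) then fst wp else 0) \<le> real (capacity ?I e)" by auto
  qed (simp add: sel)
  then show "mmd_yes ?I" using mmd_yes_iff_flowlist[OF I] by blast
 qed
qed

text \<open>Clauses index the digits and variables index the diamonds, so repetitions have to be
  removed.\<close>

definition uniq :: "'a list => 'a list" where
 "uniq xs = foldl (%acc a. if \<exists>b \<in> set acc. b = a then acc else a # acc) [] xs"

lemma uniq_snoc: "uniq (xs @ [a]) = (if a \<in> set (uniq xs) then uniq xs else a # uniq xs)"
 by (simp add: uniq_def)

lemma set_uniq [simp]: "set (uniq xs) = set xs"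
proof (induction xs rule: rev_induct)
 case (snoc a xs)
 then show ?case by (auto simp: uniq_snoc)
qed (simp add: uniq_def)

lemma distinct_uniq [simp]: "distinct (uniq xs)"
proof (induction xs rule: rev_induct)
 case (snoc a xs)
 then show ?case by (auto simp: uniq_snoc)
qed (simp add: uniq_def)

lemma sz_uniq: "sz (uniq xs) \<le> sz (xs :: 'a::tr list)"
proof (induction xs rule: rev_induct)
 case (snoc a xs)
 have "sz (xs @ [a]) + 1 = sz xs + sz [a]" by (rule sz_append)
 then show ?case using snoc by (auto simp: uniq_snoc)
qed (simp add: uniq_def)

lemma ptf_uniq:
 assumes eq: "ptf (%w :: 'a::tr \<times> 'a. fst w = snd w)" and f: "ptf f"
 shows "ptf (%z. uniq (f z :: 'a list))"
proof -
 have "ptf (%xs :: 'a list. uniq xs)"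
  unfolding uniq_def
 proof (rule ptf_foldl[where s = "%n. n"])
  show "ptf (%xs :: 'a list. xs)" by (rule ptf_id)
  show "ptf (%xs :: 'a list. [] :: 'a list)" by (rule ptf_const)
  show "pbd (%n. n)" by (rule pbd_id)
  have e: "ptf (%u :: ('a list \<times> 'a list \<times> 'a) \<times> 'a. snd u = snd (snd (fst u)))"
   by (rule ptf_lift2[where h = "(=)", OF eq]) (intro ptfs)+
  show "ptf (%w :: 'a list \<times> 'a list \<times> 'a. if \<exists>b \<in> set (fst (snd w)). b = snd (snd w) then fst (snd w) else snd (snd w) # fst (snd w))"
   by (rule ptf_if[OF ptf_bex[OF e]]) (intro ptfs)+
  show "sz (foldl (%acc a. if \<exists>b \<in> set acc. b = a then acc else a # acc) [] (take j xs)) \<le> sz xs" for j and xs :: "'a list"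
   using sz_uniq[of "take j xs"] sz_take_drop(1)[of j xs] unfolding uniq_def by linarith
 qed
 from ptf_comp[OF f this] show ?thesis .
qed

section \<open>From clauses to digit vectors\<close>

type_synonym lit = "nat list \<times> bool"

definition sat :: "lit list list => bool" where
 "sat \<phi> \<longleftrightarrow> (\<exists>\<alpha>. \<forall>c \<in> set \<phi>. \<exists>l \<in> set c. \<alpha> (fst l) = snd l)"

text \<open>The computable form of \<open>numr\<close>: one block of \<open>length bl\<close> bits
  per clause, concatenated. The two agree as long as every digit fits into its block.\<close>

definition wt :: "unit list => 'c list => ('c => nat) => nat" where
 "wt bl \<phi> f = val (concat (map (%c. take (length bl) (bits (f c) @ map (%_. False) bl)) \<phi>))"

definition numr :: "nat => 'c list => ('c => nat) => nat" where
 "numr b \<phi> f = foldr (%c acc. f c + 2 ^ b * acc) \<phi> 0"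

lemma numr_simps [simp]: "numr b [] f = 0" "numr b (c # \<phi>) f = f c + 2 ^ b * numr b \<phi> f"
 by (simp_all add: numr_def)

lemma numr_cong: "(!!c. c \<in> set \<phi> ==> f c = g c) ==> numr b \<phi> f = numr b \<phi> g"
 by (induction \<phi>) auto

lemma numr_add: "numr b \<phi> (%c. f c + g c) = numr b \<phi> f + numr b \<phi> g"
 by (induction \<phi>) (auto simp: algebra_simps)

lemma numr_zero: "numr b \<phi> (%c. 0) = 0"
 by (induction \<phi>) auto

text \<open>Digits below the base produce no carry, so taking remainders reads them off one by
  one.\<close>

lemma numr_inj:
 assumes "numr b \<phi> f = numr b \<phi> g" "!!c. c \<in> set \<phi> ==> f c < 2 ^ b & g c < 2 ^ b" "c \<in> set \<phi>"
 shows "f c = g c"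
 using assms
proof (induction \<phi>)
 case (Cons d \<phi>)
 have e: "f d + 2 ^ b * numr b \<phi> f = g d + 2 ^ b * numr b \<phi> g" using Cons.prems(1) by simp
 have lt: "f d < 2 ^ b" "g d < 2 ^ b" using Cons.prems(2) by auto
 have "f d = (f d + 2 ^ b * numr b \<phi> f) mod 2 ^ b" using lt by simp
 also have "\<dots> = g d" unfolding e using lt by simp
 finally have d: "f d = g d" .
 then have "numr b \<phi> f = numr b \<phi> g" using e by simp
 then show ?case using Cons d by auto
qed simp

lemma wt_numr:
 assumes "!!c. c \<in> set \<phi> ==> f c < 2 ^ length bl"
 shows "wt bl \<phi> f = numr (length bl) \<phi> f"
 using assms
proof (induction \<phi>)
 case (Cons c \<phi>)
 let ?x = "take (length bl) (bits (f c) @ map (%_. False) bl)"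
 have "nb (f c) \<le> length bl" using Cons.prems by (intro nb_le) simp
 then have "?x = bits (f c) @ replicate (length bl - nb (f c)) False" by (simp add: map_replicate_const)
 then have v: "val ?x = f c" by (simp add: val_append)
 have l: "length ?x = length bl" by simp
 have "wt bl (c # \<phi>) f = val ?x + 2 ^ length ?x * wt bl \<phi> f" unfolding wt_def by (simp only: list.map concat.simps val_append)
 then show ?case unfolding v l using Cons by simp
qed (simp add: wt_def)

lemma ptf_wt:
 assumes "ptf (%w. f (fst w) (snd w))" "ptf bl" "ptf \<phi>"
 shows "ptf (%z. wt (bl z) (\<phi> z) (f z))"
proof -
 have bl: "ptf (%w. bl (fst w))" by (rule ptf_comp[OF ptf_fst[OF ptf_id] assms(2)])
 have "ptf (%w. take (length (bl (fst w))) (bits (f (fst w) (snd w)) @ map (%_. False) (bl (fst w))))"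
  by (intro ptf_take_len bl ptf_append ptf_bits assms(1) ptf_map ptf_const)
 then show ?thesis unfolding wt_def by (intro ptf_val ptf_concat ptf_map assms(3))
qed

definition cnt :: "'l => 'l list => nat" where
 "cnt l c = length (filter (%l'. l' = l) c)"

lemma cnt_Cons: "cnt l [] = 0" "cnt l (k # c) = of_bool (k = l) + cnt l c"
 by (simp_all add: cnt_def)

fun csums :: "(nat \<times> nat) list => nat set" where
 "csums [] = {0}"
| "csums (d # ds) = (%s. fst d + s) ` csums ds \<union> (%s. snd d + s) ` csums ds"

lemma sums_iff: "s \<in> csums ds \<longleftrightarrow> (\<exists>\<sigma>. (\<Sum>j < length ds. if \<sigma> j then fst (ds ! j) else snd (ds ! j)) = s)"
proof (induction ds arbitrary: s)
 case (Cons d ds)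
 let ?S = "%ds \<sigma>. (\<Sum>j < length ds. if \<sigma> j then fst (ds ! j) else snd (ds ! j)) :: nat"
 have step: "?S (d # ds) \<sigma> = (if \<sigma> 0 then fst d else snd d) + ?S ds (%j. \<sigma> (Suc j))" for \<sigma> :: "nat => bool"
  by (simp add: sum.lessThan_Suc_shift del: sum.lessThan_Suc cong: if_cong)
 show ?case
 proof
  assume "s \<in> csums (d # ds)"
  then obtain b s' where s: "s' \<in> csums ds" "s = (if b then fst d else snd d) + s'" by auto (metis (full_types))+
  from s(1) obtain \<sigma> where \<sigma>: "?S ds \<sigma> = s'" unfolding Cons.IH by blast
  have "?S (d # ds) (case_nat b \<sigma>) = s" unfolding step using s(2) \<sigma> by simp
  then show "\<exists>\<sigma>. ?S (d # ds) \<sigma> = s" by blast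
 next
  assume "\<exists>\<sigma>. ?S (d # ds) \<sigma> = s"
  then obtain \<sigma> where \<sigma>: "?S (d # ds) \<sigma> = s" by blast
  have "?S ds (%j. \<sigma> (Suc j)) \<in> csums ds" unfolding Cons.IH by (rule exI) (rule refl)
  then show "s \<in> csums (d # ds)" using \<sigma> unfolding step by (cases "\<sigma> 0") auto
 qed
qed simp

text \<open>The vector version of \<open>csums\<close>: the digit vectors that can be selected from pairs of digit vectors.\<close>

fun dsums :: "(('c => nat) \<times> ('c => nat)) list => ('c => nat) set" where
 "dsums [] = {%_. 0}"
| "dsums (g # gs) = {%c. fst g c + h c | h. h \<in> dsums gs} \<union> {%c. snd g c + h c | h. h \<in> dsums gs}"

lemma sums_numr: "s \<in> csums (map (%g. (numr b \<phi> (fst g), numr b \<phi> (snd g))) gs) \<longleftrightarrow> (\<exists>h \<in> dsums gs. s = numr b \<phi> h)"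
proof (induction gs arbitrary: s)
 case (Cons g gs)
 let ?t = "map (%g. (numr b \<phi> (fst g), numr b \<phi> (snd g))) gs"
 have "s \<in> csums (map (%g. (numr b \<phi> (fst g), numr b \<phi> (snd g))) (g # gs)) \<longleftrightarrow>
  (\<exists>s' \<in> csums ?t. s = numr b \<phi> (fst g) + s' \<or> s = numr b \<phi> (snd g) + s')" by auto
 also have "\<dots> \<longleftrightarrow> (\<exists>h \<in> dsums gs. s = numr b \<phi> (fst g) + numr b \<phi> h \<or> s = numr b \<phi> (snd g) + numr b \<phi> h)"
  unfolding Bex_def Cons.IH by blast
 also have "\<dots> \<longleftrightarrow> (\<exists>h \<in> dsums (g # gs). s = numr b \<phi> h)"
 proof
  assume "\<exists>h \<in> dsums gs. s = numr b \<phi> (fst g) + numr b \<phi> h \<or> s = numr b \<phi> (snd g) + numr b \<phi> h"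
  then obtain h where "h \<in> dsums gs" "s = numr b \<phi> (%c. fst g c + h c) \<or> s = numr b \<phi> (%c. snd g c + h c)" unfolding numr_add by blast
  then show "\<exists>h \<in> dsums (g # gs). s = numr b \<phi> h" by auto
 next
  assume "\<exists>h \<in> dsums (g # gs). s = numr b \<phi> h"
  then show "\<exists>h \<in> dsums gs. s = numr b \<phi> (fst g) + numr b \<phi> h \<or> s = numr b \<phi> (snd g) + numr b \<phi> h"
   by (auto simp: numr_add)
 qed
 finally show ?case .
qed (simp add: numr_zero)

lemma dsums_append: "h \<in> dsums (gs @ gs') \<longleftrightarrow> (\<exists>h1 \<in> dsums gs. \<exists>h2 \<in> dsums gs'. h = (%c. h1 c + h2 c))"
proof (induction gs arbitrary: h)
 case (Cons g gs)
 have "h \<in> dsums ((g # gs) @ gs') \<longleftrightarrow> (\<exists>k. k \<in> dsums (gs @ gs') & (h = (%c. fst g c + k c) \<or> h = (%c. snd g c + k c)))" by auto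
 also have "\<dots> \<longleftrightarrow> (\<exists>h1 \<in> dsums gs. \<exists>h2 \<in> dsums gs'. h = (%c. (fst g c + h1 c) + h2 c) \<or> h = (%c. (snd g c + h1 c) + h2 c))"
  unfolding Cons.IH by (auto simp: add.assoc)
 also have "\<dots> \<longleftrightarrow> (\<exists>h1 \<in> dsums (g # gs). \<exists>h2 \<in> dsums gs'. h = (%c. h1 c + h2 c))"
 proof
  assume "\<exists>h1 \<in> dsums (g # gs). \<exists>h2 \<in> dsums gs'. h = (%c. h1 c + h2 c)"
  then show "\<exists>h1 \<in> dsums gs. \<exists>h2 \<in> dsums gs'. h = (%c. (fst g c + h1 c) + h2 c) \<or> h = (%c. (snd g c + h1 c) + h2 c)"
   by auto
 next
  assume "\<exists>h1 \<in> dsums gs. \<exists>h2 \<in> dsums gs'. h = (%c. (fst g c + h1 c) + h2 c) \<or> h = (%c. (snd g c + h1 c) + h2 c)"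
  then obtain h1 h2 where h: "h1 \<in> dsums gs" "h2 \<in> dsums gs'" "h = (%c. (fst g c + h1 c) + h2 c) \<or> h = (%c. (snd g c + h1 c) + h2 c)" by blast
  have "(%c. fst g c + h1 c) \<in> dsums (g # gs)" "(%c. snd g c + h1 c) \<in> dsums (g # gs)" using h(1) by auto
  with h(2,3) show "\<exists>h1 \<in> dsums (g # gs). \<exists>h2 \<in> dsums gs'. h = (%c. h1 c + h2 c)"
   by (elim disjE) (rule bexI[of _ "%c. fst g c + h1 c"], rule bexI[of _ h2], simp_all del: dsums.simps,
    rule bexI[of _ "%c. snd g c + h1 c"], rule bexI[of _ h2], simp_all del: dsums.simps)
 qed
 finally show ?case .
qed auto

lemma dsums_le: "h \<in> dsums gs ==> h c \<le> (\<Sum>g\<leftarrow>gs. fst g c + snd g c)"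
 by (induction gs arbitrary: h) (auto, fastforce+)

lemma numr_total: "(\<Sum>d\<leftarrow>map (%g. (numr b \<phi> (fst g), numr b \<phi> (snd g))) gs. fst d + snd d) = numr b \<phi> (%c. \<Sum>g\<leftarrow>gs. fst g c + snd g c)"
 by (induction gs) (simp_all add: numr_add numr_zero)

lemma dsums_ConsI:
 assumes "k \<in> dsums gs"
 shows "(%c. fst g c + k c) \<in> dsums (g # gs)" "(%c. snd g c + k c) \<in> dsums (g # gs)"
 using assms by auto

lemma dsums_select:
 assumes "distinct vs"
 shows "h \<in> dsums (map (%v. (A v, B v)) vs) \<longleftrightarrow> (\<exists>\<alpha>. h = (%c. \<Sum>v\<leftarrow>vs. if \<alpha> v then A v c else B v c))"
 using assms
proof (induction vs arbitrary: h)
 case (Cons v vs)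
 have dv: "distinct vs" "v \<notin> set vs" using Cons.prems by auto
 show ?case
 proof
  assume "h \<in> dsums (map (%v. (A v, B v)) (v # vs))"
  then have "\<exists>k. k \<in> dsums (map (%v. (A v, B v)) vs) & (h = (%c. A v c + k c) \<or> h = (%c. B v c + k c))"
   unfolding list.map dsums.simps fst_conv snd_conv by blast
  then obtain k where k: "k \<in> dsums (map (%v. (A v, B v)) vs)" "h = (%c. A v c + k c) \<or> h = (%c. B v c + k c)" by blast
  define b where "b \<longleftrightarrow> h = (%c. A v c + k c)"
  have hb: "h = (%c. (if b then A v c else B v c) + k c)"
  proof (cases b)
   case True
   then show ?thesis unfolding if_P[OF True] by (simp only: b_def)
  next
   case False
   then have "h = (%c. B v c + k c)" using k(2) b_def by blast
   then show ?thesis unfolding if_not_P[OF False] .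
  qed
  obtain \<alpha> where \<alpha>: "k = (%c. \<Sum>v\<leftarrow>vs. if \<alpha> v then A v c else B v c)" using k(1) unfolding Cons.IH[OF dv(1)] by (elim exE)
  have "(\<Sum>u\<leftarrow>vs. if (\<alpha>(v := b)) u then A u c else B u c) = (\<Sum>u\<leftarrow>vs. if \<alpha> u then A u c else B u c)" for c
   using dv(2) by (intro arg_cong[where f = sum_list] map_cong refl) auto
  then have "h = (%c. \<Sum>u\<leftarrow>v # vs. if (\<alpha>(v := b)) u then A u c else B u c)" unfolding hb \<alpha> list.map sum_list.Cons fun_upd_same by (simp only:)
  then show "\<exists>\<alpha>. h = (%c. \<Sum>u\<leftarrow>v # vs. if \<alpha> u then A u c else B u c)" by (rule exI[where x = "\<alpha>(v := b)"])
 next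
  assume "\<exists>\<alpha>. h = (%c. \<Sum>u\<leftarrow>v # vs. if \<alpha> u then A u c else B u c)"
  then obtain \<alpha> where h: "h = (%c. \<Sum>u\<leftarrow>v # vs. if \<alpha> u then A u c else B u c)" by (elim exE)
  let ?k = "%c. \<Sum>u\<leftarrow>vs. if \<alpha> u then A u c else B u c"
  have k: "?k \<in> dsums (map (%v. (A v, B v)) vs)" unfolding Cons.IH[OF dv(1)] by (rule exI) (rule refl)
  show "h \<in> dsums (map (%v. (A v, B v)) (v # vs))"
  proof (cases "\<alpha> v")
   case True
   then have "h = (%c. A v c + ?k c)" unfolding h by simp
   then show ?thesis using dsums_ConsI(1)[OF k, of "(A v, B v)"] by (simp only: list.map fst_conv snd_conv)
  next
   case False
   then have "h = (%c. B v c + ?k c)" unfolding h by simp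
   then show ?thesis using dsums_ConsI(2)[OF k, of "(A v, B v)"] by (simp only: list.map fst_conv snd_conv)
  qed
 qed
qed auto

lemma dsums_repeat:
 assumes "k \<le> length l"
 shows "(%c. k * a c) \<in> dsums (map (%_. (a, %_. 0)) l)"
 using assms
proof (induction l arbitrary: k)
 case (Cons x l)
 show ?case
 proof (cases k)
  case 0
  then show ?thesis using Cons.IH[of 0] by auto
 next
  case (Suc k')
  then show ?thesis using Cons.IH[of k'] Cons.prems by auto
 qed
qed simp

text \<open>One slack diamond for each literal of a clause but the first: with at least one true
  literal, at most \<open>length d - 1\<close> units are missing.\<close>

definition slacks :: "lit list list => ((lit list => nat) \<times> (lit list => nat)) list" where
 "slacks \<psi> = concat (map (%d. map (%_. (%c. if c = d then 1 else 0, %_. 0)) (tl d)) \<psi>)"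

lemma dsums_slacks: "(!!d. k d \<le> length (tl d)) ==> (%c. \<Sum>d\<leftarrow>\<psi>. if c = d then k d else 0) \<in> dsums (slacks \<psi>)"
proof (induction \<psi>)
 case (Cons d \<psi>)
 have a: "(%c. k d * (if c = d then 1 else 0)) \<in> dsums (map (%_. (%c. if c = d then 1 else 0, %_. 0)) (tl d))"
  by (rule dsums_repeat[OF Cons.prems])
 have b: "(%c. \<Sum>d\<leftarrow>\<psi>. if c = d then k d else 0) \<in> dsums (slacks \<psi>)" by (rule Cons.IH[OF Cons.prems])
 have e1: "(%c. \<Sum>e\<leftarrow>d # \<psi>. if c = e then k e else 0) = (%c. k d * (if c = d then 1 else 0) + (\<Sum>d\<leftarrow>\<psi>. if c = d then k d else 0))" by auto
 have e2: "slacks (d # \<psi>) = map (%_. (%c. if c = d then 1 else 0, %_. 0)) (tl d) @ slacks \<psi>" by (simp add: slacks_def)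
 show ?case unfolding e1 e2 dsums_append by (rule bexI[OF bexI[OF refl b] a])
qed (simp add: slacks_def)

lemma sum_list_select: "distinct \<psi> ==> c \<in> set \<psi> ==> (\<Sum>d\<leftarrow>\<psi>. if c = d then k d else 0) = (k c :: nat)"
 by (simp add: sum_list_distinct_conv_sum_set)

lemma slacks_total:
 assumes "distinct \<psi>" "c \<in> set \<psi>"
 shows "(\<Sum>g\<leftarrow>slacks \<psi>. fst g c + snd g c) = length (tl c)"
proof -
 have r: "(\<Sum>x\<leftarrow>l. (if c = d then 1 else 0)) = (if c = d then length l else 0)" for l :: "lit list" and d by (induction l) auto
 have "(\<Sum>g\<leftarrow>slacks \<psi>. fst g c + snd g c) = (\<Sum>d\<leftarrow>\<psi>. if c = d then length (tl d) else 0)"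
 proof (induction \<psi>)
  case (Cons d \<psi>)
  then show ?case using r[of d "tl d"] by (simp add: slacks_def o_def)
 qed (simp add: slacks_def)
 then show ?thesis using sum_list_select[OF assms] by simp
qed

lemma count_true:
 assumes "distinct vs" "fst ` set c \<subseteq> set vs"
 shows "(\<Sum>v\<leftarrow>vs. if \<alpha> v then cnt (v, True) c else cnt (v, False) c) = length (filter (%l. \<alpha> (fst l) = snd l) c)"
 using assms(2)
proof (induction c)
 case (Cons l c)
 have "(\<Sum>v\<leftarrow>vs. if \<alpha> v then cnt (v, True) (l # c) else cnt (v, False) (l # c))
  = (\<Sum>v\<leftarrow>vs. (if v = fst l then (of_bool (\<alpha> v = snd l) :: nat) else 0) + (if \<alpha> v then cnt (v, True) c else cnt (v, False) c))"
  by (intro arg_cong[where f = sum_list] map_cong refl) (cases l, auto simp: cnt_Cons)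
 also have "\<dots> = (\<Sum>v\<leftarrow>vs. if v = fst l then (of_bool (\<alpha> v = snd l) :: nat) else 0) + (\<Sum>v\<leftarrow>vs. if \<alpha> v then cnt (v, True) c else cnt (v, False) c)"
  by (rule sum_list_addf)
 also have "(\<Sum>v\<leftarrow>vs. if v = fst l then (of_bool (\<alpha> v = snd l) :: nat) else 0) = of_bool (\<alpha> (fst l) = snd l)"
  unfolding sum_list_distinct_conv_sum_set[OF assms(1)] using Cons.prems by (subst sum.delta) auto
 finally show ?case using Cons by simp
qed (simp add: cnt_Cons cong: if_cong)

definition svars :: "lit list list => nat list list" where
 "svars \<psi> = uniq (map fst (concat \<psi>))"

text \<open>Both branches together, the literals of a clause \<open>c\<close> contribute
  \<open>length c\<close> and the slack \<open>length c - 1\<close>. The leading diamond adds the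
  missing 1, so the target \<open>length c\<close> is exactly half of the digit total, as the chain
  demands.\<close>

definition digits :: "lit list list => ((lit list => nat) \<times> (lit list => nat)) list" where
 "digits \<psi> = (%_. 1, %_. 0) # map (%v. (cnt (v, True), cnt (v, False))) (svars \<psi>) @ slacks \<psi>"

lemma digits_total:
 assumes "distinct \<psi>" "c \<in> set \<psi>" "c ~= []"
 shows "(\<Sum>g\<leftarrow>digits \<psi>. fst g c + snd g c) = 2 * length c"
proof -
 have sub: "fst ` set c \<subseteq> set (svars \<psi>)" using assms(2) by (auto simp: svars_def)
 have d: "distinct (svars \<psi>)" by (simp add: svars_def)
 have "(\<Sum>v\<leftarrow>svars \<psi>. cnt (v, True) c + cnt (v, False) c) = length (filter (%l. snd l) c) + length (filter (%l. \<not> snd l) c)"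
  using count_true[OF d sub, of "%_. True"] count_true[OF d sub, of "%_. False"] by (simp add: sum_list_addf)
 also have "\<dots> = length c" by (rule sum_length_filter_compl)
 finally show ?thesis using slacks_total[OF assms(1,2)] assms(3) by (simp add: digits_def o_def)
qed

text \<open>If the leading diamond contributes 0, slack alone cannot reach \<open>length c\<close>,
  so each clause has a true literal. If it contributes 1, at most \<open>length c - 1\<close>
  literals are true, so each clause has a false literal and the negated assignment satisfies
  it.\<close>

lemma digits_sat:
 assumes "distinct \<psi>" "!!c. c \<in> set \<psi> ==> c ~= []"
 shows "(\<exists>h \<in> dsums (digits \<psi>). \<forall>c \<in> set \<psi>. h c = length c) \<longleftrightarrow> sat \<psi>"
proof
 have d: "distinct (svars \<psi>)" by (simp add: svars_def)
 have sub: "fst ` set c \<subseteq> set (svars \<psi>)" if "c \<in> set \<psi>" for c using that by (auto simp: svars_def)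
 let ?t = "%\<alpha> c. length (filter (%l :: lit. \<alpha> (fst l) = snd l) c)"
 {
  assume "\<exists>h \<in> dsums (digits \<psi>). \<forall>c \<in> set \<psi>. h c = length c"
  then obtain h where h: "h \<in> dsums (digits \<psi>)" "!!c. c \<in> set \<psi> ==> h c = length c" by blast
  have "\<exists>k. k \<in> dsums (map (%v. (cnt (v, True), cnt (v, False))) (svars \<psi>) @ slacks \<psi>) & (h = (%c. 1 + k c) \<or> h = (%c. 0 + k c))"
   using h(1) unfolding digits_def dsums.simps fst_conv snd_conv by blast
  then obtain k where k1: "k \<in> dsums (map (%v. (cnt (v, True), cnt (v, False))) (svars \<psi>) @ slacks \<psi>)" "h = (%c. 1 + k c) \<or> h = (%c. 0 + k c)"
   by blast
  define f where "f = (if h = (%c. 1 + k c) then 1 else 0 :: nat)"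
  have k2: "h = (%c. f + k c)" using k1(2) unfolding f_def by (cases "h = (%c. 1 + k c)") simp_all
  note k = k1(1) k2
  obtain hv hs where hv: "hv \<in> dsums (map (%v. (cnt (v, True), cnt (v, False))) (svars \<psi>))" and hs1: "hs \<in> dsums (slacks \<psi>)" and khv: "k = (%c. hv c + hs c)"
   using k(1) unfolding dsums_append by (elim bexE)
  obtain \<alpha> where \<alpha>: "hv = (%c. \<Sum>v\<leftarrow>svars \<psi>. if \<alpha> v then cnt (v, True) c else cnt (v, False) c)"
   using hv unfolding dsums_select[OF d, where A = "%v. cnt (v, True)" and B = "%v. cnt (v, False)"] by (elim exE)
  have hs: "hs \<in> dsums (slacks \<psi>)" "k = (%c. (\<Sum>v\<leftarrow>svars \<psi>. if \<alpha> v then cnt (v, True) c else cnt (v, False) c) + hs c)"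
   using hs1 khv \<alpha> by simp_all
  have e: "f + (?t \<alpha> c + hs c) = length c" "hs c \<le> length c - 1" "0 < length c" if "c \<in> set \<psi>" for c
   using h(2)[OF that] dsums_le[OF hs(1), of c] slacks_total[OF assms(1) that] assms(2)[OF that] unfolding k(2) hs(2) count_true[OF d sub[OF that]] by simp_all
  show "sat \<psi>"
  proof (cases "f = 0")
   case True
   have "\<exists>l \<in> set c. \<alpha> (fst l) = snd l" if "c \<in> set \<psi>" for c
   proof -
    have "?t \<alpha> c ~= 0" using e[OF that] True by linarith
    then show ?thesis by (auto simp: filter_empty_conv)
   qed
   then show ?thesis unfolding sat_def by blast
  next
   case False
   have "\<exists>l \<in> set c. (\<not> \<alpha> (fst l)) = snd l" if "c \<in> set \<psi>" for c
   proof (rule ccontr)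
    assume n: "\<not> ?thesis"
    have "filter (%l. \<alpha> (fst l) = snd l) c = c" using n by (intro filter_True) auto
    then have "?t \<alpha> c = length c" by simp
    then show False using e(1)[OF that] False by linarith
   qed
   then show ?thesis unfolding sat_def by (intro exI[of _ "%v. \<not> \<alpha> v"]) blast
  qed
 }
 assume "sat \<psi>"
 then obtain \<alpha> where \<alpha>: "!!c. c \<in> set \<psi> ==> \<exists>l \<in> set c. \<alpha> (fst l) = snd l" unfolding sat_def by blast
 let ?k = "%c. if c \<in> set \<psi> then length c - ?t \<alpha> c else 0"
 have t: "0 < ?t \<alpha> c" "?t \<alpha> c \<le> length c" if "c \<in> set \<psi>" for c using \<alpha>[OF that] by (auto simp: filter_empty_conv)
 have "?k d \<le> length (tl d)" for d
 proof (cases "d \<in> set \<psi>")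
  case True
  then have "1 \<le> ?t \<alpha> d" using t(1)[of d] by linarith
  then have "length d - ?t \<alpha> d \<le> length d - 1" by (rule diff_le_mono2)
  then show ?thesis using True by simp
 qed simp
 then have s: "(%c. \<Sum>d\<leftarrow>\<psi>. if c = d then ?k d else 0) \<in> dsums (slacks \<psi>)" by (rule dsums_slacks)
 let ?v = "%c. \<Sum>v\<leftarrow>svars \<psi>. if \<alpha> v then cnt (v, True) c else cnt (v, False) c"
 have v: "?v \<in> dsums (map (%v. (cnt (v, True), cnt (v, False))) (svars \<psi>))" unfolding dsums_select[OF d] by blast
 have "(%c. ?v c + (\<Sum>d\<leftarrow>\<psi>. if c = d then ?k d else 0)) \<in> dsums (map (%v. (cnt (v, True), cnt (v, False))) (svars \<psi>) @ slacks \<psi>)"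
  unfolding dsums_append by (intro bexI[OF _ v] bexI[OF _ s] refl)
 from dsums_ConsI(2)[OF this, of "(%_. 1, %_. 0)"]
 have H: "(%c. ?v c + (\<Sum>d\<leftarrow>\<psi>. if c = d then ?k d else 0)) \<in> dsums (digits \<psi>)" unfolding digits_def snd_conv add_0 .
 have hc: "?v c + (\<Sum>d\<leftarrow>\<psi>. if c = d then ?k d else 0) = length c" if "c \<in> set \<psi>" for c
  unfolding count_true[OF d sub[OF that]] sum_list_select[OF assms(1) that] using t[OF that] that by simp
 show "\<exists>h \<in> dsums (digits \<psi>). \<forall>c \<in> set \<psi>. h c = length c" by (rule bexI[OF _ H], rule ballI, rule hc)
qed

text \<open>The extra unit doubles the capacity of a block, making room for
  \<open>2 * length c\<close>, which bounds the digit of \<open>c\<close> in every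
  selection.\<close>

definition blist :: "lit list list => unit list" where
 "blist \<psi> = () # map (%_. ()) (concat \<psi>)"

definition diamonds :: "lit list list => (nat \<times> nat) list" where
 "diamonds \<psi> = (wt (blist \<psi>) \<psi> (%_. 1), 0) # map (%v. (wt (blist \<psi>) \<psi> (cnt (v, True)), wt (blist \<psi>) \<psi> (cnt (v, False)))) (svars \<psi>) @
  concat (map (%d. map (%_. (wt (blist \<psi>) \<psi> (%c. if c = d then 1 else 0), 0)) (tl d)) \<psi>)"

definition sat_inst :: "lit list list => inst" where
 "sat_inst \<psi> = cinst (diamonds \<psi>) (wt (blist \<psi>) \<psi> length)"

lemma ptf_sat_inst: "ptf sat_inst"
proof -
 have v: "ptf svars" unfolding svars_def[abs_def] by (rule ptf_uniq) (intro ptfs)+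
 have b: "ptf blist" unfolding blist_def[abs_def] by (intro ptfs)
 have c: "ptf (%w :: lit \<times> lit list. cnt (fst w) (snd w))" unfolding cnt_def by (intro ptfs)
 have w1: "ptf (%\<psi>. wt (blist \<psi>) \<psi> (%_. 1))" by (intro ptf_wt b) (intro ptfs)+
 have w2: "ptf (%\<psi> :: lit list list. wt (blist \<psi>) \<psi> length)" by (intro ptf_wt b) (intro ptfs)+
 have w3: "ptf (%w :: lit list list \<times> nat list. wt (blist (fst w)) (fst w) (cnt (snd w, t)))" for t
  by (intro ptf_wt ptf_lift2[OF c] ptf_comp[OF _ b]) (intro ptfs)+
 have w4: "ptf (%w :: (lit list list \<times> lit list) \<times> lit. wt (blist (fst (fst w))) (fst (fst w)) (%c. if c = snd (fst w) then 1 else 0))"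
  by (intro ptf_wt ptf_comp[OF _ b]) (intro ptfs)+
 have "ptf diamonds" unfolding diamonds_def[abs_def]
  by (intro ptf_Cons ptf_append ptf_Pair ptf_map ptf_concat w1 w3 w4 v ptf_const ptf_tl ptf_snd ptf_id)
 then show ?thesis unfolding sat_inst_def[abs_def] by (rule ptf_cinst[OF _ w2])
qed

lemma sat_inst_correct:
 assumes "distinct \<psi>" "!!c. c \<in> set \<psi> ==> c ~= []"
 shows "mk (sat_inst \<psi>) \<in> mmd_instances" "mmd_yes (mk (sat_inst \<psi>)) \<longleftrightarrow> sat \<psi>"
proof -
 let ?b = "length (blist \<psi>)"
 have ne: "diamonds \<psi> ~= []" by (simp add: diamonds_def)
 then show "mk (sat_inst \<psi>) \<in> mmd_instances" unfolding sat_inst_def by (rule cinst_instance)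
 have big: "2 * length c < 2 ^ ?b" if "c \<in> set \<psi>" for c
 proof -
  have "length c \<le> length (concat \<psi>)" using that by (induction \<psi>) auto
  moreover have "length (concat \<psi>) < 2 ^ length (concat \<psi>)" by (rule less_exp)
  moreover have "?b = Suc (length (concat \<psi>))" by (simp add: blist_def)
  ultimately have "length c < 2 ^ length (concat \<psi>)" "?b = Suc (length (concat \<psi>))" by linarith+
  then show ?thesis by simp
 qed
 have len1: "1 \<le> length c" if "c \<in> set \<psi>" for c using assms(2)[OF that] by (cases c) auto
 have wt: "wt (blist \<psi>) \<psi> f = numr ?b \<psi> f" if f: "!!c. c \<in> set \<psi> ==> f c \<le> length c" for f
 proof (rule wt_numr)
  fix c assume "c \<in> set \<psi>"
  then show "f c < 2 ^ ?b" using f[of c] big[of c] by linarith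
 qed
 have w: "wt (blist \<psi>) \<psi> (%_. 1) = numr ?b \<psi> (%_. 1)" "wt (blist \<psi>) \<psi> length = numr ?b \<psi> length"
  "wt (blist \<psi>) \<psi> (cnt l) = numr ?b \<psi> (cnt l)" "wt (blist \<psi>) \<psi> (%c. if c = d then 1 else 0) = numr ?b \<psi> (%c. if c = d then 1 else 0)" for l d
 proof -
  show "wt (blist \<psi>) \<psi> (%_. 1) = numr ?b \<psi> (%_. 1)" "wt (blist \<psi>) \<psi> length = numr ?b \<psi> length" by (rule wt, erule len1) (rule wt, rule order_refl)
  show "wt (blist \<psi>) \<psi> (cnt l) = numr ?b \<psi> (cnt l)" by (rule wt) (simp add: cnt_def)
  show "wt (blist \<psi>) \<psi> (%c. if c = d then 1 else 0) = numr ?b \<psi> (%c. if c = d then 1 else 0)"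
  proof (rule wt)
   show "(if c = d then 1 else 0) \<le> length c" if "c \<in> set \<psi>" for c using len1[OF that] by auto
  qed
 qed
 have ds: "diamonds \<psi> = map (%g. (numr ?b \<psi> (fst g), numr ?b \<psi> (snd g))) (digits \<psi>)"
  unfolding diamonds_def digits_def slacks_def w by (simp add: numr_zero map_concat o_def)
 have tot: "(\<Sum>d\<leftarrow>diamonds \<psi>. fst d + snd d) = 2 * wt (blist \<psi>) \<psi> length"
 proof -
  have "(\<Sum>d\<leftarrow>diamonds \<psi>. fst d + snd d) = numr ?b \<psi> (%c. length c + length c)"
   unfolding ds numr_total using digits_total[OF assms(1)] assms(2) by (intro numr_cong) simp
  then show ?thesis unfolding numr_add w by simp
 qed
 have "mmd_yes (mk (sat_inst \<psi>)) \<longleftrightarrow> numr ?b \<psi> length \<in> csums (diamonds \<psi>)"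
  unfolding sat_inst_def sums_iff w(2)[symmetric] by (rule chain_correct[OF ne tot])
 also have "\<dots> \<longleftrightarrow> (\<exists>h \<in> dsums (digits \<psi>). numr ?b \<psi> length = numr ?b \<psi> h)" unfolding ds sums_numr by blast
 also have "\<dots> \<longleftrightarrow> (\<exists>h \<in> dsums (digits \<psi>). \<forall>c \<in> set \<psi>. h c = length c)"
 proof (intro bex_cong refl iffI ballI)
  fix h c assume h: "h \<in> dsums (digits \<psi>)" "numr ?b \<psi> length = numr ?b \<psi> h" "c \<in> set \<psi>"
  have "h d < 2 ^ ?b & length d < 2 ^ ?b" if "d \<in> set \<psi>" for d
   using dsums_le[OF h(1), of d] digits_total[OF assms(1) that assms(2)[OF that]] big[OF that] by simp
  then show "h c = length c" using numr_inj[OF h(2)[symmetric] _ h(3)] by blast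
 next
  fix h :: "lit list => nat" assume "\<forall>c \<in> set \<psi>. h c = length c"
  then show "numr ?b \<psi> length = numr ?b \<psi> h" by (intro numr_cong) simp
 qed
 also have "\<dots> \<longleftrightarrow> sat \<psi>" by (rule digits_sat[OF assms])
 finally show "mmd_yes (mk (sat_inst \<psi>)) \<longleftrightarrow> sat \<psi>" .
qed

section \<open>The computation of a verifier as clauses\<close>

fun mv :: "move => nat" where
 "mv MoveLeft = 0"
| "mv Stay = 1"
| "mv MoveRight = 2"

text \<open>With this coding a new head position is the old one plus the code minus 1, which can be
  computed on natural numbers.\<close>

lemma shift_mv: "shift m = int (mv m) - 1"
 by (cases m) simp_all

text \<open>The halting state idles, so a run extends to all times and the clauses treat halting
  like any other transition.\<close>

definition tt :: "tm => nat => nat list => nat \<times> (nat \<times> move) list" where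
 "tt M q as = (if q = nstates M then (q, map (%a. (a, Stay)) as) else trans M q as)"

type_synonym trow = "nat \<times> nat list \<times> nat \<times> (nat \<times> nat) list"

definition trow :: "tm => nat => nat list => trow" where
 "trow M q as = (q, as, fst (tt M q as), map (%am. (fst am, mv (snd am))) (snd (tt M q as)))"

text \<open>The machine is fixed in the reduction, so this table is a constant; its size,
  exponential in the number of tapes, is constant too.\<close>

definition tab :: "tm => trow list" where
 "tab M = concat (map (%q. map (trow M q) (List.n_lists (ntapes M) [0..<nsyms M])) [0..<Suc (nstates M)])"

lemma set_tab: "r \<in> set (tab M) \<longleftrightarrow> (\<exists>q as. q \<le> nstates M & length as = ntapes M & set as \<subseteq> {..<nsyms M} & r = trow M q as)"
 by (auto simp: tab_def set_n_lists less_Suc_eq_le image_iff atLeast0LessThan simp del: upt_Suc)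

lemma step_tt:
 assumes "length ts = ntapes M"
 shows "step M (q, ts) = (fst (tt M q (map (%(t, h). t h) ts)), map2 act ts (snd (tt M q (map (%(t, h). t h) ts))))"
proof -
 have "map2 act ts (map (%a. (a, Stay)) (map (%(t, h). t h) ts)) = ts" by (induction ts) auto
 then show ?thesis by (simp add: step_def tt_def split: prod.splits)
qed

text \<open>A run of \<open>M\<close>: state \<open>q \<tau>\<close>, content \<open>t \<tau> j\<close> and head position \<open>h \<tau> j\<close> of tape \<open>j\<close> at time \<open>\<tau>\<close>.\<close>

definition is_run :: "tm => bool list => (nat => nat) => (nat => nat => int => nat) => (nat => nat => int) => (nat => (nat \<times> nat) list) => bool" where
 "is_run M v q t h ac \<longleftrightarrow> q 0 = 0 & (\<forall>j. j < ntapes M --> t 0 j = (if j = 0 then tape_of v else (%_. 0)) & h 0 j = 0) &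
  (\<forall>\<tau>. trow M (q \<tau>) (map (%j. t \<tau> j (h \<tau> j)) [0..<ntapes M]) = (q \<tau>, map (%j. t \<tau> j (h \<tau> j)) [0..<ntapes M], q (Suc \<tau>), ac \<tau>)) &
  (\<forall>\<tau>. trow M (q \<tau>) (map (%j. t \<tau> j (h \<tau> j)) [0..<ntapes M]) \<in> set (tab M)) & (\<forall>\<tau>. length (ac \<tau>) = ntapes M) &
  (\<forall>\<tau> j. j < ntapes M --> t (Suc \<tau>) j = (t \<tau> j)(h \<tau> j := fst (ac \<tau> ! j)) & h (Suc \<tau>) j = h \<tau> j + int (snd (ac \<tau> ! j)) - 1 & \<bar>h \<tau> j\<bar> \<le> int \<tau>) &
  (\<forall>\<tau> j i. j < ntapes M --> t \<tau> j i < nsyms M) &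
  (\<forall>y n. halts_with M v y n --> t n 1 = tape_of y)"

lemma run_exists:
 assumes wf: "wf_tm M"
 shows "\<exists>q t h ac. is_run M v q t h ac"
proof -
 define C where "C \<tau> = (step M ^^ \<tau>) (init_config M v)" for \<tau>
 define q where "q \<tau> = fst (C \<tau>)" for \<tau>
 define t where "t \<tau> j = fst (snd (C \<tau>) ! j)" for \<tau> j
 define h where "h \<tau> j = snd (snd (C \<tau>) ! j)" for \<tau> j
 define as where "as \<tau> = map (%(t, h). t h) (snd (C \<tau>))" for \<tau>
 define acs where "acs \<tau> = snd (tt M (q \<tau>) (as \<tau>))" for \<tau>
 have nt: "2 \<le> ntapes M" "3 \<le> nsyms M" using wf by (auto simp: wf_tm_def)
 have Suc: "C (Suc \<tau>) = step M (q \<tau>, snd (C \<tau>))" for \<tau> by (simp add: C_def q_def)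
 let ?P = "%\<tau>. length (snd (C \<tau>)) = ntapes M & q \<tau> \<le> nstates M & (\<forall>j < ntapes M. (\<forall>i. t \<tau> j i < nsyms M) & \<bar>h \<tau> j\<bar> \<le> int \<tau>)"
 have as: "as \<tau> = map (%j. t \<tau> j (h \<tau> j)) [0..<ntapes M]" if "?P \<tau>" for \<tau>
  using that by (intro nth_equalityI) (simp_all add: as_def t_def h_def case_prod_beta)
 have asS: "length (as \<tau>) = ntapes M" "set (as \<tau>) \<subseteq> {..<nsyms M}" if "?P \<tau>" for \<tau>
  using that unfolding as[OF that] by auto
 have ok: "fst (tt M (q \<tau>) (as \<tau>)) \<le> nstates M" "length (acs \<tau>) = ntapes M" "fst ` set (acs \<tau>) \<subseteq> {..<nsyms M}" if P: "?P \<tau>" for \<tau>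
 proof -
  have "fst (tt M (q \<tau>) (as \<tau>)) \<le> nstates M & length (acs \<tau>) = ntapes M & fst ` set (acs \<tau>) \<subseteq> {..<nsyms M}"
  proof (cases "q \<tau> = nstates M")
   case True
   then show ?thesis using asS[OF P] by (simp add: acs_def tt_def image_image)
  next
   case False
   then have "q \<tau> < nstates M" using P by simp
   then show ?thesis using wf asS[OF P] False unfolding wf_tm_def acs_def tt_def by (fastforce split: prod.splits)
  qed
  then show "fst (tt M (q \<tau>) (as \<tau>)) \<le> nstates M" "length (acs \<tau>) = ntapes M" "fst ` set (acs \<tau>) \<subseteq> {..<nsyms M}" by simp_all
 qed
 have CS: "C (Suc \<tau>) = (fst (tt M (q \<tau>) (as \<tau>)), map2 act (snd (C \<tau>)) (acs \<tau>))" if "?P \<tau>" for \<tau>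
  unfolding Suc acs_def as_def using that by (intro step_tt) simp
 have nx: "t (Suc \<tau>) j = (t \<tau> j)(h \<tau> j := fst (acs \<tau> ! j)) & h (Suc \<tau>) j = h \<tau> j + shift (snd (acs \<tau> ! j))" if P: "?P \<tau>" and j: "j < ntapes M" for \<tau> j
 proof -
  have "snd (C (Suc \<tau>)) ! j = act (snd (C \<tau>) ! j) (acs \<tau> ! j)" unfolding CS[OF P] using P j ok(2)[OF P] by simp
  then show ?thesis unfolding t_def h_def by (cases "snd (C \<tau>) ! j"; cases "acs \<tau> ! j") simp
 qed
 have P: "?P \<tau>" for \<tau>
 proof (induction \<tau>)
  case 0
  have "(\<forall>i. t 0 j i < nsyms M) & \<bar>h 0 j\<bar> \<le> int 0" if "j < ntapes M" for j
   using that nt by (cases j) (auto simp: t_def h_def C_def init_config_def tape_of_def)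
  then show ?case using nt by (simp add: C_def q_def init_config_def)
 next
  case (Suc \<tau>)
  have "length (snd (C (Suc \<tau>))) = ntapes M" "q (Suc \<tau>) \<le> nstates M" using CS[OF Suc] ok[OF Suc] Suc by (simp_all add: q_def)
  moreover have "(\<forall>i. t (Suc \<tau>) j i < nsyms M) & \<bar>h (Suc \<tau>) j\<bar> \<le> int (Suc \<tau>)" if j: "j < ntapes M" for j
  proof -
   have "acs \<tau> ! j \<in> set (acs \<tau>)" using ok(2)[OF Suc] j by simp
   then have "fst (acs \<tau> ! j) < nsyms M" using ok(3)[OF Suc] by auto
   moreover have "\<bar>shift m\<bar> \<le> 1" for m by (cases m) simp_all
   from this[of "snd (acs \<tau> ! j)"] have "\<bar>h \<tau> j + shift (snd (acs \<tau> ! j))\<bar> \<le> int (Suc \<tau>)" using Suc j by fastforce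
   ultimately show ?thesis using nx[OF Suc j] Suc j by simp
  qed
  ultimately show ?case by blast
 qed
 let ?ac = "%\<tau>. map (%am. (fst am, mv (snd am))) (acs \<tau>)"
 have qS: "q (Suc \<tau>) = fst (tt M (q \<tau>) (as \<tau>))" for \<tau> using CS[OF P] by (simp add: q_def)
 have 1: "q 0 = 0" by (simp add: q_def C_def init_config_def)
 have "t 0 j = (if j = 0 then tape_of v else (%_. 0)) & h 0 j = 0" if "j < ntapes M" for j
  using that by (cases j) (auto simp: t_def h_def C_def init_config_def)
 then have 2: "\<forall>j. j < ntapes M --> t 0 j = (if j = 0 then tape_of v else (%_. 0)) & h 0 j = 0" by (intro allI impI)
 have "trow M (q \<tau>) (map (%j. t \<tau> j (h \<tau> j)) [0..<ntapes M]) = (q \<tau>, map (%j. t \<tau> j (h \<tau> j)) [0..<ntapes M], q (Suc \<tau>), ?ac \<tau>)" for \<tau>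
  unfolding as[OF P, symmetric] trow_def qS acs_def ..
 then have 3: "\<forall>\<tau>. trow M (q \<tau>) (map (%j. t \<tau> j (h \<tau> j)) [0..<ntapes M]) = (q \<tau>, map (%j. t \<tau> j (h \<tau> j)) [0..<ntapes M], q (Suc \<tau>), ?ac \<tau>)"
  by (intro allI)
 have "trow M (q \<tau>) (map (%j. t \<tau> j (h \<tau> j)) [0..<ntapes M]) \<in> set (tab M)" for \<tau>
  unfolding as[OF P, symmetric] set_tab using P[of \<tau>] asS[OF P] by blast
 then have 4: "\<forall>\<tau>. trow M (q \<tau>) (map (%j. t \<tau> j (h \<tau> j)) [0..<ntapes M]) \<in> set (tab M)" by (intro allI)
 have 5: "\<forall>\<tau>. length (?ac \<tau>) = ntapes M" using ok(2)[OF P] by simp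
 have "t (Suc \<tau>) j = (t \<tau> j)(h \<tau> j := fst (?ac \<tau> ! j)) & h (Suc \<tau>) j = h \<tau> j + int (snd (?ac \<tau> ! j)) - 1 & \<bar>h \<tau> j\<bar> \<le> int \<tau>" if "j < ntapes M" for \<tau> j
  using nx[OF P that] that P[of \<tau>] ok(2)[OF P] by (simp add: shift_mv)
 then have 6: "\<forall>\<tau> j. j < ntapes M --> t (Suc \<tau>) j = (t \<tau> j)(h \<tau> j := fst (?ac \<tau> ! j)) & h (Suc \<tau>) j = h \<tau> j + int (snd (?ac \<tau> ! j)) - 1 & \<bar>h \<tau> j\<bar> \<le> int \<tau>"
  by (intro allI impI)
 have 7: "\<forall>\<tau> j i. j < ntapes M --> t \<tau> j i < nsyms M" using P by blast
 have 8: "\<forall>y n. halts_with M v y n --> t n 1 = tape_of y" by (simp add: halts_with_def t_def C_def split: prod.splits)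
 have "is_run M v q t h ?ac" unfolding is_run_def
  by (rule conjI[OF 1 conjI[OF 2 conjI[OF 3 conjI[OF 4 conjI[OF 5 conjI[OF 6 conjI[OF 7 8]]]]]]])
 then show ?thesis by (intro exI)
qed

lemma is_runD:
 assumes "is_run M v q t h ac"
 shows "q 0 = 0" "j < ntapes M ==> t 0 j = (if j = 0 then tape_of v else (%_. 0)) & h 0 j = 0"
  "trow M (q \<tau>) (map (%j. t \<tau> j (h \<tau> j)) [0..<ntapes M]) = (q \<tau>, map (%j. t \<tau> j (h \<tau> j)) [0..<ntapes M], q (Suc \<tau>), ac \<tau>)"
  "trow M (q \<tau>) (map (%j. t \<tau> j (h \<tau> j)) [0..<ntapes M]) \<in> set (tab M)" "length (ac \<tau>) = ntapes M"
  "j < ntapes M ==> t (Suc \<tau>) j = (t \<tau> j)(h \<tau> j := fst (ac \<tau> ! j)) & h (Suc \<tau>) j = h \<tau> j + int (snd (ac \<tau> ! j)) - 1 & \<bar>h \<tau> j\<bar> \<le> int \<tau>"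
  "j < ntapes M ==> t \<tau> j i < nsyms M" "halts_with M v y n ==> t n 1 = tape_of y"
proof -
 note A = assms[unfolded is_run_def]
 note A2 = A[THEN conjunct2] note A3 = A2[THEN conjunct2] note A4 = A3[THEN conjunct2] note A5 = A4[THEN conjunct2]
 note A6 = A5[THEN conjunct2] note A7 = A6[THEN conjunct2]
 show "q 0 = 0" by (rule A[THEN conjunct1])
 show "j < ntapes M ==> t 0 j = (if j = 0 then tape_of v else (%_. 0)) & h 0 j = 0" by (rule A2[THEN conjunct1, rule_format])
 show "trow M (q \<tau>) (map (%j. t \<tau> j (h \<tau> j)) [0..<ntapes M]) = (q \<tau>, map (%j. t \<tau> j (h \<tau> j)) [0..<ntapes M], q (Suc \<tau>), ac \<tau>)"
  by (rule A3[THEN conjunct1, rule_format])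
 show "trow M (q \<tau>) (map (%j. t \<tau> j (h \<tau> j)) [0..<ntapes M]) \<in> set (tab M)" by (rule A4[THEN conjunct1, rule_format])
 show "length (ac \<tau>) = ntapes M" by (rule A5[THEN conjunct1, rule_format])
 show "j < ntapes M ==> t (Suc \<tau>) j = (t \<tau> j)(h \<tau> j := fst (ac \<tau> ! j)) & h (Suc \<tau>) j = h \<tau> j + int (snd (ac \<tau> ! j)) - 1 & \<bar>h \<tau> j\<bar> \<le> int \<tau>"
  by (rule A6[THEN conjunct1, rule_format])
 show "j < ntapes M ==> t \<tau> j i < nsyms M" by (rule A7[THEN conjunct1, rule_format])
 show "halts_with M v y n ==> t n 1 = tape_of y" by (rule A7[THEN conjunct2, rule_format])
qed

text \<open>Propositional variables as number lists with a tag: state, head position, cell content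
  and symbol read. Position \<open>i\<close> stands for cell \<open>i - length U\<close>, as no head
  gets farther than \<open>length U\<close> from the origin. The symbol read decouples the tapes: a
  transition clause mentions the position of one head only.\<close>

abbreviation "fSt (\<tau>::nat) (q::nat) \<equiv> [0, \<tau>, q]"
abbreviation "fHd (\<tau>::nat) (j::nat) (i::nat) \<equiv> [1, \<tau>, j, i]"
abbreviation "fCe (\<tau>::nat) (j::nat) (i::nat) (a::nat) \<equiv> [2, \<tau>, j, i, a]"
abbreviation "fRd (\<tau>::nat) (j::nat) (a::nat) \<equiv> [3, \<tau>, j, a]"

definition body :: "nat => nat => nat => nat => trow => lit list" where
 "body nt \<tau> j i r = (fHd \<tau> j i, False) # (fSt \<tau> (fst r), False) # map (%ja. (fRd \<tau> (fst ja) (snd ja), False)) (zip [0..<nt] (fst (snd r)))"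

text \<open>Cells behind the fixed prefix are guessed; blanks propagate to the right, so the guess
  is a word, and the forced blank after \<open>length W\<close> cells bounds it. The third clause
  forbids symbol 1, the bit \<open>False\<close>, in output cell 0 at the end.\<close>

definition cl_init :: "nat => unit list => bool list => unit list => lit list list" where
 "cl_init nt U pre W = [[(fSt 0 0, True)], [(fCe 0 0 (length U + length pre + length W) 0, True)], [(fCe (length U) 1 (length U) 1, False)]] @
  map (%j. [(fHd 0 j (length U), True)]) [0..<nt] @
  concat (map (%j. map (%i. [(fCe 0 j i 0, True)]) [0..<length (() # U @ U)]) [1..<nt]) @
  map (%i. [(fCe 0 0 i 0, True)]) [0..<length U] @
  map (%i. [(fCe 0 0 (length U + i) (if nth_or False pre i then 2 else 1), True)]) [0..<length pre] @
  map (%i. [(fCe 0 0 i 0, True), (fCe 0 0 i 1, True), (fCe 0 0 i 2, True)]) (filter (%i. length U + length pre \<le> i) [0..<length (() # U @ U)]) @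
  map (%i. [(fCe 0 0 i 0, False), (fCe 0 0 (Suc i) 0, True)]) (filter (%i. length U + length pre \<le> i) [0..<length (() # U @ U)])"

text \<open>Only implications forward in time; uniqueness of states or symbols is nowhere demanded.
  Instead the clauses force every fact of the true run, and a single forbidden fact excludes
  rejection.\<close>

definition cl_step :: "tm => unit list => lit list list" where
 "cl_step M U = concat (map (%\<tau>. concat (map (%j. concat (map (%i.
  map (%a. [(fHd \<tau> j i, False), (fCe \<tau> j i a, False), (fRd \<tau> j a, True)]) [0..<nsyms M] @
  concat (map (%i'. map (%a. [(fHd \<tau> j i', False), (fCe \<tau> j i a, False), (fCe (Suc \<tau>) j i a, True)]) [0..<nsyms M])
   (filter (%i'. i' ~= i) [0..<length (() # U @ U)])) @
  map (%r. body (ntapes M) \<tau> j i r @ [(fSt (Suc \<tau>) (fst (snd (snd r))), True)]) (tab M) @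
  map (%r. body (ntapes M) \<tau> j i r @ [(fCe (Suc \<tau>) j i (fst (nth_or (0, 0) (snd (snd (snd r))) j)), True)]) (tab M) @
  map (%r. body (ntapes M) \<tau> j i r @ [(fHd (Suc \<tau>) j (i + snd (nth_or (0, 0) (snd (snd (snd r))) j) - 1), True)]) (tab M))
  [0..<length (() # U @ U)])) [0..<ntapes M])) [0..<length U])"

definition cl :: "tm => unit list => bool list => unit list => lit list list" where
 "cl M U pre W = cl_init (ntapes M) U pre W @ cl_step M U"

lemma ptf_cl:
 assumes "ptf U" "ptf pre" "ptf W"
 shows "ptf (%z. cl M (U z) (pre z) (W z))"
proof -
 have 1: "ptf (%w. cl_init (ntapes M) (fst w) (fst (snd w)) (snd (snd w)))"
  unfolding cl_init_def by (intro ptfs ptf_upt_len)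
 have 2: "ptf (cl_step M)" unfolding cl_step_def[abs_def] body_def by (intro ptfs ptf_upt_len)
 show ?thesis unfolding cl_def by (rule ptf_append[OF ptf_lift3[OF 1 assms] ptf_comp[OF assms(1) 2]])
qed

definition sc :: "(nat list => bool) => lit list => bool" where
 "sc \<alpha> c \<longleftrightarrow> (\<exists>l \<in> set c. \<alpha> (fst l) = snd l)"

text \<open>For an arbitrary predicate \<open>Q\<close>, so that the same unfolding serves to use
  the clauses and to establish them.\<close>

lemma cl_ball:
 "(\<forall>c \<in> set (cl M U pre W). Q c) \<longleftrightarrow>
  (Q [(fSt 0 0, True)] & Q [(fCe 0 0 (length U + length pre + length W) 0, True)] & Q [(fCe (length U) 1 (length U) 1, False)] &
  (\<forall>j < ntapes M. Q [(fHd 0 j (length U), True)]) &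
  (\<forall>j. 1 \<le> j & j < ntapes M --> (\<forall>i \<le> 2 * length U. Q [(fCe 0 j i 0, True)])) &
  (\<forall>i < length U. Q [(fCe 0 0 i 0, True)]) &
  (\<forall>i < length pre. Q [(fCe 0 0 (length U + i) (if pre ! i then 2 else 1), True)]) &
  (\<forall>i \<le> 2 * length U. length U + length pre \<le> i --> Q [(fCe 0 0 i 0, True), (fCe 0 0 i 1, True), (fCe 0 0 i 2, True)]) &
  (\<forall>i \<le> 2 * length U. length U + length pre \<le> i --> Q [(fCe 0 0 i 0, False), (fCe 0 0 (Suc i) 0, True)])) &
  (\<forall>\<tau> < length U. \<forall>j < ntapes M. \<forall>i \<le> 2 * length U.
   (\<forall>a < nsyms M. Q [(fHd \<tau> j i, False), (fCe \<tau> j i a, False), (fRd \<tau> j a, True)]) &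
   (\<forall>i' \<le> 2 * length U. i' ~= i --> (\<forall>a < nsyms M. Q [(fHd \<tau> j i', False), (fCe \<tau> j i a, False), (fCe (Suc \<tau>) j i a, True)])) &
   (\<forall>r \<in> set (tab M). Q (body (ntapes M) \<tau> j i r @ [(fSt (Suc \<tau>) (fst (snd (snd r))), True)])) &
   (\<forall>r \<in> set (tab M). Q (body (ntapes M) \<tau> j i r @ [(fCe (Suc \<tau>) j i (fst (nth_or (0, 0) (snd (snd (snd r))) j)), True)])) &
   (\<forall>r \<in> set (tab M). Q (body (ntapes M) \<tau> j i r @ [(fHd (Suc \<tau>) j (i + snd (nth_or (0, 0) (snd (snd (snd r))) j) - 1), True)])))"
proof -
 have l: "length (() # U @ U) = Suc (2 * length U)" by simp
 have n: "(\<forall>i \<in> set [0..<Suc k]. Q' i) \<longleftrightarrow> (\<forall>i \<le> k. Q' i)" "(\<forall>i \<in> set [0..<k]. Q' i) \<longleftrightarrow> (\<forall>i < k. Q' i)"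
  "(\<forall>i \<in> set [1..<k]. Q' i) \<longleftrightarrow> (\<forall>i. 1 \<le> i & i < k --> Q' i)" for k and Q' :: "nat => bool"
  by (auto simp: less_Suc_eq_le simp del: upt_Suc)
 have b: "(\<forall>c \<in> set (xs @ ys). Q c) \<longleftrightarrow> (\<forall>c \<in> set xs. Q c) & (\<forall>c \<in> set ys. Q c)" for xs ys by auto
 have c: "(\<forall>c \<in> set (concat (map f xs)). Q c) \<longleftrightarrow> (\<forall>x \<in> set xs. \<forall>c \<in> set (f x). Q c)" for f :: "nat => lit list list" and xs by auto
 have m: "(\<forall>c \<in> set (map g xs). Q c) \<longleftrightarrow> (\<forall>x \<in> set xs. Q (g x))" for g :: "nat => lit list" and xs by auto
 have m': "(\<forall>c \<in> set (map g xs). Q c) \<longleftrightarrow> (\<forall>x \<in> set xs. Q (g x))" for g :: "trow => lit list" and xs by auto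
 have f: "(\<forall>x \<in> set (filter R xs). Q' x) \<longleftrightarrow> (\<forall>x \<in> set xs. R x --> Q' x)" for R Q' and xs :: "nat list" by auto
 have k: "(\<forall>c \<in> set [x, y, z]. Q c) \<longleftrightarrow> Q x & Q y & Q z" for x y z by simp
 show ?thesis unfolding cl_def cl_init_def cl_step_def l b c m m' f k n by (simp add: less_Suc_eq_le cong: imp_cong conj_cong)
qed

lemma sc_simps: "sc \<alpha> [] \<longleftrightarrow> False" "sc \<alpha> (l # c) \<longleftrightarrow> \<alpha> (fst l) = snd l \<or> sc \<alpha> c"
 by (simp_all add: sc_def)

lemma sc_body: "sc \<alpha> (body nt \<tau> j i r @ [(f, True)]) \<longleftrightarrow>
  (\<alpha> (fHd \<tau> j i) & \<alpha> (fSt \<tau> (fst r)) & (\<forall>ja \<in> set (zip [0..<nt] (fst (snd r))). \<alpha> (fRd \<tau> (fst ja) (snd ja))) --> \<alpha> f)"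
 unfolding sc_def body_def by (simp add: bex_Un) blast

text \<open>An assignment may make more facts true than those of a run, even contradictory ones. So
  a witness is extracted first, and the facts of its run are then shown to hold by induction on
  time. Were the run rejecting, the forbidden output symbol would be among them.\<close>

lemma tableau_sound:
 assumes wf: "wf_tm M" and len: "length pre + length W \<le> length U"
  and halt: "!!w. length w \<le> length W ==> halts_with M (pre @ w) [pre @ w \<in> V] (length U)"
  and all: "\<forall>c \<in> set (cl M U pre W). sc \<alpha> c"
 shows "\<exists>w. length w \<le> length W & pre @ w \<in> V"
proof -
 define n where "n = length U"
 define b where "b = n + length pre"
 note A = all[unfolded cl_ball, folded n_def, folded b_def]
 note I1 = A[THEN conjunct1] note S = A[THEN conjunct2, rule_format]
 note I2 = I1[THEN conjunct2] note I3 = I2[THEN conjunct2] note I4 = I3[THEN conjunct2] note I5 = I4[THEN conjunct2]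
 note I6 = I5[THEN conjunct2] note I7 = I6[THEN conjunct2] note I8 = I7[THEN conjunct2]
 have st0: "\<alpha> (fSt 0 0)" using I1[THEN conjunct1] by (simp add: sc_simps)
 have end0: "\<alpha> (fCe 0 0 (b + length W) 0)" using I2[THEN conjunct1] by (simp add: sc_simps)
 have fin: "\<not> \<alpha> (fCe n 1 n 1)" using I3[THEN conjunct1] by (simp add: sc_simps)
 have hd0: "\<alpha> (fHd 0 j n)" if "j < ntapes M" for j using I4[THEN conjunct1, rule_format, OF that] by (simp add: sc_simps)
 have bl: "\<alpha> (fCe 0 j i 0)" if "1 \<le> j" "j < ntapes M" "i \<le> 2 * n" for i j
  using I5[THEN conjunct1, rule_format, OF conjI[OF that(1,2)] that(3)] by (simp add: sc_simps)
 have lf: "\<alpha> (fCe 0 0 i 0)" if "i < n" for i using I6[THEN conjunct1, rule_format, OF that] by (simp add: sc_simps)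
 have pr: "\<alpha> (fCe 0 0 (n + i) (if pre ! i then 2 else 1))" if "i < length pre" for i
  using I7[THEN conjunct1, rule_format, OF that] by (simp add: sc_simps)
 have gs: "\<alpha> (fCe 0 0 i 0) \<or> \<alpha> (fCe 0 0 i 1) \<or> \<alpha> (fCe 0 0 i 2)" if "i \<le> 2 * n" "b \<le> i" for i
  using I8[THEN conjunct1, rule_format, OF that] by (simp add: sc_simps)
 have mo: "\<alpha> (fCe 0 0 i 0) ==> \<alpha> (fCe 0 0 (Suc i) 0)" if "i \<le> 2 * n" "b \<le> i" for i
  using I8[THEN conjunct2, rule_format, OF that] by (simp add: sc_simps)
 \<comment> \<open>The witness ends at the first cell behind the prefix for which the assignment
   admits a blank.\<close>
 define m where "m = (LEAST m. \<alpha> (fCe 0 0 (b + m) 0))"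
 have m0: "\<alpha> (fCe 0 0 (b + m) 0)" unfolding m_def by (rule LeastI[of _ "length W"]) (rule end0)
 have mW: "m \<le> length W" unfolding m_def by (rule Least_le) (rule end0)
 have mlt: "\<not> \<alpha> (fCe 0 0 (b + k) 0)" if "k < m" for k using not_less_Least that unfolding m_def by blast
 have b2: "b + length W \<le> 2 * n" using len by (simp add: b_def n_def)
 have mge: "\<alpha> (fCe 0 0 (b + (m + k)) 0)" if "b + (m + k) \<le> 2 * n" for k
  using that
 proof (induction k)
  case 0
  then show ?case using m0 by simp
 next
  case (Suc k)
  then have "\<alpha> (fCe 0 0 (b + (m + k)) 0)" by simp
  then show ?case using mo[of "b + (m + k)"] Suc.prems by simp
 qed
 \<comment> \<open>If both bit symbols hold in a cell, either choice is justified; symbol 2 is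
   preferred.\<close>
 define w where "w = map (%k. \<alpha> (fCe 0 0 (b + k) 2)) [0..<m]"
 have lw: "length w = m" by (simp add: w_def)
 let ?v = "pre @ w"
 have cells: "\<alpha> (fCe 0 0 i (tape_of ?v (int i - int n)))" if i: "i \<le> 2 * n" for i
 proof -
  consider "i < n" | k where "i = n + k" "k < length pre" | k where "i = b + k" "k < m" | k where "i = b + (m + k)"
  proof -
   have "i < n \<or> (n \<le> i & i < b) \<or> (b \<le> i & i < b + m) \<or> b + m \<le> i" by linarith
   then show ?thesis
   proof (elim disjE conjE)
    assume "n \<le> i" "i < b"
    then have "i = n + (i - n)" "i - n < length pre" by (simp_all add: b_def less_diff_conv2 add.commute)
    then show ?thesis using that(2) by blast
   next
    assume "b \<le> i" "i < b + m"
    then have "i = b + (i - b)" "i - b < m" by (simp_all add: less_diff_conv2 add.commute)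
    then show ?thesis using that(3) by blast
   next
    assume "b + m \<le> i"
    then have "i = b + (m + (i - (b + m)))" by simp
    then show ?thesis using that(4) by blast
   qed (rule that(1))
  qed
  then show ?thesis
  proof cases
   case 1
   then show ?thesis using lf[OF 1] by (simp add: tape_of_def)
  next
   case 2
   then show ?thesis using pr[OF 2(2)] by (simp add: tape_of_def nth_append)
  next
   case 3
   have "tape_of ?v (int i - int n) = (if \<alpha> (fCe 0 0 (b + k) 2) then 2 else 1)"
    using 3 lw by (simp add: tape_of_def b_def nth_append w_def nat_add_distrib)
   moreover have "\<alpha> (fCe 0 0 (b + k) 1) \<or> \<alpha> (fCe 0 0 (b + k) 2)" using gs[of "b + k"] mlt[OF 3(2)] i 3(1) by auto
   ultimately show ?thesis using 3(1) by auto
  next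
   case 4
   have "tape_of ?v (int i - int n) = 0" using 4 lw by (simp add: tape_of_def b_def nat_add_distrib)
   then show ?thesis using mge[of k] 4 i by simp
  qed
 qed
 obtain q t h ac where run: "is_run M ?v q t h ac" using run_exists[OF wf, of ?v] by blast
 note R = is_runD[OF run]
 have nt: "0 < ntapes M" "1 < ntapes M" using wf by (auto simp: wf_tm_def)
 have inv: "\<alpha> (fSt \<tau> (q \<tau>)) & (\<forall>j < ntapes M. \<alpha> (fHd \<tau> j (nat (h \<tau> j + int n))) & (\<forall>i \<le> 2 * n. \<alpha> (fCe \<tau> j i (t \<tau> j (int i - int n)))))" if "\<tau> \<le> n" for \<tau>
  using that
 proof (induction \<tau>)
  case 0
  have "\<alpha> (fCe 0 j i (t 0 j (int i - int n)))" if "j < ntapes M" "i \<le> 2 * n" for j i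
   using R(2)[OF that(1)] cells[OF that(2)] bl[of j i] that by (cases j) auto
  moreover have "\<alpha> (fHd 0 j (nat (h 0 j + int n)))" if "j < ntapes M" for j using R(2)[OF that] hd0[OF that] by simp
  ultimately show ?case using st0 R(1) by simp
 next
  case (Suc \<tau>)
  then have IH: "\<alpha> (fSt \<tau> (q \<tau>))" "!!j. j < ntapes M ==> \<alpha> (fHd \<tau> j (nat (h \<tau> j + int n)))"
   "!!j i. j < ntapes M ==> i \<le> 2 * n ==> \<alpha> (fCe \<tau> j i (t \<tau> j (int i - int n)))" and \<tau>: "\<tau> < n" by auto
  define hp where "hp j = nat (h \<tau> j + int n)" for j
  have hp: "int (hp j) = h \<tau> j + int n" "hp j \<le> 2 * n" "1 \<le> hp j" if "j < ntapes M" for j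
   using R(6)[OF that, where \<tau> = \<tau>] \<tau> by (auto simp: hp_def)
  have rd: "\<alpha> (fRd \<tau> j (t \<tau> j (h \<tau> j)))" if j: "j < ntapes M" for j
  proof -
   have "sc \<alpha> [(fHd \<tau> j (hp j), False), (fCe \<tau> j (hp j) (t \<tau> j (h \<tau> j)), False), (fRd \<tau> j (t \<tau> j (h \<tau> j)), True)]"
    using S[OF \<tau> j hp(2)[OF j]] R(7)[OF j, where \<tau> = \<tau> and i = "h \<tau> j"] by blast
   moreover have "\<alpha> (fCe \<tau> j (hp j) (t \<tau> j (h \<tau> j)))" using IH(3)[OF j hp(2)[OF j]] hp(1)[OF j] by simp
   ultimately show ?thesis using IH(2)[OF j] by (simp add: sc_simps hp_def)
  qed
  let ?r = "trow M (q \<tau>) (map (%j. t \<tau> j (h \<tau> j)) [0..<ntapes M])"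
  have bd: "\<alpha> f" if "sc \<alpha> (body (ntapes M) \<tau> j (hp j) ?r @ [(f, True)])" "j < ntapes M" for f j
  proof -
   have "\<forall>ja \<in> set (zip [0..<ntapes M] (fst (snd ?r))). \<alpha> (fRd \<tau> (fst ja) (snd ja))"
    unfolding R(3) using rd by (auto simp: set_zip)
   moreover have "\<alpha> (fHd \<tau> j (hp j))" "\<alpha> (fSt \<tau> (fst ?r))" using IH(1) IH(2)[OF that(2)] unfolding R(3) hp_def by simp_all
   ultimately show ?thesis using that(1) unfolding sc_body by blast
  qed
  have "\<alpha> (fSt (Suc \<tau>) (fst (snd (snd ?r))))"
   by (rule bd[OF _ nt(1)]) (use S[OF \<tau> nt(1) hp(2)[OF nt(1)]] R(4)[where \<tau> = \<tau>] in blast)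
  then have 1: "\<alpha> (fSt (Suc \<tau>) (q (Suc \<tau>)))" unfolding R(3) by simp
  have 2: "\<alpha> (fHd (Suc \<tau>) j (nat (h (Suc \<tau>) j + int n)))" if j: "j < ntapes M" for j
  proof -
   have "\<alpha> (fHd (Suc \<tau>) j (hp j + snd (nth_or (0, 0) (snd (snd (snd ?r))) j) - 1))"
    by (rule bd[OF _ j]) (use S[OF \<tau> j hp(2)[OF j]] R(4)[where \<tau> = \<tau>] in blast)
   then have "\<alpha> (fHd (Suc \<tau>) j (hp j + snd (ac \<tau> ! j) - 1))" unfolding R(3) using R(5)[where \<tau> = \<tau>] j by simp
   moreover have "hp j + snd (ac \<tau> ! j) - 1 = nat (h (Suc \<tau>) j + int n)" using hp[OF j] R(6)[OF j, where \<tau> = \<tau>] by linarith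
   ultimately show ?thesis by simp
  qed
  have 3: "\<alpha> (fCe (Suc \<tau>) j i (t (Suc \<tau>) j (int i - int n)))" if j: "j < ntapes M" and i: "i \<le> 2 * n" for j i
  proof (cases "i = hp j")
   case True
   have "\<alpha> (fCe (Suc \<tau>) j (hp j) (fst (nth_or (0, 0) (snd (snd (snd ?r))) j)))"
    by (rule bd[OF _ j]) (use S[OF \<tau> j hp(2)[OF j]] R(4)[where \<tau> = \<tau>] in blast)
   then have "\<alpha> (fCe (Suc \<tau>) j (hp j) (fst (ac \<tau> ! j)))" unfolding R(3) using R(5)[where \<tau> = \<tau>] j by simp
   moreover have "t (Suc \<tau>) j (int i - int n) = fst (ac \<tau> ! j)" using R(6)[OF j, where \<tau> = \<tau>] hp(1)[OF j] True by simp
   ultimately show ?thesis using True by simp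
  next
   case False
   then have "int i - int n ~= h \<tau> j" using hp(1)[OF j] by linarith
   then have e: "t (Suc \<tau>) j (int i - int n) = t \<tau> j (int i - int n)" using R(6)[OF j, where \<tau> = \<tau>] by simp
   let ?a = "t \<tau> j (int i - int n)"
   have "sc \<alpha> [(fHd \<tau> j (hp j), False), (fCe \<tau> j i ?a, False), (fCe (Suc \<tau>) j i ?a, True)]"
    using S[OF \<tau> j i] hp(2)[OF j] R(7)[OF j, where \<tau> = \<tau> and i = "int i - int n"] False by metis
   then show ?thesis using IH(2)[OF j] IH(3)[OF j i] unfolding e by (simp add: sc_simps hp_def)
  qed
  show ?case using 1 2 3 by blast
 qed
 have "\<alpha> (fCe n 1 n (t n 1 0))" using inv[of n] nt(2) by (metis add_le_same_cancel1 diff_self le_add1 mult_2 order_refl)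
 then have ne: "t n 1 0 ~= 1" using fin by metis
 have "halts_with M ?v [?v \<in> V] n" using halt[of w] lw mW by (simp add: n_def)
 then have "t n 1 = tape_of [?v \<in> V]" by (rule R(8))
 then have "?v \<in> V" using ne by (simp add: tape_of_def split: if_splits)
 then show ?thesis using lw mW by blast
qed

lemma tableau_complete:
 assumes wf: "wf_tm M" and len: "length w \<le> length W"
  and halt: "halts_with M (pre @ w) [True] (length U)"
 shows "\<exists>\<alpha>. \<forall>c \<in> set (cl M U pre W). sc \<alpha> c"
proof -
 let ?v = "pre @ w"
 define n where "n = length U"
 obtain q t h ac where run: "is_run M ?v q t h ac" using run_exists[OF wf, of ?v] by blast
 note R = is_runD[OF run]
 have nt: "0 < ntapes M" "1 < ntapes M" using wf by (auto simp: wf_tm_def)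
 define \<alpha> where "\<alpha> l = (if l ! 0 = 0 then q (l ! 1) = l ! 2 else if l ! 0 = 1 then h (l ! 1) (l ! 2) + int n = int (l ! 3)
  else if l ! 0 = 2 then t (l ! 1) (l ! 2) (int (l ! 3) - int n) = l ! 4 else t (l ! 1) (l ! 2) (h (l ! 1) (l ! 2)) = l ! 3)" for l :: "nat list"
 have a: "\<alpha> (fSt \<tau> p) \<longleftrightarrow> q \<tau> = p" "\<alpha> (fHd \<tau> j i) \<longleftrightarrow> h \<tau> j + int n = int i" "\<alpha> (fCe \<tau> j i s) \<longleftrightarrow> t \<tau> j (int i - int n) = s"
  "\<alpha> (fRd \<tau> j s) \<longleftrightarrow> t \<tau> j (h \<tau> j) = s" for \<tau> p j i s by (simp_all add: \<alpha>_def)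
 have t0: "t 0 0 = tape_of ?v" using R(2)[OF nt(1)] by simp
 have row: "r = (q \<tau>, map (%j. t \<tau> j (h \<tau> j)) [0..<ntapes M], q (Suc \<tau>), ac \<tau>)"
  if r: "r \<in> set (tab M)" "q \<tau> = fst r" "\<forall>ja \<in> set (zip [0..<ntapes M] (fst (snd r))). t \<tau> (fst ja) (h \<tau> (fst ja)) = snd ja" for r \<tau>
 proof -
  obtain p as where p: "length as = ntapes M" "r = trow M p as" using r(1) unfolding set_tab by blast
  have "as = map (%j. t \<tau> j (h \<tau> j)) [0..<ntapes M]"
  proof (rule nth_equalityI)
   fix i assume i: "i < length as"
   then have "(i, as ! i) \<in> set (zip [0..<ntapes M] (fst (snd r)))" using p by (auto simp: set_zip trow_def intro!: exI[of _ i])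
   then show "as ! i = map (%j. t \<tau> j (h \<tau> j)) [0..<ntapes M] ! i" using r(3) i p(1) by fastforce
  qed (simp add: p(1))
  moreover have "p = q \<tau>" using r(2) p(2) by (simp add: trow_def)
  ultimately show ?thesis using p(2) R(3)[where \<tau> = \<tau>] by simp
 qed
 have "\<forall>c \<in> set (cl M U pre W). sc \<alpha> c"
  unfolding cl_ball n_def[symmetric]
 proof (intro conjI allI impI ballI)
  show "sc \<alpha> [(fSt 0 0, True)]" by (simp add: sc_simps a R(1) del: One_nat_def)
  show "sc \<alpha> [(fCe 0 0 (n + length pre + length W) 0, True)]" using len by (simp add: sc_simps a t0 tape_of_def nat_add_distrib del: One_nat_def)
  have "t n 1 0 ~= 1" using R(8)[OF halt, folded n_def] by (simp add: tape_of_def)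
  then show "sc \<alpha> [(fCe n 1 n 1, False)]" by (simp add: sc_simps a del: One_nat_def)
  show "sc \<alpha> [(fHd 0 j n, True)]" if "j < ntapes M" for j using R(2)[OF that] by (simp add: sc_simps a del: One_nat_def)
  show "sc \<alpha> [(fCe 0 j i 0, True)]" if "1 \<le> j & j < ntapes M" "i \<le> 2 * n" for j i
   using R(2)[where j = j] that by (simp add: sc_simps a del: One_nat_def)
  show "sc \<alpha> [(fCe 0 0 i 0, True)]" if "i < n" for i using that by (simp add: sc_simps a t0 tape_of_def del: One_nat_def)
  show "sc \<alpha> [(fCe 0 0 (n + i) (if pre ! i then 2 else 1), True)]" if "i < length pre" for i
   using that by (simp add: sc_simps a t0 tape_of_def nth_append del: One_nat_def)
  show "sc \<alpha> [(fCe 0 0 i 0, True), (fCe 0 0 i 1, True), (fCe 0 0 i 2, True)]" for i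
   by (simp add: sc_simps a t0 tape_of_def del: One_nat_def)
  show "sc \<alpha> [(fCe 0 0 i 0, False), (fCe 0 0 (Suc i) 0, True)]" if ni: "n + length pre \<le> i" for i
  proof -
   obtain k where k: "i = n + k" using le_Suc_ex[OF order_trans[OF le_add1 ni]] by blast
   have e: "int i - int n = int k" "int (Suc i) - int n = int (Suc k)" by (simp_all add: k)
   show ?thesis unfolding sc_simps fst_conv snd_conv a e t0 tape_of_def nat_int by auto
  qed
  fix \<tau> j i assume \<tau>: "\<tau> < n" and j: "j < ntapes M" and i: "i \<le> 2 * n"
  have hi: "h \<tau> j = int i' - int n" if "h \<tau> j + int n = int i'" for i' using that by linarith
  show "sc \<alpha> [(fHd \<tau> j i, False), (fCe \<tau> j i s, False), (fRd \<tau> j s, True)]" for s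
   unfolding sc_simps fst_conv snd_conv a using hi[of i] by metis
  show "sc \<alpha> [(fHd \<tau> j i', False), (fCe \<tau> j i s, False), (fCe (Suc \<tau>) j i s, True)]" if ii: "i' ~= i" for i' s
  proof (cases "h \<tau> j + int n = int i'")
   case True
   have "int i - int n ~= h \<tau> j"
   proof
    assume "int i - int n = h \<tau> j"
    then have "int i = int i'" using True by linarith
    then show False using ii by simp
   qed
   then have "t (Suc \<tau>) j (int i - int n) = t \<tau> j (int i - int n)" unfolding R(6)[OF j, THEN conjunct1] by simp
   then show ?thesis unfolding sc_simps fst_conv snd_conv a by simp
  next
   case False
   then show ?thesis unfolding sc_simps fst_conv snd_conv a by simp
  qed
  fix r assume r: "r \<in> set (tab M)"
  have jl: "j < length (ac \<tau>)" unfolding R(5) by (rule j)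
  show "sc \<alpha> (body (ntapes M) \<tau> j i r @ [(fSt (Suc \<tau>) (fst (snd (snd r))), True)])"
   unfolding sc_body a
  proof (intro impI, elim conjE)
   assume b: "q \<tau> = fst r" "\<forall>ja \<in> set (zip [0..<ntapes M] (fst (snd r))). t \<tau> (fst ja) (h \<tau> (fst ja)) = snd ja"
   show "q (Suc \<tau>) = fst (snd (snd r))" unfolding row[OF r b] snd_conv fst_conv by (rule refl)
  qed
  show "sc \<alpha> (body (ntapes M) \<tau> j i r @ [(fCe (Suc \<tau>) j i (fst (nth_or (0, 0) (snd (snd (snd r))) j)), True)])"
   unfolding sc_body a
  proof (intro impI, elim conjE)
   assume b: "h \<tau> j + int n = int i" "q \<tau> = fst r" "\<forall>ja \<in> set (zip [0..<ntapes M] (fst (snd r))). t \<tau> (fst ja) (h \<tau> (fst ja)) = snd ja"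
   have e: "fst (nth_or (0, 0) (snd (snd (snd r))) j) = fst (ac \<tau> ! j)"
    unfolding row[OF r b(2,3)] snd_conv nth_or_lt[OF jl] by (rule refl)
   show "t (Suc \<tau>) j (int i - int n) = fst (nth_or (0, 0) (snd (snd (snd r))) j)"
    unfolding e R(6)[OF j, THEN conjunct1] hi[OF b(1)] by simp
  qed
  show "sc \<alpha> (body (ntapes M) \<tau> j i r @ [(fHd (Suc \<tau>) j (i + snd (nth_or (0, 0) (snd (snd (snd r))) j) - 1), True)])"
   unfolding sc_body a
  proof (intro impI, elim conjE)
   assume b: "h \<tau> j + int n = int i" "q \<tau> = fst r" "\<forall>ja \<in> set (zip [0..<ntapes M] (fst (snd r))). t \<tau> (fst ja) (h \<tau> (fst ja)) = snd ja"
   have h1: "h (Suc \<tau>) j = h \<tau> j + int (snd (ac \<tau> ! j)) - 1" and h2: "\<bar>h \<tau> j\<bar> \<le> int \<tau>"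
    by (rule R(6)[OF j, where \<tau> = \<tau>, THEN conjunct2, THEN conjunct1], rule R(6)[OF j, where \<tau> = \<tau>, THEN conjunct2, THEN conjunct2])
   have e: "snd (nth_or (0, 0) (snd (snd (snd r))) j) = snd (ac \<tau> ! j)"
    unfolding row[OF r b(2,3)] snd_conv nth_or_lt[OF jl] by (rule refl)
   \<comment> \<open>The subtraction in the head clause is truncated; a head has moved at most
     \<open>\<tau> < n\<close> cells, so its shifted position is positive.\<close>
   have i1: "1 \<le> i" using h2 b(1) \<tau> by linarith
   have "int (i + snd (ac \<tau> ! j) - 1) = int i + int (snd (ac \<tau> ! j)) - 1" using i1 by linarith
   then show "h (Suc \<tau>) j + int n = int (i + snd (nth_or (0, 0) (snd (snd (snd r))) j) - 1)" unfolding e h1 using b(1) by linarith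
  qed
 qed
 then show ?thesis by blast
qed

text \<open>Horner's scheme on lists: multiplication by the argument repeats a list once per input
  bit.\<close>

lemma unary_poly: "\<exists>U :: bool list => unit list. ptf U & (\<forall>x. length (U x) = poly p (length x))"
proof (induction p)
 case 0
 have "ptf (%x :: bool list. [] :: unit list)" by (rule ptf_const)
 then show ?case by (intro exI[of _ "%_. []"]) simp
next
 case (pCons a p)
 then obtain U :: "bool list => unit list" where U: "ptf U" "!!x. length (U x) = poly p (length x)" by blast
 have "ptf (%x. replicate a () @ concat (map (%_. U x) x))"
  by (intro ptf_append ptf_const ptf_concat ptf_map ptf_id ptf_comp[OF ptf_fst[OF ptf_id] U(1)])
 moreover have "length (concat (map (%_. u) y)) = length y * length u" for u :: "unit list" and y :: "bool list" by (induction y) auto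
 ultimately show ?case using U(2) by (intro exI[of _ "%x. replicate a () @ concat (map (%_. U x) x)"]) simp
qed

lemma poly_mono_nat: "x \<le> y ==> poly p x \<le> poly p (y :: nat)"
 by (induction p) (auto intro!: add_mono mult_mono)

lemma mmd_NP_hard:
 assumes "A \<in> class_NP"
 shows "poly_reducible A (language_of mmd_instances mmd_encode mmd_yes)"
proof -
 let ?L = "language_of mmd_instances mmd_encode mmd_yes"
 obtain V and p :: "nat poly" where V: "V \<in> class_P" "!!x. x \<in> A \<longleftrightarrow> (\<exists>w. length w \<le> poly p (length x) & pair_word x w \<in> V)"
  using assms unfolding class_NP_def by blast
 obtain M and pt :: "nat poly" where M: "wf_tm M" "!!x. \<exists>n \<le> poly pt (length x). halts_with M x [x \<in> V] n"
  using V(1) unfolding class_P_def poly_time_computable_def by blast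
 \<comment> \<open>\<open>[:2, 2:] + p\<close> bounds the length of the verifier input, a prefix of
   length \<open>2 * length x + 2\<close> and a witness. Its composition with \<open>pt\<close>
   bounds the running time, and adding it once more makes the input fit into the grid.\<close>
 obtain U :: "bool list => unit list" where U: "ptf U" "!!x. length (U x) = poly (pcompose pt ([:2, 2:] + p) + ([:2, 2:] + p)) (length x)"
  using unary_poly by blast
 obtain W :: "bool list => unit list" where W: "ptf W" "!!x. length (W x) = poly p (length x)" using unary_poly by blast
 define pre where "pre x = concat (map (%b. [b, b]) x) @ [False, True]" for x :: "bool list"
 have pre: "ptf pre" unfolding pre_def[abs_def] by (intro ptfs)
 have lpre: "length (pre x) = 2 * length x + 2" for x by (induction x) (auto simp: pre_def)
 have pw: "pair_word x w = pre x @ w" for x w by (simp add: pair_word_def pre_def)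
 have len: "length (pre x) + length (W x) \<le> length (U x)" for x unfolding U(2) W(2) lpre by (simp add: poly_pcompose)
 have halt: "halts_with M (pre x @ w) [pre x @ w \<in> V] (length (U x))" if "length w \<le> length (W x)" for x w
 proof -
  obtain k where k: "k \<le> poly pt (length (pre x @ w))" "halts_with M (pre x @ w) [pre x @ w \<in> V] k" using M(2) by blast
  have "poly pt (length (pre x @ w)) \<le> poly pt (2 + 2 * length x + poly p (length x))"
   using that lpre[of x] W(2)[of x] by (intro poly_mono_nat) simp
  also have "\<dots> \<le> length (U x)"
  proof -
   have e: "poly ([:2, 2:] + p) (length x) = 2 + 2 * length x + poly p (length x)" by simp
   show ?thesis unfolding U(2) poly_add[of "pcompose pt ([:2, 2:] + p)"] poly_pcompose e by (rule le_add1)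
  qed
  finally show ?thesis using halts_with_mono[OF k(2)] k(1) by simp
 qed
 define \<phi> where "\<phi> x = uniq (cl M (U x) (pre x) (W x))" for x
 have ptf\<phi>: "ptf \<phi>" unfolding \<phi>_def[abs_def] by (rule ptf_uniq[OF _ ptf_cl[OF U(1) pre W(1)]]) (intro ptfs)
 have ne: "c ~= []" if "c \<in> set (\<phi> x)" for c x
 proof -
  have "\<forall>c \<in> set (cl M (U x) (pre x) (W x)). c ~= []" unfolding cl_ball by (simp add: body_def)
  then show ?thesis using that by (simp add: \<phi>_def)
 qed
 have d: "distinct (\<phi> x)" for x by (simp add: \<phi>_def)
 have sat: "sat (\<phi> x) \<longleftrightarrow> (\<exists>\<alpha>. \<forall>c \<in> set (cl M (U x) (pre x) (W x)). sc \<alpha> c)" for x by (simp add: sat_def \<phi>_def sc_def)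
 have sic: "mk (sat_inst (\<phi> x)) \<in> mmd_instances" "mmd_yes (mk (sat_inst (\<phi> x))) \<longleftrightarrow> sat (\<phi> x)" for x
  by (rule sat_inst_correct[OF d], erule ne)+
 have "x \<in> A \<longleftrightarrow> mmd_encode (mk (sat_inst (\<phi> x))) \<in> ?L" for x
 proof -
  have "x \<in> A \<longleftrightarrow> (\<exists>w. length w \<le> length (W x) & pre x @ w \<in> V)" unfolding V(2) W(2) pw ..
  also have "\<dots> \<longleftrightarrow> sat (\<phi> x)"
  proof
   assume "\<exists>w. length w \<le> length (W x) & pre x @ w \<in> V"
   then obtain w where w: "length w \<le> length (W x)" "pre x @ w \<in> V" by blast
   have "halts_with M (pre x @ w) [True] (length (U x))" using halt[OF w(1)] w(2) by simp
   then show "sat (\<phi> x)" unfolding sat by (rule tableau_complete[OF M(1) w(1)])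
  next
   assume "sat (\<phi> x)"
   then obtain \<alpha> where "\<forall>c \<in> set (cl M (U x) (pre x) (W x)). sc \<alpha> c" unfolding sat by blast
   then show "\<exists>w. length w \<le> length (W x) & pre x @ w \<in> V" by (rule tableau_sound[OF M(1) len, rotated]) (rule halt)
  qed
  also have "\<dots> \<longleftrightarrow> mmd_yes (mk (sat_inst (\<phi> x)))" using sic(2) by blast
  also have "\<dots> \<longleftrightarrow> mmd_encode (mk (sat_inst (\<phi> x))) \<in> ?L"
   unfolding language_dec mk_dec_encode valid_iff using sic(1) by blast
  finally show ?thesis .
 qed
 moreover have "poly_time_computable (%x. mmd_encode (mk (sat_inst (\<phi> x))))"
  by (rule ptf_computable[OF ptf_comp[OF ptf_comp[OF ptf\<phi> ptf_sat_inst] ptf_encode_mk]])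
 ultimately show ?thesis unfolding poly_reducible_def by blast
qed

theorem theorem4:
 shows "NP_complete (language_of mmd_instances mmd_encode mmd_yes) &
    pseudo_poly_solvable mmd_instances mmd_encode mmd_yes mmd_max"
 unfolding NP_complete_def using mmd_in_NP mmd_NP_hard mmd_pseudo_poly by blast

end
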